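(* The following decision problem is $\mathsf{GI}$-complete with respect to polynomial-time many-one reductions: given two countable sofic shifts $X$ and $Y$ of Cantor-Bendixson rank at most $2$, each encoded by its structure graph, decide whether $X$ and $Y$ are conjugate. The same holds when the inputs $X$ and $Y$ are restricted to be countable shifts of finite type of Cantor-Bendixson rank at most $2$ (again encoded by structure graphs).
   Context: Shift spaces. For a finite alphabet $A$, $A^{\mathbb{Z}}$ has the product topology and $\sigma(x)_i = x_{i+1}$. A shift space is a closed $\sigma$-invariant subset $X \subset A^{\mathbb{Z}}$; equivalently, the set of $x \in A^{\mathbb Z}$ in which no word of some set $F \subset A^*$ of forbidden words occurs. $X$ is a shift of finite type (SFT) if $F$ can be chosen finite, and sofic if $F$ can be chosen to be a regular language. A block map $f : X \to Y$ between shift spaces (possibly over different alphabets) is a continuous map with $\sigma \circ f = f \circ \sigma$; a conjugacy is a bijective block map, and $X, Y$ are conjugate if a conjugacy between them exists. Cantor-Bendixson rank. $X'$ is $X$ minus its isolated points; $X^{(0)} = X$, $X^{(\beta+1)} = (X^{(\beta)})'$, with intersections at limit ordinals; $\mathrm{rank}(X)$ is the least $\lambda$ with $X^{(\lambda)} = X^{(\lambda+1)}$. Structure graph. Let $\mathcal{O}_\sigma(z) = \{\sigma^n(z) \mid n \in \mathbb{Z}\}$ and let $\mathcal{P}(X)$ be the set of $\sigma$-periodic points of $X$. For a countable sofic shift $X$ of rank at most $2$, the structure graph $G(X)$ is the finite labeled directed graph with vertex set $\mathcal{P}(X)$ and the following edges. (i) For each $x \in \mathcal{P}(X)$, a rotation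 edge $x \to \sigma(x)$ with the special label $\circlearrowright$. (ii) For each pair $x, y \in \mathcal{P}(X)$ such that the set $$C_{(x,y)} = \{ z \in X \mid \exists n \in \mathbb{N} : z_{(-\infty,-n]} = x_{(-\infty,-n]},\ z_{[n,\infty)} = y_{[n,\infty)} \}$$ is nonempty, a transition edge $x \to y$ labeled by the positive integer $|\{\mathcal{O}_\sigma(z) \mid z \in C_{(x,y)}\}|$ (which is finite). A rotation edge and a transition edge between the same two vertices are distinct edges. Encoding. An instance presents each shift space by its structure graph, given as a finite labeled directed graph whose vertices carry arbitrary names, with integer labels in binary. $\mathsf{GI}$ is the class of decision problems that are polynomial-time reducible to the problem of deciding whether two finite simple undirected graphs (given as lists of edges) are isomorphic. *)

theory Defs
  imports "HOL-Analysis.Analysis" "HOL-Library.Extended_Nat"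
    "HOL-Computational_Algebra.Polynomial"
begin

section \<open>Shift spaces\<close>

definition full_shift :: "'a set \<Rightarrow> (int \<Rightarrow> 'a) topology" where
  "full_shift A = product_topology (\<lambda>_. discrete_topology A) UNIV"

definition shift_by :: "int \<Rightarrow> (int \<Rightarrow> 'a) \<Rightarrow> int \<Rightarrow> 'a" where
  "shift_by n x = (\<lambda>i. x (i + n))"

abbreviation shift_map :: "(int \<Rightarrow> 'a) \<Rightarrow> int \<Rightarrow> 'a" where
  "shift_map \<equiv> shift_by 1"

text \<open>Invariance is an equality: a closed set that is only mapped into itself by the shift need not
  be given by forbidden words.\<close>

definition shift_space :: "'a set \<Rightarrow> (int \<Rightarrow> 'a) set \<Rightarrow> bool" where
  "shift_space A X \<longleftrightarrow> finite A \<and> closedin (full_shift A) X \<and> shift_map ` X = X"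

definition occurs_in :: "'a list \<Rightarrow> (int \<Rightarrow> 'a) \<Rightarrow> bool" where
  "occurs_in w x \<longleftrightarrow> (\<exists>i. \<forall>j<length w. x (i + int j) = w ! j)"

definition avoiding :: "'a set \<Rightarrow> 'a list set \<Rightarrow> (int \<Rightarrow> 'a) set" where
  "avoiding A F = {x. range x \<subseteq> A \<and> (\<forall>w\<in>F. \<not> occurs_in w x)}"

text \<open>Regular languages are those accepted by a deterministic finite automaton with state set \<open>Q\<close>,
  initial state \<open>q0\<close>, transition function \<open>\<delta>\<close> and accepting states \<open>Acc\<close>.\<close>

definition regular_language :: "'a set \<Rightarrow> 'a list set \<Rightarrow> bool" where
  "regular_language A L \<longleftrightarrow>
     (\<exists>(Q :: nat set) q0 \<delta> Acc.
        finite Q \<and> q0 \<in> Q \<and> Acc \<subseteq> Q \<and> (\<forall>q\<in>Q. \<forall>a\<in>A. \<delta> q a \<in> Q) \<and>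
        L = {w \<in> lists A. foldl \<delta> q0 w \<in> Acc})"

definition sofic_shift :: "'a set \<Rightarrow> (int \<Rightarrow> 'a) set \<Rightarrow> bool" where
  "sofic_shift A X \<longleftrightarrow>
     shift_space A X \<and> (\<exists>F. regular_language A F \<and> X = avoiding A F)"

definition shift_of_finite_type :: "'a set \<Rightarrow> (int \<Rightarrow> 'a) set \<Rightarrow> bool" where
  "shift_of_finite_type A X \<longleftrightarrow>
     shift_space A X \<and> (\<exists>F. F \<subseteq> lists A \<and> finite F \<and> X = avoiding A F)"

definition block_map ::
  "'a set \<Rightarrow> (int \<Rightarrow> 'a) set \<Rightarrow> 'b set \<Rightarrow> (int \<Rightarrow> 'b) set \<Rightarrow> ((int \<Rightarrow> 'a) \<Rightarrow> int \<Rightarrow> 'b) \<Rightarrow> bool" where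
  "block_map A X B Y f \<longleftrightarrow>
     continuous_map (subtopology (full_shift A) X) (subtopology (full_shift B) Y) f \<and>
     (\<forall>x\<in>X. shift_map (f x) = f (shift_map x))"

definition conjugate ::
  "'a set \<Rightarrow> (int \<Rightarrow> 'a) set \<Rightarrow> 'b set \<Rightarrow> (int \<Rightarrow> 'b) set \<Rightarrow> bool" where
  "conjugate A X B Y \<longleftrightarrow> (\<exists>f. block_map A X B Y f \<and> bij_betw f X Y)"


section \<open>Cantor-Bendixson rank\<close>

text \<open>The set \<open>S\<close> without its isolated points.\<close>

definition cb_derivative :: "'a topology \<Rightarrow> 'a set \<Rightarrow> 'a set" where
  "cb_derivative T S = S \<inter> (T derived_set_of S)"

text \<open>The least stage at which the iterated derivatives become stationary, if it is a finite
  ordinal. All infinite ordinal ranks are identified with \<open>\<infinity>\<close> (the infimum of the empty set).\<close>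

definition cb_rank :: "'a topology \<Rightarrow> 'a set \<Rightarrow> enat" where
  "cb_rank T S =
     (INF k \<in> {k. (cb_derivative T ^^ k) S = (cb_derivative T ^^ Suc k) S}. enat k)"

definition countable_sofic_rank2 :: "'a set \<Rightarrow> (int \<Rightarrow> 'a) set \<Rightarrow> bool" where
  "countable_sofic_rank2 A X \<longleftrightarrow> sofic_shift A X \<and> countable X \<and> cb_rank (full_shift A) X \<le> 2"

definition countable_sft_rank2 :: "'a set \<Rightarrow> (int \<Rightarrow> 'a) set \<Rightarrow> bool" where
  "countable_sft_rank2 A X \<longleftrightarrow>
     shift_of_finite_type A X \<and> countable X \<and> cb_rank (full_shift A) X \<le> 2"


section \<open>Structure graphs\<close>

datatype edge_label = Rotation | Transition nat

text \<open>Edges are triples (source, label, target). Two vertices are thus joined by at most one edge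
  with a given label, as is the case in structure graphs.\<close>

record 'v labeled_digraph =
  nodes :: "'v set"
  edges :: "('v \<times> edge_label \<times> 'v) set"

definition shift_orbit :: "(int \<Rightarrow> 'a) \<Rightarrow> (int \<Rightarrow> 'a) set" where
  "shift_orbit z = {shift_by n z | n. True}"

definition periodic_points :: "(int \<Rightarrow> 'a) set \<Rightarrow> (int \<Rightarrow> 'a) set" where
  "periodic_points X = {x \<in> X. \<exists>p>0. shift_by p x = x}"

definition connecting_points ::
  "(int \<Rightarrow> 'a) set \<Rightarrow> (int \<Rightarrow> 'a) \<Rightarrow> (int \<Rightarrow> 'a) \<Rightarrow> (int \<Rightarrow> 'a) set" where
  "connecting_points X x y =
     {z \<in> X. \<exists>n :: nat. (\<forall>i \<le> - int n. z i = x i) \<and> (\<forall>i \<ge> int n. z i = y i)}"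

definition structure_graph :: "(int \<Rightarrow> 'a) set \<Rightarrow> (int \<Rightarrow> 'a) labeled_digraph" where
  "structure_graph X =
     \<lparr>nodes = periodic_points X,
      edges =
        {(x, Rotation, shift_map x) | x. x \<in> periodic_points X} \<union>
        {(x, Transition (card (shift_orbit ` connecting_points X x y)), y) | x y.
           x \<in> periodic_points X \<and> y \<in> periodic_points X \<and> connecting_points X x y \<noteq> {}}\<rparr>"

definition labeled_digraph_iso :: "'v labeled_digraph \<Rightarrow> 'w labeled_digraph \<Rightarrow> bool" where
  "labeled_digraph_iso G H \<longleftrightarrow>
     (\<exists>\<phi>. bij_betw \<phi> (nodes G) (nodes H) \<and>
          (\<lambda>(u, l, v). (\<phi> u, l, \<phi> v)) ` edges G = edges H)"


section \<open>Polynomial time\<close>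

text \<open>Deterministic Turing machines with a fixed number of two-way infinite tapes. The symbols are
  the numbers below \<open>symbols M\<close>, where 0 is the blank, 1 stands for \<open>False\<close> and 2 for \<open>True\<close>. The
  states are the numbers up to \<open>states M\<close>; the initial state is 0, and \<open>states M\<close> is the halting
  state. An action \<open>(s, d)\<close> on a tape writes \<open>s\<close> and then moves the head by \<open>d\<close>.\<close>

record tm =
  tapes :: nat
  symbols :: nat
  states :: nat
  delta :: "nat \<Rightarrow> nat list \<Rightarrow> nat \<times> (nat \<times> int) list"

definition turing_machine :: "tm \<Rightarrow> bool" where
  "turing_machine M \<longleftrightarrow>
     tapes M \<ge> 1 \<and> symbols M \<ge> 3 \<and>
     (\<forall>q ss q' acts.
        q < states M \<and> length ss = tapes M \<and> set ss \<subseteq> {..<symbols M} \<and> delta M q ss = (q', acts) \<longrightarrow>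
        q' \<le> states M \<and> length acts = tapes M \<and> set acts \<subseteq> {..<symbols M} \<times> {-1, 0, 1})"

type_synonym tape = "(int \<Rightarrow> nat) \<times> int"  \<comment> \<open>contents and head position\<close>

fun act :: "nat \<times> int \<Rightarrow> tape \<Rightarrow> tape" where
  "act (s, d) (c, h) = (c(h := s), h + d)"

definition tm_step :: "tm \<Rightarrow> nat \<times> tape list \<Rightarrow> nat \<times> tape list" where
  "tm_step M = (\<lambda>(q, ts).
     if q \<ge> states M then (q, ts)
     else let (q', acts) = delta M q (map (\<lambda>(c, h). c h) ts) in (q', map2 act acts ts))"

definition bit_symbol :: "bool \<Rightarrow> nat" where
  "bit_symbol b = (if b then 2 else 1)"

definition string_tape :: "bool list \<Rightarrow> tape" where
  "string_tape w = (\<lambda>i. if 0 \<le> i \<and> i < int (length w) then bit_symbol (w ! nat i) else 0, 0)"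

text \<open>The input is on the first tape, all other tapes are blank.\<close>

definition initial_config :: "tm \<Rightarrow> bool list \<Rightarrow> nat \<times> tape list" where
  "initial_config M w = (0, string_tape w # replicate (tapes M - 1) (string_tape []))"

text \<open>The output is the string that starts in cell 0 of the last tape and ends before a blank.\<close>

definition has_output :: "nat \<times> tape list \<Rightarrow> bool list \<Rightarrow> bool" where
  "has_output cfg v \<longleftrightarrow>
     (let c = fst (last (snd cfg))
      in (\<forall>i<length v. c (int i) = bit_symbol (v ! i)) \<and> c (int (length v)) = 0)"

definition polynomial_time_computable :: "(bool list \<Rightarrow> bool list) \<Rightarrow> bool" where
  "polynomial_time_computable f \<longleftrightarrow>
     (\<exists>M (p :: nat poly). turing_machine M \<and>
        (\<forall>w. \<exists>t \<le> poly p (length w).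
           let cfg = (tm_step M ^^ t) (initial_config M w)
           in fst cfg = states M \<and> has_output cfg (f w)))"


section \<open>Decision problems and reductions\<close>

text \<open>A decision problem consists of the encodings of its yes-instances and the encodings of its
  no-instances; other strings are not encodings of instances.

  A reduction is a many-one reduction between the languages of yes-instances that also maps
  instances to instances. In particular, a problem in which some string encodes both a yes-instance
  and a no-instance (so that the answer is not a function of the encoding) does not reduce to one
  whose two components are disjoint.\<close>

record decision_problem =
  yes_instances :: "bool list set"
  no_instances :: "bool list set"

definition poly_reducible :: "decision_problem \<Rightarrow> decision_problem \<Rightarrow> bool" where
  "poly_reducible P Q \<longleftrightarrow>
     (\<exists>f. polynomial_time_computable f \<and>
          (\<forall>w. w \<in> yes_instances P \<longleftrightarrow> f w \<in> yes_instances Q) \<and>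
          (\<forall>w. w \<in> no_instances P \<longrightarrow> f w \<in> no_instances Q))"


section \<open>Encodings\<close>

text \<open>All of the following codes are prefix-free, so that concatenations are uniquely decodable.\<close>

text \<open>Binary digits, least significant first, without leading zeros.\<close>

fun binary :: "nat \<Rightarrow> bool list" where
  "binary n = (if n = 0 then [] else odd n # binary (n div 2))"

declare binary.simps [simp del]

definition encode_list :: "('a \<Rightarrow> bool list) \<Rightarrow> 'a list \<Rightarrow> bool list" where
  "encode_list e xs = concat (map (\<lambda>x. True # e x) xs) @ [False]"

definition encode_nat :: "nat \<Rightarrow> bool list" where
  "encode_nat n = encode_list (\<lambda>b. [b]) (binary n)"

fun encode_label :: "edge_label \<Rightarrow> bool list" where
  "encode_label Rotation = [False]"
| "encode_label (Transition n) = True # encode_nat n"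

text \<open>A labeled directed graph is given by the list of its vertices, whose names are arbitrary
  numbers, and the list of its edges.\<close>

type_synonym digraph_lists = "nat list \<times> (nat \<times> edge_label \<times> nat) list"

fun encode_digraph :: "digraph_lists \<Rightarrow> bool list" where
  "encode_digraph (vs, es) =
     encode_list encode_nat vs @
     encode_list (\<lambda>(u, l, v). encode_nat u @ encode_label l @ encode_nat v) es"

fun digraph_presentation :: "digraph_lists \<Rightarrow> nat labeled_digraph \<Rightarrow> bool" where
  "digraph_presentation (vs, es) G \<longleftrightarrow>
     distinct vs \<and> distinct es \<and> set es \<subseteq> set vs \<times> UNIV \<times> set vs \<and>
     G = \<lparr>nodes = set vs, edges = set es\<rparr>"

definition presents_shift :: "digraph_lists \<Rightarrow> (int \<Rightarrow> 'a) set \<Rightarrow> bool" where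
  "presents_shift D X \<longleftrightarrow>
     (\<exists>G. digraph_presentation D G \<and> labeled_digraph_iso G (structure_graph X))"

text \<open>A simple undirected graph is given by the list of its vertices (some of which may be isolated)
  and the list of its edges, each edge listed once in one of the two orientations.\<close>

type_synonym ugraph_lists = "nat list \<times> (nat \<times> nat) list"

fun encode_ugraph :: "ugraph_lists \<Rightarrow> bool list" where
  "encode_ugraph (vs, es) =
     encode_list encode_nat vs @ encode_list (\<lambda>(u, v). encode_nat u @ encode_nat v) es"

fun ugraph_presentation :: "ugraph_lists \<Rightarrow> nat set \<Rightarrow> nat set set \<Rightarrow> bool" where
  "ugraph_presentation (vs, es) V E \<longleftrightarrow>
     distinct vs \<and> distinct (map (\<lambda>(u, v). {u, v}) es) \<and>
     (\<forall>(u, v) \<in> set es. u \<in> set vs \<and> v \<in> set vs \<and> u \<noteq> v) \<and>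
     V = set vs \<and> E = (\<lambda>(u, v). {u, v}) ` set es"

definition ugraph_iso :: "'v set \<Rightarrow> 'v set set \<Rightarrow> 'w set \<Rightarrow> 'w set set \<Rightarrow> bool" where
  "ugraph_iso V E V' E' \<longleftrightarrow>
     (\<exists>\<phi>. bij_betw \<phi> V V' \<and> (\<forall>u\<in>V. \<forall>v\<in>V. {u, v} \<in> E \<longleftrightarrow> {\<phi> u, \<phi> v} \<in> E'))"


section \<open>The problems\<close>

definition graph_isomorphism :: decision_problem where
  "graph_isomorphism =
     \<lparr>yes_instances = {encode_ugraph D @ encode_ugraph D' | D D' V E V' E'.
        ugraph_presentation D V E \<and> ugraph_presentation D' V' E' \<and> ugraph_iso V E V' E'},
      no_instances = {encode_ugraph D @ encode_ugraph D' | D D' V E V' E'.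
        ugraph_presentation D V E \<and> ugraph_presentation D' V' E' \<and> \<not> ugraph_iso V E V' E'}\<rparr>"

definition GI :: "decision_problem set" where
  "GI = {P. poly_reducible P graph_isomorphism}"

definition GI_complete :: "decision_problem \<Rightarrow> bool" where
  "GI_complete P \<longleftrightarrow> P \<in> GI \<and> (\<forall>Q\<in>GI. poly_reducible Q P)"

text \<open>Conjugacy of shift spaces from the class \<open>C\<close> (a predicate on an alphabet and a shift space over
  it). Finite alphabets are taken to be sets of natural numbers.\<close>

definition conjugacy_problem :: "(nat set \<Rightarrow> (int \<Rightarrow> nat) set \<Rightarrow> bool) \<Rightarrow> decision_problem" where
  "conjugacy_problem C =
     \<lparr>yes_instances = {encode_digraph D @ encode_digraph D' | D D' A X B Y.
        C A X \<and> C B Y \<and> presents_shift D X \<and> presents_shift D' Y \<and> conjugate A X B Y},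
      no_instances = {encode_digraph D @ encode_digraph D' | D D' A X B Y.
        C A X \<and> C B Y \<and> presents_shift D X \<and> presents_shift D' Y \<and> \<not> conjugate A X B Y}\<rparr>"

end

theory Submission
  imports Defs
begin

text \<open>A countable shift of rank at most 2 consists of finitely many periodic points and finitely many orbits
  of isolated points, each of which is asymptotic to a periodic point on either side. A conjugacy preserves all of this,
  so it induces an isomorphism of the structure graphs; conversely, an isomorphism is turned into a conjugacy by
  matching the orbits of connecting points, and continuity is automatic away from the periodic points.
  Hence conjugacy is isomorphism of those labeled digraphs that are structure graphs, and these are recognised by
  simple local conditions: such a digraph is realised by a sofic shift, whose points are the periodic sequences
  given by the rotation and their concatenations at one special transition symbol. The shift may be chosen of finite
  type iff no two nontrivial transitions can be composed, since points could otherwise be glued.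
  Labeled digraphs reduce to graphs by replacing edges by gadgets with pendant leaves, and graphs reduce to
  structure graphs with trivial rotation by a bipartite double, in which transitions cannot be composed.

  Polynomial time is obtained from a calculus of functions on binary trees that is compiled to stack machines,
  which are Turing machines.\<close>

section \<open>Stack machines\<close>

text \<open>Hardness quantifies over all problems reducible to graph isomorphism, so functions given
  by unknown machines must be composed with the concrete reduction. Hence \<open>pt\<close> is shown
  equivalent to polynomial time in both directions, and machines are simulated inside the calculus.
  Its shape is dictated by composition: a program leaves the stack below its argument alone and
  comes with a bound on the size of its result. Loops need more: a step may enlarge the data only by
  an amount that does not depend on the data built so far. A reduction must also be right on words
  that are no instances. So it has to be decided in polynomial time whether a list of edges is a
  structure graph at all; this requires an intrinsic characterisation and a realisation of every
  such graph. The shift moves the two ends of a connecting point simultaneously. Pairs of periodic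
  points are therefore treated up to simultaneous rotation, with one representative per class, both
  when orbits are matched and when a shift is realised.\<close>

datatype instr =
    Left nat
  | Write nat bool
  | Erase nat
  | Emit bool
  | Jump nat "nat \<Rightarrow> bool" int

text \<open>An action writes before it moves, so a pop is one instruction (\<open>Erase\<close>),
  while a push takes \<open>Left\<close> and then \<open>Write\<close>. Jumps are relative to the
  next instruction, which makes fragments relocatable; the target is capped at \<open>n\<close>, the
  halting state, so that any offset yields a legal machine.\<close>

fun instr_delta :: "nat \<Rightarrow> instr \<Rightarrow> nat \<Rightarrow> nat list \<Rightarrow> nat \<times> (nat \<times> int) list" where
  "instr_delta n (Left x) q ss = (Suc q, (map (\<lambda>s. (s, 0)) ss)[x := (ss ! x, -1)])"
| "instr_delta n (Write x b) q ss = (Suc q, (map (\<lambda>s. (s, 0)) ss)[x := (bit_symbol b, 0)])"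
| "instr_delta n (Erase x) q ss = (Suc q, (map (\<lambda>s. (s, 0)) ss)[x := (0, 1)])"
| "instr_delta n (Emit b) q ss = (Suc q, (map (\<lambda>s. (s, 0)) ss)[4 := (bit_symbol b, 1)])"
| "instr_delta n (Jump x P j) q ss =
     (if P (ss ! x) then min n (nat (int q + 1 + j)) else Suc q, map (\<lambda>s. (s, 0)) ss)"

definition machine :: "instr list \<Rightarrow> tm" where
  "machine cs = \<lparr>tapes = 5, symbols = 3, states = length cs,
     delta = (\<lambda>q ss. instr_delta (length cs) (cs ! q) q ss)\<rparr>"

lemma turing_machine_machine: "turing_machine (machine cs)"
proof -
  have upd: "set ((map (\<lambda>s. (s, 0)) ss)[x := a]) \<subseteq> {..<3} \<times> {-1, 0, 1}"
    if "set ss \<subseteq> {..<3}" "x < length ss \<Longrightarrow> a \<in> {..<3} \<times> {-1, 0, 1 :: int}" for ss :: "nat list" and x a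
  proof (cases "x < length ss")
    case True
    then show ?thesis using that by (intro set_update_subsetI) auto
  next
    case False
    then show ?thesis using that by (auto simp: list_update_beyond)
  qed
  have "q' \<le> length cs \<and> length acts = 5 \<and> set acts \<subseteq> {..<3} \<times> {-1, 0, 1}"
    if "q < length cs" "length ss = 5" "set ss \<subseteq> {..<3}"
      "instr_delta (length cs) (cs ! q) q ss = (q', acts)" for q ss q' acts
  proof (cases "cs ! q")
    case (Left x)
    moreover have "ss ! x < 3" if "x < length ss"
      using \<open>set ss \<subseteq> {..<3}\<close> nth_mem[OF that] by auto
    ultimately show ?thesis using that upd[of ss x "(ss ! x, -1)"] by fastforce
  next
    case (Write x b)
    then show ?thesis using that upd[of ss x "(bit_symbol b, 0)"] by (auto simp: bit_symbol_def)
  next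
    case (Erase x)
    then show ?thesis using that upd[of ss x "(0, 1)"] by auto
  next
    case (Emit b)
    then show ?thesis using that upd[of ss 4 "(bit_symbol b, 1)"] by (auto simp: bit_symbol_def)
  next
    case (Jump x P j)
    then show ?thesis using that by (auto split: if_splits)
  qed
  then have "\<forall>q ss q' acts. q < length cs \<and> length ss = 5 \<and> set ss \<subseteq> {..<3} \<and>
      instr_delta (length cs) (cs ! q) q ss = (q', acts) \<longrightarrow>
      q' \<le> length cs \<and> length acts = 5 \<and> set acts \<subseteq> {..<3} \<times> {-1, 0, 1}"
    by blast
  then show ?thesis
    by (simp add: turing_machine_def machine_def)
qed

type_synonym store = "nat \<Rightarrow> bool list"

fun stack_tape :: "bool list \<Rightarrow> tape \<Rightarrow> bool" where
  "stack_tape w (c, h) \<longleftrightarrow>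
     (\<forall>i. c i = (if h \<le> i \<and> i < h + int (length w) then bit_symbol (w ! nat (i - h)) else 0))"

fun output_tape :: "bool list \<Rightarrow> tape \<Rightarrow> bool" where
  "output_tape w (c, h) \<longleftrightarrow> h = int (length w) \<and>
     (\<forall>i. c i = (if 0 \<le> i \<and> i < int (length w) then bit_symbol (w ! nat i) else 0))"

text \<open>Tapes 0 to 3 are stacks whose top is under the head, tape 4 is a write-only output tape.\<close>

definition represents :: "store \<Rightarrow> tape list \<Rightarrow> bool" where
  "represents s ts \<longleftrightarrow>
     length ts = 5 \<and> (\<forall>x<4. stack_tape (s x) (ts ! x)) \<and> output_tape (s 4) (ts ! 4)"

definition top_symbol :: "bool list \<Rightarrow> nat" where
  "top_symbol w = (case w of [] \<Rightarrow> 0 | b # _ \<Rightarrow> bit_symbol b)"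

lemma top_symbol_simps [simp]:
  "top_symbol [] = 0" "top_symbol (True # w) = 2" "top_symbol (False # w) = 1"
  by (auto simp: top_symbol_def bit_symbol_def)

lemma stack_tape_read: "stack_tape w (c, h) \<Longrightarrow> c h = top_symbol w"
  by (cases w) (auto simp: top_symbol_def)

lemma stack_tape_push: "stack_tape w (c, h) \<Longrightarrow> stack_tape (b # w) (c(h - 1 := bit_symbol b), h - 1)"
  by (auto simp: nth_Cons' nat_diff_distrib' nat_eq_iff) (auto intro!: arg_cong[where f = bit_symbol] arg_cong[where f = "nth w"])

lemma stack_tape_pop: "stack_tape w (c, h) \<Longrightarrow> stack_tape (tl w) (c(h := 0), h + 1)"
  by (cases w) (auto simp: nth_Cons' nat_diff_distrib' nat_eq_iff
      intro!: arg_cong[where f = bit_symbol] arg_cong[where f = "nth _"])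

lemma output_tape_emit: "output_tape w (c, h) \<Longrightarrow> output_tape (w @ [b]) (c(h := bit_symbol b), h + 1)"
  by (auto simp: nth_append nat_less_iff)

lemma act_keep [simp]: "act ((\<lambda>(c, h). c h) t, 0) t = t"
  by (cases t) auto

lemma map2_act_update:
  assumes "length ts = 5"
  shows "map2 act ((map (\<lambda>s. (s, 0)) (map (\<lambda>(c, h). c h) ts))[x := a]) ts = ts[x := act a (ts ! x)]"
  using assms by (cases "x < 5"; intro nth_equalityI) (auto simp: nth_list_update list_update_beyond)

lemma map2_act_keep:
  assumes "length ts = 5"
  shows "map2 act (map (\<lambda>s. (s, 0)) (map (\<lambda>(c, h). c h) ts)) ts = ts"
  using assms by (intro nth_equalityI) auto

text \<open>The fragment \<open>cs\<close>, placed anywhere in a program, leads from its first to behind its last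
  instruction and from the store \<open>s\<close> to the store \<open>s'\<close> in at most \<open>T\<close> steps.\<close>

definition runs :: "instr list \<Rightarrow> store \<Rightarrow> nat \<Rightarrow> store \<Rightarrow> bool" where
  "runs cs s T s' \<longleftrightarrow>
     (\<forall>pre post ts. represents s ts \<longrightarrow>
        (\<exists>t\<le>T. \<exists>ts'. represents s' ts' \<and>
           (tm_step (machine (pre @ cs @ post)) ^^ t) (length pre, ts) = (length pre + length cs, ts')))"

lemma runsD:
  assumes "runs cs s T s'" "represents s ts"
  obtains t ts' where "t \<le> T" "represents s' ts'"
    "(tm_step (machine (pre @ cs @ post)) ^^ t) (length pre, ts) = (length pre + length cs, ts')"
  using assms unfolding runs_def by blast

lemma runs_mono: "runs cs s T s' \<Longrightarrow> T \<le> T' \<Longrightarrow> runs cs s T' s'"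
  unfolding runs_def by (meson le_trans)

lemma runs_Nil: "runs [] s 0 s"
  unfolding runs_def by auto

lemma runs_append:
  assumes "runs c1 s T1 s1" "runs c2 s1 T2 s2"
  shows "runs (c1 @ c2) s (T1 + T2) s2"
  unfolding runs_def
proof (intro allI impI)
  fix pre post ts
  assume r: "represents s ts"
  obtain t1 ts1 where 1: "t1 \<le> T1" "represents s1 ts1"
    "(tm_step (machine (pre @ c1 @ (c2 @ post))) ^^ t1) (length pre, ts) = (length pre + length c1, ts1)"
    using runsD[OF assms(1) r] by metis
  obtain t2 ts2 where 2: "t2 \<le> T2" "represents s2 ts2"
    "(tm_step (machine ((pre @ c1) @ c2 @ post)) ^^ t2) (length (pre @ c1), ts1)
       = (length (pre @ c1) + length c2, ts2)"
    using runsD[OF assms(2) 1(2)] by metis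
  have "(tm_step (machine (pre @ (c1 @ c2) @ post)) ^^ (t2 + t1)) (length pre, ts)
      = (length pre + length (c1 @ c2), ts2)"
    using 1 2 by (simp add: funpow_add)
  then show "\<exists>t\<le>T1 + T2. \<exists>ts'. represents s2 ts' \<and>
      (tm_step (machine (pre @ (c1 @ c2) @ post)) ^^ t) (length pre, ts)
        = (length pre + length (c1 @ c2), ts')"
    using 1 2 by (intro exI[of _ "t2 + t1"]) auto
qed

lemma tm_step_machine:
  assumes "q < length cs"
  shows "tm_step (machine cs) (q, ts) =
    (let (q', acts) = instr_delta (length cs) (cs ! q) q (map (\<lambda>(c, h). c h) ts) in (q', map2 act acts ts))"
  using assms by (simp add: tm_step_def machine_def)

lemma tm_step_jump:
  assumes "length ts = 5" "q < length cs" "cs ! q = Jump x P j"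
  shows "tm_step (machine cs) (q, ts) =
    (if P (map (\<lambda>(c, h). c h) ts ! x) then min (length cs) (nat (int q + 1 + j)) else Suc q, ts)"
  using assms by (subst tm_step_machine) (auto simp: map2_act_keep simp del: map_map)

lemma represents_top:
  assumes "represents s ts" "x < 4"
  shows "map (\<lambda>(c, h). c h) ts ! x = top_symbol (s x)"
  using assms stack_tape_read[of "s x" "fst (ts ! x)" "snd (ts ! x)"]
  by (auto simp: represents_def split: prod.splits)

lemma runs_push: assumes "x < 4" shows "runs [Left x, Write x b] s 2 (s(x := b # s x))"
  unfolding runs_def
proof (intro allI impI)
  fix pre post ts
  assume r: "represents s ts"
  then have len: "length ts = 5" by (simp add: represents_def)
  let ?cs = "pre @ [Left x, Write x b] @ post"
  obtain c h where ch: "ts ! x = (c, h)" by fastforce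
  let ?ts1 = "ts[x := (c, h - 1)]" and ?ts2 = "ts[x := (c(h - 1 := bit_symbol b), h - 1)]"
  have 1: "tm_step (machine ?cs) (length pre, ts) = (Suc (length pre), ?ts1)"
    using len ch assms by (subst tm_step_machine) (auto simp: map2_act_update simp del: map_map)
  have 2: "tm_step (machine ?cs) (Suc (length pre), ?ts1) = (Suc (Suc (length pre)), ?ts2)"
    using len ch assms by (subst tm_step_machine) (auto simp: map2_act_update nth_append simp del: map_map)
  have "represents (s(x := b # s x)) ?ts2"
    using r assms ch stack_tape_push[of "s x" c h b]
    by (auto simp: represents_def nth_list_update simp del: stack_tape.simps output_tape.simps)
  then show "\<exists>t\<le>2. \<exists>ts'. represents (s(x := b # s x)) ts' \<and> (tm_step (machine ?cs) ^^ t) (length pre, ts)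
        = (length pre + length [Left x, Write x b], ts')"
    using 1 2 by (intro exI[of _ 2]) (auto simp: numeral_2_eq_2)
qed

lemma runs_pop: assumes "x < 4" shows "runs [Erase x] s 1 (s(x := tl (s x)))"
  unfolding runs_def
proof (intro allI impI)
  fix pre post ts
  assume r: "represents s ts"
  then have len: "length ts = 5" by (simp add: represents_def)
  let ?cs = "pre @ [Erase x] @ post"
  obtain c h where ch: "ts ! x = (c, h)" by fastforce
  let ?ts1 = "ts[x := (c(h := 0), h + 1)]"
  have 1: "tm_step (machine ?cs) (length pre, ts) = (Suc (length pre), ?ts1)"
    using len ch assms by (subst tm_step_machine) (auto simp: map2_act_update simp del: map_map)
  have "represents (s(x := tl (s x))) ?ts1"
    using r assms ch stack_tape_pop[of "s x" c h]
    by (auto simp: represents_def nth_list_update simp del: stack_tape.simps output_tape.simps)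
  then show "\<exists>t\<le>1. \<exists>ts'. represents (s(x := tl (s x))) ts' \<and> (tm_step (machine ?cs) ^^ t) (length pre, ts)
        = (length pre + length [Erase x], ts')"
    using 1 by (intro exI[of _ 1]) auto
qed

lemma runs_emit: "runs [Emit b] s 1 (s(4 := s 4 @ [b]))"
  unfolding runs_def
proof (intro allI impI)
  fix pre post ts
  assume r: "represents s ts"
  then have len: "length ts = 5" by (simp add: represents_def)
  let ?cs = "pre @ [Emit b] @ post"
  obtain c h where ch: "ts ! 4 = (c, h)" by fastforce
  let ?ts1 = "ts[4 := (c(h := bit_symbol b), h + 1)]"
  have 1: "tm_step (machine ?cs) (length pre, ts) = (Suc (length pre), ?ts1)"
    using len ch by (subst tm_step_machine) (auto simp: map2_act_update simp del: map_map)
  have "represents (s(4 := s 4 @ [b])) ?ts1"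
    using r ch output_tape_emit[of "s 4" c h b]
    by (auto simp: represents_def nth_list_update simp del: stack_tape.simps output_tape.simps)
  then show "\<exists>t\<le>1. \<exists>ts'. represents (s(4 := s 4 @ [b])) ts' \<and> (tm_step (machine ?cs) ^^ t) (length pre, ts)
        = (length pre + length [Emit b], ts')"
    using 1 by (intro exI[of _ 1]) auto
qed

text \<open>The first jump tests the negated condition and skips \<open>c1\<close> together with the
  jump that ends it, hence the offset \<open>+ 1\<close>.\<close>

definition branch :: "nat \<Rightarrow> (nat \<Rightarrow> bool) \<Rightarrow> instr list \<Rightarrow> instr list \<Rightarrow> instr list" where
  "branch x P c1 c2 =
     [Jump x (\<lambda>s. \<not> P s) (int (length c1) + 1)] @ c1 @ [Jump 0 (\<lambda>_. True) (int (length c2))] @ c2"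

text \<open>The backward offset counts from behind the last jump: it has to cross the two jumps and
  the body.\<close>

definition while :: "nat \<Rightarrow> (nat \<Rightarrow> bool) \<Rightarrow> instr list \<Rightarrow> instr list" where
  "while x P c =
     [Jump x (\<lambda>s. \<not> P s) (int (length c) + 1)] @ c @ [Jump 0 (\<lambda>_. True) (- int (length c) - 2)]"

lemma runs_branch:
  assumes x: "x < 4"
    and 1: "P (top_symbol (s x)) \<Longrightarrow> runs c1 s T s'"
    and 2: "\<not> P (top_symbol (s x)) \<Longrightarrow> runs c2 s T s'"
  shows "runs (branch x P c1 c2) s (T + 2) s'"
  unfolding runs_def
proof (intro allI impI)
  fix pre post ts
  assume r: "represents s ts"
  then have len: "length ts = 5" by (simp add: represents_def)
  let ?j = "Jump x (\<lambda>s. \<not> P s) (int (length c1) + 1)" and ?k = "Jump 0 (\<lambda>_. True) (int (length c2))"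
  let ?cs = "pre @ branch x P c1 c2 @ post"
  have cs: "?cs = pre @ [?j] @ c1 @ [?k] @ c2 @ post"
    by (simp add: branch_def)
  have s1: "tm_step (machine ?cs) (length pre, ts) =
    (if P (top_symbol (s x)) then Suc (length pre) else length pre + length c1 + 2, ts)"
    using len r x unfolding cs
    by (subst tm_step_jump[where x = x and P = "\<lambda>s. \<not> P s" and j = "int (length c1) + 1"])
       (auto simp: represents_top simp del: nth_map)
  show "\<exists>t\<le>T + 2. \<exists>ts'. represents s' ts' \<and>
     (tm_step (machine ?cs) ^^ t) (length pre, ts) = (length pre + length (branch x P c1 c2), ts')"
  proof (cases "P (top_symbol (s x))")
    case True
    obtain t ts' where t: "t \<le> T" "represents s' ts'"
      "(tm_step (machine ((pre @ [?j]) @ c1 @ [?k] @ c2 @ post)) ^^ t) (length (pre @ [?j]), ts)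
         = (length (pre @ [?j]) + length c1, ts')"
      using runsD[OF 1[OF True] r] by metis
    have "tm_step (machine ?cs) (length (pre @ [?j]) + length c1, ts')
       = (length pre + length (branch x P c1 c2), ts')"
      using t(2) unfolding cs
      by (subst tm_step_jump[where x = 0 and P = "\<lambda>_. True" and j = "int (length c2)"])
         (auto simp: represents_def nth_append branch_def)
    then have "(tm_step (machine ?cs) ^^ (1 + t + 1)) (length pre, ts)
       = (length pre + length (branch x P c1 c2), ts')"
      using t True s1 unfolding funpow_add o_apply by (simp add: cs)
    then show ?thesis using t by (intro exI[of _ "1 + t + 1"]) auto
  next
    case False
    let ?p = "pre @ [?j] @ c1 @ [?k]"
    obtain t ts' where t: "t \<le> T" "represents s' ts'"
      "(tm_step (machine (?p @ c2 @ post)) ^^ t) (length ?p, ts) = (length ?p + length c2, ts')"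
      using runsD[OF 2[OF False] r] by metis
    have "(tm_step (machine ?cs) ^^ (t + 1)) (length pre, ts)
       = (length pre + length (branch x P c1 c2), ts')"
      using t False s1 unfolding funpow_add o_apply by (simp add: cs branch_def)
    then show ?thesis using t by (intro exI[of _ "t + 1"]) auto
  qed
qed

lemma runs_while_stop:
  assumes x: "x < 4" and P: "\<not> P (top_symbol (s x))"
  shows "runs (while x P c) s 1 s"
  unfolding runs_def
proof (intro allI impI)
  fix pre post ts
  assume r: "represents s ts"
  then have len: "length ts = 5" by (simp add: represents_def)
  let ?cs = "pre @ while x P c @ post"
  have "tm_step (machine ?cs) (length pre, ts) = (length pre + length (while x P c), ts)"
    using len r x P unfolding while_def
    by (subst tm_step_jump[where x = x and P = "\<lambda>s. \<not> P s" and j = "int (length c) + 1"])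
       (auto simp: represents_top simp del: nth_map)
  then show "\<exists>t\<le>1. \<exists>ts'. represents s ts' \<and>
      (tm_step (machine ?cs) ^^ t) (length pre, ts) = (length pre + length (while x P c), ts')"
    using r by (intro exI[of _ 1]) auto
qed

text \<open>There is no invariant rule: loops are unrolled one iteration at a time, so that each of
  them is handled by induction on the data it consumes, and its time bound accumulates along that
  induction.\<close>

lemma runs_while_step:
  assumes x: "x < 4" and P: "P (top_symbol (s x))"
    and c: "runs c s T1 s1" and w: "runs (while x P c) s1 T2 s2"
  shows "runs (while x P c) s (T1 + T2 + 2) s2"
  unfolding runs_def
proof (intro allI impI)
  fix pre post ts
  assume r: "represents s ts"
  then have len: "length ts = 5" by (simp add: represents_def)
  let ?j = "Jump x (\<lambda>s. \<not> P s) (int (length c) + 1)"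
  let ?k = "Jump 0 (\<lambda>_. True) (- int (length c) - 2)"
  let ?cs = "pre @ while x P c @ post"
  have cs: "?cs = (pre @ [?j]) @ c @ [?k] @ post"
    by (simp add: while_def)
  have s1: "tm_step (machine ?cs) (length pre, ts) = (length (pre @ [?j]), ts)"
    using len r x P unfolding cs
    by (subst tm_step_jump[where x = x and P = "\<lambda>s. \<not> P s" and j = "int (length c) + 1"])
       (auto simp: represents_top nth_append simp del: nth_map)
  obtain t1 ts1 where t1: "t1 \<le> T1" "represents s1 ts1"
    "(tm_step (machine ?cs) ^^ t1) (length (pre @ [?j]), ts) = (length (pre @ [?j]) + length c, ts1)"
    unfolding cs using runsD[OF c r] by metis
  have s2: "tm_step (machine ?cs) (length (pre @ [?j]) + length c, ts1) = (length pre, ts1)"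
    using t1(2) unfolding cs
    by (subst tm_step_jump[where x = 0 and P = "\<lambda>_. True" and j = "- int (length c) - 2"])
       (auto simp: represents_def nth_append)
  obtain t2 ts2 where t2: "t2 \<le> T2" "represents s2 ts2"
    "(tm_step (machine ?cs) ^^ t2) (length pre, ts1) = (length pre + length (while x P c), ts2)"
    using runsD[OF w t1(2)] by metis
  have "(tm_step (machine ?cs) ^^ (t2 + (1 + (t1 + 1)))) (length pre, ts)
      = (length pre + length (while x P c), ts2)"
    using s1 s2 t1 t2 unfolding funpow_add o_apply by simp
  then show "\<exists>t\<le>T1 + T2 + 2. \<exists>ts'. represents s2 ts' \<and>
      (tm_step (machine ?cs) ^^ t) (length pre, ts) = (length pre + length (while x P c), ts')"
    using t1 t2 by (intro exI[of _ "t2 + (1 + (t1 + 1))"]) auto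
qed

section \<open>Programs on a stack of trees\<close>

datatype tree = Leaf | Node tree tree

fun enc :: "tree \<Rightarrow> bool list" where
  "enc Leaf = [False]"
| "enc (Node a b) = True # enc a @ enc b"

abbreviation sz :: "tree \<Rightarrow> nat" where "sz x \<equiv> length (enc x)"

lemma sz_pos: "0 < sz x"
  by (cases x) auto

text \<open>The preorder code is prefix-free, so a stack can hold several trees without separators.
  The remainders are arbitrary because the induction reads the left subtree with the code of the
  right one still behind it.\<close>

lemma enc_inj_append: "enc x @ r = enc y @ r' \<Longrightarrow> x = y \<and> r = r'"
proof (induction x arbitrary: y r r')
  case Leaf
  then show ?case by (cases y) auto
next
  case (Node a b)
  from Node.prems obtain c d where y: "y = Node c d" by (cases y) auto
  then have "enc a @ (enc b @ r) = enc c @ (enc d @ r')" using Node.prems by simp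
  from Node.IH(1)[OF this] Node.IH(2) y show ?case by blast
qed

lemma enc_inj: "enc x = enc y \<Longrightarrow> x = y"
  using enc_inj_append[of x "[]" y "[]"] by simp

text \<open>\<open>m\<close> is the main stack, which holds the trees; \<open>a\<close>,
  \<open>b\<close>, \<open>c\<close> are scratch stacks and \<open>v\<close> is the output. Indices
  beyond 4 are fixed to the empty word, so that updates of the five components again have this
  form.\<close>

definition st :: "bool list \<Rightarrow> bool list \<Rightarrow> bool list \<Rightarrow> bool list \<Rightarrow> bool list \<Rightarrow> store" where
  "st m a b c v = (\<lambda>i. if i = 0 then m else if i = 1 then a else if i = 2 then b
     else if i = 3 then c else if i = 4 then v else [])"

lemma st_apply [simp]:
  "st m a b c v 0 = m" "st m a b c v 1 = a" "st m a b c v (Suc 0) = a" "st m a b c v 2 = b"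
  "st m a b c v 3 = c" "st m a b c v 4 = v"
  by (auto simp: st_def)

lemma st_update [simp]:
  "(st m a b c v)(0 := x) = st x a b c v" "(st m a b c v)(1 := x) = st m x b c v"
  "(st m a b c v)(Suc 0 := x) = st m x b c v" "(st m a b c v)(2 := x) = st m a x c v"
  "(st m a b c v)(3 := x) = st m a b x v" "(st m a b c v)(4 := x) = st m a b c x"
  by (auto simp: st_def fun_eq_iff)

lemma runs_seq: "runs c1 s T1 s1 \<Longrightarrow> runs c2 s1 T2 s2 \<Longrightarrow> T1 + T2 \<le> T \<Longrightarrow> runs (c1 @ c2) s T s2"
  by (rule runs_mono[OF runs_append])

lemma runs_while_stop':
  "x < 4 \<Longrightarrow> \<not> P (top_symbol (s x)) \<Longrightarrow> 1 \<le> T \<Longrightarrow> s' = s \<Longrightarrow> runs (while x P c) s T s'"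
  using runs_mono[OF runs_while_stop[of x P s c]] by simp

section \<open>Moving words and trees between the stacks\<close>

definition push :: "nat \<Rightarrow> bool \<Rightarrow> instr list" where "push x b = [Left x, Write x b]"
definition pop :: "nat \<Rightarrow> instr list" where "pop x = [Erase x]"

lemma runs_push': "x < 4 \<Longrightarrow> s' = s(x := b # s x) \<Longrightarrow> runs (push x b) s 2 s'"
  by (simp add: push_def runs_push)

lemma runs_pop': "x < 4 \<Longrightarrow> s' = s(x := tl (s x)) \<Longrightarrow> runs (pop x) s 1 s'"
  using runs_pop[of x s] by (simp add: pop_def)

definition nonempty :: "nat \<Rightarrow> bool" where "nonempty s \<longleftrightarrow> s \<noteq> 0"
definition is_true :: "nat \<Rightarrow> bool" where "is_true s \<longleftrightarrow> s = 2"
definition is_false :: "nat \<Rightarrow> bool" where "is_false s \<longleftrightarrow> s = 1"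

lemma test_simps [simp]:
  "nonempty (top_symbol w) \<longleftrightarrow> w \<noteq> []" "is_true (top_symbol (b # w)) \<longleftrightarrow> b"
  "is_false (top_symbol (b # w)) \<longleftrightarrow> \<not> b" 
  "\<not> nonempty 0" "nonempty 1" "nonempty (Suc 0)" "nonempty 2"
  "\<not> is_true 0" "\<not> is_true 1" "\<not> is_true (Suc 0)" "is_true 2"
  "\<not> is_false 0" "is_false 1" "is_false (Suc 0)" "\<not> is_false 2"
  by (auto simp: is_false_def nonempty_def is_true_def top_symbol_def bit_symbol_def split: list.split)

definition push_word :: "bool list \<Rightarrow> instr list" where
  "push_word w = concat (map (push 0) (rev w))"

lemma runs_push_word: "runs (push_word w) (st m a b c v) (2 * length w) (st (w @ m) a b c v)"
proof (induction w)
  case Nil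
  then show ?case by (simp add: push_word_def runs_Nil)
next
  case (Cons x w)
  have "push_word (x # w) = push_word w @ push 0 x" by (simp add: push_word_def)
  then show ?case using runs_seq[OF Cons runs_push'[OF _ refl, of 0 x]] by simp
qed

definition pour :: "nat \<Rightarrow> nat \<Rightarrow> instr list" where
  "pour k j = while k nonempty (branch k is_true (pop k @ push j True) (pop k @ push j False))"

lemma runs_pour:
  assumes "k < 4" "j < 4" "k \<noteq> j" "s k = w"
  shows "runs (pour k j) s (7 * length w + 1) (s(k := [], j := rev w @ s j))"
  using assms(4)
proof (induction w arbitrary: s)
  case Nil
  then show ?case unfolding pour_def
    by (intro runs_while_stop') (use assms in \<open>auto simp: fun_eq_iff\<close>)
next
  case (Cons x w)
  let ?s = "s(k := w, j := x # s j)"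
  have 1: "runs (branch k is_true (pop k @ push j True) (pop k @ push j False)) s (3 + 2) ?s"
    by (rule runs_branch)
       (use assms Cons.prems in \<open>auto intro!: runs_seq[OF runs_pop'[OF _ refl] runs_push'] simp: fun_eq_iff\<close>)
  have 2: "runs (pour k j) ?s (7 * length w + 1) (?s(k := [], j := rev w @ ?s j))"
    by (rule Cons.IH) (use assms in auto)
  have 3: "?s(k := [], j := rev w @ ?s j) = s(k := [], j := rev (x # w) @ s j)"
    using assms by (auto simp: fun_eq_iff)
  have "runs (pour k j) s ((3 + 2) + (7 * length w + 1) + 2) (s(k := [], j := rev (x # w) @ s j))"
    unfolding pour_def
    by (rule runs_while_step[OF _ _ 1 2[unfolded 3 pour_def]]) (use assms Cons.prems in simp_all)
  then show ?case by (rule runs_mono) simp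
qed

definition pour2 :: "nat \<Rightarrow> nat \<Rightarrow> nat \<Rightarrow> instr list" where
  "pour2 k j l = while k nonempty
     (branch k is_true (pop k @ push j True @ push l True) (pop k @ push j False @ push l False))"

lemma runs_pour2:
  assumes "k < 4" "j < 4" "l < 4" "k \<noteq> j" "k \<noteq> l" "j \<noteq> l" "s k = w"
  shows "runs (pour2 k j l) s (9 * length w + 1) (s(k := [], j := rev w @ s j, l := rev w @ s l))"
  using assms(7)
proof (induction w arbitrary: s)
  case Nil
  then show ?case unfolding pour2_def
    by (intro runs_while_stop') (use assms in \<open>auto simp: fun_eq_iff\<close>)
next
  case (Cons x w)
  let ?s = "s(k := w, j := x # s j, l := x # s l)"
  have 1: "runs (branch k is_true (pop k @ push j True @ push l True) (pop k @ push j False @ push l False))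
      s (5 + 2) ?s"
    by (rule runs_branch)
       (use assms Cons.prems in \<open>auto intro!: runs_seq[OF runs_pop'[OF _ refl] runs_seq[OF runs_push'[OF _ refl] runs_push']]
          simp: fun_eq_iff\<close>)
  have 2: "runs (pour2 k j l) ?s (9 * length w + 1) (?s(k := [], j := rev w @ ?s j, l := rev w @ ?s l))"
    by (rule Cons.IH) (use assms in auto)
  have 3: "?s(k := [], j := rev w @ ?s j, l := rev w @ ?s l)
      = s(k := [], j := rev (x # w) @ s j, l := rev (x # w) @ s l)"
    using assms by (auto simp: fun_eq_iff)
  have "runs (pour2 k j l) s ((5 + 2) + (9 * length w + 1) + 2)
      (s(k := [], j := rev (x # w) @ s j, l := rev (x # w) @ s l))"
    unfolding pour2_def
    by (rule runs_while_step[OF _ _ 1 2[unfolded 3 pour2_def]]) (use assms Cons.prems in simp_all)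
  then show ?case by (rule runs_mono) simp
qed

text \<open>Stack 3 counts, in unary, the trees that remain to be read.\<close>

definition scan_loop :: "nat \<Rightarrow> instr list" where
  "scan_loop k = while 3 nonempty
     (branch 0 is_true (pop 0 @ push k True @ push 3 True) (pop 0 @ push k False @ pop 3))"

lemma runs_scan_body:
  assumes "k = 1 \<or> k = 2"
  shows "runs (pop 0 @ push k True @ push 3 True) s 5 (s(0 := tl (s 0), k := True # s k, 3 := True # s 3))"
    and "runs (pop 0 @ push k False @ pop 3) s 5 (s(0 := tl (s 0), k := False # s k, 3 := tl (s 3)))"
proof -
  show "runs (pop 0 @ push k True @ push 3 True) s 5 (s(0 := tl (s 0), k := True # s k, 3 := True # s 3))"
    by (rule runs_seq[OF runs_pop'[OF _ refl] runs_seq[OF runs_push'[OF _ refl] runs_push']])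
       (use assms in auto)
  show "runs (pop 0 @ push k False @ pop 3) s 5 (s(0 := tl (s 0), k := False # s k, 3 := tl (s 3)))"
    by (rule runs_seq[OF runs_pop'[OF _ refl] runs_seq[OF runs_push'[OF _ refl] runs_pop']])
       (use assms in auto)
qed

text \<open>In continuation form: a run that starts behind the tree is extended to one that starts
  before it. The case \<open>Node\<close> then just applies the hypothesis for the right subtree and
  after it the one for the left subtree. Each symbol costs 9 steps: 5 for the body, 2 for the branch
  and 2 for the loop.\<close>

lemma runs_scan_loop:
  assumes k: "k = 1 \<or> k = 2"
    and "runs (scan_loop k) (s(0 := r, k := rev (enc x) @ a, 3 := c)) T s'"
  shows "runs (scan_loop k) (s(0 := enc x @ r, k := a, 3 := True # c)) (9 * sz x + T) s'"
  using assms(2)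
proof (induction x arbitrary: r a c T)
  case Leaf
  let ?s = "s(0 := enc Leaf @ r, k := a, 3 := True # c)"
  let ?s' = "s(0 := r, k := rev (enc Leaf) @ a, 3 := c)"
  have eq: "?s(0 := tl (?s 0), k := False # ?s k, 3 := tl (?s 3)) = ?s'"
    using k by (auto simp: fun_eq_iff)
  have 1: "runs (branch 0 is_true (pop 0 @ push k True @ push 3 True) (pop 0 @ push k False @ pop 3))
      ?s (5 + 2) ?s'"
    by (rule runs_branch)
       (use k runs_scan_body(2)[OF k, of ?s, unfolded eq] in auto)
  have "runs (scan_loop k) ?s (5 + 2 + T + 2) s'"
    unfolding scan_loop_def
  proof (rule runs_while_step[OF _ _ 1])
    show "runs (while 3 nonempty (branch 0 is_true (pop 0 @ push k True @ push 3 True)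
        (pop 0 @ push k False @ pop 3))) ?s' T s'"
      using Leaf unfolding scan_loop_def .
  qed simp_all
  then show ?case by (rule runs_mono) simp
next
  case (Node x y)
  let ?s = "s(0 := enc (Node x y) @ r, k := a, 3 := True # c)"
  let ?s' = "s(0 := enc x @ enc y @ r, k := True # a, 3 := True # True # c)"
  have eq: "?s(0 := tl (?s 0), k := True # ?s k, 3 := True # ?s 3) = ?s'"
    using k by (auto simp: fun_eq_iff)
  have 1: "runs (branch 0 is_true (pop 0 @ push k True @ push 3 True) (pop 0 @ push k False @ pop 3))
      ?s (5 + 2) ?s'"
    by (rule runs_branch)
       (use k runs_scan_body(1)[OF k, of ?s, unfolded eq] in auto)
  have "rev (enc (Node x y)) @ a = rev (enc y) @ rev (enc x) @ True # a" by simp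
  have "runs (scan_loop k) (s(0 := r, k := rev (enc y) @ rev (enc x) @ True # a, 3 := c)) T s'"
    unfolding \<open>rev (enc (Node x y)) @ a = _\<close>[symmetric] by (rule Node.prems)
  note 2 = Node.IH(1)[OF Node.IH(2)[OF this]]
  have "runs (scan_loop k) ?s (5 + 2 + (9 * sz x + (9 * sz y + T)) + 2) s'"
    unfolding scan_loop_def by (rule runs_while_step[OF _ _ 1 2[unfolded scan_loop_def]]) simp_all
  then show ?case by (rule runs_mono) simp
qed

definition take_tree :: "nat \<Rightarrow> instr list" where
  "take_tree k = push 3 True @ scan_loop k"

lemma runs_take_tree1:
  "runs (take_tree 1) (st (enc x @ r) a b [] v) (9 * sz x + 3) (st r (rev (enc x) @ a) b [] v)"
proof -
  let ?s = "st r a b [] v"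
  have "runs (scan_loop 1) (?s(0 := r, 1 := rev (enc x) @ a, 3 := [])) 1 (st r (rev (enc x) @ a) b [] v)"
    unfolding scan_loop_def st_update by (rule runs_while_stop) auto
  from runs_scan_loop[OF _ this] show ?thesis
    unfolding take_tree_def by (auto intro!: runs_seq[OF runs_push'[OF _ refl]])
qed

lemma runs_take_tree2:
  "runs (take_tree 2) (st (enc x @ r) a b [] v) (9 * sz x + 3) (st r a (rev (enc x) @ b) [] v)"
proof -
  let ?s = "st r a b [] v"
  have "runs (scan_loop 2) (?s(0 := r, 2 := rev (enc x) @ b, 3 := [])) 1 (st r a (rev (enc x) @ b) [] v)"
    unfolding scan_loop_def st_update by (rule runs_while_stop) auto
  from runs_scan_loop[OF _ this] show ?thesis
    unfolding take_tree_def by (auto intro!: runs_seq[OF runs_push'[OF _ refl]])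
qed

lemma runs_pour_st:
  "runs (pour 0 1) (st m a b c v) (7 * length m + 1) (st [] (rev m @ a) b c v)"
  "runs (pour 1 0) (st m a b c v) (7 * length a + 1) (st (rev a @ m) [] b c v)"
  "runs (pour 2 0) (st m a b c v) (7 * length b + 1) (st (rev b @ m) a [] c v)"
  "runs (pour 2 1) (st m a b c v) (7 * length b + 1) (st m (rev b @ a) [] c v)"
  using runs_pour[of 0 1 "st m a b c v" m] runs_pour[of 1 0 "st m a b c v" a]
    runs_pour[of 2 0 "st m a b c v" b] runs_pour[of 2 1 "st m a b c v" b] by auto

definition clear :: "nat \<Rightarrow> instr list" where "clear k = while k nonempty (pop k)"

lemma runs_clear:
  assumes "k < 4" "s k = w"
  shows "runs (clear k) s (3 * length w + 1) (s(k := []))"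
  using assms(2)
proof (induction w arbitrary: s)
  case Nil
  then show ?case unfolding clear_def
    by (intro runs_while_stop') (use assms in auto)
next
  case (Cons x w)
  have "runs (clear k) (s(k := w)) (3 * length w + 1) ((s(k := w))(k := []))"
    by (rule Cons.IH) simp
  then have "runs (clear k) s (1 + (3 * length w + 1) + 2) (s(k := []))"
    unfolding clear_def
    by (intro runs_while_step[OF _ _ runs_pop'[where s' = "s(k := w)"]])
       (use Cons.prems assms in simp_all)
  then show ?case by (rule runs_mono) simp
qed

abbreviation main :: "bool list \<Rightarrow> store" where "main m \<equiv> st m [] [] [] []"

text \<open>Pouring reverses. After \<open>take_tree\<close> the word lies reversed on stack 1;
  \<open>pour2\<close> puts it upright on stacks 0 and 2, and the copy on stack 2 needs a detour
  over stack 1 to arrive upright on stack 0 as well.\<close>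

definition dup :: "instr list" where "dup = take_tree 1 @ pour2 1 0 2 @ pour 2 1 @ pour 1 0"

lemma runs_dup: "runs dup (main (enc x @ r)) (32 * sz x + 6) (main (enc x @ enc x @ r))"
proof -
  have "runs (pour2 1 0 2) (st r (rev (enc x)) [] [] []) (9 * sz x + 1) (st (enc x @ r) [] (enc x) [] [])"
    using runs_pour2[of 1 0 2 "st r (rev (enc x)) [] [] []" "rev (enc x)"] by auto
  moreover have "runs (pour 2 1) (st (enc x @ r) [] (enc x) [] []) (7 * sz x + 1)
      (st (enc x @ r) (rev (enc x)) [] [] [])"
    using runs_pour_st(4)[of "enc x @ r" "[]" "enc x"] by simp
  moreover have "runs (pour 1 0) (st (enc x @ r) (rev (enc x)) [] [] []) (7 * sz x + 1)
      (main (enc x @ enc x @ r))"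
    using runs_pour_st(2)[of "enc x @ r" "rev (enc x)"] by simp
  moreover have "runs (take_tree 1) (main (enc x @ r)) (9 * sz x + 3) (st r (rev (enc x)) [] [] [])"
    using runs_take_tree1[of x r "[]"] by simp
  ultimately show ?thesis unfolding dup_def by (elim runs_seq) auto
qed

definition swap :: "instr list" where "swap = take_tree 1 @ take_tree 2 @ pour 1 0 @ pour 2 0"

lemma runs_swap:
  "runs swap (main (enc x @ enc y @ r)) (16 * (sz x + sz y) + 8) (main (enc y @ enc x @ r))"
proof -
  have "runs (take_tree 1) (main (enc x @ enc y @ r)) (9 * sz x + 3) (st (enc y @ r) (rev (enc x)) [] [] [])"
    using runs_take_tree1[of x _ "[]"] by simp
  moreover have "runs (take_tree 2) (st (enc y @ r) (rev (enc x)) [] [] []) (9 * sz y + 3)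
      (st r (rev (enc x)) (rev (enc y)) [] [])"
    using runs_take_tree2[of y r _ "[]"] by simp
  moreover have "runs (pour 1 0) (st r (rev (enc x)) (rev (enc y)) [] []) (7 * sz x + 1)
      (st (enc x @ r) [] (rev (enc y)) [] [])"
    using runs_pour_st(2)[of r "rev (enc x)"] by simp
  moreover have "runs (pour 2 0) (st (enc x @ r) [] (rev (enc y)) [] []) (7 * sz y + 1)
      (main (enc y @ enc x @ r))"
    using runs_pour_st(3)[of "enc x @ r" "[]" "rev (enc y)"] by simp
  ultimately show ?thesis unfolding swap_def by (elim runs_seq) auto
qed

definition drop_tree :: "instr list" where "drop_tree = take_tree 1 @ clear 1"

lemma runs_drop: "runs drop_tree (main (enc x @ r)) (12 * sz x + 4) (main r)"
proof -
  have "runs (take_tree 1) (main (enc x @ r)) (9 * sz x + 3) (st r (rev (enc x)) [] [] [])"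
    using runs_take_tree1[of x _ "[]"] by simp
  moreover have "runs (clear 1) (st r (rev (enc x)) [] [] []) (3 * sz x + 1) (main r)"
    using runs_clear[of 1 "st r (rev (enc x)) [] [] []" "rev (enc x)"] by simp
  ultimately show ?thesis unfolding drop_tree_def by (elim runs_seq) auto
qed

subsection \<open>Comparison\<close>

text \<open>Larger than necessary on purpose: its code has length 7, so that consuming a bit
  \<open>True\<close> of the input pays for the nodes which a parser creates (see
  \<open>parser_list\<close>).\<close>

definition true_tree :: tree where
  "true_tree = Node Leaf (Node Leaf (Node Leaf Leaf))"

lemma enc_true_tree: "enc true_tree = [True, False, True, False, True, False, False]"
  by (simp add: true_tree_def)

definition bit_tree :: "bool \<Rightarrow> tree" where "bit_tree b = (if b then true_tree else Leaf)"

text \<open>Each mismatch leaves a mark on stack 3, so there is no early exit and equality is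
  emptiness of stack 3 at the end. One branch tests for \<open>is_true\<close> and the other for
  \<open>is_false\<close>, so that an exhausted stack 2, whose top symbol is a blank, counts as a
  mismatch in both.\<close>

definition compare_loop :: "instr list" where
  "compare_loop = while 1 nonempty
     (branch 1 is_true
        (branch 2 is_true (pop 1 @ pop 2) (push 3 True @ pop 1 @ pop 2))
        (branch 2 is_false (pop 1 @ pop 2) (push 3 True @ pop 1 @ pop 2)))"

lemma runs_compare_loop:
  "\<exists>c'. (c' = [] \<longleftrightarrow> c = [] \<and> a = take (length a) b) \<and> length c' \<le> length c + length a \<and>
     runs compare_loop (st m a b c v) (10 * length a + 1) (st m [] (drop (length a) b) c' v)"
proof (induction a arbitrary: b c)
  case Nil
  then show ?case by (intro exI[of _ c]) (auto simp: compare_loop_def intro!: runs_while_stop')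
next
  case (Cons x a)
  let ?eq = "b \<noteq> [] \<and> hd b = x"
  let ?c = "if ?eq then c else True # c"
  obtain c' where c': "c' = [] \<longleftrightarrow> ?c = [] \<and> a = take (length a) (tl b)"
    "length c' \<le> length ?c + length a"
    "runs compare_loop (st m a (tl b) ?c v) (10 * length a + 1) (st m [] (drop (length a) (tl b)) c' v)"
    using Cons.IH[of ?c "tl b"] by blast
  have eq: "runs (pop 1 @ pop 2) (st m (x # a) b c v) (2 + 2) (st m a (tl b) c v)"
    by (auto intro!: runs_seq[OF runs_pop'[OF _ refl] runs_pop'])
  have neq: "runs (push 3 True @ pop 1 @ pop 2) (st m (x # a) b c v) (2 + 2) (st m a (tl b) (True # c) v)"
    by (rule runs_seq[OF runs_push' runs_seq[OF runs_pop'[OF _ refl] runs_pop']]) auto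
  have "runs (branch 1 is_true
        (branch 2 is_true (pop 1 @ pop 2) (push 3 True @ pop 1 @ pop 2))
        (branch 2 is_false (pop 1 @ pop 2) (push 3 True @ pop 1 @ pop 2))) (st m (x # a) b c v)
      ((2 + 2) + 2 + 2) (st m a (tl b) ?c v)"
  proof (rule runs_branch)
    show "runs (branch 2 is_true (pop 1 @ pop 2) (push 3 True @ pop 1 @ pop 2)) (st m (x # a) b c v)
        (2 + 2 + 2) (st m a (tl b) ?c v)" if "is_true (top_symbol (st m (x # a) b c v 1))"
    proof (rule runs_branch)
      show "runs (pop 1 @ pop 2) (st m (x # a) b c v) (2 + 2) (st m a (tl b) ?c v)"
        if "is_true (top_symbol (st m (x # a) b c v 2))"
        using that \<open>is_true (top_symbol (st m (x # a) b c v 1))\<close> eq by (cases b) auto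
      show "runs (push 3 True @ pop 1 @ pop 2) (st m (x # a) b c v) (2 + 2) (st m a (tl b) ?c v)"
        if "\<not> is_true (top_symbol (st m (x # a) b c v 2))"
        using that \<open>is_true (top_symbol (st m (x # a) b c v 1))\<close> neq by (cases b) auto
    qed simp
    show "runs (branch 2 is_false (pop 1 @ pop 2) (push 3 True @ pop 1 @ pop 2)) (st m (x # a) b c v)
        (2 + 2 + 2) (st m a (tl b) ?c v)" if "\<not> is_true (top_symbol (st m (x # a) b c v 1))"
    proof (rule runs_branch)
      show "runs (pop 1 @ pop 2) (st m (x # a) b c v) (2 + 2) (st m a (tl b) ?c v)"
        if "is_false (top_symbol (st m (x # a) b c v 2))"
        using that \<open>\<not> is_true (top_symbol (st m (x # a) b c v 1))\<close> eq by (cases b) auto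
      show "runs (push 3 True @ pop 1 @ pop 2) (st m (x # a) b c v) (2 + 2) (st m a (tl b) ?c v)"
        if "\<not> is_false (top_symbol (st m (x # a) b c v 2))"
        using that \<open>\<not> is_true (top_symbol (st m (x # a) b c v 1))\<close> neq by (cases b) auto
    qed simp
  qed simp
  from runs_while_step[OF _ _ this c'(3)[unfolded compare_loop_def]]
  have "runs compare_loop (st m (x # a) b c v) (10 * length (x # a) + 1)
      (st m [] (drop (length (x # a)) b) c' v)"
    by (simp add: compare_loop_def drop_Suc)
  then show ?case using c' by (intro exI[of _ c']) (cases b; auto split: if_splits)
qed

text \<open>A comparison needs its two arguments in one tree; elsewhere the value is irrelevant.\<close>

fun eq_tree :: "tree \<Rightarrow> tree" where
  "eq_tree Leaf = Leaf"
| "eq_tree (Node a b) = bit_tree (a = b)"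

definition compare_trees :: "instr list" where
  "compare_trees = branch 0 is_true
     (pop 0 @ take_tree 1 @ take_tree 2 @
      compare_loop @ branch 2 nonempty (push 3 True @ clear 2) [] @
      branch 3 nonempty (clear 3 @ push_word [False]) (push_word (enc true_tree)))
     []"

lemma runs_compare_trees:
  "runs compare_trees (main (enc x @ r)) (25 * sz x + 50) (main (enc (eq_tree x) @ r))"
proof (cases x)
  case Leaf
  have "runs compare_trees (main (enc x @ r)) (0 + 2) (main (enc (eq_tree x) @ r))"
    unfolding compare_trees_def by (rule runs_branch) (auto simp: Leaf intro: runs_Nil)
  then show ?thesis by (rule runs_mono) simp
next
  case (Node a b)
  let ?a = "rev (enc a)" and ?b = "rev (enc b)"
  let ?m = "enc (eq_tree x) @ r"
  have 0: "runs (pop 0) (main (enc x @ r)) 1 (main (enc a @ enc b @ r))"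
    using Node by (intro runs_pop') auto
  have 1: "runs (take_tree 1) (main (enc a @ enc b @ r)) (9 * sz a + 3) (st (enc b @ r) ?a [] [] [])"
    using runs_take_tree1[of a _ "[]"] by simp
  have 2: "runs (take_tree 2) (st (enc b @ r) ?a [] [] []) (9 * sz b + 3) (st r ?a ?b [] [])"
    using runs_take_tree2[of b r _ "[]"] by simp
  obtain c where c: "c = [] \<longleftrightarrow> ?a = take (sz a) ?b" "length c \<le> sz a"
    "runs compare_loop (st r ?a ?b [] []) (10 * sz a + 1) (st r [] (drop (sz a) ?b) c [])"
    using runs_compare_loop[of "[]" ?a ?b r "[]"] by auto
  \<comment> \<open>Leftover bits of the second code add one more mark, so no mark remains exactly
    if the two words are equal.\<close>
  let ?c = "if drop (sz a) ?b = [] then c else True # c"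
  have eq: "?c = [] \<longleftrightarrow> a = b"
  proof
    assume "?c = []"
    then have "drop (sz a) ?b = []" "?a = take (sz a) ?b" using c by (auto split: if_splits)
    then have "?a = ?b" by (metis append_take_drop_id append_Nil2)
    then show "a = b" using enc_inj by auto
  qed (use c in auto)
  have 3: "runs (branch 2 nonempty (push 3 True @ clear 2) []) (st r [] (drop (sz a) ?b) c [])
      ((3 * sz b + 3) + 2) (st r [] [] ?c [])"
  proof (rule runs_branch)
    assume "nonempty (top_symbol (st r [] (drop (sz a) ?b) c [] 2))"
    then have ne: "drop (sz a) ?b \<noteq> []" by auto
    have "runs (clear 2) (st r [] (drop (sz a) ?b) (True # c) []) (3 * (sz b - sz a) + 1)
        (st r [] [] (True # c) [])"
      using runs_clear[of 2 "st r [] (drop (sz a) ?b) (True # c) []" "drop (sz a) ?b"] by simp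
    then show "runs (push 3 True @ clear 2) (st r [] (drop (sz a) ?b) c []) (3 * sz b + 3)
        (st r [] [] ?c [])"
      using ne by (intro runs_seq[OF runs_push'[OF _ refl]]) auto
  qed (auto intro!: runs_mono[OF runs_Nil])
  have 4: "runs (branch 3 nonempty (clear 3 @ push_word [False]) (push_word (enc true_tree)))
      (st r [] [] ?c []) ((3 * sz a + 20) + 2) (main ?m)"
  proof (rule runs_branch)
    assume "nonempty (top_symbol (st r [] [] ?c [] 3))"
    then have ne: "?c \<noteq> []" by auto
    then have m: "?m = [False] @ r" using eq Node by (simp add: bit_tree_def)
    have "runs (clear 3) (st r [] [] ?c []) (3 * length ?c + 1) (main r)"
      using runs_clear[of 3 "st r [] [] ?c []" ?c] by simp
    then show "runs (clear 3 @ push_word [False]) (st r [] [] ?c []) (3 * sz a + 20) (main ?m)"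
      unfolding m by (rule runs_seq[OF _ runs_push_word]) (use c(2) in auto)
  next
    assume "\<not> nonempty (top_symbol (st r [] [] ?c [] 3))"
    then have e: "?c = []" by auto
    then have m: "?m = enc true_tree @ r" using eq Node by (simp add: bit_tree_def)
    show "runs (push_word (enc true_tree)) (st r [] [] ?c []) (3 * sz a + 20) (main ?m)"
      unfolding m e by (rule runs_mono[OF runs_push_word]) (simp add: enc_true_tree)
  qed auto
  have "runs (pop 0 @ take_tree 1 @ take_tree 2 @
      compare_loop @ branch 2 nonempty (push 3 True @ clear 2) [] @
      branch 3 nonempty (clear 3 @ push_word [False]) (push_word (enc true_tree)))
     (main (enc x @ r)) (22 * sz a + 12 * sz b + 35) (main ?m)"
    using 0 1 2 c(3) 3 4 by (elim runs_seq) auto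
  then have "runs compare_trees (main (enc x @ r)) (22 * sz a + 12 * sz b + 35 + 2) (main ?m)"
    unfolding compare_trees_def by (intro runs_branch) (auto simp: Node)
  then show ?thesis by (rule runs_mono) (simp add: Node)
qed

subsection \<open>Words as trees\<close>

fun list_tree :: "tree list \<Rightarrow> tree" where
  "list_tree [] = Leaf"
| "list_tree (x # xs) = Node x (list_tree xs)"

definition word_tree :: "bool list \<Rightarrow> tree" where
  "word_tree w = list_tree (map bit_tree w)"

lemma word_tree_simps [simp]:
  "word_tree [] = Leaf" "word_tree (b # w) = Node (bit_tree b) (word_tree w)"
  by (auto simp: word_tree_def)

text \<open>Stack 1 holds the word reversed, so its last bit comes first and the list is built from
  its end. Each bit is prepended as the code of its tree behind a symbol \<open>True\<close>, which
  is the list cell.\<close>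

definition collect_word :: "instr list" where
  "collect_word = push_word [False] @ while 1 nonempty
     (branch 1 is_true (pop 1 @ push_word (True # enc true_tree)) (pop 1 @ push_word [True, False]))"

lemma runs_collect_word:
  "runs collect_word (st m (rev w) [] [] []) (21 * length w + 3) (main (enc (word_tree w) @ m))"
proof -
  let ?b = "branch 1 is_true (pop 1 @ push_word (True # enc true_tree)) (pop 1 @ push_word [True, False])"
  have "runs (while 1 nonempty ?b) (st (enc (word_tree u) @ m) (rev w) [] [] []) (21 * length w + 1)
     (main (enc (word_tree (w @ u)) @ m))" for u
  proof (induction w arbitrary: u rule: rev_induct)
    case Nil
    then show ?case by (auto intro!: runs_while_stop')
  next
    case (snoc x w)
    have 1: "runs ?b (st (enc (word_tree u) @ m) (rev (w @ [x])) [] [] []) (17 + 2)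
       (st (enc (word_tree (x # u)) @ m) (rev w) [] [] [])"
      using runs_push_word[of "True # enc true_tree" "enc (word_tree u) @ m" "rev w" "[]" "[]" "[]"]
        runs_push_word[of "[True, False]" "enc (word_tree u) @ m" "rev w" "[]" "[]" "[]"]
      by (intro runs_branch) (auto intro!: runs_seq[OF runs_pop'[OF _ refl]] simp: bit_tree_def enc_true_tree)
    show ?case
      using runs_while_step[OF _ _ 1 snoc.IH[of "x # u"]] by simp
  qed
  from this[of "[]"] show ?thesis
    unfolding collect_word_def using runs_push_word[of "[False]" m "rev w" "[]" "[]" "[]"]
    by (auto intro: runs_seq)
qed

text \<open>Turns the code of a tree into data, namely a list of bits. This is what makes
  \<open>name\<close> computable, and with it the vertex names of the constructed graphs.\<close>

definition quote :: "instr list" where "quote = take_tree 1 @ collect_word"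

lemma runs_quote: "runs quote (main (enc x @ r)) (30 * sz x + 6) (main (enc (word_tree (enc x)) @ r))"
  unfolding quote_def
  using runs_take_tree1[of x r "[]" "[]" "[]"] runs_collect_word[of r "enc x"]
  by (auto intro: runs_seq)

definition read_input :: "instr list" where "read_input = pour 0 1 @ collect_word"

lemma runs_read_input: "runs read_input (main w) (28 * length w + 4) (main (enc (word_tree w)))"
  unfolding read_input_def
  using runs_pour_st(1)[of w "[]" "[]" "[]" "[]"] runs_collect_word[of "[]" w]
  by (auto intro: runs_seq)

text \<open>The tree of a bit is recognised by its first symbol; the seven pops remove the code of
  \<open>true_tree\<close>. The loop ends at the symbol \<open>False\<close> that codes the empty
  list.\<close>

definition write_output :: "instr list" where
  "write_output = while 0 is_true (pop 0 @ branch 0 is_true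
     (Emit True # pop 0 @ pop 0 @ pop 0 @ pop 0 @ pop 0 @ pop 0 @ pop 0) (Emit False # pop 0))"

lemma runs_pop_st: "runs (pop 0) (st (x # m) a b c v) 1 (st m a b c v)"
  by (rule runs_pop') auto

lemma runs_pop_append:
  "runs k (st m a b c v) T s' \<Longrightarrow> runs (pop 0 @ k) (st (x # m) a b c v) (1 + T) s'"
  by (rule runs_append[OF runs_pop_st])

lemma runs_write_output:
  "runs write_output (st (enc (word_tree w)) [] [] [] v) (13 * length w + 1) (st [False] [] [] [] (v @ w))"
proof (induction w arbitrary: v)
  case Nil
  then show ?case by (auto simp: write_output_def intro!: runs_while_stop')
next
  case (Cons x w)
  have e: "runs (Emit b # c) (st m [] [] [] v) (1 + T) s'"
    if "runs c (st m [] [] [] (v @ [b])) T s'" for b c m T s'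
    using runs_append[OF runs_emit, of c "st m [] [] [] v" b T s'] that by simp
  let ?r = "enc (word_tree w)"
  have t: "runs (Emit True # pop 0 @ pop 0 @ pop 0 @ pop 0 @ pop 0 @ pop 0 @ pop 0)
       (st (enc true_tree @ ?r) [] [] [] v) (1 + (1 + (1 + (1 + (1 + (1 + (1 + 1)))))))
       (st ?r [] [] [] (v @ [True]))"
    unfolding enc_true_tree append_Cons append_Nil by (intro e runs_pop_append runs_pop_st)
  have f: "runs (Emit False # pop 0) (st (False # ?r) [] [] [] v) (1 + 1) (st ?r [] [] [] (v @ [False]))"
    by (intro e runs_pop_st)
  have "runs (branch 0 is_true
     (Emit True # pop 0 @ pop 0 @ pop 0 @ pop 0 @ pop 0 @ pop 0 @ pop 0) (Emit False # pop 0))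
     (st (enc (bit_tree x) @ ?r) [] [] [] v) (8 + 2) (st ?r [] [] [] (v @ [x]))"
  proof (rule runs_branch)
    assume "is_true (top_symbol (st (enc (bit_tree x) @ ?r) [] [] [] v 0))"
    then have x by (cases x) (auto simp: bit_tree_def)
    then show "runs (Emit True # pop 0 @ pop 0 @ pop 0 @ pop 0 @ pop 0 @ pop 0 @ pop 0)
       (st (enc (bit_tree x) @ ?r) [] [] [] v) 8 (st ?r [] [] [] (v @ [x]))"
      using runs_mono[OF t, of 8] by (simp add: bit_tree_def)
  next
    assume "\<not> is_true (top_symbol (st (enc (bit_tree x) @ ?r) [] [] [] v 0))"
    then have "\<not> x" by (cases x) (auto simp: bit_tree_def enc_true_tree)
    then show "runs (Emit False # pop 0)
       (st (enc (bit_tree x) @ ?r) [] [] [] v) 8 (st ?r [] [] [] (v @ [x]))"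
      using runs_mono[OF f, of 8] by (simp add: bit_tree_def)
  qed simp
  then have 1: "runs (pop 0 @ branch 0 is_true
     (Emit True # pop 0 @ pop 0 @ pop 0 @ pop 0 @ pop 0 @ pop 0 @ pop 0) (Emit False # pop 0))
     (st (enc (word_tree (x # w))) [] [] [] v) (1 + (8 + 2)) (st ?r [] [] [] (v @ [x]))"
    by (simp only: word_tree_simps enc.simps append_Cons runs_pop_append)
  have "runs write_output (st (enc (word_tree (x # w))) [] [] [] v) (1 + (8 + 2) + (13 * length w + 1) + 2)
      (st [False] [] [] [] ((v @ [x]) @ w))"
    unfolding write_output_def
    by (rule runs_while_step[OF _ _ 1 Cons.IH[unfolded write_output_def]]) simp_all
  then show ?case by simp
qed

section \<open>Polynomial time functions on structured data\<close>

lemma poly_nat_mono: "m \<le> n \<Longrightarrow> poly (p :: nat poly) m \<le> poly p n"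
  by (induction p) (auto intro!: mult_mono)

text \<open>Time bounds arise as sums, products and compositions of other bounds. Closure rules for
  functions that are merely dominated by a polynomial avoid writing these expressions as
  polynomials.\<close>

definition poly_bounded :: "(nat \<Rightarrow> nat) \<Rightarrow> bool" where
  "poly_bounded f \<longleftrightarrow> (\<exists>p :: nat poly. \<forall>n. f n \<le> poly p n)"

lemma poly_bounded_const: "poly_bounded (\<lambda>n. c)"
  unfolding poly_bounded_def by (intro exI[of _ "[:c:]"]) auto

lemma poly_bounded_id: "poly_bounded (\<lambda>n. n)"
  unfolding poly_bounded_def by (intro exI[of _ "[:0, 1:]"]) auto

lemma poly_bounded_add: "poly_bounded f \<Longrightarrow> poly_bounded g \<Longrightarrow> poly_bounded (\<lambda>n. f n + g n)"
  unfolding poly_bounded_def by (metis add_mono poly_add)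

lemma poly_bounded_mult: "poly_bounded f \<Longrightarrow> poly_bounded g \<Longrightarrow> poly_bounded (\<lambda>n. f n * g n)"
  unfolding poly_bounded_def by (metis mult_le_mono poly_mult)

lemma poly_bounded_poly: "poly_bounded f \<Longrightarrow> poly_bounded (\<lambda>n. poly p (f n))"
  unfolding poly_bounded_def by (metis poly_pcompose poly_nat_mono)

lemmas poly_bounded_intros =
  poly_bounded_const poly_bounded_id poly_bounded_add poly_bounded_mult poly_bounded_poly

text \<open>Injectivity lets equality of data be decided by comparing codes, and makes names of
  different objects different.\<close>

class treeable =
  fixes tr :: "'a \<Rightarrow> tree"
  assumes inj_tr: "tr x = tr y \<Longrightarrow> x = y"

abbreviation tsz :: "'a::treeable \<Rightarrow> nat" where "tsz x \<equiv> sz (tr x)"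

text \<open>One program and one polynomial for all arguments. The rest \<open>r\<close> of the stack
  is arbitrary, which allows other values to be kept below the argument; the size bound is what
  turns the time bound of a second program into one in terms of the original input.\<close>

definition pt :: "('a::treeable \<Rightarrow> 'b::treeable) \<Rightarrow> bool" where
  "pt f \<longleftrightarrow> (\<exists>cs p. \<forall>x. tsz (f x) \<le> poly p (tsz x) \<and>
     (\<forall>r. runs cs (main (enc (tr x) @ r)) (poly p (tsz x)) (main (enc (tr (f x)) @ r))))"

lemma ptI:
  assumes "poly_bounded S" "poly_bounded T"
    and "\<And>x. tsz (f x) \<le> S (tsz x)"
    and "\<And>x r. runs cs (main (enc (tr x) @ r)) (T (tsz x)) (main (enc (tr (f x)) @ r))"
  shows "pt f"
proof -
  obtain p q :: "nat poly" where "\<And>n. S n \<le> poly p n" "\<And>n. T n \<le> poly q n"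
    using assms(1,2) unfolding poly_bounded_def by blast
  then have *: "S n \<le> poly (p + q) n" "T n \<le> poly (p + q) n" for n
    by (simp_all add: trans_le_add1 trans_le_add2)
  have "tsz (f x) \<le> poly (p + q) (tsz x)"
    "runs cs (main (enc (tr x) @ r)) (poly (p + q) (tsz x)) (main (enc (tr (f x)) @ r))" for x r
    using le_trans[OF assms(3) *(1)] runs_mono[OF assms(4) *(2)] by blast+
  then show ?thesis unfolding pt_def by blast
qed

lemma ptD:
  assumes "pt f"
  shows "\<exists>cs p. (\<forall>x. tsz (f x) \<le> poly p (tsz x)) \<and>
    (\<forall>x r. runs cs (main (enc (tr x) @ r)) (poly p (tsz x)) (main (enc (tr (f x)) @ r)))"
  using assms unfolding pt_def by blast

lemma pt_same_tree: "(\<And>x. tr (f x) = tr x) \<Longrightarrow> pt f"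
  by (rule ptI[where S = "\<lambda>n. n" and T = "\<lambda>n. 0" and cs = "[]"])
     (auto intro: poly_bounded_intros runs_Nil)

lemma pt_id: "pt (\<lambda>x. x)"
  by (rule pt_same_tree) simp

lemma pt_compose:
  assumes "pt g" "pt f"
  shows "pt (\<lambda>x. g (f x))"
proof -
  obtain c p where f0: "\<forall>x. tsz (f x) \<le> poly p (tsz x)"
    "\<forall>x r. runs c (main (enc (tr x) @ r)) (poly p (tsz x)) (main (enc (tr (f x)) @ r))"
    using ptD[OF assms(2)] by blast
  note f = f0[rule_format]
  obtain d q where g0: "\<forall>x. tsz (g x) \<le> poly q (tsz x)"
    "\<forall>x r. runs d (main (enc (tr x) @ r)) (poly q (tsz x)) (main (enc (tr (g x)) @ r))"
    using ptD[OF assms(1)] by blast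
  note g = g0[rule_format]
  have le: "poly q (tsz (f x)) \<le> poly q (poly p (tsz x))" for x
    by (rule poly_nat_mono[OF f(1)])
  show ?thesis
  proof (rule ptI)
    show "poly_bounded (\<lambda>n. poly q (poly p n))" "poly_bounded (\<lambda>n. poly p n + poly q (poly p n))"
      by (intro poly_bounded_intros)+
    show "tsz (g (f x)) \<le> poly q (poly p (tsz x))" for x
      using le_trans[OF g(1) le] .
    show "runs (c @ d) (main (enc (tr x) @ r)) (poly p (tsz x) + poly q (poly p (tsz x)))
        (main (enc (tr (g (f x))) @ r))" for x r
      by (rule runs_append[OF f(2) runs_mono[OF g(2) le]])
  qed
qed

lemma pt_const: "pt (\<lambda>x. c)"
proof (rule ptI)
  show "poly_bounded (\<lambda>n. tsz c)" "poly_bounded (\<lambda>n. 12 * n + 4 + 2 * tsz c)"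
    by (intro poly_bounded_intros)+
  show "runs (drop_tree @ push_word (enc (tr c))) (main (enc (tr x) @ r)) (12 * tsz x + 4 + 2 * tsz c)
     (main (enc (tr c) @ r))" for x :: 'a and r
    by (rule runs_append[OF runs_drop runs_push_word])
qed simp

section \<open>Data types as trees\<close>

instantiation tree :: treeable begin
definition tr_tree :: "tree \<Rightarrow> tree" where "tr_tree x = x"
instance by standard (simp add: tr_tree_def)
end

instantiation bool :: treeable begin
definition tr_bool :: "bool \<Rightarrow> tree" where "tr_bool = bit_tree"
instance by standard (auto simp: tr_bool_def bit_tree_def true_tree_def split: if_splits)
end

instantiation prod :: (treeable, treeable) treeable begin
definition tr_prod :: "'a \<times> 'b \<Rightarrow> tree" where "tr_prod p = Node (tr (fst p)) (tr (snd p))"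
instance by standard (auto simp: tr_prod_def prod_eq_iff dest: inj_tr)
end

instantiation list :: (treeable) treeable begin
definition tr_list :: "'a list \<Rightarrow> tree" where "tr_list xs = list_tree (map tr xs)"
instance
proof
  fix x y :: "'a list"
  show "tr x = tr y \<Longrightarrow> x = y"
  proof (induction x arbitrary: y)
    case Nil
    then show ?case by (cases y) (auto simp: tr_list_def)
  next
    case (Cons a x)
    then show ?case by (cases y) (auto simp: tr_list_def dest: inj_tr)
  qed
qed
end

lemma tr_list_simps: "tr [] = Leaf" "tr (x # xs) = Node (tr x) (tr xs)"
  by (auto simp: tr_list_def)

lemma tr_pair: "tr (x, y) = Node (tr x) (tr y)"
  by (simp add: tr_prod_def)

lemma tsz_simps:
  "tsz (x, y) = 1 + tsz x + tsz y" "tsz ([] :: 'a::treeable list) = 1"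
  "tsz (z # xs) = 1 + tsz z + tsz xs"
  by (auto simp: tr_pair tr_list_simps)

lemma tsz_append: "tsz (xs @ ys) + 1 = tsz xs + tsz ys"
  by (induction xs) (auto simp: tsz_simps)

lemma tsz_rev: "tsz (rev xs) = tsz xs"
proof (induction xs)
  case (Cons x xs)
  then show ?case using tsz_append[of "rev xs" "[x]"] by (simp add: tsz_simps)
qed simp

lemma length_le_tsz: "length xs \<le> tsz xs"
  by (induction xs) (auto simp: tsz_simps)

lemma tsz_member: "y \<in> set ys \<Longrightarrow> tsz y \<le> tsz ys"
  by (induction ys) (auto simp: tsz_simps)

text \<open>The second component is computed first, from a copy. A swap brings the other copy of the
  argument to the top for \<open>f\<close>, and the two results already lie in the order of a pair
  code, which lacks only its leading \<open>True\<close>.\<close>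

lemma pt_pair:
  assumes "pt f" "pt g"
  shows "pt (\<lambda>x. (f x, g x))"
proof -
  obtain c p where f0: "\<forall>x. tsz (f x) \<le> poly p (tsz x)"
    "\<forall>x r. runs c (main (enc (tr x) @ r)) (poly p (tsz x)) (main (enc (tr (f x)) @ r))"
    using ptD[OF assms(1)] by blast
  note f = f0[rule_format]
  obtain d q where g0: "\<forall>x. tsz (g x) \<le> poly q (tsz x)"
    "\<forall>x r. runs d (main (enc (tr x) @ r)) (poly q (tsz x)) (main (enc (tr (g x)) @ r))"
    using ptD[OF assms(2)] by blast
  note g = g0[rule_format]
  let ?S = "\<lambda>n. 1 + poly p n + poly q n"
  let ?T = "\<lambda>n. (32 * n + 6) + (poly q n + ((16 * (poly q n + n) + 8) + (poly p n + 2)))"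
  show ?thesis
  proof (rule ptI)
    show "poly_bounded ?S" "poly_bounded ?T"
      by (intro poly_bounded_intros)+
    show "tsz (f x, g x) \<le> ?S (tsz x)" for x
      using f(1)[of x] g(1)[of x] by (simp add: tsz_simps)
    show "runs (dup @ d @ swap @ c @ push 0 True) (main (enc (tr x) @ r)) (?T (tsz x))
        (main (enc (tr (f x, g x)) @ r))" for x r
    proof (intro runs_append)
      show "runs dup (main (enc (tr x) @ r)) (32 * tsz x + 6) (main (enc (tr x) @ (enc (tr x) @ r)))"
        using runs_dup by simp
      show "runs d (main (enc (tr x) @ (enc (tr x) @ r))) (poly q (tsz x))
          (main (enc (tr (g x)) @ (enc (tr x) @ r)))"
        by (rule g(2))
      show "runs swap (main (enc (tr (g x)) @ (enc (tr x) @ r))) (16 * (poly q (tsz x) + tsz x) + 8)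
          (main (enc (tr x) @ (enc (tr (g x)) @ r)))"
        by (rule runs_mono[OF runs_swap]) (use g(1)[of x] in simp)
      show "runs c (main (enc (tr x) @ (enc (tr (g x)) @ r))) (poly p (tsz x))
          (main (enc (tr (f x)) @ (enc (tr (g x)) @ r)))"
        by (rule f(2))
      show "runs (push 0 True) (main (enc (tr (f x)) @ enc (tr (g x)) @ r)) 2
          (main (enc (tr (f x, g x)) @ r))"
        by (rule runs_push') (auto simp: tr_pair)
    qed
  qed
qed

text \<open>A function may be computed on trees, whatever this does to trees that represent nothing.\<close>

lemma pt_tree:
  fixes g :: "tree \<Rightarrow> tree"
  assumes "pt g" "\<And>x. g (tr x) = tr (f x)"
  shows "pt f"
proof -
  obtain c p where *: "\<forall>t. tsz (g t) \<le> poly p (tsz t)"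
    "\<forall>t r. runs c (main (enc (tr t) @ r)) (poly p (tsz t)) (main (enc (tr (g t)) @ r))"
    using ptD[OF assms(1)] by blast
  have "tsz (f x) \<le> poly p (tsz x)"
    "runs c (main (enc (tr x) @ r)) (poly p (tsz x)) (main (enc (tr (f x)) @ r))" for x r
    using *(1)[rule_format, of "tr x"] *(2)[rule_format, of "tr x" r]
    unfolding tr_tree_def assms(2) by simp_all
  then show ?thesis
    unfolding pt_def by blast
qed

fun left :: "tree \<Rightarrow> tree" where "left Leaf = Leaf" | "left (Node a b) = a"
fun right :: "tree \<Rightarrow> tree" where "right Leaf = Leaf" | "right (Node a b) = b"

lemma pt_left_tree: "pt left"
proof (rule ptI)
  show "poly_bounded (\<lambda>n. n)" "poly_bounded (\<lambda>n. 1 + ((16 * n + 8) + (12 * n + 4)) + 2)"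
    by (intro poly_bounded_intros)+
  show "tsz (left x) \<le> tsz x" for x
    by (cases x) (auto simp: tr_tree_def)
  show "runs (branch 0 is_true (pop 0 @ swap @ drop_tree) []) (main (enc (tr x) @ r))
     (1 + ((16 * tsz x + 8) + (12 * tsz x + 4)) + 2) (main (enc (tr (left x)) @ r))" for x r
  proof (rule runs_branch)
    assume "is_true (top_symbol (main (enc (tr x) @ r) 0))"
    then obtain a b where x: "x = Node a b" by (cases x) (auto simp: tr_tree_def)
    have "runs (pop 0) (main (enc x @ r)) 1 (main (enc a @ enc b @ r))"
      by (rule runs_pop') (auto simp: x)
    moreover have "runs swap (main (enc a @ enc b @ r)) (16 * sz x + 8) (main (enc b @ enc a @ r))"
      by (rule runs_mono[OF runs_swap]) (simp add: x)
    moreover have "runs drop_tree (main (enc b @ enc a @ r)) (12 * sz x + 4) (main (enc a @ r))"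
      by (rule runs_mono[OF runs_drop]) (simp add: x)
    ultimately have "runs (pop 0 @ swap @ drop_tree) (main (enc x @ r))
        (1 + ((16 * sz x + 8) + (12 * sz x + 4))) (main (enc a @ r))"
      by (intro runs_append)
    then show "runs (pop 0 @ swap @ drop_tree) (main (enc (tr x) @ r))
        (1 + ((16 * tsz x + 8) + (12 * tsz x + 4))) (main (enc (tr (left x)) @ r))"
      by (simp add: tr_tree_def x)
  next
    assume "\<not> is_true (top_symbol (main (enc (tr x) @ r) 0))"
    then have "x = Leaf" by (cases x) (auto simp: tr_tree_def)
    then show "runs [] (main (enc (tr x) @ r)) (1 + ((16 * tsz x + 8) + (12 * tsz x + 4)))
        (main (enc (tr (left x)) @ r))"
      by (auto simp: tr_tree_def intro: runs_mono[OF runs_Nil])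
  qed simp
qed

lemma pt_right_tree: "pt right"
proof (rule ptI)
  show "poly_bounded (\<lambda>n. n)" "poly_bounded (\<lambda>n. 1 + (12 * n + 4) + 2)"
    by (intro poly_bounded_intros)+
  show "tsz (right x) \<le> tsz x" for x
    by (cases x) (auto simp: tr_tree_def)
  show "runs (branch 0 is_true (pop 0 @ drop_tree) []) (main (enc (tr x) @ r))
     (1 + (12 * tsz x + 4) + 2) (main (enc (tr (right x)) @ r))" for x r
  proof (rule runs_branch)
    assume "is_true (top_symbol (main (enc (tr x) @ r) 0))"
    then obtain a b where x: "x = Node a b" by (cases x) (auto simp: tr_tree_def)
    have "runs (pop 0) (main (enc x @ r)) 1 (main (enc a @ enc b @ r))"
      by (rule runs_pop') (auto simp: x)
    moreover have "runs drop_tree (main (enc a @ enc b @ r)) (12 * sz x + 4) (main (enc b @ r))"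
      by (rule runs_mono[OF runs_drop]) (simp add: x)
    ultimately have "runs (pop 0 @ drop_tree) (main (enc x @ r)) (1 + (12 * sz x + 4)) (main (enc b @ r))"
      by (intro runs_append)
    then show "runs (pop 0 @ drop_tree) (main (enc (tr x) @ r)) (1 + (12 * tsz x + 4))
        (main (enc (tr (right x)) @ r))"
      by (simp add: tr_tree_def x)
  next
    assume "\<not> is_true (top_symbol (main (enc (tr x) @ r) 0))"
    then have "x = Leaf" by (cases x) (auto simp: tr_tree_def)
    then show "runs [] (main (enc (tr x) @ r)) (1 + (12 * tsz x + 4)) (main (enc (tr (right x)) @ r))"
      by (auto simp: tr_tree_def intro: runs_mono[OF runs_Nil])
  qed simp
qed

lemma pt_fst: "pt f \<Longrightarrow> pt (\<lambda>x. fst (f x))"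
  by (rule pt_compose[OF pt_tree[OF pt_left_tree]]) (auto simp: tr_prod_def)

lemma pt_snd: "pt f \<Longrightarrow> pt (\<lambda>x. snd (f x))"
  by (rule pt_compose[OF pt_tree[OF pt_right_tree]]) (auto simp: tr_prod_def)

lemma pt_tl: assumes "pt f" shows "pt (\<lambda>x. tl (f x))"
proof (rule pt_compose[OF pt_tree[OF pt_right_tree] assms])
  show "right (tr xs) = tr (tl xs)" for xs :: "'b list"
    by (cases xs) (auto simp: tr_list_simps)
qed

lemma pt_Cons: assumes "pt f" "pt g" shows "pt (\<lambda>x. f x # g x)"
proof -
  have "pt (\<lambda>p. fst p # snd p)"
    by (rule pt_same_tree) (auto simp: tr_list_simps tr_prod_def)
  from pt_compose[OF this pt_pair[OF assms]] show ?thesis by simp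
qed

lemma pt_eq:
  assumes "pt f" "pt g"
  shows "pt (\<lambda>x. f x = g x)"
proof -
  have "pt (\<lambda>p :: 'b \<times> 'b. fst p = snd p)"
  proof (rule ptI)
    show "poly_bounded (\<lambda>n. 7)" "poly_bounded (\<lambda>n. 25 * n + 50)"
      by (intro poly_bounded_intros)+
    show "tsz (fst x = snd x) \<le> 7" for x :: "'b \<times> 'b"
      by (simp add: tr_bool_def bit_tree_def true_tree_def)
    have "tr a = tr b \<longleftrightarrow> a = b" for a b :: 'b by (auto dest: inj_tr)
    then have e: "eq_tree (tr x) = tr (fst x = snd x)" for x :: "'b \<times> 'b"
      by (simp add: tr_prod_def tr_bool_def)
    show "runs compare_trees (main (enc (tr x) @ r)) (25 * tsz x + 50) (main (enc (tr (fst x = snd x)) @ r))"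
      for x :: "'b \<times> 'b" and r
      using runs_compare_trees[of "tr x" r] unfolding e .
  qed
  from pt_compose[OF this pt_pair[OF assms]] show ?thesis by simp
qed


lemma pt_if:
  assumes "pt b" "pt f" "pt g"
  shows "pt (\<lambda>x. if b x then f x else g x)"
proof -
  obtain c p where b0: "\<forall>x. tsz (b x) \<le> poly p (tsz x)"
    "\<forall>x r. runs c (main (enc (tr x) @ r)) (poly p (tsz x)) (main (enc (tr (b x)) @ r))"
    using ptD[OF assms(1)] by blast
  note b = b0[rule_format]
  obtain d q where f0: "\<forall>x. tsz (f x) \<le> poly q (tsz x)"
    "\<forall>x r. runs d (main (enc (tr x) @ r)) (poly q (tsz x)) (main (enc (tr (f x)) @ r))"
    using ptD[OF assms(2)] by blast
  note f = f0[rule_format]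
  obtain e u where g0: "\<forall>x. tsz (g x) \<le> poly u (tsz x)"
    "\<forall>x r. runs e (main (enc (tr x) @ r)) (poly u (tsz x)) (main (enc (tr (g x)) @ r))"
    using ptD[OF assms(3)] by blast
  note g = g0[rule_format]
  let ?S = "\<lambda>n. poly q n + poly u n"
  \<comment> \<open>Removing the tree of the test value takes at most 12 * 7 + 4 = 88 steps; 100
    covers this.\<close>
  let ?B = "\<lambda>n. 100 + poly q n + poly u n"
  let ?T = "\<lambda>n. (32 * n + 6) + (poly p n + (?B n + 2))"
  show ?thesis
  proof (rule ptI)
    show "poly_bounded ?S" "poly_bounded ?T"
      by (intro poly_bounded_intros)+
    show "tsz (if b x then f x else g x) \<le> ?S (tsz x)" for x
      using f(1)[of x] g(1)[of x] by simp
    show "runs (dup @ c @ branch 0 is_true (drop_tree @ d) (pop 0 @ e)) (main (enc (tr x) @ r)) (?T (tsz x))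
        (main (enc (tr (if b x then f x else g x)) @ r))" for x r
    proof (rule runs_append[OF _ runs_append[OF _ runs_branch]])
      show "runs dup (main (enc (tr x) @ r)) (32 * tsz x + 6) (main (enc (tr x) @ (enc (tr x) @ r)))"
        using runs_dup by simp
      show "runs c (main (enc (tr x) @ (enc (tr x) @ r))) (poly p (tsz x))
          (main (enc (tr (b x)) @ (enc (tr x) @ r)))"
        by (rule b(2))
      let ?s = "main (enc (tr (b x)) @ (enc (tr x) @ r))"
      show "runs (drop_tree @ d) ?s (?B (tsz x)) (main (enc (tr (if b x then f x else g x)) @ r))"
        if "is_true (top_symbol (?s 0))"
      proof -
        have "b x" using that by (auto simp: tr_bool_def bit_tree_def split: if_splits)
        then show ?thesis
          by (intro runs_seq[OF runs_drop])
             (use f(2)[of x r] in \<open>auto simp: tr_bool_def bit_tree_def true_tree_def\<close>)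
      qed
      show "runs (pop 0 @ e) ?s (?B (tsz x)) (main (enc (tr (if b x then f x else g x)) @ r))"
        if "\<not> is_true (top_symbol (?s 0))"
      proof -
        have nb: "\<not> b x" using that by (auto simp: tr_bool_def bit_tree_def true_tree_def)
        have "runs (pop 0) ?s 1 (main (enc (tr x) @ r))"
          by (rule runs_pop') (use nb in \<open>auto simp: tr_bool_def bit_tree_def\<close>)
        from runs_append[OF this g(2)] show ?thesis
          using nb by (auto elim!: runs_mono)
      qed
    qed simp
  qed
qed

lemma pt_not: assumes "pt b" shows "pt (\<lambda>x. \<not> b x)"
proof -
  have "(\<lambda>x. \<not> b x) = (\<lambda>x. if b x then False else True)" by auto
  then show ?thesis by (simp only:) (intro pt_if pt_const assms)
qed

lemma pt_conj: assumes "pt a" "pt b" shows "pt (\<lambda>x. a x \<and> b x)"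
proof -
  have "(\<lambda>x. a x \<and> b x) = (\<lambda>x. if a x then b x else False)" by auto
  then show ?thesis by (simp only:) (intro pt_if pt_const assms)
qed

lemma pt_disj: assumes "pt a" "pt b" shows "pt (\<lambda>x. a x \<or> b x)"
proof -
  have "(\<lambda>x. a x \<or> b x) = (\<lambda>x. if a x then True else b x)" by auto
  then show ?thesis by (simp only:) (intro pt_if pt_const assms)
qed

lemma pt_imp: assumes "pt a" "pt b" shows "pt (\<lambda>x. a x \<longrightarrow> b x)"
proof -
  have "(\<lambda>x. a x \<longrightarrow> b x) = (\<lambda>x. if a x then b x else True)" by auto
  then show ?thesis by (simp only:) (intro pt_if pt_const assms)
qed

lemma pt_hd:
  fixes f :: "'a::treeable \<Rightarrow> 'b::treeable list"
  assumes "pt f" shows "pt (\<lambda>x. hd (f x))"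
proof (rule pt_compose[OF pt_tree assms])
  \<comment> \<open>\<open>hd []\<close> is unspecified but fixed, so its tree can be built into the
    program as a constant.\<close>
  show "pt (\<lambda>t. if t = Leaf then tr (hd [] :: 'b) else left t)"
    by (intro pt_if pt_eq pt_const pt_id pt_left_tree)
  show "(if tr xs = Leaf then tr (hd [] :: 'b) else left (tr xs)) = tr (hd xs)" for xs :: "'b list"
    by (cases xs) (auto simp: tr_list_simps)
qed

text \<open>Besides the number \<open>n x\<close> of iterations, all intermediate values must be
  bounded polynomially in the input: repeating a polynomial-time step polynomially often could
  otherwise enlarge the data beyond any polynomial.\<close>

lemma pt_while:
  fixes b :: "'a::treeable \<Rightarrow> 'a"
  assumes "pt t" "pt b"
    and t: "\<And>x i. i < n x \<Longrightarrow> t ((b ^^ i) x)" "\<And>x. \<not> t ((b ^^ n x) x)"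
    and n: "\<And>x. n x \<le> poly q (tsz x)"
    and s: "\<And>x i. i \<le> n x \<Longrightarrow> tsz ((b ^^ i) x) \<le> poly q (tsz x)"
  shows "pt (\<lambda>x. (b ^^ n x) x)"
proof -
  obtain c p where t0: "\<forall>x. tsz (t x) \<le> poly p (tsz x)"
    "\<forall>x r. runs c (main (enc (tr x) @ r)) (poly p (tsz x)) (main (enc (tr (t x)) @ r))"
    using ptD[OF assms(1)] by blast
  note t' = t0[rule_format]
  obtain d u where b0: "\<forall>x. tsz (b x) \<le> poly u (tsz x)"
    "\<forall>x r. runs d (main (enc (tr x) @ r)) (poly u (tsz x)) (main (enc (tr (b x)) @ r))"
    using ptD[OF assms(2)] by blast
  note b = b0[rule_format]
  let ?D = "\<lambda>m. (32 * m + 6) + poly p m"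
  \<comment> \<open>88 = 12 * 7 + 4 bounds the removal of the previous test value.\<close>
  let ?L = "\<lambda>m. 88 + (poly u m + ?D m)"
  let ?loop = "while 0 is_true (drop_tree @ d @ dup @ c)"
  have test: "runs (dup @ c) (main (enc (tr x) @ r)) (?D m) (main (enc (tr (t x)) @ (enc (tr x) @ r)))"
    if "tsz x \<le> m" for x r m
    using runs_append[OF runs_dup[of "tr x" r] t'(2)[of x "enc (tr x) @ r"]]
    by (rule runs_mono) (use that poly_nat_mono[OF that, of p] in simp)
  have body: "runs (drop_tree @ d @ dup @ c) (main (enc (tr (t x)) @ (enc (tr x) @ r))) (?L m)
      (main (enc (tr (t (b x))) @ (enc (tr (b x)) @ r)))" if "tsz x \<le> m" "tsz (b x) \<le> m" for x r m
  proof -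
    have 1: "runs drop_tree (main (enc (tr (t x)) @ (enc (tr x) @ r))) 88 (main (enc (tr x) @ r))"
      by (rule runs_mono[OF runs_drop]) (simp add: tr_bool_def bit_tree_def true_tree_def)
    have 2: "runs d (main (enc (tr x) @ r)) (poly u m) (main (enc (tr (b x)) @ r))"
      by (rule runs_mono[OF b(2) poly_nat_mono[OF that(1)]])
    show ?thesis by (rule runs_append[OF 1 runs_append[OF 2 test[OF that(2)]]])
  qed
  have loop: "runs ?loop (main (enc (tr (t ((b ^^ i) x))) @ (enc (tr ((b ^^ i) x)) @ r)))
      ((n x - i) * (?L m + 2) + 1) (main (enc Leaf @ (enc (tr ((b ^^ n x) x)) @ r)))"
    if "i \<le> n x" "m = poly q (tsz x)" for i x r m
    using that(1)
  proof (induction "n x - i" arbitrary: i)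
    case 0
    then have "i = n x" by simp
    then show ?case using t(2)[of x]
      by (intro runs_while_stop') (auto simp: tr_bool_def bit_tree_def)
  next
    case (Suc k)
    then have i: "i < n x" "k = n x - Suc i" by auto
    have sz: "tsz ((b ^^ i) x) \<le> m" "tsz (b ((b ^^ i) x)) \<le> m"
      using s[of i x] s[of "Suc i" x] i that(2) by auto
    have "runs ?loop (main (enc (tr (t ((b ^^ Suc i) x))) @ (enc (tr ((b ^^ Suc i) x)) @ r)))
      ((n x - Suc i) * (?L m + 2) + 1) (main (enc Leaf @ (enc (tr ((b ^^ n x) x)) @ r)))"
      using Suc.hyps(1)[OF i(2)] i by simp
    then have "runs ?loop (main (enc (tr (t ((b ^^ i) x))) @ (enc (tr ((b ^^ i) x)) @ r)))
      (?L m + ((n x - Suc i) * (?L m + 2) + 1) + 2) (main (enc Leaf @ (enc (tr ((b ^^ n x) x)) @ r)))"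
      by (intro runs_while_step[OF _ _ body[OF sz]])
         (use t(1)[OF i(1)] in \<open>auto simp: tr_bool_def bit_tree_def true_tree_def\<close>)
    moreover have "n x - i = Suc (n x - Suc i)" using i by simp
    ultimately show ?case by (auto elim!: runs_mono)
  qed
  let ?T = "\<lambda>k. ?D k + ((poly q k * (?L (poly q k) + 2) + 1) + 1)"
  show ?thesis
  proof (rule ptI)
    show "poly_bounded (\<lambda>k. poly q k)" "poly_bounded ?T"
      by (intro poly_bounded_intros)+
    show "tsz ((b ^^ n x) x) \<le> poly q (tsz x)" for x
      using s by simp
    show "runs ((dup @ c) @ ?loop @ pop 0) (main (enc (tr x) @ r)) (?T (tsz x))
        (main (enc (tr ((b ^^ n x) x)) @ r))" for x r
    proof (rule runs_append[OF _ runs_append])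
      show "runs (dup @ c) (main (enc (tr x) @ r)) (?D (tsz x)) (main (enc (tr (t x)) @ (enc (tr x) @ r)))"
        by (rule test) simp
      have "runs ?loop (main (enc (tr (t x)) @ (enc (tr x) @ r)))
         (n x * (?L (poly q (tsz x)) + 2) + 1) (main (enc Leaf @ (enc (tr ((b ^^ n x) x)) @ r)))"
        using loop[of 0 x _ r] by simp
      then show "runs ?loop (main (enc (tr (t x)) @ (enc (tr x) @ r)))
         (poly q (tsz x) * (?L (poly q (tsz x)) + 2) + 1) (main (enc Leaf @ (enc (tr ((b ^^ n x) x)) @ r)))"
        by (rule runs_mono) (use n[of x] in simp)
      show "runs (pop 0) (main (enc Leaf @ (enc (tr ((b ^^ n x) x)) @ r))) 1
          (main (enc (tr ((b ^^ n x) x)) @ r))"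
        by (rule runs_pop') auto
    qed
  qed
qed

text \<open>The growth condition keeps iteration polynomial. A step may add to the accumulator an
  amount measured by the environment and the list element through \<open>g\<close>, plus a constant,
  but nothing proportional to the accumulator itself; so the increments add up along the list
  instead of compounding.\<close>

lemma pt_fold:
  assumes "pt (\<lambda>p. s (fst p) (fst (snd p)) (snd (snd p)))" "pt ys" "pt a0"
    and "pt (\<lambda>p. g (fst p) (snd p))"
    and growth: "\<And>e y a. tsz (s e y a) \<le> tsz a + tsz (g e y) + k"
  shows "pt (\<lambda>e. fold (s e) (ys e) (a0 e))"
proof -
  \<comment> \<open>The state of the loop consists of the environment, the remaining list and the
    accumulator.\<close>
  define b where "b = (\<lambda>z. (fst z, tl (fst (snd z)), s (fst z) (hd (fst (snd z))) (snd (snd z))))"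
  define n where "n = (\<lambda>z :: 'a \<times> 'b list \<times> 'c. length (fst (snd z)))"
  obtain q where "\<forall>p. tsz (g (fst p) (snd p)) \<le> poly q (tsz p)"
    using assms(4) unfolding pt_def by blast
  then have q: "tsz (g e y) \<le> poly q (tsz (e, y))" for e y
    by (metis fst_conv snd_conv)
  have iter: "(b ^^ i) (e, xs, a) = (e, drop i xs, fold (s e) (take i xs) a)" if "i \<le> length xs" for i e xs a
    using that
  proof (induction i)
    case (Suc i)
    then show ?case by (simp add: b_def take_Suc_conv_app_nth tl_drop drop_Suc hd_drop_conv_nth)
  qed simp
  have fold_size: "tsz (fold (s e) zs a) \<le> tsz a + length zs * (poly q N + k)"
    if "\<And>y. y \<in> set zs \<Longrightarrow> tsz (e, y) \<le> N" for e zs a N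
    using that
  proof (induction zs arbitrary: a)
    case (Cons z zs)
    have "tsz (fold (s e) zs (s e z a)) \<le> tsz (s e z a) + length zs * (poly q N + k)"
      by (rule Cons.IH) (use Cons.prems in auto)
    also have "tsz (s e z a) \<le> tsz a + (poly q N + k)"
      using growth[of e z a] q[of e z] poly_nat_mono[of "tsz (e, z)" N q] Cons.prems by fastforce
    finally show ?case by simp
  qed simp
  let ?r = "[:0, 2:] + [:0, 1:] * (q + [:k:])"
  have r: "poly ?r N = 2 * N + N * (poly q N + k)" for N by simp
  have "pt (\<lambda>z. (b ^^ n z) z)"
  proof (rule pt_while[where t = "\<lambda>z. fst (snd z) \<noteq> []" and q = ?r])
    show "pt (\<lambda>z :: 'a \<times> 'b list \<times> 'c. fst (snd z) \<noteq> [])"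
      by (intro pt_not pt_eq pt_fst pt_snd pt_id pt_const)
    have "pt (\<lambda>z :: 'a \<times> 'b list \<times> 'c. (fst z, hd (fst (snd z)), snd (snd z)))"
      by (intro pt_pair pt_fst pt_snd pt_id pt_hd)
    from pt_compose[OF assms(1) this] show "pt b"
      unfolding b_def by (intro pt_pair pt_fst pt_snd pt_id pt_tl) simp
    fix z :: "'a \<times> 'b list \<times> 'c"
    obtain e xs a where z: "z = (e, xs, a)" by (cases z)
    show "fst (snd ((b ^^ i) z)) \<noteq> []" if "i < n z" for i
      using that iter[of i xs e a] by (simp add: z n_def)
    show "\<not> fst (snd ((b ^^ n z) z)) \<noteq> []"
      using iter[of "length xs" xs e a] by (simp add: z n_def)
    have N: "tsz z = 2 + tsz e + tsz xs + tsz a" by (simp add: z tsz_simps)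
    have len: "length xs \<le> tsz z" using length_le_tsz[of xs] N by simp
    then show "n z \<le> poly ?r (tsz z)" unfolding r by (simp add: z n_def)
    fix i assume i: "i \<le> n z"
    then have it: "(b ^^ i) z = (e, drop i xs, fold (s e) (take i xs) a)"
      using iter[of i xs e a] by (simp add: z n_def)
    have "tsz (fold (s e) (take i xs) a) \<le> tsz a + length (take i xs) * (poly q (tsz z) + k)"
    proof (rule fold_size)
      fix y assume "y \<in> set (take i xs)"
      then have "y \<in> set xs" by (meson in_set_takeD)
      from tsz_member[OF this] show "tsz (e, y) \<le> tsz z" by (simp add: N tsz_simps)
    qed
    also have "\<dots> \<le> tsz a + tsz z * (poly q (tsz z) + k)"
      using len by (intro add_left_mono mult_right_mono) auto
    finally have "tsz (fold (s e) (take i xs) a) \<le> tsz a + tsz z * (poly q (tsz z) + k)" .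
    moreover have "tsz (drop i xs) \<le> tsz xs"
      using tsz_append[of "take i xs" "drop i xs"] sz_pos[of "tr (take i xs)"]
      unfolding append_take_drop_id by linarith
    ultimately show "tsz ((b ^^ i) z) \<le> poly ?r (tsz z)"
      unfolding r it by (simp add: tsz_simps N)
  qed
  from pt_snd[OF pt_snd[OF pt_compose[OF this pt_pair[OF pt_id pt_pair[OF assms(2,3)]]]]]
  show ?thesis
    by (simp add: n_def iter)
qed

lemma polynomial_time_pt:
  fixes f :: "bool list \<Rightarrow> bool list"
  assumes "pt f"
  shows "polynomial_time_computable f"
proof -
  have w: "tr w = word_tree w" for w :: "bool list"
    by (simp add: tr_list_def word_tree_def tr_bool_def)
  \<comment> \<open>A list cell costs one symbol and the tree of a bit at most seven.\<close>
  have wsz: "sz (word_tree w) \<le> 8 * length w + 1" for w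
    by (induction w) (auto simp: bit_tree_def true_tree_def)
  have lsz: "length w \<le> sz (word_tree w)" for w
    by (induction w) auto
  obtain cs p where f0: "\<forall>x. tsz (f x) \<le> poly p (tsz x)"
    "\<forall>x r. runs cs (main (enc (tr x) @ r)) (poly p (tsz x)) (main (enc (tr (f x)) @ r))"
    using ptD[OF assms] by blast
  note f = f0[rule_format]
  let ?T = "\<lambda>n. (28 * n + 4) + (poly p (8 * n + 1) + (13 * poly p (8 * n + 1) + 1))"
  have "poly_bounded ?T" by (intro poly_bounded_intros)
  then obtain q :: "nat poly" where q: "\<And>n. ?T n \<le> poly q n" unfolding poly_bounded_def by blast
  let ?c = "read_input @ cs @ write_output"
  have run: "runs ?c (main v) (?T (length v)) (st [False] [] [] [] (f v))" for v
  proof (intro runs_append)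
    show "runs read_input (main v) (28 * length v + 4) (main (enc (word_tree v)))"
      by (rule runs_read_input)
    have le: "poly p (tsz v) \<le> poly p (8 * length v + 1)"
      using wsz[of v] by (intro poly_nat_mono) (simp add: w)
    show "runs cs (main (enc (word_tree v))) (poly p (8 * length v + 1)) (main (enc (word_tree (f v))))"
      using runs_mono[OF f(2)[of v "[]"] le] by (simp add: w)
    have "length (f v) \<le> poly p (8 * length v + 1)"
      using lsz[of "f v"] f(1)[of v] le by (simp add: w)
    then show "runs write_output (main (enc (word_tree (f v)))) (13 * poly p (8 * length v + 1) + 1)
        (st [False] [] [] [] (f v))"
      using runs_write_output[of "f v" "[]"] by (auto elim!: runs_mono)
  qed
  have "\<exists>t \<le> poly q (length v).
      let cfg = (tm_step (machine ?c) ^^ t) (initial_config (machine ?c) v)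
      in fst cfg = states (machine ?c) \<and> has_output cfg (f v)" for v
  proof -
    let ?ts = "string_tape v # replicate 4 (string_tape [])"
    have tapes: "stack_tape u (string_tape u)" "output_tape [] (string_tape [])" for u
      by (auto simp: string_tape_def)
    have "stack_tape (main v x) (?ts ! x)" if "x < 4" for x
      using that tapes(1) by (cases "x = 0") (auto simp: nth_Cons' st_def simp del: stack_tape.simps)
    moreover have "output_tape (main v 4) (?ts ! 4)"
      using tapes(2) by simp
    ultimately have "represents (main v) ?ts"
      unfolding represents_def by simp
    from runsD[OF run this, of "[]" "[]"] obtain t ts' where t: "t \<le> ?T (length v)"
      "represents (st [False] [] [] [] (f v)) ts'"
      "(tm_step (machine ?c) ^^ t) (0, ?ts) = (length ?c, ts')"
      by auto
    have "initial_config (machine ?c) v = (0, ?ts)"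
      by (simp add: initial_config_def machine_def)
    moreover have "states (machine ?c) = length ?c" by (simp add: machine_def)
    moreover have "has_output (length ?c, ts') (f v)"
    proof -
      obtain c h where ch: "ts' ! 4 = (c, h)" by fastforce
      have "length ts' = 5" "output_tape (f v) (c, h)"
        using t(2) ch by (auto simp: represents_def)
      then have "last ts' = (c, h)" using ch by (subst last_conv_nth) auto
      then show ?thesis using \<open>output_tape (f v) (c, h)\<close>
        by (auto simp: has_output_def)
    qed
    ultimately show ?thesis using t(1,3) le_trans[OF t(1) q] by (auto simp: Let_def)
  qed
  then show ?thesis
    unfolding polynomial_time_computable_def using turing_machine_machine by blast
qed

text \<open>Programs see trees only. So \<open>f\<close> and \<open>h\<close> may have different
  result types, as for a number and its list of binary digits, and conversions between such types
  cost nothing.\<close>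

lemma pt_cong_tr: "pt h \<Longrightarrow> (\<And>x. tr (f x) = tr (h x)) \<Longrightarrow> pt f"
  unfolding pt_def by simp

lemma pt_case_prod:
  "pt (\<lambda>e. f e (fst (x e)) (snd (x e))) \<Longrightarrow> pt (\<lambda>e. case x e of (a, b) \<Rightarrow> f e a b)"
  by (simp add: case_prod_beta)

lemma pt_let: "pt (\<lambda>e. f e (x e)) \<Longrightarrow> pt (\<lambda>e. let y = x e in f e y)"
  by simp

lemmas pt_basic = pt_id pt_const pt_pair pt_fst pt_snd pt_if pt_eq pt_not pt_conj pt_disj pt_imp
  pt_Cons pt_hd pt_tl pt_case_prod pt_let

section \<open>Functions on lists\<close>

lemma pt_rev: assumes "pt xs" shows "pt (\<lambda>e. rev (xs e))"
proof -
  have "pt (\<lambda>e. fold (\<lambda>y a. y # a) (xs e) [])"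
    by (rule pt_fold[where g = "\<lambda>e y. y" and k = 1])
       (intro pt_basic assms | simp add: tsz_simps)+
  moreover have "fold (\<lambda>y a. y # a) ys [] = rev ys" for ys :: "'b list"
    by (simp add: fold_Cons_rev)
  ultimately show ?thesis by simp
qed

lemma pt_map:
  assumes "pt (\<lambda>p. f (fst p) (snd p))" "pt ys"
  shows "pt (\<lambda>e. map (f e) (ys e))"
proof -
  have "pt (\<lambda>p. f (fst p) (fst (snd p)))"
    using pt_compose[OF assms(1) pt_pair[OF pt_fst[OF pt_id] pt_fst[OF pt_snd[OF pt_id]]]] by simp
  then have "pt (\<lambda>e. fold (\<lambda>y a. f e y # a) (ys e) [])"
    by (intro pt_fold[where g = f and k = 1] pt_basic assms) (simp_all add: tsz_simps)
  moreover have "fold (\<lambda>y a. f e y # a) xs a = rev (map (f e) xs) @ a" for e xs a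
    by (induction xs arbitrary: a) auto
  ultimately show ?thesis using pt_rev by fastforce
qed

lemma pt_append: assumes "pt xs" "pt ys" shows "pt (\<lambda>e. xs e @ ys e)"
proof -
  have "pt (\<lambda>e. fold (\<lambda>y a. y # a) (rev (xs e)) (ys e))"
    by (rule pt_fold[where g = "\<lambda>e y. y" and k = 1])
       (intro pt_basic pt_rev assms | simp add: tsz_simps)+
  moreover have "fold (\<lambda>y a. y # a) (rev us) vs = us @ vs" for us vs :: "'b list"
    by (simp add: fold_Cons_rev)
  ultimately show ?thesis by simp
qed

lemma pt_concat: assumes "pt xs" shows "pt (\<lambda>e. concat (xs e))"
proof -
  have growth: "tsz (y @ a) \<le> tsz a + tsz y + 0" for y a :: "'b list"
    using tsz_append[of y a] by simp
  have "pt (\<lambda>e. fold (\<lambda>y a. y @ a) (rev (xs e)) [])"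
    by (rule pt_fold[where g = "\<lambda>e y. y" and k = 0])
       (intro pt_basic pt_append pt_rev assms growth)+
  moreover have "fold (\<lambda>y a. y @ a) (rev us) vs = concat us @ vs" for us and vs :: "'b list"
    by (induction us arbitrary: vs) auto
  ultimately show ?thesis by simp
qed

lemma pt_filter:
  assumes "pt (\<lambda>p. P (fst p) (snd p))" "pt ys"
  shows "pt (\<lambda>e. filter (P e) (ys e))"
proof -
  have "filter Q xs = concat (map (\<lambda>y. if Q y then [y] else []) xs)" for Q and xs :: "'b list"
    by (induction xs) auto
  then show ?thesis
    by (simp only:) (intro pt_concat pt_map pt_basic assms)
qed

lemma pt_ball:
  assumes "pt (\<lambda>p. P (fst p) (snd p))" "pt ys"
  shows "pt (\<lambda>e. \<forall>y\<in>set (ys e). P e y)"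
proof -
  have "(\<forall>y\<in>set xs. Q y) \<longleftrightarrow> filter (\<lambda>y. \<not> Q y) xs = []" for Q and xs :: "'b list"
    by (auto simp: filter_empty_conv)
  then show ?thesis
    by (simp only:) (intro pt_filter pt_basic assms)
qed

lemma pt_bex:
  assumes "pt (\<lambda>p. P (fst p) (snd p))" "pt ys"
  shows "pt (\<lambda>e. \<exists>y\<in>set (ys e). P e y)"
proof -
  have "(\<exists>y\<in>set xs. Q y) \<longleftrightarrow> filter Q xs \<noteq> []" for Q and xs :: "'b list"
    by (auto simp: filter_empty_conv)
  then show ?thesis
    by (simp only:) (intro pt_filter pt_basic assms)
qed

lemma pt_member: assumes "pt x" "pt ys" shows "pt (\<lambda>e. x e \<in> set (ys e))"
proof -
  have "pt (\<lambda>e. \<exists>y\<in>set (ys e). x e = y)"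
    by (intro pt_bex pt_basic pt_compose[OF assms(1) pt_fst[OF pt_id]] assms)
  moreover have "(\<exists>y\<in>A. z = y) \<longleftrightarrow> z \<in> A" for z :: 'b and A by auto
  ultimately show ?thesis by simp
qed

definition dedup :: "'a list \<Rightarrow> 'a list" where
  "dedup xs = fold (\<lambda>y a. if y \<in> set a then a else y # a) xs []"

lemma fold_dedup:
  fixes xs a :: "'a list"
  assumes "distinct a"
  shows "set (fold (\<lambda>y a. if y \<in> set a then a else y # a) xs a) = set xs \<union> set a \<and>
    distinct (fold (\<lambda>y a. if y \<in> set a then a else y # a) xs a)"
  using assms
proof (induction xs arbitrary: a)
  case (Cons x xs)
  then show ?case using Cons.IH[of "if x \<in> set a then a else x # a"] by auto
qed simp

lemma set_dedup [simp]: "set (dedup xs) = set xs" and distinct_dedup [simp]: "distinct (dedup xs)"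
  using fold_dedup[of "[]" xs] by (auto simp: dedup_def)

lemma pt_dedup: assumes "pt xs" shows "pt (\<lambda>e. dedup (xs e))"
  unfolding dedup_def
proof (rule pt_fold[where g = "\<lambda>e y. y" and k = 1])
  show "tsz (if y \<in> set a then a else y # a) \<le> tsz a + tsz y + 1" for y :: 'b and a
    by (simp add: tsz_simps)
qed (intro pt_basic pt_member assms)+

text \<open>Makes distinctness an equality test: accumulating elements at the front reverses the
  list, and nothing is dropped exactly if there are no repetitions.\<close>

lemma dedup_eq_rev: "dedup xs = rev xs \<longleftrightarrow> distinct xs"
proof
  assume "dedup xs = rev xs"
  then show "distinct xs" using distinct_dedup[of xs] by simp
next
  assume "distinct xs"
  moreover have "fold (\<lambda>y a. if y \<in> set a then a else y # a) xs a = rev xs @ a"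
    if "distinct xs" "set xs \<inter> set a = {}" for a
    using that by (induction xs arbitrary: a) auto
  ultimately show "dedup xs = rev xs" by (simp add: dedup_def)
qed

lemma pt_distinct: assumes "pt xs" shows "pt (\<lambda>e. distinct (xs e))"
  unfolding dedup_eq_rev[symmetric] by (intro pt_basic pt_dedup pt_rev assms)

lemma pt_takeWhile:
  assumes "pt (\<lambda>p. P (fst p) (snd p))" "pt ys"
  shows "pt (\<lambda>e. takeWhile (P e) (ys e))"
proof -
  let ?s = "\<lambda>e y a. if fst a \<or> \<not> P e y then (True, snd a) else (False, y # snd a)"
  have "pt (\<lambda>p. P (fst p) (fst (snd p)))"
    using pt_compose[OF assms(1) pt_pair[OF pt_fst[OF pt_id] pt_fst[OF pt_snd[OF pt_id]]]] by simp
  \<comment> \<open>Raising the flag replaces a tree of size 1 by one of size 7, and a list cell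
    adds one; 8 covers either.\<close>
  moreover have "tsz (?s e y a) \<le> tsz a + tsz y + 8" for e y a
    by (cases a) (auto simp: tsz_simps tr_bool_def bit_tree_def true_tree_def)
  ultimately have "pt (\<lambda>e. rev (snd (fold (?s e) (ys e) (False, []))))"
    by (intro pt_rev pt_snd pt_fold[where g = "\<lambda>e y. y" and k = 8] pt_basic assms)
  moreover have "fold (?s e) xs (True, a) = (True, a)" for e xs a
    by (induction xs) auto
  then have "snd (fold (?s e) xs (False, a)) = rev (takeWhile (P e) xs) @ a" for e xs a
    by (induction xs arbitrary: a) auto
  ultimately show ?thesis by simp
qed

lemmas pt_lists = pt_rev pt_map pt_append pt_concat pt_filter pt_ball pt_bex pt_member pt_dedup
  pt_distinct pt_takeWhile

subsection \<open>Numbers and labels\<close>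

fun val :: "bool list \<Rightarrow> nat" where
  "val [] = 0"
| "val (b # bs) = of_bool b + 2 * val bs"

lemma val_binary: "val (binary n) = n"
proof (induction n rule: less_induct)
  case (less n)
  show ?case
  proof (cases "n = 0")
    case False
    then have "val (binary n) = of_bool (odd n) + 2 * (n div 2)"
      using less[of "n div 2"] by (subst binary.simps) simp
    then show ?thesis by (cases "even n") (auto simp: odd_two_times_div_two_succ)
  qed (simp add: binary.simps)
qed

lemma binary_eq_Nil: "binary n = [] \<longleftrightarrow> n = 0"
  by (subst binary.simps) simp

lemma binary_val: "bs = [] \<or> last bs \<Longrightarrow> binary (val bs) = bs"
proof (induction bs)
  case (Cons b bs)
  show ?case
  proof (cases "bs = []")
    case True
    then show ?thesis using Cons.prems by (simp add: binary.simps)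
  next
    case False
    then have bs: "binary (val bs) = bs" using Cons by simp
    then have "val bs \<noteq> 0" using False by (metis binary_eq_Nil)
    then show ?thesis using bs by (subst binary.simps) auto
  qed
qed (simp add: binary.simps)

lemma last_binary: "binary n = [] \<or> last (binary n)"
proof (induction n rule: less_induct)
  case (less n)
  show ?case
  proof (cases "n = 0")
    case False
    then have "binary n = odd n # binary (n div 2)" by (subst binary.simps) simp
    moreover have "binary (n div 2) = [] \<or> last (binary (n div 2))" using less False by simp
    moreover have "odd n" if "binary (n div 2) = []"
    proof -
      have "n div 2 = 0" using that by (simp add: binary_eq_Nil)
      then have "n = 1" using False by linarith
      then show ?thesis by simp
    qed
    ultimately show ?thesis by auto
  qed (simp add: binary_eq_Nil)
qed

text \<open>The tree of a number is that of its binary digits. Labels are given in binary, so a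
  unary representation would be exponentially larger than the input.\<close>

instantiation nat :: treeable begin
definition tr_nat :: "nat \<Rightarrow> tree" where "tr_nat n = tr (binary n)"
instance by standard (metis inj_tr tr_nat_def val_binary)
end

instantiation edge_label :: treeable begin
fun tr_edge_label :: "edge_label \<Rightarrow> tree" where
  "tr_edge_label Rotation = Leaf"
| "tr_edge_label (Transition n) = Node Leaf (tr n)"
instance
proof
  show "tr x = tr y \<Longrightarrow> x = y" for x y :: edge_label
    by (cases x; cases y) (auto dest: inj_tr)
qed
end

lemma pt_binary: "pt n \<Longrightarrow> pt (\<lambda>e. binary (n e))"
  by (rule pt_cong_tr[where h = n]) (auto simp: tr_nat_def)

text \<open>Words with a leading zero are sent to 0. Hence the tree of the result is the tree of the
  word itself or of the empty word, and reading a number involves no arithmetic. The last bit is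
  written \<open>hd (rev bs)\<close> to stay within computable list functions.\<close>

definition nat_of :: "bool list \<Rightarrow> nat" where
  "nat_of bs = (if bs = [] \<or> hd (rev bs) then val bs else 0)"

lemma tr_nat_of: "tr (nat_of bs) = tr (if bs = [] \<or> hd (rev bs) then bs else [])"
  by (auto simp: nat_of_def tr_nat_def hd_rev binary_val binary.simps[of 0])

lemma nat_of_binary: "nat_of (binary n) = n"
  using last_binary[of n] by (auto simp: nat_of_def val_binary hd_rev)

lemma pt_nat_of: "pt bs \<Longrightarrow> pt (\<lambda>e. nat_of (bs e))"
  by (rule pt_cong_tr[OF _ tr_nat_of]) (intro pt_basic pt_lists)

text \<open>The final digit 1 makes every code a binary number without leading zeros.\<close>

definition name :: "'a::treeable \<Rightarrow> nat" where "name x = val (enc (tr x) @ [True])"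

lemma inj_name: "name x = name y \<longleftrightarrow> x = y"
proof
  assume "name x = name y"
  then have "binary (name x) = binary (name y)" by simp
  then show "x = y" by (auto simp: name_def binary_val dest: enc_inj inj_tr)
qed simp

lemma pt_enc: "pt (\<lambda>x. enc (tr x))"
proof (rule ptI)
  have w: "tr w = word_tree w" for w :: "bool list"
    by (simp add: tr_list_def word_tree_def tr_bool_def)
  have "sz (word_tree w) \<le> 8 * length w + 1" for w
    by (induction w) (auto simp: bit_tree_def true_tree_def)
  then show "tsz (enc (tr x)) \<le> 8 * tsz x + 1" for x :: 'a
    by (simp add: w)
  show "runs quote (main (enc (tr x) @ r)) (30 * tsz x + 6) (main (enc (tr (enc (tr x))) @ r))"
    for x :: 'a and r
    using runs_quote by (simp add: w)
  show "poly_bounded (\<lambda>n. 8 * n + 1)" "poly_bounded (\<lambda>n. 30 * n + 6)"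
    by (intro poly_bounded_intros)+
qed

lemma pt_name: assumes "pt f" shows "pt (\<lambda>e. name (f e))"
proof (rule pt_cong_tr)
  show "pt (\<lambda>e. enc (tr (f e)) @ [True])"
    by (intro pt_basic pt_append pt_compose[OF pt_enc assms])
  show "tr (name (f e)) = tr (enc (tr (f e)) @ [True])" for e
    by (simp add: name_def tr_nat_def binary_val)
qed

lemma pt_Transition: assumes "pt n" shows "pt (\<lambda>e. Transition (n e))"
  by (rule pt_cong_tr[where h = "\<lambda>e. ([] :: bool list, n e)"])
     (auto simp: tr_pair tr_list_simps intro!: pt_basic assms)

text \<open>The value 0 for \<open>Rotation\<close> is chosen to fit the trees: both
  \<open>Rotation\<close> and 0 are \<open>Leaf\<close>, and \<open>right Leaf\<close> is
  \<open>Leaf\<close>, so that \<open>right\<close> computes the count in either case.\<close>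

fun label_count :: "edge_label \<Rightarrow> nat" where
  "label_count Rotation = 0"
| "label_count (Transition n) = n"

lemma pt_label_count: assumes "pt l" shows "pt (\<lambda>e. label_count (l e))"
proof (rule pt_compose[OF pt_tree[OF pt_right_tree] assms])
  show "right (tr x) = tr (label_count x)" for x
    by (cases x) (auto simp: tr_nat_def binary.simps[of 0] tr_list_simps)
qed

subsection \<open>Encoding and parsing\<close>

lemma pt_encode_list:
  assumes "pt (\<lambda>p. f (fst p) (snd p))" "pt xs"
  shows "pt (\<lambda>e. encode_list (f e) (xs e))"
  unfolding encode_list_def by (intro pt_basic pt_lists assms)

lemma pt_encode_nat: assumes "pt n" shows "pt (\<lambda>e. encode_nat (n e))"
  unfolding encode_nat_def by (intro pt_encode_list pt_basic pt_binary assms)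

lemma pt_encode_label: assumes "pt l" shows "pt (\<lambda>e. encode_label (l e))"
proof -
  have "encode_label x = (if x = Rotation then [False] else True # encode_nat (label_count x))" for x
    by (cases x) auto
  then show ?thesis
    by (simp only:) (intro pt_basic pt_encode_nat pt_label_count assms)
qed

lemma pt_encode_digraph: assumes "pt D" shows "pt (\<lambda>e. encode_digraph (D e))"
proof -
  have "encode_digraph D = encode_list encode_nat (fst D) @
     encode_list (\<lambda>(u, l, v). encode_nat u @ encode_label l @ encode_nat v) (snd D)" for D
    by (cases D) auto
  then show ?thesis
    by (simp only:) (intro pt_encode_list pt_basic pt_append pt_encode_nat pt_encode_label assms)
qed

lemma pt_encode_ugraph: assumes "pt D" shows "pt (\<lambda>e. encode_ugraph (D e))"
proof -
  have "encode_ugraph D = encode_list encode_nat (fst D) @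
     encode_list (\<lambda>(u, v). encode_nat u @ encode_nat v) (snd D)" for D
    by (cases D) auto
  then show ?thesis
    by (simp only:) (intro pt_encode_list pt_basic pt_append pt_encode_nat assms)
qed

text \<open>A parser need only be right on words with a valid prefix: the result can be encoded again and
  compared with the input. The number \<open>k\<close> bounds the growth of the trees. It must not exceed 7, the
  size of the tree of a bit \<open>True\<close>, for the iteration in \<open>parse_list\<close> not to make trees larger.\<close>

definition parser :: "nat \<Rightarrow> ('a::treeable \<Rightarrow> bool list) \<Rightarrow> (bool list \<Rightarrow> 'a \<times> bool list) \<Rightarrow> bool" where
  "parser k e p \<longleftrightarrow> pt p \<and> (\<forall>x r. p (e x @ r) = (x, r)) \<and>
     (\<forall>r. tsz (fst (p r)) + tsz (snd (p r)) \<le> tsz r + k)"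

lemma parser_mono: "parser k e p \<Longrightarrow> k \<le> l \<Longrightarrow> parser l e p"
  unfolding parser_def by (meson add_left_mono le_trans)

lemma tsz_tl: "tsz (tl r) \<le> tsz r"
  by (cases r) (auto simp: tsz_simps)

definition parse_step ::
  "(bool list \<Rightarrow> 'a \<times> bool list) \<Rightarrow> 'a list \<times> bool list \<Rightarrow> 'a list \<times> bool list" where
  "parse_step p s = (if snd s \<noteq> [] \<and> hd (snd s)
     then (fst (p (tl (snd s))) # fst s, snd (p (tl (snd s)))) else s)"

definition parse_list :: "(bool list \<Rightarrow> 'a \<times> bool list) \<Rightarrow> bool list \<Rightarrow> 'a list \<times> bool list" where
  "parse_list p w = (let s = fold (\<lambda>_. parse_step p) w ([], w) in (rev (fst s), tl (snd s)))"

lemma parser_list: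
  assumes p: "parser 7 e p"
  shows "parser 1 (encode_list e) (parse_list p)"
proof -
  \<comment> \<open>Consuming the separator \<open>True\<close> frees 1 + 7 symbols. The 7 pay for
    the slack of \<open>p\<close> and the 1 for the new list cell, so a step does not increase the
    total size.\<close>
  have step_size: "tsz (fst (parse_step p s)) + tsz (snd (parse_step p s)) \<le> tsz (fst s) + tsz (snd s)" for s
  proof (cases "snd s \<noteq> [] \<and> hd (snd s)")
    case True
    then obtain r where r: "snd s = True # r" by (cases "snd s") auto
    have "tsz (fst (p r)) + tsz (snd (p r)) \<le> tsz r + 7" using p by (simp add: parser_def)
    then show ?thesis
      by (simp add: parse_step_def r tsz_simps tr_bool_def bit_tree_def true_tree_def)
  qed (auto simp: parse_step_def)
  have ptp: "pt (\<lambda>e. p (f e))" if "pt f" for f :: "'b::treeable \<Rightarrow> bool list"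
    using p that pt_compose unfolding parser_def by blast
  have "pt (\<lambda>w. fold (\<lambda>_. parse_step p) w ([], w))"
  proof (rule pt_fold[where g = "\<lambda>_ y. y" and k = 0])
    show "pt (\<lambda>q. parse_step p (snd (snd q)))"
      unfolding parse_step_def by (intro pt_basic ptp)
    show "tsz (parse_step p s) \<le> tsz s + tsz y + 0" for s and y :: bool
      using step_size[of s] by (simp add: tr_prod_def)
  qed (intro pt_basic)+
  then have "pt (parse_list p)"
    unfolding parse_list_def by (intro pt_basic pt_rev)
  moreover have "parse_list p (encode_list e xs @ r) = (xs, r)" for xs r
  proof -
    have stop: "fold (\<lambda>_. parse_step p) w (a, False # r) = (a, False # r)" for w :: "bool list" and a
      by (induction w) (auto simp: parse_step_def)
    have run: "fold (\<lambda>_. parse_step p) w (a, encode_list e xs @ r) = (rev xs @ a, False # r)"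
      if "length xs \<le> length w" for w :: "bool list" and a
      using that
    proof (induction xs arbitrary: w a)
      case Nil
      then show ?case by (simp add: encode_list_def stop)
    next
      case (Cons x xs)
      then obtain b w' where w: "w = b # w'" by (cases w) auto
      have "encode_list e (x # xs) @ r = True # e x @ encode_list e xs @ r"
        by (simp add: encode_list_def)
      moreover have "p (e x @ encode_list e xs @ r) = (x, encode_list e xs @ r)"
        using p by (simp add: parser_def)
      ultimately have "parse_step p (a, encode_list e (x # xs) @ r) = (x # a, encode_list e xs @ r)"
        by (simp add: parse_step_def)
      then show ?case using Cons w by simp
    qed
    have "length xs \<le> length (encode_list e xs)"
      by (induction xs) (auto simp: encode_list_def)
    then show ?thesis unfolding parse_list_def Let_def by (subst (1 2) run) auto
  qed
  moreover have "tsz (fst (parse_list p r)) + tsz (snd (parse_list p r)) \<le> tsz r + 1" for r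
  proof -
    have "tsz (fst (fold (\<lambda>_. parse_step p) w s)) + tsz (snd (fold (\<lambda>_. parse_step p) w s))
        \<le> tsz (fst s) + tsz (snd s)" for w :: "bool list" and s
    proof (induction w arbitrary: s)
      case (Cons b w)
      show ?case using Cons[of "parse_step p s"] step_size[of s] by simp
    qed simp
    from this[of r "([], r)"] tsz_tl show ?thesis
      unfolding parse_list_def Let_def fst_conv snd_conv tsz_rev
      by (fastforce simp: tsz_simps intro: order_trans[OF add_left_mono])
  qed
  ultimately show ?thesis by (simp add: parser_def)
qed

lemma parser_pair:
  assumes "parser i e p" "parser j d q"
  shows "parser (i + j + 1) (\<lambda>(x, y). e x @ d y)
    (\<lambda>r. ((fst (p r), fst (q (snd (p r)))), snd (q (snd (p r)))))"
proof -
  let ?p = "\<lambda>r. ((fst (p r), fst (q (snd (p r)))), snd (q (snd (p r))))"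
  have "pt p" using assms(1) by (simp add: parser_def)
  have pq: "pt (\<lambda>x. q (f x))" if "pt f" for f :: "bool list \<Rightarrow> bool list"
    using assms that pt_compose unfolding parser_def by blast
  have "pt ?p"
    by (intro pt_basic \<open>pt p\<close> pq)
  moreover have "?p ((case xy of (x, y) \<Rightarrow> e x @ d y) @ r) = (xy, r)" for xy r
    using assms by (cases xy) (simp add: parser_def)
  moreover have "tsz (fst (?p r)) + tsz (snd (?p r)) \<le> tsz r + (i + j + 1)" for r
  proof -
    have "tsz (fst (p r)) + tsz (snd (p r)) \<le> tsz r + i"
      "tsz (fst (q (snd (p r)))) + tsz (snd (q (snd (p r)))) \<le> tsz (snd (p r)) + j"
      using assms by (auto simp: parser_def)
    then show ?thesis unfolding fst_conv snd_conv tsz_simps by linarith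
  qed
  ultimately show ?thesis
    unfolding parser_def by blast
qed

definition parse_nat :: "bool list \<Rightarrow> nat \<times> bool list" where
  "parse_nat r = (let s = parse_list (\<lambda>r. (r \<noteq> [] \<and> hd r, tl r)) r in (nat_of (fst s), snd s))"

lemma parser_nat: "parser 1 encode_nat parse_nat"
proof -
  have "parser 7 (\<lambda>b. [b]) (\<lambda>r. (r \<noteq> [] \<and> hd r, tl r))"
    unfolding parser_def
  proof (intro conjI allI)
    show "tsz (fst (r \<noteq> [] \<and> hd r, tl r)) + tsz (snd (r \<noteq> [] \<and> hd r, tl r)) \<le> tsz r + 7" for r
      by (cases r) (auto simp: tsz_simps tr_bool_def bit_tree_def)
  qed (intro pt_basic | simp)+
  from parser_list[OF this] have p: "parser 1 (encode_list (\<lambda>b. [b])) (parse_list (\<lambda>r. (r \<noteq> [] \<and> hd r, tl r)))" .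
  have size: "tsz (nat_of bs) \<le> tsz bs" for bs
    unfolding tr_nat_of using sz_pos[of "tr bs"] by (simp add: tsz_simps Suc_le_eq)
  have "pt parse_nat"
    unfolding parse_nat_def using p by (intro pt_basic pt_nat_of) (simp_all add: parser_def)
  moreover have "parse_nat (encode_nat n @ r) = (n, r)" for n r
    using p by (simp add: parse_nat_def encode_nat_def parser_def nat_of_binary)
  moreover have "tsz (fst (parse_nat r)) + tsz (snd (parse_nat r)) \<le> tsz r + 1" for r
    unfolding parse_nat_def Let_def fst_conv snd_conv
    by (rule order_trans[OF add_right_mono[OF size]]) (use p in \<open>simp add: parser_def\<close>)
  ultimately show ?thesis by (simp add: parser_def)
qed

definition parse_label :: "bool list \<Rightarrow> edge_label \<times> bool list" where
  "parse_label r = (if r \<noteq> [] \<and> hd r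
     then (Transition (fst (parse_nat (tl r))), snd (parse_nat (tl r))) else (Rotation, tl r))"

lemma parser_label: "parser 1 encode_label parse_label"
proof -
  have pn: "pt (\<lambda>x. parse_nat (f x))" if "pt f" for f :: "bool list \<Rightarrow> bool list"
    using parser_nat that pt_compose unfolding parser_def by blast
  have "pt parse_label"
    unfolding parse_label_def by (intro pt_basic pt_Transition pn)
  moreover have "parse_label (encode_label l @ r) = (l, r)" for l r
    using parser_nat by (cases l) (auto simp: parse_label_def parser_def)
  moreover have "tsz (fst (parse_label r)) + tsz (snd (parse_label r)) \<le> tsz r + 1" for r
  proof (cases r)
    case (Cons b r')
    have "tsz (fst (parse_nat r')) + tsz (snd (parse_nat r')) \<le> tsz r' + 1"
      using parser_nat by (simp add: parser_def)
    then show ?thesis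
      using Cons by (simp add: parse_label_def tsz_simps tr_bool_def bit_tree_def true_tree_def)
  qed (simp add: parse_label_def tsz_simps)
  ultimately show ?thesis by (simp add: parser_def)
qed

text \<open>The slack of an edge parser is 1 + (1 + 1 + 1) + 1 = 5, which stays within the 7 that
  \<open>parser_list\<close> admits for elements.\<close>

lemma parser_digraphs: "\<exists>k p. parser k (\<lambda>(D, D'). encode_digraph D @ encode_digraph D') p"
proof -
  have "encode_digraph = (\<lambda>(vs, es). encode_list encode_nat vs @
      encode_list (\<lambda>(u, k). encode_nat u @ (case k of (l, v) \<Rightarrow> encode_label l @ encode_nat v)) es)"
    by (auto simp: fun_eq_iff intro!: arg_cong[where f = "\<lambda>f. encode_list f _"])
  then show ?thesis
    using parser_pair[OF
        parser_pair[OF parser_list[OF parser_mono[OF parser_nat]]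
          parser_list[OF parser_mono[OF parser_pair[OF parser_nat parser_pair[OF parser_label parser_nat]]]]]
        parser_pair[OF parser_list[OF parser_mono[OF parser_nat]]
          parser_list[OF parser_mono[OF parser_pair[OF parser_nat parser_pair[OF parser_label parser_nat]]]]]]
    by (simp only:) (rule exI, rule exI, simp)
qed

lemma parser_ugraphs: "\<exists>k p. parser k (\<lambda>(D, D'). encode_ugraph D @ encode_ugraph D') p"
proof -
  have "encode_ugraph = (\<lambda>(vs, es). encode_list encode_nat vs @
      encode_list (\<lambda>(u, v). encode_nat u @ encode_nat v) es)"
    by (auto simp: fun_eq_iff)
  then show ?thesis
    using parser_pair[OF
        parser_pair[OF parser_list[OF parser_mono[OF parser_nat]]
          parser_list[OF parser_mono[OF parser_pair[OF parser_nat parser_nat]]]]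
        parser_pair[OF parser_list[OF parser_mono[OF parser_nat]]
          parser_list[OF parser_mono[OF parser_pair[OF parser_nat parser_nat]]]]]
    by (simp only:) (rule exI, rule exI, simp)
qed

text \<open>A reduction has to respect membership for every word, instance or not. Therefore
  anything that is not the code of an \<open>ok\<close> value is sent to the empty word, which will
  be no code in the target problem.\<close>

lemma polynomial_time_on_codes:
  fixes f :: "'a::treeable \<Rightarrow> bool list"
  assumes "\<exists>k p. parser k e p" "pt e" "pt f" "pt ok"
  shows "\<exists>h. polynomial_time_computable h \<and>
    (\<forall>x. h (e x) = (if ok x then f x else [])) \<and> (\<forall>w. w \<notin> range e \<longrightarrow> h w = [])"
proof -
  obtain k p where p: "parser k e p" using assms(1) by blast
  let ?h = "\<lambda>w. if e (fst (p w)) = w \<and> ok (fst (p w)) then f (fst (p w)) else []"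
  have "pt p" and inv: "fst (p (e x)) = x" for x
  proof -
    show "pt p" using p by (simp add: parser_def)
    have "p (e x @ []) = (x, [])" using p unfolding parser_def by blast
    then show "fst (p (e x)) = x" by simp
  qed
  have "pt (\<lambda>w. fst (p w))" by (intro pt_basic \<open>pt p\<close>)
  then have "pt ?h"
    by (intro pt_basic \<open>pt p\<close> pt_compose[OF assms(2)] pt_compose[OF assms(3)] pt_compose[OF assms(4)])
  moreover have "?h w = []" if "w \<notin> range e" for w
    using that by (metis rangeI)
  ultimately show ?thesis
    by (intro exI[of _ ?h]) (auto intro: polynomial_time_pt simp: inv)
qed

section \<open>Simulation of Turing machines\<close>

instantiation int :: treeable begin
definition tr_int :: "int \<Rightarrow> tree" where "tr_int i = tr (i < 0, nat \<bar>i\<bar>)"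
instance
proof
  fix x y :: int
  assume "tr x = tr y"
  then have "(x < 0, nat \<bar>x\<bar>) = (y < 0, nat \<bar>y\<bar>)"
    unfolding tr_int_def by (rule inj_tr)
  then show "x = y" by (auto simp: abs_if split: if_splits)
qed
end

text \<open>A chain of equality tests, one for each exceptional argument; this hard-codes the
  transition table of a machine.\<close>

lemma pt_finite_support:
  assumes "finite S"
  shows "pt (\<lambda>x. if x \<in> S then g x else d)"
  using assms
proof (induction S)
  case empty
  then show ?case by (simp add: pt_const)
next
  case (insert a S)
  have "(\<lambda>x. if x \<in> insert a S then g x else d) = (\<lambda>x. if x = a then g a else if x \<in> S then g x else d)"
    by auto
  then show ?case by (simp only:) (intro pt_if pt_eq pt_id pt_const insert.IH)
qed

lemma pt_dropWhile:
  assumes "pt (\<lambda>p. P (fst p) (snd p))" "pt ys"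
  shows "pt (\<lambda>e. dropWhile (P e) (ys e))"
proof -
  let ?s = "\<lambda>e y a. if fst a \<or> \<not> P e y then (True, y # snd a) else a"
  have "pt (\<lambda>p. P (fst p) (fst (snd p)))"
    using pt_compose[OF assms(1) pt_pair[OF pt_fst[OF pt_id] pt_fst[OF pt_snd[OF pt_id]]]] by simp
  moreover have "tsz (?s e y a) \<le> tsz a + tsz y + 8" for e y a
    by (cases a) (auto simp: tsz_simps tr_bool_def bit_tree_def true_tree_def)
  ultimately have "pt (\<lambda>e. rev (snd (fold (?s e) (ys e) (False, []))))"
    by (intro pt_rev pt_snd pt_fold[where g = "\<lambda>e y. y" and k = 8] pt_basic assms)
  moreover have t: "fold (?s e) xs (True, a) = (True, rev xs @ a)" for e xs a
    by (induction xs arbitrary: a) auto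
  have "snd (fold (?s e) xs (False, [])) = rev (dropWhile (P e) xs)" for e xs
    by (induction xs) (auto simp: t)
  ultimately show ?thesis by simp
qed

text \<open>A word as long as the time bound serves as a clock: folding over it iterates a machine
  step that many times. The construction follows Horner's scheme.\<close>

lemma unary_poly:
  fixes p :: "nat poly"
  shows "\<exists>u :: bool list \<Rightarrow> bool list. pt u \<and> (\<forall>w. length (u w) = poly p (length w))"
proof (induction p)
  case 0
  then show ?case by (intro exI[of _ "\<lambda>_. []"]) (simp add: pt_const)
next
  case (pCons a p)
  then obtain u :: "bool list \<Rightarrow> bool list" where u: "pt u" "\<And>w. length (u w) = poly p (length w)"
    by blast
  have "pt (\<lambda>w. replicate a False @ concat (map (\<lambda>_. u w) w))"
    by (intro pt_append pt_concat pt_map pt_basic pt_compose[OF u(1)])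
  moreover have "length (concat (map (\<lambda>_. v) w)) = length w * length v" for v w :: "bool list"
    by (induction w) auto
  ultimately show ?case
    using u(2) by (intro exI[of _ "\<lambda>w. replicate a False @ concat (map (\<lambda>_. u w) w)"]) simp
qed

text \<open>A tape is represented by the cells to the left of the head (in reverse order), the cell under
  the head and the cells to its right, up to blanks. The flag of a cell marks the origin of the tape,
  from which the output has to be read.\<close>

type_synonym cell = "nat \<times> bool"
type_synonym ztape = "cell list \<times> cell \<times> cell list"

definition cell_at :: "(int \<Rightarrow> nat) \<Rightarrow> int \<Rightarrow> cell" where
  "cell_at c i = (c i, i = 0)"

definition blank_nth :: "cell list \<Rightarrow> nat \<Rightarrow> cell" where
  "blank_nth xs i = (if i < length xs then xs ! i else (0, False))"

text \<open>The padding cell of \<open>blank_nth\<close> carries the flag \<open>False\<close>, so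
  the origin always lies in the explicitly stored part; \<open>read_ztape\<close> relies on finding
  it there.\<close>

definition zrep :: "tape \<Rightarrow> ztape \<Rightarrow> bool" where
  "zrep t z \<longleftrightarrow> fst (snd z) = cell_at (fst t) (snd t) \<and>
     (\<forall>i. blank_nth (fst z) i = cell_at (fst t) (snd t - 1 - int i)) \<and>
     (\<forall>i. blank_nth (snd (snd z)) i = cell_at (fst t) (snd t + 1 + int i))"

definition blank_hd :: "cell list \<Rightarrow> cell" where
  "blank_hd xs = (if xs = [] then (0, False) else hd xs)"

definition zact :: "nat \<times> int \<Rightarrow> ztape \<Rightarrow> ztape" where
  "zact a z = (let x = (fst a, snd (fst (snd z))) in
     if snd a = -1 then (tl (fst z), blank_hd (fst z), x # snd (snd z))
     else if snd a = 1 then (x # fst z, blank_hd (snd (snd z)), tl (snd (snd z)))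
     else (fst z, x, snd (snd z)))"

lemma blank_nth_tl: "blank_nth (tl xs) i = blank_nth xs (Suc i)"
  by (cases xs) (auto simp: blank_nth_def)

lemma blank_hd_nth: "blank_hd xs = blank_nth xs 0"
  by (cases xs) (auto simp: blank_nth_def blank_hd_def)

lemma blank_nth_Cons: "blank_nth (x # xs) i = (case i of 0 \<Rightarrow> x | Suc j \<Rightarrow> blank_nth xs j)"
  by (auto simp: blank_nth_def split: nat.split)

lemma zrep_act:
  assumes "zrep t z" "d \<in> {-1, 0, 1}"
  shows "zrep (act (s, d) t) (zact (s, d) z)"
proof -
  obtain c h where t: "t = (c, h)" by (cases t)
  obtain ls x rs where z: "z = (ls, x, rs)" by (cases z)
  have *: "x = cell_at c h" "\<And>i. blank_nth ls i = cell_at c (h - 1 - int i)"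
    "\<And>i. blank_nth rs i = cell_at c (h + 1 + int i)"
    using assms(1) by (auto simp: zrep_def t z)
  consider "d = -1" | "d = 0" | "d = 1" using assms(2) by auto
  then show ?thesis
    by cases (auto simp: zrep_def zact_def t z * blank_nth_tl blank_hd_nth blank_nth_Cons Let_def
        cell_at_def algebra_simps split: nat.split)
qed

lemma tsz_zact: "tsz (zact a z) \<le> tsz z + tsz a + 5"
proof -
  obtain ls x rs where z: "z = (ls, x, rs)" by (cases z)
  have blank: "tsz (0 :: nat, False) = 3"
    by (simp add: tsz_simps tr_bool_def bit_tree_def tr_nat_def binary.simps[of 0] tr_list_simps)
  have "tsz (tl xs) + tsz (blank_hd xs) \<le> tsz xs + 3" for xs
    using blank by (cases xs) (auto simp: blank_hd_def tsz_simps)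
  from this[of ls] this[of rs] show ?thesis
    by (cases a; cases x) (auto simp: zact_def z Let_def tsz_simps)
qed

lemma pt_zact: "pt a \<Longrightarrow> pt z \<Longrightarrow> pt (\<lambda>e. zact (a e) (z e))"
  unfolding zact_def blank_hd_def by (intro pt_basic)

text \<open>This is \<open>map2 zact\<close> (see \<open>zacts_map2\<close>), written as a fold over
  the actions that carries the remaining tapes in its accumulator, because folds run over a single
  list.\<close>

definition zacts :: "(nat \<times> int) list \<Rightarrow> ztape list \<Rightarrow> ztape list" where
  "zacts as zs = rev (snd (fold (\<lambda>a s. if fst s = [] then s
     else (tl (fst s), zact a (hd (fst s)) # snd s)) as (zs, [])))"

lemma zacts_map2: "zacts as zs = map2 zact as zs"
proof -
  have "rev (snd (fold (\<lambda>a s. if fst s = [] then s else (tl (fst s), zact a (hd (fst s)) # snd s)) as (zs, ys)))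
     = rev ys @ map2 zact as zs" for ys
  proof (induction as arbitrary: zs ys)
    case (Cons a as)
    show ?case
    proof (cases zs)
      case Nil
      then have "fold (\<lambda>a s. if fst s = [] then s else (tl (fst s), zact a (hd (fst s)) # snd s)) bs (zs, ys)
        = (zs, ys)" for bs by (induction bs) auto
      then show ?thesis using Nil by simp
    qed (simp add: Cons.IH)
  qed simp
  from this[of "[]"] show ?thesis by (simp add: zacts_def)
qed

lemma zacts_step_size:
  "tsz (if fst s = [] then s else (tl (fst s), zact a (hd (fst s)) # snd s)) \<le> tsz s + tsz a + 6"
proof (cases "fst s")
  case (Cons z zs)
  then show ?thesis using tsz_zact[of a z] by (cases s) (auto simp: tsz_simps)
qed simp

lemma tsz_zacts: "tsz (zacts as zs) \<le> tsz zs + 7 * tsz as + 2"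
proof -
  have "tsz (fold (\<lambda>a s. if fst s = [] then s else (tl (fst s), zact a (hd (fst s)) # snd s)) as s)
     \<le> tsz s + 7 * tsz as" for s
  proof (induction as arbitrary: s)
    case (Cons a as)
    show ?case
      using Cons[of "if fst s = [] then s else (tl (fst s), zact a (hd (fst s)) # snd s)"]
        zacts_step_size[of s a] by (simp add: tsz_simps)
  qed simp
  from this[of "(zs, [])"] show ?thesis
    unfolding zacts_def tsz_rev by (simp add: tr_prod_def tsz_simps)
qed

lemma pt_zacts:
  assumes "pt as" "pt zs"
  shows "pt (\<lambda>e. zacts (as e) (zs e))"
  unfolding zacts_def
  by (intro pt_rev pt_snd pt_fold[where g = "\<lambda>e a. a" and k = 6] pt_basic pt_zact assms zacts_step_size)

definition heads :: "ztape list \<Rightarrow> nat list" where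
  "heads zs = map (\<lambda>z. fst (fst (snd z))) zs"

definition table_domain :: "tm \<Rightarrow> (nat \<times> nat list) set" where
  "table_domain M = {..<states M} \<times> {ss. set ss \<subseteq> {..<symbols M} \<and> length ss = tapes M}"

definition table :: "tm \<Rightarrow> nat \<times> nat list \<Rightarrow> nat \<times> (nat \<times> int) list" where
  "table M p = (if p \<in> table_domain M then delta M (fst p) (snd p) else (0, []))"

text \<open>The halting state lies outside the table, so a halted configuration is left unchanged,
  as by \<open>tm_step\<close>.\<close>

definition sim_step :: "tm \<Rightarrow> nat \<times> ztape list \<Rightarrow> nat \<times> ztape list" where
  "sim_step M s = (let p = (fst s, heads (snd s)) in
     if p \<in> table_domain M then (fst (table M p), zacts (snd (table M p)) (snd s)) else s)"

lemma finite_table_domain: "finite (table_domain M)"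
  unfolding table_domain_def by (intro finite_cartesian_product finite_lists_length_eq) auto

lemma pt_sim_step: "pt (sim_step M)"
proof -
  have t: "pt (table M)"
    unfolding table_def using pt_finite_support[OF finite_table_domain] by fast
  have d: "pt (\<lambda>p. p \<in> table_domain M)"
  proof -
    have "(\<lambda>p. p \<in> table_domain M) = (\<lambda>p. if p \<in> table_domain M then True else False)" by auto
    then show ?thesis by (simp only: pt_finite_support[OF finite_table_domain])
  qed
  show ?thesis
    unfolding sim_step_def heads_def
    by (intro pt_basic pt_map pt_zacts pt_compose[OF t] pt_compose[OF d])
qed

text \<open>The table has finitely many values, so the written symbols and the new state have
  bounded size, and there is a bounded number of actions. Growth by a constant is what
  \<open>pt_fold\<close> demands for iterating the step.\<close>

lemma sim_step_growth: "\<exists>k. \<forall>s. tsz (sim_step M s) \<le> tsz s + k"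
proof -
  have "range (table M) \<subseteq> insert (0, []) (table M ` table_domain M)"
    by (auto simp: table_def)
  then have "finite (range (table M))"
    using finite_table_domain finite_subset by blast
  then have "finite ((\<lambda>x. tsz x) ` range (table M))" by simp
  then obtain K where K: "\<And>p. tsz (table M p) \<le> K"
    using finite_nat_set_iff_bounded_le by fastforce
  have "tsz (sim_step M s) \<le> tsz s + (8 * K + 3)" for s
  proof -
    obtain q zs where s: "s = (q, zs)" by (cases s)
    obtain q' as where t: "table M (q, heads zs) = (q', as)" by fastforce
    have "tsz q' \<le> K" "tsz as \<le> K" using K[of "(q, heads zs)"] unfolding t by (auto simp: tsz_simps)
    then have "tsz (q', zacts as zs) \<le> tsz s + (8 * K + 3)"
      using tsz_zacts[of as zs] by (simp add: tsz_simps s)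
    then show ?thesis by (simp add: sim_step_def s t Let_def)
  qed
  then show ?thesis by blast
qed

text \<open>The bound on the tape symbols is carried along as an invariant, since it guarantees that
  the symbols under the heads are found in the finite table.\<close>

definition config_rep :: "tm \<Rightarrow> nat \<times> tape list \<Rightarrow> nat \<times> ztape list \<Rightarrow> bool" where
  "config_rep M s z \<longleftrightarrow> fst s = fst z \<and> list_all2 zrep (snd s) (snd z) \<and>
     length (snd s) = tapes M \<and> (\<forall>t\<in>set (snd s). \<forall>i. fst t i < symbols M)"

lemma config_rep_step:
  assumes M: "turing_machine M" and r: "config_rep M s z"
  shows "config_rep M (tm_step M s) (sim_step M z)"
proof -
  obtain q ts where s: "s = (q, ts)" by (cases s)
  obtain zs where z: "z = (q, zs)" using r s by (cases z) (auto simp: config_rep_def)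
  have rep: "list_all2 zrep ts zs" and len: "length ts = tapes M"
    and sym: "\<And>t i. t \<in> set ts \<Longrightarrow> fst t i < symbols M"
    using r by (auto simp: config_rep_def s z)
  have heads: "heads zs = map (\<lambda>(c, h). c h) ts"
    using rep by (auto simp: heads_def list_all2_conv_all_nth zrep_def cell_at_def case_prod_beta
        intro!: nth_equalityI)
  have ss: "set (heads zs) \<subseteq> {..<symbols M}" "length (heads zs) = tapes M"
    using sym len unfolding heads by auto
  show ?thesis
  proof (cases "q < states M")
    case False
    then show ?thesis using r by (simp add: tm_step_def sim_step_def s z table_domain_def)
  next
    case True
    then have dom: "(q, heads zs) \<in> table_domain M" using ss by (simp add: table_domain_def)
    obtain q' as where d: "delta M q (heads zs) = (q', as)" by fastforce
    have as: "length as = tapes M" "set as \<subseteq> {..<symbols M} \<times> {-1, 0, 1}"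
      using M True ss d unfolding turing_machine_def by blast+
    have step: "tm_step M s = (q', map2 act as ts)" "sim_step M z = (q', map2 zact as zs)"
      using True d dom heads
      by (simp_all add: tm_step_def s sim_step_def z table_def zacts_map2)
    have "list_all2 zrep (map2 act as ts) (map2 zact as zs)"
      unfolding list_all2_conv_all_nth
    proof (intro conjI allI impI)
      show "length (map2 act as ts) = length (map2 zact as zs)"
        using rep by (simp add: list_all2_lengthD)
      fix i assume "i < length (map2 act as ts)"
      then have i: "i < length as" "i < length ts" "i < length zs"
        using rep by (auto dest: list_all2_lengthD)
      obtain a d where ad: "as ! i = (a, d)" by fastforce
      have "d \<in> {-1, 0, 1}" using as(2) nth_mem[OF i(1)] ad by auto
      then show "zrep (map2 act as ts ! i) (map2 zact as zs ! i)"
        using i ad rep zrep_act by (simp add: list_all2_conv_all_nth)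
    qed
    moreover have "fst t i < symbols M" if t: "t \<in> set (map2 act as ts)" for t i
    proof -
      obtain a t' where a: "(a, t') \<in> set (zip as ts)" "t = act a t'" using t by auto
      then have "a \<in> set as" "t' \<in> set ts" by (auto dest: set_zip_leftD set_zip_rightD)
      then have "fst a < symbols M" "fst t' i < symbols M" using as(2) sym by auto
      then show ?thesis using a(2) by (cases a; cases t') auto
    qed
    ultimately show ?thesis using as(1) len by (auto simp: config_rep_def step)
  qed
qed

definition sim_init :: "tm \<Rightarrow> bool list \<Rightarrow> nat \<times> ztape list" where
  "sim_init M w = (0, ([], (if w = [] then 0 else if hd w then 2 else 1, True),
     map (\<lambda>b. (if b then 2 else 1, False)) (tl w)) # replicate (tapes M - 1) ([], (0, True), []))"

lemma config_rep_init:
  assumes "turing_machine M"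
  shows "config_rep M (initial_config M w) (sim_init M w)"
proof -
  have "zrep (string_tape w) ([], (if w = [] then 0 else if hd w then 2 else 1, True),
     map (\<lambda>b. (if b then 2 else 1, False)) (tl w))" for w
  proof (cases w)
    case (Cons b v)
    then show ?thesis
      by (auto simp: zrep_def string_tape_def cell_at_def blank_nth_def bit_symbol_def nth_Cons'
          nat_add_distrib nat_diff_distrib')
  qed (simp add: zrep_def string_tape_def cell_at_def blank_nth_def)
  from this[of w] this[of "[]"] have "list_all2 zrep (snd (initial_config M w)) (snd (sim_init M w))"
    by (auto simp: initial_config_def sim_init_def list_all2_conv_all_nth nth_Cons')
  moreover have "fst (string_tape v) i < symbols M" for v i
    using assms by (auto simp: turing_machine_def string_tape_def bit_symbol_def)
  ultimately show ?thesis
    using assms by (auto simp: config_rep_def initial_config_def sim_init_def turing_machine_def)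
qed

definition read_ztape :: "ztape \<Rightarrow> bool list" where
  "read_ztape z = map (\<lambda>x. fst x = 2) (takeWhile (\<lambda>x. fst x \<noteq> 0)
     (dropWhile (\<lambda>x. \<not> snd x) (rev (fst z) @ fst (snd z) # snd (snd z))))"

text \<open>The flag locates cell 0 in the stored list, and from there on list positions are tape
  positions. A blank ends the output; if the stored part ends first, then the next cell is padding
  and hence blank.\<close>

lemma read_ztape:
  assumes rep: "zrep (c, h) z"
    and v: "\<And>i. i < length v \<Longrightarrow> c (int i) = bit_symbol (v ! i)" "c (int (length v)) = 0"
  shows "read_ztape z = v"
proof -
  obtain ls x rs where z: "z = (ls, x, rs)" by (cases z)
  have x: "x = cell_at c h" and ls: "\<And>i. blank_nth ls i = cell_at c (h - 1 - int i)"
    and rs: "\<And>i. blank_nth rs i = cell_at c (h + 1 + int i)"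
    using rep by (auto simp: zrep_def z)
  define all where "all = rev ls @ x # rs"
  have len_all: "length all = length ls + 1 + length rs" by (simp add: all_def)
  let ?lo = "h - int (length ls)" and ?hi = "h + int (length rs)"
  have nth: "all ! j = cell_at c (?lo + int j)" if j: "j < length all" for j
  proof -
    consider "j < length ls" | "j = length ls" | k where "j = length ls + 1 + k" "k < length rs"
    proof (cases "length ls < j")
      case True
      then have "j = length ls + 1 + (j - length ls - 1)" "j - length ls - 1 < length rs" using j len_all by auto
      then show ?thesis using that(3) by blast
    qed (use that len_all in force)
    then show ?thesis
    proof cases
      case 1
      then have "length ls - Suc j < length ls" by simp
      with 1 have "all ! j = blank_nth ls (length ls - 1 - j)"
        by (auto simp: nth_append rev_nth blank_nth_def all_def)
      also have "\<dots> = cell_at c (?lo + int j)"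
        unfolding ls using 1 by (simp add: of_nat_diff algebra_simps)
      finally show ?thesis .
    next
      case 2
      then show ?thesis by (simp add: nth_append x all_def)
    next
      case 3
      then have "all ! j = blank_nth rs k" by (simp add: nth_append blank_nth_def all_def)
      then show ?thesis unfolding rs using 3 by (simp add: algebra_simps)
    qed
  qed
  \<comment> \<open>Beyond the stored cells there is only padding, which is blank and not flagged;
    so cell 0 is stored.\<close>
  have outside: "c i = 0 \<and> i \<noteq> 0" if "i < ?lo \<or> ?hi < i" for i
    using that
  proof
    assume i: "i < ?lo"
    then have "blank_nth ls (nat (h - 1 - i)) = (0, False)" by (auto simp: blank_nth_def)
    then show ?thesis using i by (auto simp: ls cell_at_def)
  next
    assume i: "?hi < i"
    then have "blank_nth rs (nat (i - h - 1)) = (0, False)" by (auto simp: blank_nth_def)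
    then show ?thesis using i by (auto simp: rs cell_at_def)
  qed
  define k where "k = nat (- ?lo)"
  have k: "?lo + int k = 0" "k < length all"
  proof -
    have "\<not> (0 < ?lo \<or> ?hi < 0)" using outside[of 0] by blast
    then show "?lo + int k = 0" "k < length all" by (auto simp: k_def len_all)
  qed
  let ?from = "drop k all"
  have len: "int (length ?from) = ?hi + 1" using k len_all by simp
  have from_nth: "?from ! j = cell_at c (int j)" if "j < length ?from" for j
    using that nth[of "k + j"] k by (simp add: add.assoc[symmetric])
  have "?from = all ! k # drop (Suc k) all"
    using k(2) by (simp add: Cons_nth_drop_Suc)
  moreover have "snd (all ! k)" using nth[OF k(2)] k(1) by (simp add: cell_at_def)
  moreover have "\<not> snd y" if y: "y \<in> set (take k all)" for y
  proof -
    obtain j where j: "j < k" "y = all ! j" using y k(2) by (auto simp: in_set_conv_nth)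
    then show ?thesis using nth[of j] k by (auto simp: cell_at_def)
  qed
  ultimately have "dropWhile (\<lambda>x. \<not> snd x) (take k all @ ?from) = ?from"
    by (subst dropWhile_append2) auto
  then have drop: "dropWhile (\<lambda>x. \<not> snd x) all = ?from" by simp
  have bits: "c (int i) \<noteq> 0" if "i < length v" for i
    using v(1)[OF that] by (simp add: bit_symbol_def)
  have lv: "length v \<le> length ?from"
  proof (rule ccontr)
    assume "\<not> length v \<le> length ?from"
    then have "c (int (length ?from)) \<noteq> 0" using bits by simp
    then show False using outside[of "int (length ?from)"] len by simp
  qed
  have "takeWhile (\<lambda>x. fst x \<noteq> 0) ?from = take (length v) ?from"
  proof (rule takeWhile_eq_take_P_nth)
    show "fst (?from ! i) \<noteq> 0" if "i < length v" "i < length ?from" for i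
      using that bits from_nth by (simp add: cell_at_def)
    show "\<not> fst (?from ! length v) \<noteq> 0" if "length v < length ?from"
      using from_nth[OF that] v(2) by (simp add: cell_at_def)
  qed
  moreover have "map (\<lambda>x. fst x = 2) (take (length v) ?from) = v"
    using lv from_nth v(1) by (intro nth_equalityI) (auto simp: cell_at_def bit_symbol_def)
  ultimately show ?thesis by (simp add: read_ztape_def z drop[unfolded all_def] all_def)
qed

text \<open>Converse of \<open>polynomial_time_pt\<close>. The machine is run for exactly as many
  steps as its time bound allows, since its actual halting time is unknown; running on after halting
  is harmless because the configuration is then a fixed point.\<close>

theorem pt_polynomial_time:
  fixes f :: "bool list \<Rightarrow> bool list"
  assumes "polynomial_time_computable f"
  shows "pt f"
proof -
  obtain M and p :: "nat poly" where M: "turing_machine M"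
    and time: "\<And>w. \<exists>t \<le> poly p (length w). let cfg = (tm_step M ^^ t) (initial_config M w)
           in fst cfg = states M \<and> has_output cfg (f w)"
    using assms unfolding polynomial_time_computable_def by blast
  obtain u :: "bool list \<Rightarrow> bool list" where u: "pt u" "\<And>w. length (u w) = poly p (length w)"
    using unary_poly[of p] by blast
  obtain k where k: "\<And>s. tsz (sim_step M s) \<le> tsz s + k" using sim_step_growth by blast
  let ?sim = "\<lambda>w. fold (\<lambda>_ s. sim_step M s) (u w) (sim_init M w)"
  have growth: "tsz (sim_step M s) \<le> tsz s + tsz y + k" for s and y :: bool
    using k[of s] by simp
  have init: "pt (sim_init M)"
    unfolding sim_init_def by (intro pt_basic pt_map)
  have step: "pt (\<lambda>p :: bool list \<times> bool \<times> nat \<times> ztape list. sim_step M (snd (snd p)))"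
    by (rule pt_compose[OF pt_sim_step]) (intro pt_basic)
  have "pt ?sim"
    by (rule pt_fold[where g = "\<lambda>e y. y" and k = k, OF step u(1) init _ growth]) (intro pt_basic)
  then have "pt (\<lambda>w. read_ztape (hd (rev (snd (?sim w)))))"
    unfolding read_ztape_def
    by (intro pt_map pt_takeWhile pt_dropWhile pt_append pt_basic pt_rev)
  moreover have "read_ztape (hd (rev (snd (?sim w)))) = f w" for w
  proof -
    obtain t where t: "t \<le> poly p (length w)"
      "fst ((tm_step M ^^ t) (initial_config M w)) = states M"
      "has_output ((tm_step M ^^ t) (initial_config M w)) (f w)"
      using time[of w] by (auto simp: Let_def)
    let ?n = "poly p (length w)"
    let ?c = "(tm_step M ^^ t) (initial_config M w)"
    have "tm_step M ?c = ?c"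
    proof -
      obtain q ts where c: "?c = (q, ts)" by fastforce
      then have "q = states M" using t(2) by simp
      then show ?thesis unfolding c by (simp add: tm_step_def)
    qed
    then have "(tm_step M ^^ i) ?c = ?c" for i by (induction i) auto
    then have "(tm_step M ^^ (?n - t + t)) (initial_config M w) = ?c"
      unfolding funpow_add o_apply .
    then have c: "(tm_step M ^^ ?n) (initial_config M w) = ?c" using t(1) by simp
    have "config_rep M ((tm_step M ^^ i) (initial_config M w)) ((sim_step M ^^ i) (sim_init M w))" for i
      by (induction i) (auto intro: config_rep_init config_rep_step M)
    moreover have "fold (\<lambda>_ s. sim_step M s) xs s = (sim_step M ^^ length xs) s" for xs :: "bool list" and s
      by (induction xs arbitrary: s) (auto simp: funpow_swap1)
    ultimately have rep: "config_rep M ?c (?sim w)"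
      unfolding c[symmetric] by (simp add: u(2))
    then have ne: "snd ?c \<noteq> []" "snd (?sim w) \<noteq> []" "list_all2 zrep (snd ?c) (snd (?sim w))"
      using M by (auto simp: config_rep_def turing_machine_def)
    then have "zrep (last (snd ?c)) (last (snd (?sim w)))"
      by (simp add: last_conv_nth list_all2_conv_all_nth)
    then have "zrep (fst (last (snd ?c)), snd (last (snd ?c))) (last (snd (?sim w)))" by simp
    from read_ztape[OF this] have "read_ztape (last (snd (?sim w))) = f w"
      using t(3) by (auto simp: has_output_def Let_def)
    then show ?thesis using ne by (simp add: hd_rev)
  qed
  ultimately show ?thesis by simp
qed

text \<open>Two machines are composed by translating both into the calculus, composing there and
  compiling back.\<close>

lemma poly_reducible_trans:
  assumes "poly_reducible P Q" "poly_reducible Q R"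
  shows "poly_reducible P R"
proof -
  obtain f g where f: "polynomial_time_computable f" "\<And>w. w \<in> yes_instances P \<longleftrightarrow> f w \<in> yes_instances Q"
      "\<And>w. w \<in> no_instances P \<Longrightarrow> f w \<in> no_instances Q"
    and g: "polynomial_time_computable g" "\<And>w. w \<in> yes_instances Q \<longleftrightarrow> g w \<in> yes_instances R"
      "\<And>w. w \<in> no_instances Q \<Longrightarrow> g w \<in> no_instances R"
    using assms unfolding poly_reducible_def by blast
  have "polynomial_time_computable (\<lambda>w. g (f w))"
    by (rule polynomial_time_pt[OF pt_compose[OF pt_polynomial_time[OF g(1)] pt_polynomial_time[OF f(1)]]])
  moreover have "\<forall>w. w \<in> yes_instances P \<longleftrightarrow> g (f w) \<in> yes_instances R"
    using f(2) g(2) by blast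
  moreover have "\<forall>w. w \<in> no_instances P \<longrightarrow> g (f w) \<in> no_instances R"
    using f(3) g(3) by blast
  ultimately show ?thesis
    unfolding poly_reducible_def by blast
qed

section \<open>The topology of the full shift\<close>

definition agree :: "nat \<Rightarrow> (int \<Rightarrow> 'a) \<Rightarrow> (int \<Rightarrow> 'a) \<Rightarrow> bool" where
  "agree n x y \<longleftrightarrow> (\<forall>i. \<bar>i\<bar> \<le> int n \<longrightarrow> x i = y i)"

lemma agree_refl [simp]: "agree n x x"
  by (simp add: agree_def)

lemma agree_sym: "agree n x y \<Longrightarrow> agree n y x"
  by (simp add: agree_def)

lemma agree_trans: "agree n x y \<Longrightarrow> agree n y z \<Longrightarrow> agree n x z"
  by (simp add: agree_def)

lemma agree_mono: "agree n x y \<Longrightarrow> m \<le> n \<Longrightarrow> agree m x y"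
  by (simp add: agree_def)

lemma not_agree: "x \<noteq> y \<Longrightarrow> \<exists>m. \<forall>n\<ge>m. \<not> agree n x y"
proof -
  assume "x \<noteq> y"
  then obtain i where "x i \<noteq> y i" by auto
  then show ?thesis by (intro exI[of _ "nat \<bar>i\<bar>"]) (force simp: agree_def)
qed

text \<open>Finitely many statements that each hold eventually hold eventually together. Local
  bounds are stated in the form \<open>\<exists>m. \<forall>n\<ge>m\<close> so that they can be
  merged in this way.\<close>

lemma uniform_bound:
  assumes "finite P" "\<And>p. p \<in> P \<Longrightarrow> \<exists>m :: nat. \<forall>n\<ge>m. R p n"
  shows "\<exists>m. \<forall>p\<in>P. \<forall>n\<ge>m. R p n"
  using assms
proof (induction P)
  case (insert p P)
  obtain m where m: "\<forall>n\<ge>m. R p n" using insert.prems by blast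
  obtain m' where m': "\<forall>p\<in>P. \<forall>n\<ge>m'. R p n" using insert.IH insert.prems by blast
  show ?case using m m' by (intro exI[of _ "max m m'"]) auto
qed auto

lemma topspace_full_shift: "topspace (full_shift A) = {x. range x \<subseteq> A}"
  by (auto simp: full_shift_def PiE_def extensional_def Pi_def)

text \<open>Cylinders around the origin are a neighbourhood base: a basic open set restricts
  finitely many coordinates, and these lie in one symmetric window.\<close>

lemma openin_full_shift:
  "openin (full_shift A) U \<longleftrightarrow>
     (\<forall>x\<in>U. range x \<subseteq> A) \<and> (\<forall>x\<in>U. \<exists>n. \<forall>y. range y \<subseteq> A \<longrightarrow> agree n x y \<longrightarrow> y \<in> U)"
proof
  assume U: "openin (full_shift A) U"
  have "\<exists>n. \<forall>y. range y \<subseteq> A \<longrightarrow> agree n x y \<longrightarrow> y \<in> U" if "x \<in> U" for x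
  proof -
    from U that obtain V where V: "finite {i. V i \<noteq> A}" "x \<in> Pi\<^sub>E UNIV V" "Pi\<^sub>E UNIV V \<subseteq> U"
      unfolding full_shift_def openin_product_topology_alt by auto
    have "\<exists>n. \<forall>i\<in>{i. V i \<noteq> A}. \<forall>m\<ge>n. \<bar>i\<bar> \<le> int m"
    proof (rule uniform_bound[OF V(1)])
      show "\<exists>m. \<forall>n\<ge>m. \<bar>i\<bar> \<le> int n" for i :: int
        by (rule exI[of _ "nat \<bar>i\<bar>"]) auto
    qed
    then obtain n where n: "\<And>i. V i \<noteq> A \<Longrightarrow> \<bar>i\<bar> \<le> int n" by auto
    have "y \<in> U" if "range y \<subseteq> A" "agree n x y" for y
    proof -
      have "y i \<in> V i" for i
      proof (cases "V i = A")
        case False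
        then have "y i = x i" using n that(2) by (simp add: agree_def)
        then show ?thesis using V(2) by (auto simp: PiE_def Pi_def)
      qed (use that in auto)
      then show ?thesis using V(3) by (auto simp: PiE_def Pi_def extensional_def)
    qed
    then show ?thesis by blast
  qed
  moreover have "range x \<subseteq> A" if "x \<in> U" for x
    using subsetD[OF openin_subset[OF U] that] by (simp add: topspace_full_shift)
  ultimately show "(\<forall>x\<in>U. range x \<subseteq> A) \<and> (\<forall>x\<in>U. \<exists>n. \<forall>y. range y \<subseteq> A \<longrightarrow> agree n x y \<longrightarrow> y \<in> U)"
    by simp
next
  assume *: "(\<forall>x\<in>U. range x \<subseteq> A) \<and> (\<forall>x\<in>U. \<exists>n. \<forall>y. range y \<subseteq> A \<longrightarrow> agree n x y \<longrightarrow> y \<in> U)"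
  show "openin (full_shift A) U"
    unfolding full_shift_def openin_product_topology_alt
  proof
    fix x assume x: "x \<in> U"
    then obtain n where n: "\<And>y. range y \<subseteq> A \<Longrightarrow> agree n x y \<Longrightarrow> y \<in> U" using * by blast
    have xA: "x i \<in> A" for i using * x by blast
    let ?V = "\<lambda>i. if \<bar>i\<bar> \<le> int n then {x i} else A"
    have "{i. ?V i \<noteq> A} \<subseteq> {- int n..int n}" by auto
    then have "finite {i. ?V i \<noteq> A}" by (rule finite_subset) simp
    moreover have "Pi\<^sub>E UNIV ?V \<subseteq> U"
    proof
      fix y assume "y \<in> Pi\<^sub>E UNIV ?V"
      then have y: "y i \<in> ?V i" for i by (auto simp: PiE_def Pi_def)
      have "y i \<in> A" for i using y[of i] xA[of i] by (auto split: if_splits)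
      moreover have "agree n x y" unfolding agree_def using y by (metis singletonD)
      ultimately show "y \<in> U" using n by blast
    qed
    ultimately show "\<exists>V. finite {i \<in> UNIV. V i \<noteq> topspace (discrete_topology A)} \<and>
        (\<forall>i\<in>UNIV. openin (discrete_topology A) (V i)) \<and> x \<in> Pi\<^sub>E UNIV V \<and> Pi\<^sub>E UNIV V \<subseteq> U"
      using xA by (intro exI[of _ ?V]) auto
  qed
qed

lemma derived_set_full_shift:
  assumes "S \<subseteq> {x. range x \<subseteq> A}"
  shows "x \<in> full_shift A derived_set_of S \<longleftrightarrow> range x \<subseteq> A \<and> (\<forall>n. \<exists>y\<in>S. y \<noteq> x \<and> agree n x y)"
proof
  assume x: "x \<in> full_shift A derived_set_of S"
  then have "range x \<subseteq> A" by (simp add: in_derived_set_of topspace_full_shift)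
  moreover have "\<exists>y\<in>S. y \<noteq> x \<and> agree n x y" for n
  proof -
    have op: "openin (full_shift A) {y. range y \<subseteq> A \<and> agree n x y}"
      unfolding openin_full_shift by (auto intro!: exI[of _ n] intro: agree_trans)
    have "\<forall>T. x \<in> T \<and> openin (full_shift A) T \<longrightarrow> (\<exists>y. y \<noteq> x \<and> y \<in> S \<and> y \<in> T)"
      using x by (simp add: in_derived_set_of)
    from spec[OF this, of "{y. range y \<subseteq> A \<and> agree n x y}"] op have "\<exists>y. y \<noteq> x \<and> y \<in> S \<and> y \<in> {y. range y \<subseteq> A \<and> agree n x y}"
      using \<open>range x \<subseteq> A\<close> by simp
    then show ?thesis by auto
  qed
  ultimately show "range x \<subseteq> A \<and> (\<forall>n. \<exists>y\<in>S. y \<noteq> x \<and> agree n x y)" by blast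
next
  assume x: "range x \<subseteq> A \<and> (\<forall>n. \<exists>y\<in>S. y \<noteq> x \<and> agree n x y)"
  have "\<exists>y. y \<noteq> x \<and> y \<in> S \<and> y \<in> T" if "x \<in> T" "openin (full_shift A) T" for T
  proof -
    from that obtain n where n: "\<And>y. range y \<subseteq> A \<Longrightarrow> agree n x y \<Longrightarrow> y \<in> T"
      unfolding openin_full_shift by blast
    then show ?thesis using x assms by blast
  qed
  then show "x \<in> full_shift A derived_set_of S"
    using x by (auto simp: in_derived_set_of topspace_full_shift)
qed

lemma compact_full_shift: "finite A \<Longrightarrow> compact_space (full_shift A)"
  unfolding full_shift_def
  by (simp add: compact_space_product_topology compact_space_discrete_topology)

lemma Hausdorff_full_shift: "Hausdorff_space (full_shift A)"
  unfolding full_shift_def by (simp add: Hausdorff_space_product_topology)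

text \<open>Baire category: in a compact Hausdorff space without isolated points singletons are
  closed with empty interior, so a countable union of them has empty interior and cannot be the
  whole space unless it is empty.\<close>

lemma countable_perfect_empty:
  assumes "finite A" "closedin (full_shift A) S" "countable S" "S \<subseteq> full_shift A derived_set_of S"
  shows "S = {}"
proof -
  let ?T = "subtopology (full_shift A) S"
  have top: "topspace ?T = S" using closedin_subset[OF assms(2)] by auto
  have H: "Hausdorff_space ?T" by (rule Hausdorff_space_subtopology[OF Hausdorff_full_shift])
  have "compact_space ?T"
    using closedin_compact_space[OF compact_full_shift[OF assms(1)] assms(2)] by (simp add: compact_space_subtopology)
  then have loc: "locally_compact_space ?T \<and> regular_space ?T"
    using H by (auto intro: compact_imp_locally_compact_space compact_Hausdorff_imp_regular_space)
  have "?T interior_of \<Union>((\<lambda>x. {x}) ` S) = {}"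
  proof (rule Baire_category_alt)
    show "completely_metrizable_space ?T \<or> locally_compact_space ?T \<and> regular_space ?T" using loc by simp
    show "countable ((\<lambda>x. {x}) ` S)" using assms(3) by simp
    fix T assume "T \<in> (\<lambda>x. {x}) ` S"
    then obtain x where x: "x \<in> S" "T = {x}" by auto
    have "closedin ?T {x}"
      using H x(1) top by (simp add: Hausdorff_imp_t1_space closedin_t1_singleton)
    moreover have "\<not> openin ?T {x}"
    proof
      assume "openin ?T {x}"
      then obtain U where U: "openin (full_shift A) U" "{x} = U \<inter> S" by (auto simp: openin_subtopology)
      have "x \<in> full_shift A derived_set_of S" using x assms(4) by blast
      then show False using U unfolding in_derived_set_of by blast
    qed
    ultimately show "closedin ?T T \<and> ?T interior_of T = {}"
      using x interior_of_subset[of ?T "{x}"] openin_interior_of[of ?T "{x}"]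
      by (metis subset_singleton_iff)
  qed
  then have "?T interior_of S = {}" by simp
  then have "?T interior_of (topspace ?T) = {}" by (simp only: top)
  then show ?thesis using top by (metis interior_of_topspace)
qed

section \<open>Countable shift spaces of rank at most 2\<close>

lemma shift_by_add [simp]: "shift_by m (shift_by n x) = shift_by (m + n) x"
  by (simp add: shift_by_def fun_eq_iff algebra_simps)

lemma shift_by_0 [simp]: "shift_by 0 x = x"
  by (simp add: shift_by_def)

lemma shift_by_apply: "shift_by n x i = x (i + n)"
  by (simp add: shift_by_def)

lemma shift_by_inj [simp]: "shift_by n x = shift_by n y \<longleftrightarrow> x = y"
  by (metis add.left_inverse shift_by_0 shift_by_add)

lemma agree_shift: "agree (m + nat \<bar>n\<bar>) x y \<Longrightarrow> agree m (shift_by n x) (shift_by n y)"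
  by (auto simp: agree_def shift_by_apply)

lemma shift_space_shift:
  assumes "shift_map ` X = X" "x \<in> X"
  shows "shift_by n x \<in> X"
proof -
  have "shift_by (int k) x \<in> X" for k
  proof (induction k)
    case (Suc k)
    then have "shift_map (shift_by (int k) x) \<in> shift_map ` X" by (rule imageI)
    then show ?case using assms(1) by simp
  qed (use assms in simp)
  moreover have "shift_by (- int k) x \<in> X" for k
  proof (induction k)
    case (Suc k)
    then obtain y where y: "y \<in> X" "shift_by (- int k) x = shift_map y" using assms(1) by blast
    have "shift_by (- int (Suc k)) x = shift_by (-1) (shift_by (- int k) x)" by (simp add: algebra_simps)
    also have "\<dots> = y" unfolding y(2) by simp
    finally show ?case using y(1) by simp
  qed (use assms in simp)
  ultimately show ?thesis by (cases n rule: int_cases2) auto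
qed

lemma periodic_shift: "shift_by p x = x \<Longrightarrow> shift_by (int k * p) x = x"
proof (induction k)
  case (Suc k)
  have "shift_by (int (Suc k) * p) x = shift_by (int k * p) (shift_by p x)"
    by (simp add: algebra_simps)
  then show ?case using Suc by simp
qed simp

lemma periodic_shift_int: "shift_by p x = x \<Longrightarrow> shift_by (k * p) x = x"
proof (cases k rule: int_cases2)
  case (nonpos n)
  assume "shift_by p x = x"
  then have "shift_by (int n * p) x = x" by (rule periodic_shift)
  then have "shift_by (- (int n * p)) (shift_by (int n * p) x) = shift_by (- (int n * p)) x" by simp
  then show ?thesis by (simp add: nonpos)
qed (simp add: periodic_shift)

text \<open>The product of the periods is a period of both points, and a multiple of it moves any
  position into the half line where the points agree.\<close>

lemma periodic_eq:
  assumes "shift_by p x = x" "shift_by q y = y" "p > 0" "q > 0"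
    and "(\<forall>i\<ge>n. x i = y i) \<or> (\<forall>i\<le>n. x i = y i)"
  shows "x = y"
proof
  fix i
  have px: "x (i + k * (p * q)) = x i" for k
    using periodic_shift_int[OF assms(1), of "k * q"] by (metis mult.assoc mult.commute shift_by_apply)
  have py: "y (i + k * (p * q)) = y i" for k
    using periodic_shift_int[OF assms(2), of "k * p"] by (metis mult.assoc shift_by_apply)
  let ?k = "\<bar>n\<bar> + \<bar>i\<bar>"
  define K where "K = ?k * (p * q)"
  have "?k * 1 \<le> ?k * (p * q)"
    using assms(3,4) by (intro mult_left_mono) (auto simp: int_one_le_iff_zero_less)
  then have K: "?k \<le> K" by (simp add: K_def)
  have "i + K \<ge> n" using K by linarith
  moreover have "i - K \<le> n" using K by linarith
  ultimately have "i + ?k * (p * q) \<ge> n" "i + (- ?k) * (p * q) \<le> n"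
    by (simp_all only: K_def mult_minus_left)
  then show "x i = y i" using assms(5) px py by metis
qed

lemma periodic_points_eq:
  assumes "x \<in> periodic_points X" "y \<in> periodic_points Y"
    and "(\<forall>i\<ge>n. x i = y i) \<or> (\<forall>i\<le>n. x i = y i)"
  shows "x = y"
proof -
  obtain p q where "p > 0" "shift_by p x = x" "q > 0" "shift_by q y = y"
    using assms by (auto simp: periodic_points_def)
  then show ?thesis using periodic_eq assms(3) by blast
qed

lemma finite_invariant_periodic:
  assumes "finite Q" "\<And>x n. x \<in> Q \<Longrightarrow> shift_by n x \<in> Q" "x \<in> Q"
  shows "\<exists>p>0. shift_by p x = x"
proof -
  have "finite (range (\<lambda>n :: nat. shift_by (int n) x))"
    by (rule finite_subset[OF _ assms(1)]) (use assms in auto)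
  then have "\<not> inj (\<lambda>n :: nat. shift_by (int n) x)"
    using finite_imageD infinite_UNIV_nat by blast
  then obtain i j :: nat where "shift_by (int i) x = shift_by (int j) x" "i \<noteq> j"
    unfolding inj_def by blast
  then obtain m n :: nat where mn: "shift_by (int m) x = shift_by (int n) x" "m < n"
    by (metis nat_neq_iff)
  have "shift_by (int n - int m) x = shift_by (- int m) (shift_by (int n) x)" by simp
  also have "\<dots> = x" unfolding mn(1)[symmetric] by simp
  finally show ?thesis using mn(2) by (intro exI[of _ "int n - int m"]) simp
qed

lemma shift_orbit_shift [simp]: "shift_orbit (shift_by i z) = shift_orbit z"
proof -
  have "\<exists>m. shift_by n z = shift_by (m + i) z" for n by (rule exI[of _ "n - i"]) simp
  then show ?thesis by (auto simp: shift_orbit_def)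
qed

section \<open>Accumulation points and the finitely many exceptional points\<close>

locale rank2 =
  fixes A :: "'a set" and X :: "(int \<Rightarrow> 'a) set"
  assumes shift: "shift_space A X" and count: "countable X" and rank: "cb_rank (full_shift A) X \<le> 2"
begin

definition Q :: "(int \<Rightarrow> 'a) set" where "Q = cb_derivative (full_shift A) X"

abbreviation "Per \<equiv> periodic_points X"

lemma finite_A: "finite A" and closed: "closedin (full_shift A) X"
  and shift_in: "x \<in> X \<Longrightarrow> shift_by n x \<in> X"
  using shift shift_space_shift by (auto simp: shift_space_def)

lemma shift_in_iff [simp]: "shift_by n x \<in> X \<longleftrightarrow> x \<in> X"
  using shift_in[of x n] shift_in[of "shift_by n x" "- n"] by auto

lemma X_range: "X \<subseteq> {x. range x \<subseteq> A}"
  using closedin_subset[OF closed] by (simp add: topspace_full_shift)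

lemma Q_iff: "x \<in> Q \<longleftrightarrow> x \<in> X \<and> (\<forall>n. \<exists>y\<in>X. y \<noteq> x \<and> agree n x y)"
proof -
  have "x \<in> Q \<longleftrightarrow> x \<in> X \<and> x \<in> full_shift A derived_set_of X"
    by (simp add: Q_def cb_derivative_def)
  moreover have "x \<in> X \<Longrightarrow> range x \<subseteq> A" using X_range by auto
  ultimately show ?thesis using derived_set_full_shift[OF X_range, of x] by argo
qed

text \<open>A derivative that equals its own derivative is closed, countable and without isolated
  points, hence empty by Baire. Rank at most 2 thus makes the second derivative empty, so
  \<open>Q\<close> is compact without accumulation points in itself.\<close>

lemma finite_Q: "finite Q"
proof -
  let ?T = "full_shift A" and ?D = "cb_derivative (full_shift A)"
  have cl: "closedin ?T (?D S)" if "closedin ?T S" for S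
    unfolding cb_derivative_def
    by (intro closedin_Int that closedin_derived_set_of Hausdorff_full_shift)
  have clk: "closedin ?T ((?D ^^ k) X)" for k
  proof (induction k)
    case (Suc k)
    then show ?case using cl[OF Suc] by simp
  qed (simp add: closed)
  have sub: "(?D ^^ k) X \<subseteq> X" for k
    by (induction k) (auto simp: cb_derivative_def)
  have "\<exists>k\<le>2. (?D ^^ k) X = (?D ^^ Suc k) X"
  proof (rule ccontr)
    assume no: "\<not> (\<exists>k\<le>2. (?D ^^ k) X = (?D ^^ Suc k) X)"
    have "3 \<le> cb_rank ?T X"
      unfolding cb_rank_def
    proof (rule INF_greatest)
      fix k assume "k \<in> {k. (?D ^^ k) X = (?D ^^ Suc k) X}"
      then have "(?D ^^ k) X = (?D ^^ Suc k) X" by (rule CollectD)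
      with no have "\<not> k \<le> 2" by blast
      then have "3 \<le> k" by linarith
      then show "(3 :: enat) \<le> enat k" by (simp add: numeral_eq_enat)
    qed
    then have "(3 :: enat) \<le> 2" using rank by (rule order_trans)
    then show False by (simp add: numeral_eq_enat)
  qed
  then obtain k where k: "k \<le> 2" "(?D ^^ k) X = (?D ^^ Suc k) X" by blast
  have "(?D ^^ k) X = {}"
  proof (rule countable_perfect_empty[OF finite_A clk])
    show "countable ((?D ^^ k) X)" using count sub countable_subset by blast
    show "(?D ^^ k) X \<subseteq> ?T derived_set_of (?D ^^ k) X"
      using k(2) by (auto simp: cb_derivative_def)
  qed
  moreover have empty: "?D {} = {}" by (simp add: cb_derivative_def)
  ultimately have "?D (?D X) = {}"
  proof -
    have "k = 0 \<or> k = 1 \<or> k = 2" using k(1) by linarith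
    then show ?thesis using \<open>(?D ^^ k) X = {}\<close> empty by (elim disjE) (simp_all add: numeral_2_eq_2)
  qed
  then have "Q \<inter> ?T derived_set_of Q = {}" by (simp only: Q_def[symmetric] cb_derivative_def[of _ Q])
  moreover have "compactin ?T Q"
    unfolding Q_def using closedin_compact_space[OF compact_full_shift[OF finite_A] cl[OF closed]] .
  ultimately show ?thesis using discrete_compactin_eq_finite by blast
qed

lemma Q_shift: "x \<in> Q \<Longrightarrow> shift_by n x \<in> Q"
proof -
  assume x: "x \<in> Q"
  have "\<exists>y\<in>X. y \<noteq> shift_by n x \<and> agree m (shift_by n x) y" for m
  proof -
    obtain y where y: "y \<in> X" "y \<noteq> x" "agree (m + nat \<bar>n\<bar>) x y" using x unfolding Q_iff by blast
    then show ?thesis using agree_shift by (intro bexI[of _ "shift_by n y"]) auto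
  qed
  then show ?thesis using x unfolding Q_iff by simp
qed

lemma Q_Per: "Q \<subseteq> Per"
  using finite_invariant_periodic[OF finite_Q Q_shift] by (auto simp: periodic_points_def Q_iff)

lemma isolated: "x \<in> X \<Longrightarrow> x \<notin> Per \<Longrightarrow> \<exists>n. \<forall>y\<in>X. agree n x y \<longrightarrow> y = x"
  using Q_Per Q_iff[of x] by blast

lemma separating_window: "\<exists>N. \<forall>q\<in>Q. \<forall>q'\<in>Q. agree N q q' \<longrightarrow> q = q'"
proof -
  have "\<exists>m. \<forall>n\<ge>m. agree n (fst p) (snd p) \<longrightarrow> fst p = snd p" for p :: "(int \<Rightarrow> 'a) \<times> (int \<Rightarrow> 'a)"
    using not_agree by blast
  from uniform_bound[of "Q \<times> Q" "\<lambda>p n. agree n (fst p) (snd p) \<longrightarrow> fst p = snd p", OF _ this]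
  show ?thesis using finite_Q by fastforce
qed

text \<open>One more than a separating radius: when two windows are shifted against each other by
  one position, they still overlap in a window that determines the point of
  \<open>Q\<close>.\<close>

definition window :: nat where
  "window = Suc (SOME N. \<forall>q\<in>Q. \<forall>q'\<in>Q. agree N q q' \<longrightarrow> q = q')"

lemma window: "q \<in> Q \<Longrightarrow> q' \<in> Q \<Longrightarrow> agree (window - 1) q q' \<Longrightarrow> q = q'"
  using someI_ex[OF separating_window] by (simp add: window_def)

definition W :: "(int \<Rightarrow> 'a) set" where
  "W = {z \<in> X. \<forall>q\<in>Q. \<not> agree window q z}"

text \<open>By compactness an infinite \<open>W\<close> would accumulate at some point of
  \<open>X\<close>. That point lies in \<open>Q\<close>, but the points of \<open>W\<close> differ
  from all points of \<open>Q\<close> within a fixed window and so cannot approach it.\<close>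

lemma finite_W: "finite W"
proof (rule ccontr)
  assume inf: "infinite W"
  have "compactin (full_shift A) X"
    by (rule closedin_compact_space[OF compact_full_shift[OF finite_A] closed])
  then obtain x where x: "x \<in> X" "x \<in> full_shift A derived_set_of W"
    using compactin_imp_Bolzano_Weierstrass[of "full_shift A" X W] inf by (auto simp: W_def)
  have W: "W \<subseteq> {x. range x \<subseteq> A}" using X_range by (auto simp: W_def)
  have "x \<in> Q"
    using x unfolding Q_iff derived_set_full_shift[OF W] by (auto simp: W_def)
  moreover obtain w where "w \<in> W" "agree window x w"
    using x unfolding derived_set_full_shift[OF W] by blast
  ultimately show False by (auto simp: W_def)
qed

text \<open>Neighbouring windows of \<open>z\<close> that occur in points of the finite set \<open>Q\<close> overlap enough to
  come from the same point.\<close>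

lemma follow:
  assumes z: "z \<in> X" and good: "\<And>i. a \<le> i \<Longrightarrow> i \<le> a + int k \<Longrightarrow> shift_by i z \<notin> W"
    and q: "q \<in> Q" "agree window q (shift_by a z)"
  shows "agree window (shift_by (int k) q) (shift_by (a + int k) z)"
  using good
proof (induction k)
  case 0
  then show ?case using q by simp
next
  case (Suc k)
  let ?q = "shift_by (int k) q"
  have IH: "agree window ?q (shift_by (a + int k) z)"
    using Suc.IH Suc.prems by simp
  have "shift_by (a + int (Suc k)) z \<notin> W" by (rule Suc.prems) auto
  then obtain r where r: "r \<in> Q" "agree window r (shift_by (a + int (Suc k)) z)"
    using z by (auto simp: W_def)
  have w: "window = (window - 1) + nat \<bar>1\<bar>" by (simp add: window_def)
  have "agree (window - 1) (shift_by 1 ?q) (shift_by 1 (shift_by (a + int k) z))"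
    by (rule agree_shift) (use IH w in simp)
  moreover have "shift_by 1 (shift_by (a + int k) z) = shift_by (a + int (Suc k)) z"
    by (simp add: algebra_simps)
  moreover have "agree (window - 1) (shift_by (a + int (Suc k)) z) r"
    by (rule agree_mono[OF agree_sym[OF r(2)]]) simp
  ultimately have "agree (window - 1) (shift_by 1 ?q) r"
    using agree_trans by metis
  then have "shift_by 1 ?q = r" using window Q_shift q(1) r(1) by simp
  then show ?case using r(2) by (simp add: algebra_simps)
qed

lemma agree_0: "agree n x y \<Longrightarrow> x 0 = y 0"
  by (simp add: agree_def)

lemma eventually_right:
  assumes "z \<in> X" "\<And>i. a \<le> i \<Longrightarrow> shift_by i z \<notin> W"
  shows "\<exists>q\<in>Q. \<forall>i\<ge>a. z i = q i"
proof -
  have "shift_by a z \<notin> W" using assms by simp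
  then obtain q where q: "q \<in> Q" "agree window q (shift_by a z)" using assms(1) by (auto simp: W_def)
  have "z i = shift_by (- a) q i" if i: "a \<le> i" for i
  proof -
    obtain k where k: "i = a + int k" using i zle_iff_zadd[of a i] by auto
    have "agree window (shift_by (int k) q) (shift_by (a + int k) z)"
      by (rule follow) (use assms q in auto)
    from agree_0[OF this] show ?thesis by (simp add: shift_by_apply k)
  qed
  then show ?thesis using Q_shift q(1) by blast
qed

lemma eventually_left:
  assumes "z \<in> X" "\<And>i. i \<le> a \<Longrightarrow> shift_by i z \<notin> W"
  shows "\<exists>q\<in>Q. \<forall>i\<le>a. z i = q i"
proof -
  have "shift_by a z \<notin> W" using assms by simp
  then obtain r where r: "r \<in> Q" "agree window r (shift_by a z)" using assms(1) by (auto simp: W_def)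
  have "z i = shift_by (- a) r i" if i: "i \<le> a" for i
  proof -
    obtain k where k: "a = i + int k" using i zle_iff_zadd[of i a] by auto
    have "shift_by i z \<notin> W" using assms i by simp
    then obtain q where q: "q \<in> Q" "agree window q (shift_by i z)" using assms(1) by (auto simp: W_def)
    have "agree window (shift_by (int k) q) (shift_by a z)"
      unfolding k by (rule follow) (use assms q k in auto)
    then have "agree (window - 1) (shift_by (int k) q) r"
      by (intro agree_mono[OF agree_trans[OF _ agree_sym[OF r(2)]]]) simp_all
    then have "shift_by (int k) q = r" using window Q_shift q(1) r(1) by simp
    then have "q = shift_by (- int k) r" by auto
    then show ?thesis using agree_0[OF q(2)] by (simp add: shift_by_apply k)
  qed
  then show ?thesis using Q_shift r(1) by blast
qed

text \<open>Otherwise the point follows some point of \<open>Q\<close> from any position on. These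
  periodic points agree far to the right, hence they are all the same one, and the given point
  equals it everywhere.\<close>

lemma orbit_meets_W:
  assumes "z \<in> X" "z \<notin> Q"
  shows "\<exists>i. shift_by i z \<in> W"
proof (rule ccontr)
  assume no: "\<nexists>i. shift_by i z \<in> W"
  then obtain q where q: "q \<in> Q" "\<forall>i\<ge>0. z i = q i" using eventually_right[of z 0] assms by blast
  obtain r where r: "r \<in> Q" "\<forall>i\<le>0. z i = r i" using no eventually_left[of z 0] assms by blast
  have "z = q"
  proof
    fix i
    obtain q' where q': "q' \<in> Q" "\<forall>j\<ge>min i 0. z j = q' j"
      using no eventually_right[of z "min i 0"] assms by blast
    have "q' = q"
    proof (rule periodic_points_eq)
      show "q' \<in> Per" "q \<in> Per" using Q_Per q(1) q'(1) by auto
      show "(\<forall>i\<ge>0. q' i = q i) \<or> (\<forall>i\<le>0. q' i = q i)" using q(2) q'(2) by simp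
    qed
    then show "z i = q i" using q'(2) by simp
  qed
  then show False using q(1) assms by simp
qed

text \<open>The orbit of a periodic point outside \<open>Q\<close> meets the finite set
  \<open>W\<close>, and the orbit of a periodic point is finite.\<close>

lemma finite_Per: "finite Per"
proof -
  have "Per \<subseteq> Q \<union> (\<Union>w\<in>W. {x \<in> Per. \<exists>n. x = shift_by n w})"
  proof
    fix x assume x: "x \<in> Per"
    show "x \<in> Q \<union> (\<Union>w\<in>W. {x \<in> Per. \<exists>n. x = shift_by n w})"
    proof (cases "x \<in> Q")
      case False
      then obtain i where i: "shift_by i x \<in> W" using orbit_meets_W x by (auto simp: periodic_points_def)
      have "x = shift_by (- i) (shift_by i x)" by simp
      then show ?thesis using i x by blast
    qed simp
  qed
  moreover have "finite {x \<in> Per. \<exists>n. x = shift_by n w}" for w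
  proof (cases "\<exists>p>0. shift_by p w = w")
    case True
    then obtain p where p: "p > 0" "shift_by p w = w" by blast
    have "shift_by n w \<in> (\<lambda>k. shift_by k w) ` {0..<p}" for n
    proof -
      have "shift_by n w = shift_by (n mod p) (shift_by ((n div p) * p) w)" by simp
      also have "\<dots> = shift_by (n mod p) w" using periodic_shift_int[OF p(2)] by simp
      finally show ?thesis using p(1) by auto
    qed
    then have "{x \<in> Per. \<exists>n. x = shift_by n w} \<subseteq> (\<lambda>k. shift_by k w) ` {0..<p}" by auto
    then show ?thesis by (rule finite_subset) simp
  next
    case False
    have "x \<notin> Per" if "x = shift_by n w" for x n
    proof
      assume "x \<in> Per"
      then obtain p where p: "p > 0" "shift_by p x = x"
        by (auto simp: periodic_points_def)
      then have "shift_by (- n) (shift_by p x) = shift_by (- n) x" by simp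
      then have "shift_by p w = w" by (simp add: that)
      then show False using False p(1) by simp
    qed
    then have "{x \<in> Per. \<exists>n. x = shift_by n w} = {}" by blast
    then show ?thesis by (simp only: finite.emptyI)
  qed
  ultimately have "finite (Q \<union> (\<Union>w\<in>W. {x \<in> Per. \<exists>n. x = shift_by n w}))"
    using finite_Q finite_W by blast
  with \<open>Per \<subseteq> _\<close> show ?thesis by (rule finite_subset)
qed

text \<open>The shifts of an aperiodic point are pairwise different, so only finitely many of them
  lie in \<open>W\<close>. Outside a bounded interval the point therefore follows points of
  \<open>Q\<close> on both sides, and these are periodic.\<close>

lemma connecting_exists:
  assumes "z \<in> X"
  shows "\<exists>x\<in>Per. \<exists>y\<in>Per. z \<in> connecting_points X x y"
proof (cases "z \<in> Per")
  case True
  then show ?thesis using assms by (auto simp: connecting_points_def)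
next
  case False
  have "inj (\<lambda>i. shift_by i z)"
  proof (rule injI)
    fix i j assume ij: "shift_by i z = shift_by j z"
    show "i = j"
    proof (rule ccontr)
      assume "i \<noteq> j"
      have "shift_by (i - j) z = z"
        using arg_cong[OF ij, of "shift_by (- j)"] by simp
      moreover have "shift_by (j - i) z = z"
        using arg_cong[OF ij, of "shift_by (- i)"] by simp
      ultimately have "shift_by \<bar>i - j\<bar> z = z" "\<bar>i - j\<bar> > 0" using \<open>i \<noteq> j\<close> by (auto simp: abs_if)
      then show False using False assms by (auto simp: periodic_points_def)
    qed
  qed
  then have "finite {i. shift_by i z \<in> W}"
    using finite_vimageI[OF finite_W] by (simp add: vimage_def)
  then have "\<exists>n. \<forall>i\<in>{i. shift_by i z \<in> W}. \<forall>m\<ge>n. \<bar>i\<bar> < int m"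
  proof (rule uniform_bound)
    show "\<exists>n. \<forall>m\<ge>n. \<bar>i\<bar> < int m" for i
      by (rule exI[of _ "Suc (nat \<bar>i\<bar>)"]) auto
  qed
  then obtain n :: nat where n: "\<And>i. shift_by i z \<in> W \<Longrightarrow> \<bar>i\<bar> < int n" by auto
  obtain y where y: "y \<in> Q" "\<forall>i\<ge>int n. z i = y i"
    using eventually_right[OF assms, of "int n"] n by force
  obtain x where x: "x \<in> Q" "\<forall>i\<le>- int n. z i = x i"
    using eventually_left[OF assms, of "- int n"] n by force
  have "z \<in> connecting_points X x y"
    unfolding connecting_points_def using x(2) y(2) assms by blast
  then show ?thesis using x(1) y(1) Q_Per by blast
qed

text \<open>Every orbit meets the finite set \<open>Q \<union> W\<close>.\<close>

lemma finite_orbits: "finite (shift_orbit ` X)"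
proof -
  note orb = shift_orbit_shift
  have "shift_orbit z \<in> shift_orbit ` (Q \<union> W)" if z: "z \<in> X" for z
  proof (cases "z \<in> Q")
    case False
    then obtain i where "shift_by i z \<in> W" using orbit_meets_W z by blast
    then have "shift_orbit (shift_by i z) \<in> shift_orbit ` (Q \<union> W)" by blast
    then show ?thesis by (simp only: orb)
  qed blast
  then have "shift_orbit ` X \<subseteq> shift_orbit ` (Q \<union> W)" by blast
  moreover have "finite (shift_orbit ` (Q \<union> W))" using finite_Q finite_W by simp
  ultimately show ?thesis by (rule finite_subset)
qed

end

section \<open>Isomorphisms of labeled digraphs\<close>

definition wf_digraph :: "'v labeled_digraph \<Rightarrow> bool" where
  "wf_digraph G \<longleftrightarrow> edges G \<subseteq> nodes G \<times> UNIV \<times> nodes G"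

definition digraph_iso_map :: "('v \<Rightarrow> 'w) \<Rightarrow> 'v labeled_digraph \<Rightarrow> 'w labeled_digraph \<Rightarrow> bool" where
  "digraph_iso_map \<phi> G H \<longleftrightarrow> bij_betw \<phi> (nodes G) (nodes H) \<and>
     (\<forall>u\<in>nodes G. \<forall>v\<in>nodes G. \<forall>l. (u, l, v) \<in> edges G \<longleftrightarrow> (\<phi> u, l, \<phi> v) \<in> edges H)"

lemma labeled_digraph_iso_iff:
  assumes G: "wf_digraph G" and H: "wf_digraph H"
  shows "labeled_digraph_iso G H \<longleftrightarrow> (\<exists>\<phi>. digraph_iso_map \<phi> G H)"
proof -
  have "(\<lambda>(u, l, v). (\<phi> u, l, \<phi> v)) ` edges G = edges H \<longleftrightarrow>
     (\<forall>u\<in>nodes G. \<forall>v\<in>nodes G. \<forall>l. (u, l, v) \<in> edges G \<longleftrightarrow> (\<phi> u, l, \<phi> v) \<in> edges H)"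
    if bij: "bij_betw \<phi> (nodes G) (nodes H)" for \<phi>
  proof
    assume im: "(\<lambda>(u, l, v). (\<phi> u, l, \<phi> v)) ` edges G = edges H"
    have "(u, l, v) \<in> edges G \<longleftrightarrow> (\<phi> u, l, \<phi> v) \<in> edges H" if uv: "u \<in> nodes G" "v \<in> nodes G" for u v l
    proof
      assume "(\<phi> u, l, \<phi> v) \<in> edges H"
      then obtain u' v' where e: "(u', l, v') \<in> edges G" "\<phi> u' = \<phi> u" "\<phi> v' = \<phi> v"
        unfolding im[symmetric] by auto
      then have "u' \<in> nodes G" "v' \<in> nodes G" using G by (auto simp: wf_digraph_def)
      then have "u' = u" "v' = v" using e uv bij by (auto simp: bij_betw_def dest: inj_onD)
      then show "(u, l, v) \<in> edges G" using e by simp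
    qed (use im in force)
    then show "\<forall>u\<in>nodes G. \<forall>v\<in>nodes G. \<forall>l. (u, l, v) \<in> edges G \<longleftrightarrow> (\<phi> u, l, \<phi> v) \<in> edges H"
      by blast
  next
    assume iff: "\<forall>u\<in>nodes G. \<forall>v\<in>nodes G. \<forall>l. (u, l, v) \<in> edges G \<longleftrightarrow> (\<phi> u, l, \<phi> v) \<in> edges H"
    show "(\<lambda>(u, l, v). (\<phi> u, l, \<phi> v)) ` edges G = edges H"
    proof (intro equalityI subsetI)
      fix e assume "e \<in> (\<lambda>(u, l, v). (\<phi> u, l, \<phi> v)) ` edges G"
      then obtain u l v where "(u, l, v) \<in> edges G" "e = (\<phi> u, l, \<phi> v)" by auto
      then show "e \<in> edges H" using iff G by (auto simp: wf_digraph_def)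
    next
      fix e assume e: "e \<in> edges H"
      obtain a l b where abl: "e = (a, l, b)" by (cases e)
      then have "a \<in> nodes H" "b \<in> nodes H" using e H by (auto simp: wf_digraph_def)
      moreover have "nodes H = \<phi> ` nodes G" using bij by (simp add: bij_betw_def)
      ultimately obtain u v where "u \<in> nodes G" "v \<in> nodes G" "a = \<phi> u" "b = \<phi> v" by blast
      then show "e \<in> (\<lambda>(u, l, v). (\<phi> u, l, \<phi> v)) ` edges G"
        using e iff abl by (auto intro!: image_eqI[of _ _ "(u, l, v)"])
    qed
  qed
  then show ?thesis unfolding labeled_digraph_iso_def digraph_iso_map_def by blast
qed

lemma digraph_iso_map_inv:
  assumes "digraph_iso_map \<phi> G H"
  shows "digraph_iso_map (inv_into (nodes G) \<phi>) H G"
proof -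
  have bij: "bij_betw \<phi> (nodes G) (nodes H)" using assms by (simp add: digraph_iso_map_def)
  have "inv_into (nodes G) \<phi> u \<in> nodes G \<and> \<phi> (inv_into (nodes G) \<phi> u) = u" if "u \<in> nodes H" for u
    using bij that by (metis bij_betw_def f_inv_into_f inv_into_into)
  then show ?thesis
    using assms bij_betw_inv_into[OF bij] unfolding digraph_iso_map_def by metis
qed

lemma digraph_iso_map_comp:
  assumes "digraph_iso_map \<phi> G H" "digraph_iso_map \<psi> H K"
  shows "digraph_iso_map (\<psi> \<circ> \<phi>) G K"
proof -
  have "\<phi> u \<in> nodes H" if "u \<in> nodes G" for u
    using assms(1) that unfolding digraph_iso_map_def by (meson bij_betwE)
  then show ?thesis
    using assms bij_betw_trans[of \<phi> "nodes G" "nodes H" \<psi> "nodes K"]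
    unfolding digraph_iso_map_def by simp
qed

section \<open>Block maps\<close>

text \<open>The pointwise form of a sliding block code, for coordinate 0 only: the radius may depend
  on the point. Equivariance transfers it to all other coordinates in \<open>local_agree\<close>,
  and \<open>block_mapI\<close> is the converse.\<close>

lemma block_map_local:
  assumes f: "block_map A X B Y f" and X: "X \<subseteq> {x. range x \<subseteq> A}" and x: "x \<in> X"
  shows "\<exists>m. \<forall>n\<ge>m. \<forall>y\<in>X. agree n x y \<longrightarrow> f x 0 = f y 0"
proof -
  let ?U = "{y :: int \<Rightarrow> _. range y \<subseteq> B \<and> y 0 = f x 0}"
  have cont: "continuous_map (subtopology (full_shift A) X) (subtopology (full_shift B) Y) f"
    using f by (simp add: block_map_def)
  have "openin (full_shift B) ?U"
    unfolding openin_full_shift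
  proof (intro conjI ballI)
    fix y assume "y \<in> ?U"
    then show "\<exists>n. \<forall>z. range z \<subseteq> B \<longrightarrow> agree n y z \<longrightarrow> z \<in> ?U"
      by (intro exI[of _ 0]) (simp add: agree_def)
  qed blast
  then have "openin (subtopology (full_shift B) Y) (?U \<inter> Y)"
    by (auto simp: openin_subtopology)
  from openin_continuous_map_preimage[OF cont this]
  obtain T where T: "openin (full_shift A) T"
    "{z \<in> topspace (subtopology (full_shift A) X). f z \<in> ?U \<inter> Y} = T \<inter> X"
    by (auto simp: openin_subtopology)
  have top: "topspace (subtopology (full_shift A) X) = X"
    unfolding topspace_subtopology topspace_full_shift using X by blast
  have fin: "f z \<in> Y \<and> range (f z) \<subseteq> B" if "z \<in> X" for z
  proof -
    have "f z \<in> topspace (subtopology (full_shift B) Y)"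
      using continuous_map_image_subset_topspace[OF cont] that unfolding top by blast
    then show ?thesis by (simp add: topspace_full_shift)
  qed
  have "x \<in> T \<inter> X"
    unfolding T(2)[symmetric] using fin[OF x] x top by simp
  then obtain n where n: "\<And>y. range y \<subseteq> A \<Longrightarrow> agree n x y \<Longrightarrow> y \<in> T"
    using T(1) unfolding openin_full_shift by blast
  have "f x 0 = f y 0" if "y \<in> X" "agree k x y" "n \<le> k" for y k
  proof -
    have "agree n x y" using agree_mono that by blast
    then have "y \<in> T \<inter> X" using n that X by blast
    then show ?thesis unfolding T(2)[symmetric] by simp
  qed
  then show ?thesis by blast
qed

lemma equivariant_shift_by:
  assumes X: "\<And>x n. x \<in> X \<Longrightarrow> shift_by n x \<in> X" and f: "\<And>x. x \<in> X \<Longrightarrow> shift_map (f x) = f (shift_map x)"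
    and x: "x \<in> X"
  shows "f (shift_by n x) = shift_by n (f x)"
proof -
  have pos: "f (shift_by (int k) x) = shift_by (int k) (f x)" if "x \<in> X" for k x
  proof (induction k)
    case (Suc k)
    have "f (shift_by (int (Suc k)) x) = f (shift_map (shift_by (int k) x))" by simp
    also have "\<dots> = shift_map (f (shift_by (int k) x))" using f X that by metis
    also have "\<dots> = shift_by (int (Suc k)) (f x)" by (simp add: Suc)
    finally show ?case .
  qed simp
  show ?thesis
  proof (cases n rule: int_cases2)
    case (nonneg k)
    then show ?thesis using pos x by simp
  next
    case (nonpos k)
    have "f x = shift_by (int k) (f (shift_by (- int k) x))"
      using pos[OF X[OF x], of k "- int k"] by simp
    then have "shift_by (- int k) (f x) = shift_by (- int k) (shift_by (int k) (f (shift_by (- int k) x)))"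
      by simp
    then show ?thesis using nonpos by simp
  qed
qed

lemma local_agree:
  assumes X: "\<And>x n. x \<in> X \<Longrightarrow> shift_by n x \<in> X" and f: "\<And>x n. x \<in> X \<Longrightarrow> f (shift_by n x) = shift_by n (f x)"
    and loc: "\<And>x. x \<in> X \<Longrightarrow> \<exists>m. \<forall>n\<ge>m. \<forall>y\<in>X. agree n x y \<longrightarrow> f x 0 = f y 0" and x: "x \<in> X"
  shows "\<exists>m. \<forall>y\<in>X. agree m x y \<longrightarrow> agree k (f x) (f y)"
proof -
  have "\<exists>m. \<forall>i\<in>{- int k..int k}. \<forall>n\<ge>m. \<forall>y\<in>X. agree n x y \<longrightarrow> f x i = f y i"
  proof (rule uniform_bound)
    fix i
    obtain m where m: "\<And>n y. n \<ge> m \<Longrightarrow> y \<in> X \<Longrightarrow> agree n (shift_by i x) y \<Longrightarrow> f (shift_by i x) 0 = f y 0"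
      using loc[OF X[OF x], of i] by blast
    have "f x i = f y i" if "n \<ge> m + nat \<bar>i\<bar>" "y \<in> X" "agree n x y" for n y
    proof -
      have "agree m (shift_by i x) (shift_by i y)"
        by (rule agree_shift, rule agree_mono[OF that(3) that(1)])
      then have "f (shift_by i x) 0 = f (shift_by i y) 0" using m[of m] X[OF that(2)] by blast
      then show ?thesis using f x that(2) by (simp add: shift_by_apply)
    qed
    then show "\<exists>m. \<forall>n\<ge>m. \<forall>y\<in>X. agree n x y \<longrightarrow> f x i = f y i" by blast
  qed simp
  then obtain m where "\<And>i y. i \<in> {- int k..int k} \<Longrightarrow> y \<in> X \<Longrightarrow> agree m x y \<Longrightarrow> f x i = f y i"
    by blast
  then show ?thesis by (intro exI[of _ m]) (auto simp: agree_def abs_le_iff)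
qed

lemma block_mapI:
  assumes X: "\<And>x n. x \<in> X \<Longrightarrow> shift_by n x \<in> X" "X \<subseteq> {x. range x \<subseteq> A}" "Y \<subseteq> {x. range x \<subseteq> B}"
    and fY: "\<And>x. x \<in> X \<Longrightarrow> f x \<in> Y"
    and f: "\<And>x n. x \<in> X \<Longrightarrow> f (shift_by n x) = shift_by n (f x)"
    and loc: "\<And>x. x \<in> X \<Longrightarrow> \<exists>m. \<forall>n\<ge>m. \<forall>y\<in>X. agree n x y \<longrightarrow> f x 0 = f y 0"
  shows "block_map A X B Y f"
proof -
  have top: "topspace (subtopology (full_shift A) X) = X" "topspace (subtopology (full_shift B) Y) = Y"
    unfolding topspace_subtopology topspace_full_shift using X(2,3) by blast+
  have "openin (subtopology (full_shift A) X) {x \<in> X. f x \<in> U}"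
    if "openin (subtopology (full_shift B) Y) U" for U
  proof -
    from that obtain T where T: "openin (full_shift B) T" "U = T \<inter> Y" by (auto simp: openin_subtopology)
    \<comment> \<open>The preimage of an open set is the trace on \<open>X\<close> of a union of
      cylinders around its points. The cylinders are taken in the full shift because openness in a
      subspace is defined through open sets of the whole space.\<close>
    define good where "good x m \<longleftrightarrow> x \<in> X \<and> f x \<in> T \<and> (\<forall>y\<in>X. agree m x y \<longrightarrow> f y \<in> T)" for x m
    let ?V = "{z. range z \<subseteq> A \<and> (\<exists>x m. good x m \<and> agree m x z)}"
    have "openin (full_shift A) ?V"
      unfolding openin_full_shift
    proof (intro conjI ballI)
      fix z assume "z \<in> ?V"
      then obtain x m where xm: "good x m" "agree m x z" by blast
      have "y \<in> ?V" if "range y \<subseteq> A" "agree m z y" for y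
      proof -
        have "good x m \<and> agree m x y" using xm(1) agree_trans[OF xm(2) that(2)] by (rule conjI)
        then show ?thesis using that(1) by blast
      qed
      then show "\<exists>n. \<forall>y. range y \<subseteq> A \<longrightarrow> agree n z y \<longrightarrow> y \<in> ?V" by blast
    qed blast
    moreover have "{x \<in> X. f x \<in> U} = ?V \<inter> X"
    proof (intro equalityI subsetI)
      fix x assume "x \<in> {x \<in> X. f x \<in> U}"
      then have x: "x \<in> X" "f x \<in> T" using T(2) by auto
      obtain k where k: "\<And>y. range y \<subseteq> B \<Longrightarrow> agree k (f x) y \<Longrightarrow> y \<in> T"
        using T(1) x(2) unfolding openin_full_shift by blast
      obtain m where m: "\<forall>y\<in>X. agree m x y \<longrightarrow> agree k (f x) (f y)"
        using local_agree[OF X(1) f loc x(1)] by blast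
      have "f y \<in> T" if "y \<in> X" "agree m x y" for y
      proof (rule k)
        show "range (f y) \<subseteq> B" using fY[OF that(1)] X(3) by blast
        show "agree k (f x) (f y)" using m that by blast
      qed
      then have "good x m" using x by (simp add: good_def)
      moreover have "range x \<subseteq> A" using x(1) X(2) by blast
      ultimately show "x \<in> ?V \<inter> X" using x(1) agree_refl by blast
    next
      fix x assume x: "x \<in> ?V \<inter> X"
      then obtain y m where "good y m" "agree m y x" by blast
      then have "f x \<in> T" using x by (simp add: good_def)
      then show "x \<in> {x \<in> X. f x \<in> U}" using x T(2) fY by simp
    qed
    ultimately show ?thesis by (auto simp: openin_subtopology)
  qed
  then have "continuous_map (subtopology (full_shift A) X) (subtopology (full_shift B) Y) f"
    unfolding continuous_map_def top using fY by (simp add: Pi_def)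
  then show ?thesis using f by (simp add: block_map_def)
qed

section \<open>Conjugate shifts have isomorphic structure graphs\<close>

lemma shift_orbit_range: "shift_orbit z = range (\<lambda>n. shift_by n z)"
  unfolding shift_orbit_def by blast

lemma shift_orbit_eqD:
  assumes "shift_orbit z = shift_orbit w"
  shows "\<exists>n. z = shift_by n w"
proof -
  have "shift_by 0 z \<in> shift_orbit z" unfolding shift_orbit_def by blast
  then have "z \<in> shift_orbit w" unfolding assms by simp
  then show ?thesis unfolding shift_orbit_def by blast
qed

context rank2 begin

lemma Per_in [simp]: "x \<in> Per \<Longrightarrow> x \<in> X"
  by (simp add: periodic_points_def)

lemma PerI: "x \<in> X \<Longrightarrow> p > 0 \<Longrightarrow> shift_by p x = x \<Longrightarrow> x \<in> Per"
  unfolding periodic_points_def by blast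

lemma PerE: assumes "x \<in> Per" obtains p where "p > 0" "shift_by p x = x" "x \<in> X"
  using assms unfolding periodic_points_def by blast

lemma Per_shift: assumes "x \<in> Per" shows "shift_by n x \<in> Per"
  using assms
proof (rule PerE)
  fix p assume p: "p > 0" "shift_by p x = x" "x \<in> X"
  have "shift_by p (shift_by n x) = shift_by n (shift_by p x)"
    unfolding shift_by_add by (rule arg_cong[OF add.commute])
  then have "shift_by p (shift_by n x) = shift_by n x" unfolding p(2) .
  then show ?thesis by (rule PerI[OF shift_in[OF p(3)] p(1)])
qed

lemma Per_shift_iff [simp]: "shift_by n x \<in> Per \<longleftrightarrow> x \<in> Per"
proof
  assume "shift_by n x \<in> Per"
  from Per_shift[OF this, of "- n"] show "x \<in> Per" by (simp only: shift_by_add) simp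
qed (rule Per_shift)

lemma connecting_shift:
  "z \<in> connecting_points X x y \<Longrightarrow> shift_by n z \<in> connecting_points X (shift_by n x) (shift_by n y)"
proof -
  assume "z \<in> connecting_points X x y"
  then obtain k :: nat where k: "z \<in> X" "\<forall>i\<le>- int k. z i = x i" "\<forall>i\<ge>int k. z i = y i"
    by (auto simp: connecting_points_def)
  have "(\<forall>i\<le>- int (k + nat \<bar>n\<bar>). shift_by n z i = shift_by n x i) \<and>
      (\<forall>i\<ge>int (k + nat \<bar>n\<bar>). shift_by n z i = shift_by n y i)"
    using k by (auto simp: shift_by_apply)
  then show ?thesis unfolding connecting_points_def mem_Collect_eq shift_in_iff using k(1) by blast
qed

lemma connecting_unique:
  assumes "z \<in> connecting_points X x y" "z \<in> connecting_points X x' y'"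
    "x \<in> Per" "y \<in> Per" "x' \<in> Per" "y' \<in> Per"
  shows "x = x'" "y = y'"
proof -
  obtain k l :: nat where k: "\<forall>i\<le>- int k. z i = x i" "\<forall>i\<ge>int k. z i = y i"
    and l: "\<forall>i\<le>- int l. z i = x' i" "\<forall>i\<ge>int l. z i = y' i"
    using assms(1,2) by (auto simp: connecting_points_def)
  have "\<forall>i\<le>- int (max k l). x i = x' i"
  proof (intro allI impI)
    fix i assume "i \<le> - int (max k l)"
    then have "i \<le> - int k" "i \<le> - int l" by auto
    then show "x i = x' i" using k(1) l(1) by metis
  qed
  then show "x = x'" using periodic_points_eq assms by blast
  have "\<forall>i\<ge>int (max k l). y i = y' i"
  proof (intro allI impI)
    fix i assume "i \<ge> int (max k l)"
    then have "i \<ge> int k" "i \<ge> int l" by auto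
    then show "y i = y' i" using k(2) l(2) by metis
  qed
  then show "y = y'" using periodic_points_eq assms by blast
qed

lemma connecting_self: "x \<in> X \<Longrightarrow> x \<in> connecting_points X x x"
  by (simp add: connecting_points_def)

lemma finite_connecting_orbits: "finite (shift_orbit ` connecting_points X x y)"
  by (rule finite_subset[OF _ finite_orbits]) (auto simp: connecting_points_def)

definition orbit_count :: "(int \<Rightarrow> 'a) \<Rightarrow> (int \<Rightarrow> 'a) \<Rightarrow> nat" where
  "orbit_count x y = card (shift_orbit ` connecting_points X x y)"

lemma orbit_count_eq_0: "orbit_count x y = 0 \<longleftrightarrow> connecting_points X x y = {}"
  unfolding orbit_count_def using finite_connecting_orbits by simp

lemma rotation_edge: "(u, Rotation, v) \<in> edges (structure_graph X) \<longleftrightarrow> u \<in> Per \<and> v = shift_map u"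
  by (auto simp: structure_graph_def)

lemma transition_edge: "(u, Transition n, v) \<in> edges (structure_graph X) \<longleftrightarrow>
    u \<in> Per \<and> v \<in> Per \<and> n > 0 \<and> n = orbit_count u v"
proof -
  have "(u, Transition n, v) \<in> edges (structure_graph X) \<longleftrightarrow>
    u \<in> Per \<and> v \<in> Per \<and> connecting_points X u v \<noteq> {} \<and> n = orbit_count u v"
    by (auto simp: structure_graph_def orbit_count_def)
  then show ?thesis using orbit_count_eq_0[of u v] by auto
qed

lemma nodes_structure_graph: "nodes (structure_graph X) = Per"
  by (simp add: structure_graph_def)

lemma wf_structure_graph: "wf_digraph (structure_graph X)"
  unfolding wf_digraph_def nodes_structure_graph
  by (auto simp: structure_graph_def)

end

locale rank2_pair = X: rank2 A X + Y: rank2 B Y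
  for A :: "'a set" and X and B :: "'b set" and Y
begin

lemma structure_graph_iso_mapI:
  assumes "bij_betw \<phi> X.Per Y.Per" "\<And>x. x \<in> X.Per \<Longrightarrow> \<phi> (shift_map x) = shift_map (\<phi> x)"
    and "\<And>x y. x \<in> X.Per \<Longrightarrow> y \<in> X.Per \<Longrightarrow> X.orbit_count x y = Y.orbit_count (\<phi> x) (\<phi> y)"
  shows "digraph_iso_map \<phi> (structure_graph X) (structure_graph Y)"
  unfolding digraph_iso_map_def X.nodes_structure_graph Y.nodes_structure_graph
proof (intro conjI ballI allI)
  fix u v l
  assume uv: "u \<in> X.Per" "v \<in> X.Per"
  then have \<phi>: "\<phi> u \<in> Y.Per" "\<phi> v \<in> Y.Per" using assms(1) by (auto simp: bij_betw_def)
  have inj: "\<phi> v = \<phi> (shift_map u) \<longleftrightarrow> v = shift_map u"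
    using assms(1) uv by (auto simp: bij_betw_def inj_on_eq_iff)
  show "(u, l, v) \<in> edges (structure_graph X) \<longleftrightarrow> (\<phi> u, l, \<phi> v) \<in> edges (structure_graph Y)"
  proof (cases l)
    case Rotation
    then show ?thesis using uv \<phi> inj assms(2) by (simp add: X.rotation_edge Y.rotation_edge)
  next
    case (Transition n)
    then show ?thesis using uv \<phi> assms(3) by (simp add: X.transition_edge Y.transition_edge)
  qed
qed (fact assms(1))

lemma structure_graph_iso_mapD:
  assumes "digraph_iso_map \<phi> (structure_graph X) (structure_graph Y)"
  shows "bij_betw \<phi> X.Per Y.Per"
    and "x \<in> X.Per \<Longrightarrow> \<phi> (shift_map x) = shift_map (\<phi> x)"
    and "x \<in> X.Per \<Longrightarrow> y \<in> X.Per \<Longrightarrow> X.orbit_count x y = Y.orbit_count (\<phi> x) (\<phi> y)"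
proof -
  have edge: "(u, l, v) \<in> edges (structure_graph X) \<longleftrightarrow> (\<phi> u, l, \<phi> v) \<in> edges (structure_graph Y)"
    if "u \<in> X.Per" "v \<in> X.Per" for u l v
    using assms that unfolding digraph_iso_map_def X.nodes_structure_graph by blast
  show bij: "bij_betw \<phi> X.Per Y.Per"
    using assms unfolding digraph_iso_map_def X.nodes_structure_graph Y.nodes_structure_graph by blast
  show "\<phi> (shift_map x) = shift_map (\<phi> x)" if "x \<in> X.Per"
    using edge[of x "shift_map x" Rotation] that by (simp add: X.rotation_edge Y.rotation_edge)
  show "X.orbit_count x y = Y.orbit_count (\<phi> x) (\<phi> y)" if xy: "x \<in> X.Per" "y \<in> X.Per"
  proof -
    have \<phi>: "\<phi> x \<in> Y.Per" "\<phi> y \<in> Y.Per" using bij xy by (auto simp: bij_betw_def)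
    have "n > 0 \<and> n = X.orbit_count x y \<longleftrightarrow> n > 0 \<and> n = Y.orbit_count (\<phi> x) (\<phi> y)" for n
      using edge[OF xy, of "Transition n"] xy \<phi> by (simp add: X.transition_edge Y.transition_edge)
    then show ?thesis by (metis gr0I)
  qed
qed

text \<open>For the last claim: far out, the windows of \<open>z\<close> coincide with windows of a
  periodic point, where the map is determined by a window. Since there are finitely many periodic
  points, one radius serves all of them, so the image is asymptotic to the images of the two
  ends.\<close>

lemma block_map_properties:
  assumes f: "block_map A X B Y f"
  shows "x \<in> X \<Longrightarrow> f x \<in> Y"
    and "x \<in> X \<Longrightarrow> f (shift_by n x) = shift_by n (f x)"
    and "x \<in> X.Per \<Longrightarrow> f x \<in> Y.Per"
    and "x \<in> X.Per \<Longrightarrow> y \<in> X.Per \<Longrightarrow> z \<in> connecting_points X x y \<Longrightarrow> f z \<in> connecting_points Y (f x) (f y)"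
proof -
  have fY: "f x \<in> Y" if "x \<in> X" for x
  proof -
    have cont: "continuous_map (subtopology (full_shift A) X) (subtopology (full_shift B) Y) f"
      using f by (simp add: block_map_def)
    have "x \<in> topspace (subtopology (full_shift A) X)"
      unfolding topspace_subtopology topspace_full_shift using that X.X_range by blast
    then have "f x \<in> topspace (subtopology (full_shift B) Y)"
      using continuous_map_image_subset_topspace[OF cont] by blast
    then show ?thesis by simp
  qed
  then show "x \<in> X \<Longrightarrow> f x \<in> Y" by simp
  have eq: "f (shift_by n x) = shift_by n (f x)" if "x \<in> X" for n x
    by (rule equivariant_shift_by[OF X.shift_in _ that]) (use f in \<open>simp_all add: block_map_def\<close>)
  then show "x \<in> X \<Longrightarrow> f (shift_by n x) = shift_by n (f x)" by simp
  show "f x \<in> Y.Per" if xP: "x \<in> X.Per"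
  proof -
    obtain p where p: "p > 0" "shift_by p x = x" "x \<in> X" using X.PerE[OF xP] by blast
    have "shift_by p (f x) = f x" using eq[OF p(3), of p] unfolding p(2) by (rule sym)
    then show ?thesis by (rule Y.PerI[OF fY[OF p(3)] p(1)])
  qed
  show "f z \<in> connecting_points Y (f x) (f y)"
    if xy: "x \<in> X.Per" "y \<in> X.Per" and z: "z \<in> connecting_points X x y"
  proof -
    obtain k :: nat where k: "z \<in> X" "\<forall>i\<le>- int k. z i = x i" "\<forall>i\<ge>int k. z i = y i"
      using z by (auto simp: connecting_points_def)
    have "\<exists>m. \<forall>p\<in>X.Per. \<forall>n\<ge>m. \<forall>y\<in>X. agree n p y \<longrightarrow> f p 0 = f y 0"
      by (rule uniform_bound[OF X.finite_Per]) (rule block_map_local[OF f X.X_range X.Per_in])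
    then obtain m where m: "\<And>p y. p \<in> X.Per \<Longrightarrow> y \<in> X \<Longrightarrow> agree m p y \<Longrightarrow> f p 0 = f y 0" by blast
    have "f z i = f x i" if "i \<le> - int (k + m)" for i
    proof -
      have "agree m (shift_by i x) (shift_by i z)"
        using k(2) that by (auto simp: agree_def shift_by_apply)
      then have "f (shift_by i x) 0 = f (shift_by i z) 0"
        using m[of "shift_by i x" "shift_by i z"] xy(1) k(1) by simp
      then show ?thesis using eq k(1) xy(1) by (simp add: shift_by_apply)
    qed
    moreover have "f z i = f y i" if "i \<ge> int (k + m)" for i
    proof -
      have "agree m (shift_by i y) (shift_by i z)"
        using k(3) that by (auto simp: agree_def shift_by_apply)
      then have "f (shift_by i y) 0 = f (shift_by i z) 0"
        using m[of "shift_by i y" "shift_by i z"] xy(2) k(1) by simp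
      then show ?thesis using eq k(1) xy(2) by (simp add: shift_by_apply)
    qed
    ultimately show ?thesis unfolding connecting_points_def using fY k(1) by blast
  qed
qed

end

text \<open>A continuous bijection from a compact space to a Hausdorff space is a homeomorphism, so
  the inverse is a block map, too. Applying \<open>block_map_properties\<close> to both maps shows
  that connecting points correspond to connecting points, and equivariance carries this over to
  orbits.\<close>

lemma conjugate_imp_iso:
  assumes "rank2 A X" "rank2 B Y" "conjugate A X B Y"
  shows "\<exists>\<phi>. digraph_iso_map \<phi> (structure_graph X) (structure_graph Y)"
proof -
  interpret XY: rank2_pair A X B Y using assms by (simp add: rank2_pair_def)
  interpret YX: rank2_pair B Y A X using assms by (simp add: rank2_pair_def)
  obtain f where f: "block_map A X B Y f" "bij_betw f X Y" using assms(3) by (auto simp: conjugate_def)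
  let ?TX = "subtopology (full_shift A) X" and ?TY = "subtopology (full_shift B) Y"
  have top: "topspace ?TX = X" "topspace ?TY = Y"
    unfolding topspace_subtopology topspace_full_shift
    using XY.X.X_range XY.Y.X_range by blast+
  have "homeomorphic_map ?TX ?TY f"
  proof (rule continuous_imp_homeomorphic_map)
    show "compact_space ?TX"
      using closedin_compact_space[OF compact_full_shift[OF XY.X.finite_A] XY.X.closed]
      by (simp add: compact_space_subtopology)
    show "Hausdorff_space ?TY" by (rule Hausdorff_space_subtopology[OF Hausdorff_full_shift])
  qed (use f top in \<open>simp_all add: block_map_def bij_betw_def\<close>)
  then obtain g where g: "homeomorphic_maps ?TX ?TY f g" by (auto simp: homeomorphic_map_maps)
  then have gf: "g (f x) = x" if "x \<in> X" for x using that top by (simp add: homeomorphic_maps_def)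
  have fg: "f (g y) = y" if "y \<in> Y" for y using g that top by (simp add: homeomorphic_maps_def)
  note F = XY.block_map_properties[OF f(1)]
  have gm: "block_map B Y A X g"
    unfolding block_map_def
  proof (intro conjI ballI)
    show "continuous_map ?TY ?TX g" using g by (simp add: homeomorphic_maps_def)
    fix y assume y: "y \<in> Y"
    then obtain x where x: "x \<in> X" "y = f x" using f(2) by (auto simp: bij_betw_def)
    then show "shift_map (g y) = g (shift_map y)"
      using gf[OF x(1)] gf[OF XY.X.shift_in[OF x(1)], of 1] F(2)[OF x(1), of 1] by simp
  qed
  note G = YX.block_map_properties[OF gm]
  have inj: "inj_on f X" using f(2) by (simp add: bij_betw_def)
  have "bij_betw f XY.X.Per XY.Y.Per"
  proof (rule bij_betwI[where g = g])
    show "f \<in> XY.X.Per \<rightarrow> XY.Y.Per" "g \<in> XY.Y.Per \<rightarrow> XY.X.Per" using F(3) G(3) by blast+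
    show "g (f x) = x" if "x \<in> XY.X.Per" for x using gf[OF XY.X.Per_in[OF that]] .
    show "f (g y) = y" if "y \<in> XY.Y.Per" for y using fg[OF XY.Y.Per_in[OF that]] .
  qed
  moreover have "XY.X.orbit_count x y = XY.Y.orbit_count (f x) (f y)" if xy: "x \<in> XY.X.Per" "y \<in> XY.X.Per" for x y
  proof -
    have "f ` connecting_points X x y = connecting_points Y (f x) (f y)"
    proof (intro equalityI subsetI)
      fix w assume w: "w \<in> connecting_points Y (f x) (f y)"
      then have "g w \<in> connecting_points X (g (f x)) (g (f y))" using G(4) F(3) xy by blast
      then have "g w \<in> connecting_points X x y" using gf xy by simp
      then have "f (g w) \<in> f ` connecting_points X x y" by (rule imageI)
      moreover have "f (g w) = w" using w by (intro fg) (simp add: connecting_points_def)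
      ultimately show "w \<in> f ` connecting_points X x y" by simp
    qed (use F(4) xy in blast)
    moreover have orb: "shift_orbit (f z) = f ` shift_orbit z" if "z \<in> X" for z
      unfolding shift_orbit_range image_image using F(2)[OF that] by simp
    ultimately have "shift_orbit ` connecting_points Y (f x) (f y)
        = (\<lambda>o'. f ` o') ` shift_orbit ` connecting_points X x y"
    proof -
      have "shift_orbit ` f ` connecting_points X x y = (\<lambda>o'. f ` o') ` shift_orbit ` connecting_points X x y"
        unfolding image_image by (rule image_cong) (use orb in \<open>auto simp: connecting_points_def\<close>)
      then show ?thesis using \<open>f ` connecting_points X x y = _\<close> by simp
    qed
    moreover have "inj_on (\<lambda>o'. f ` o') (shift_orbit ` connecting_points X x y)"
    proof (rule inj_on_subset[OF inj_on_image_Pow[OF inj]])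
      show "shift_orbit ` connecting_points X x y \<subseteq> Pow X"
        by (auto simp: connecting_points_def shift_orbit_def)
    qed
    ultimately show ?thesis
      unfolding XY.X.orbit_count_def XY.Y.orbit_count_def by (simp add: card_image)
  qed
  ultimately have "digraph_iso_map f (structure_graph X) (structure_graph Y)"
    by (intro XY.structure_graph_iso_mapI) (use F(2)[OF XY.X.Per_in, of _ 1] in blast)+
  then show ?thesis by blast
qed

section \<open>Isomorphic structure graphs come from conjugate shifts\<close>

type_synonym 'a ends = "(int \<Rightarrow> 'a) \<times> (int \<Rightarrow> 'a)"

definition shift_ends :: "int \<Rightarrow> 'a ends \<Rightarrow> 'a ends" where
  "shift_ends n p = (shift_by n (fst p), shift_by n (snd p))"

lemma shift_ends_add [simp]: "shift_ends m (shift_ends n p) = shift_ends (m + n) p"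
  by (simp add: shift_ends_def)

lemma shift_ends_0 [simp]: "shift_ends 0 p = p"
  by (simp add: shift_ends_def)

text \<open>The ends of an orbit are defined only up to a simultaneous shift. Fixing one pair in
  each class means that the matching of orbits is chosen once per class, which makes the resulting
  map equivariant. Shifted pairs have the same set of candidates, hence the same choice.\<close>

definition ends_rep :: "'a ends \<Rightarrow> 'a ends" where
  "ends_rep p = (SOME q. \<exists>n. q = shift_ends n p)"

lemma ends_rep_ex: "\<exists>n. ends_rep p = shift_ends n p"
  unfolding ends_rep_def by (rule someI_ex) blast

lemma ends_rep_shift: "ends_rep (shift_ends n p) = ends_rep p"
proof -
  have "(\<exists>m. q = shift_ends m (shift_ends n p)) \<longleftrightarrow> (\<exists>m. q = shift_ends m p)" for q
  proof
    assume "\<exists>m. q = shift_ends m p"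
    then obtain m where "q = shift_ends m p" ..
    then have "q = shift_ends (m - n) (shift_ends n p)" by simp
    then show "\<exists>m. q = shift_ends m (shift_ends n p)" ..
  qed auto
  then show ?thesis by (simp only: ends_rep_def)
qed

context rank2 begin

definition conn :: "'a ends \<Rightarrow> (int \<Rightarrow> 'a) set" where
  "conn p = connecting_points X (fst p) (snd p) - Per"

definition orbs :: "'a ends \<Rightarrow> (int \<Rightarrow> 'a) set set" where
  "orbs p = shift_orbit ` conn p"

lemma conn_X: "z \<in> conn p \<Longrightarrow> z \<in> X - Per"
  by (simp add: conn_def connecting_points_def)

lemma conn_shift: "z \<in> conn p \<Longrightarrow> shift_by n z \<in> conn (shift_ends n p)"
  unfolding conn_def shift_ends_def fst_conv snd_conv using connecting_shift by simp

lemma conn_unique: "z \<in> conn p \<Longrightarrow> z \<in> conn q \<Longrightarrow> p \<in> Per \<times> Per \<Longrightarrow> q \<in> Per \<times> Per \<Longrightarrow> p = q"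
  using connecting_unique[of z "fst p" "snd p" "fst q" "snd q"]
  by (simp add: conn_def mem_Times_iff prod_eq_iff)

lemma orbs_iff: "c \<in> orbs p \<longleftrightarrow> (\<exists>z\<in>conn p. c = shift_orbit z)"
  by (auto simp: orbs_def)

lemma finite_orbs: "finite (orbs p)"
  unfolding orbs_def
  by (rule finite_subset[OF _ finite_orbits]) (auto simp: conn_def connecting_points_def)

text \<open>A periodic point that connects \<open>x\<close> to \<open>y\<close> equals both of them.
  So leaving out periodic points loses only the orbit of \<open>x\<close> itself, and this only for
  \<open>x = y\<close>.\<close>

lemma orbit_count_orbs:
  assumes x: "x \<in> Per" and y: "y \<in> Per"
  shows "orbit_count x y = card (orbs (x, y)) + of_bool (x = y)"
proof (cases "x = y")
  case False
  have "z \<notin> Per" if z: "z \<in> connecting_points X x y" for z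
  proof
    assume zP: "z \<in> Per"
    have "z \<in> connecting_points X z z" using zP by (intro connecting_self) simp
    from connecting_unique[OF z this x y zP zP] False show False by simp
  qed
  then have "conn (x, y) = connecting_points X x y" by (auto simp: conn_def)
  then show ?thesis using False by (simp add: orbit_count_def orbs_def)
next
  case True
  have "z = x" if z: "z \<in> connecting_points X x x" "z \<in> Per" for z
  proof -
    have "z \<in> connecting_points X z z" using z(2) by (intro connecting_self) simp
    from connecting_unique[OF z(1) this x x z(2) z(2)] show ?thesis by simp
  qed
  moreover have "x \<in> connecting_points X x x" using x by (intro connecting_self) simp
  ultimately have "connecting_points X x x = insert x (conn (x, x))"
    using x by (auto simp: conn_def)
  then have eq: "shift_orbit ` connecting_points X x x = insert (shift_orbit x) (orbs (x, x))"
    by (simp add: orbs_def)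
  have "shift_orbit x \<notin> orbs (x, x)"
  proof
    assume "shift_orbit x \<in> orbs (x, x)"
    then obtain z where z: "z \<in> conn (x, x)" "shift_orbit z = shift_orbit x" by (auto simp: orbs_iff)
    then obtain n where "z = shift_by n x" using shift_orbit_eqD by blast
    then show False using z(1) x by (simp add: conn_def)
  qed
  then show ?thesis using True eq finite_orbs by (simp add: orbit_count_def)
qed

lemma nonper_shift_inj:
  assumes "z \<in> X" "z \<notin> Per" "shift_by m z = shift_by n z"
  shows "m = n"
proof (rule ccontr)
  assume "m \<noteq> n"
  have 1: "shift_by (m - n) z = z" using arg_cong[OF assms(3), of "shift_by (- n)"] by simp
  have 2: "shift_by (n - m) z = z" using arg_cong[OF assms(3), of "shift_by (- m)"] by simp
  have "m - n > 0 \<or> n - m > 0" using \<open>m \<noteq> n\<close> by linarith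
  then show False using PerI[OF assms(1) _ 1] PerI[OF assms(1) _ 2] assms(2) by blast
qed

lemma ends_exist: assumes "z \<in> X" "z \<notin> Per" shows "\<exists>p\<in>Per \<times> Per. z \<in> conn p"
proof -
  obtain x y where "x \<in> Per" "y \<in> Per" "z \<in> connecting_points X x y"
    using connecting_exists[OF assms(1)] by blast
  then have "(x, y) \<in> Per \<times> Per" "z \<in> conn (x, y)" using assms(2) by (simp_all add: conn_def)
  then show ?thesis by blast
qed

definition ends_of :: "(int \<Rightarrow> 'a) \<Rightarrow> 'a ends" where
  "ends_of z = (SOME p. p \<in> Per \<times> Per \<and> z \<in> conn p)"

lemma ends_of: assumes "z \<in> X" "z \<notin> Per" shows "ends_of z \<in> Per \<times> Per" "z \<in> conn (ends_of z)"
proof -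
  have "ends_of z \<in> Per \<times> Per \<and> z \<in> conn (ends_of z)"
    unfolding ends_of_def by (rule someI_ex) (use ends_exist[OF assms] in blast)
  then show "ends_of z \<in> Per \<times> Per" "z \<in> conn (ends_of z)" by simp_all
qed

lemma ends_of_eq: "z \<in> conn p \<Longrightarrow> p \<in> Per \<times> Per \<Longrightarrow> ends_of z = p"
  using conn_unique ends_of conn_X by blast

lemma shift_ends_Per: "p \<in> Per \<times> Per \<Longrightarrow> shift_ends n p \<in> Per \<times> Per"
  by (simp add: shift_ends_def mem_Times_iff)

lemma ends_rep_Per: "p \<in> Per \<times> Per \<Longrightarrow> ends_rep p \<in> Per \<times> Per"
  using ends_rep_ex[of p] shift_ends_Per by metis

definition rep_ends :: "(int \<Rightarrow> 'a) \<Rightarrow> 'a ends" where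
  "rep_ends z = ends_rep (ends_of z)"

lemma rep_ends:
  assumes "z \<in> X" "z \<notin> Per"
  shows "rep_ends z \<in> Per \<times> Per" "shift_orbit z \<in> orbs (rep_ends z)"
proof -
  show "rep_ends z \<in> Per \<times> Per" unfolding rep_ends_def by (rule ends_rep_Per[OF ends_of(1)[OF assms]])
  obtain n where n: "rep_ends z = shift_ends n (ends_of z)" unfolding rep_ends_def using ends_rep_ex by blast
  have "shift_by n z \<in> conn (rep_ends z)" unfolding n by (rule conn_shift[OF ends_of(2)[OF assms]])
  then have "shift_orbit (shift_by n z) \<in> orbs (rep_ends z)" unfolding orbs_def by (rule imageI)
  then show "shift_orbit z \<in> orbs (rep_ends z)" by (simp only: shift_orbit_shift)
qed

lemma rep_ends_conn:
  assumes "z \<in> conn (shift_ends n p)" "p \<in> Per \<times> Per"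
  shows "rep_ends z = ends_rep p"
  using ends_of_eq[OF assms(1) shift_ends_Per[OF assms(2)]] by (simp add: rep_ends_def ends_rep_shift)

lemma rep_ends_shift:
  assumes "z \<in> X" "z \<notin> Per"
  shows "rep_ends (shift_by n z) = rep_ends z"
  using rep_ends_conn[OF conn_shift[OF ends_of(2)[OF assms]] ends_of(1)[OF assms]]
  by (simp add: rep_ends_def)

text \<open>A marked point of the orbit. An orbit may contain several points with the same pair of
  ends, so the ends alone do not mark one; the other points of the orbit are addressed by their
  \<open>offset\<close> from it, which is unique by aperiodicity.\<close>

definition base :: "'a ends \<Rightarrow> (int \<Rightarrow> 'a) set \<Rightarrow> int \<Rightarrow> 'a" where
  "base p c = (SOME z. z \<in> conn p \<and> shift_orbit z = c)"

lemma base: assumes "c \<in> orbs p" shows "base p c \<in> conn p" "shift_orbit (base p c) = c"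
proof -
  have ex: "\<exists>z. z \<in> conn p \<and> shift_orbit z = c"
    using assms by (auto simp: orbs_iff)
  have "base p c \<in> conn p \<and> shift_orbit (base p c) = c"
    using ex unfolding base_def by (rule someI_ex)
  then show "base p c \<in> conn p" "shift_orbit (base p c) = c" by simp_all
qed

definition base_of :: "(int \<Rightarrow> 'a) \<Rightarrow> int \<Rightarrow> 'a" where
  "base_of z = base (rep_ends z) (shift_orbit z)"

definition offset :: "(int \<Rightarrow> 'a) \<Rightarrow> int" where
  "offset z = (SOME n. z = shift_by n (base_of z))"

lemma base_of:
  assumes "z \<in> X" "z \<notin> Per"
  shows "base_of z \<in> conn (rep_ends z)" "z = shift_by (offset z) (base_of z)"
proof -
  note b = base[OF rep_ends(2)[OF assms]]
  show "base_of z \<in> conn (rep_ends z)" using b(1) by (simp add: base_of_def)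
  have "shift_orbit z = shift_orbit (base_of z)" using b(2) by (simp add: base_of_def)
  then have "\<exists>n. z = shift_by n (base_of z)" by (rule shift_orbit_eqD)
  then show "z = shift_by (offset z) (base_of z)" unfolding offset_def by (rule someI_ex)
qed

lemma offset_eq:
  assumes "z \<in> X" "z \<notin> Per" "z = shift_by n (base_of z)"
  shows "offset z = n"
proof -
  have "base_of z \<in> X - Per" by (rule conn_X[OF base_of(1)[OF assms(1,2)]])
  moreover have "shift_by (offset z) (base_of z) = shift_by n (base_of z)"
    using base_of(2)[OF assms(1,2)] assms(3) by simp
  ultimately show ?thesis using nonper_shift_inj[of "base_of z" "offset z" n] by simp
qed

lemma base_of_shift:
  assumes "z \<in> X" "z \<notin> Per"
  shows "base_of (shift_by n z) = base_of z" "offset (shift_by n z) = n + offset z"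
proof -
  show b: "base_of (shift_by n z) = base_of z"
    by (simp only: base_of_def rep_ends_shift[OF assms] shift_orbit_shift)
  have "shift_by n z = shift_by n (shift_by (offset z) (base_of z))"
    by (rule arg_cong[OF base_of(2)[OF assms]])
  then have "shift_by n z = shift_by (n + offset z) (base_of (shift_by n z))"
    unfolding b by (simp only: shift_by_add)
  then show "offset (shift_by n z) = n + offset z"
    by (intro offset_eq) (use assms in simp_all)
qed

text \<open>Half windows are needed because a window of a transition point may contain the
  transition: only on one side of the centre it is then known to agree with a periodic
  point.\<close>

lemma Per_window: "\<exists>n. \<forall>m\<ge>n. \<forall>x\<in>Per. \<forall>y\<in>Per.
    (\<forall>i. 0 \<le> i \<and> i \<le> int m \<longrightarrow> x i = y i) \<or> (\<forall>i. - int m \<le> i \<and> i \<le> 0 \<longrightarrow> x i = y i) \<longrightarrow> x = y"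
proof -
  let ?R = "\<lambda>p m. (\<forall>i. 0 \<le> i \<and> i \<le> int m \<longrightarrow> fst p i = snd p i) \<or>
      (\<forall>i. - int m \<le> i \<and> i \<le> 0 \<longrightarrow> fst p i = snd p i) \<longrightarrow> fst p = snd p"
  have "\<exists>n. \<forall>p\<in>Per \<times> Per. \<forall>m\<ge>n. ?R p m"
  proof (rule uniform_bound)
    show "finite (Per \<times> Per)" using finite_Per by simp
    fix p assume p: "p \<in> Per \<times> Per"
    show "\<exists>n. \<forall>m\<ge>n. ?R p m"
    proof (cases "fst p = snd p")
      case False
      have P: "fst p \<in> Per" "snd p \<in> Per" using p by auto
      have "\<not> ((\<forall>i\<ge>0. fst p i = snd p i) \<or> (\<forall>i\<le>0. fst p i = snd p i))"
      proof
        assume H: "(\<forall>i\<ge>0. fst p i = snd p i) \<or> (\<forall>i\<le>0. fst p i = snd p i)"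
        have "fst p = snd p" by (rule periodic_points_eq[OF P H])
        with False show False by contradiction
      qed
      note ne = this[unfolded de_Morgan_disj]
      obtain i where i: "i \<ge> 0" "fst p i \<noteq> snd p i"
        using conjunct1[OF ne] unfolding not_all not_imp by (elim exE conjE)
      obtain j where j: "j \<le> 0" "fst p j \<noteq> snd p j"
        using conjunct2[OF ne] unfolding not_all not_imp by (elim exE conjE)
      note ij = i j
      have "\<not> ((\<forall>i. 0 \<le> i \<and> i \<le> int m \<longrightarrow> fst p i = snd p i) \<or>
          (\<forall>i. - int m \<le> i \<and> i \<le> 0 \<longrightarrow> fst p i = snd p i))" if "m \<ge> nat i + nat (- j)" for m
      proof -
        have "i \<le> int m" "- int m \<le> j" using that ij(1,3) by linarith+
        then show ?thesis using ij by blast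
      qed
      then show ?thesis by blast
    qed simp
  qed
  then obtain n where n: "\<forall>p\<in>Per \<times> Per. \<forall>m\<ge>n. ?R p m" ..
  show ?thesis
  proof (rule exI[of _ n], intro allI impI ballI)
    fix m x y assume "n \<le> m" "x \<in> Per" "y \<in> Per"
      "(\<forall>i. 0 \<le> i \<and> i \<le> int m \<longrightarrow> x i = y i) \<or> (\<forall>i. - int m \<le> i \<and> i \<le> 0 \<longrightarrow> x i = y i)"
    then show "x = y" using bspec[OF n, of "(x, y)"] unfolding fst_conv snd_conv mem_Times_iff by meson
  qed
qed

end

locale rank2_iso = rank2_pair A X B Y for A :: "'a set" and X and B :: "'b set" and Y +
  fixes \<phi> :: "(int \<Rightarrow> 'a) \<Rightarrow> int \<Rightarrow> 'b"
  assumes iso: "digraph_iso_map \<phi> (structure_graph X) (structure_graph Y)"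
begin

lemma bij: "bij_betw \<phi> X.Per Y.Per"
  by (rule structure_graph_iso_mapD(1)[OF iso])

lemma \<phi>_Per: "x \<in> X.Per \<Longrightarrow> \<phi> x \<in> Y.Per"
  by (rule bij_betw_apply[OF bij])

lemma \<phi>_eq: "x \<in> X.Per \<Longrightarrow> y \<in> X.Per \<Longrightarrow> \<phi> x = \<phi> y \<longleftrightarrow> x = y"
  by (rule inj_on_eq_iff[OF bij_betw_imp_inj_on[OF bij]])

lemma \<phi>_shift: "x \<in> X.Per \<Longrightarrow> \<phi> (shift_by n x) = shift_by n (\<phi> x)"
proof -
  assume x: "x \<in> X.Per"
  show ?thesis
  proof (rule equivariant_shift_by[where X = X.Per and f = \<phi>])
    show "shift_by n y \<in> X.Per" if "y \<in> X.Per" for y n using that by (rule X.Per_shift)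
    show "shift_map (\<phi> y) = \<phi> (shift_map y)" if y: "y \<in> X.Per" for y
      by (rule structure_graph_iso_mapD(2)[OF iso y, symmetric])
  qed (rule x)
qed

definition \<phi>2 :: "'a ends \<Rightarrow> 'b ends" where "\<phi>2 p = (\<phi> (fst p), \<phi> (snd p))"

lemma \<phi>2_Per: "p \<in> X.Per \<times> X.Per \<Longrightarrow> \<phi>2 p \<in> Y.Per \<times> Y.Per"
  by (simp add: \<phi>2_def mem_Times_iff \<phi>_Per)

lemma \<phi>2_eq: "p \<in> X.Per \<times> X.Per \<Longrightarrow> q \<in> X.Per \<times> X.Per \<Longrightarrow> \<phi>2 p = \<phi>2 q \<longleftrightarrow> p = q"
  unfolding \<phi>2_def prod.inject mem_Times_iff using \<phi>_eq[of "fst p" "fst q"] \<phi>_eq[of "snd p" "snd q"] prod_eq_iff[of p q]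
  by argo

lemma \<phi>2_shift: "p \<in> X.Per \<times> X.Per \<Longrightarrow> \<phi>2 (shift_ends n p) = shift_ends n (\<phi>2 p)"
  by (simp add: \<phi>2_def shift_ends_def mem_Times_iff \<phi>_shift)

lemma card_orbs: "p \<in> X.Per \<times> X.Per \<Longrightarrow> card (X.orbs p) = card (Y.orbs (\<phi>2 p))"
proof -
  assume p: "p \<in> X.Per \<times> X.Per"
  then have xy: "fst p \<in> X.Per" "snd p \<in> X.Per" by auto
  have "card (X.orbs (fst p, snd p)) + of_bool (fst p = snd p)
      = card (Y.orbs (\<phi> (fst p), \<phi> (snd p))) + of_bool (\<phi> (fst p) = \<phi> (snd p))"
    using structure_graph_iso_mapD(3)[OF iso xy] X.orbit_count_orbs[OF xy]
      Y.orbit_count_orbs[OF \<phi>_Per[OF xy(1)] \<phi>_Per[OF xy(2)]] by simp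
  then show ?thesis using \<phi>_eq[OF xy] by (simp add: \<phi>2_def)
qed

definition \<beta> :: "'a ends \<Rightarrow> (int \<Rightarrow> 'a) set \<Rightarrow> (int \<Rightarrow> 'b) set" where
  "\<beta> p = (SOME b. bij_betw b (X.orbs p) (Y.orbs (\<phi>2 p)))"

lemma \<beta>: "p \<in> X.Per \<times> X.Per \<Longrightarrow> bij_betw (\<beta> p) (X.orbs p) (Y.orbs (\<phi>2 p))"
proof -
  assume p: "p \<in> X.Per \<times> X.Per"
  have "\<exists>b. bij_betw b (X.orbs p) (Y.orbs (\<phi>2 p))"
    by (rule finite_same_card_bij[OF X.finite_orbs Y.finite_orbs card_orbs[OF p]])
  then show ?thesis unfolding \<beta>_def by (rule someI_ex)
qed

definition target :: "(int \<Rightarrow> 'a) \<Rightarrow> int \<Rightarrow> 'b" where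
  "target z = Y.base (\<phi>2 (X.rep_ends z)) (\<beta> (X.rep_ends z) (shift_orbit z))"

text \<open>An aperiodic point keeps its offset: it is as far from the base point of its orbit as
  its image is from the base point of the matched orbit. Equivariance follows, since a shift changes
  only the offset.\<close>

definition F :: "(int \<Rightarrow> 'a) \<Rightarrow> int \<Rightarrow> 'b" where
  "F z = (if z \<in> X.Per then \<phi> z else shift_by (X.offset z) (target z))"

lemma target:
  assumes "z \<in> X" "z \<notin> X.Per"
  shows "target z \<in> Y.conn (\<phi>2 (X.rep_ends z))"
    "shift_orbit (target z) = \<beta> (X.rep_ends z) (shift_orbit z)"
proof -
  have "\<beta> (X.rep_ends z) (shift_orbit z) \<in> Y.orbs (\<phi>2 (X.rep_ends z))"
    by (rule bij_betw_apply[OF \<beta>[OF X.rep_ends(1)[OF assms]] X.rep_ends(2)[OF assms]])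
  from Y.base[OF this] show "target z \<in> Y.conn (\<phi>2 (X.rep_ends z))"
    "shift_orbit (target z) = \<beta> (X.rep_ends z) (shift_orbit z)" by (simp_all add: target_def)
qed

lemma F_nonper:
  assumes "z \<in> X" "z \<notin> X.Per"
  shows "F z \<in> Y.conn (shift_ends (X.offset z) (\<phi>2 (X.rep_ends z)))" "F z \<in> Y" "F z \<notin> Y.Per"
proof -
  have "F z = shift_by (X.offset z) (target z)" using assms by (simp add: F_def)
  then show c: "F z \<in> Y.conn (shift_ends (X.offset z) (\<phi>2 (X.rep_ends z)))"
    using Y.conn_shift[OF target(1)[OF assms]] by simp
  show "F z \<in> Y" "F z \<notin> Y.Per" using Y.conn_X[OF c] by simp_all
qed

lemma F_in: "z \<in> X \<Longrightarrow> F z \<in> Y"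
  using F_nonper(2)[of z] Y.Per_in[OF \<phi>_Per[of z]] by (cases "z \<in> X.Per") (simp_all add: F_def)

lemma F_shift: "z \<in> X \<Longrightarrow> F (shift_by n z) = shift_by n (F z)"
proof (cases "z \<in> X.Per")
  case True
  then show ?thesis by (simp add: F_def \<phi>_shift)
next
  case False
  assume z: "z \<in> X"
  have "target (shift_by n z) = target z"
    by (simp only: target_def X.rep_ends_shift[OF z False] shift_orbit_shift)
  then show ?thesis using False X.base_of_shift(2)[OF z False] by (simp add: F_def)
qed

lemma F_inj: assumes "z \<in> X" "z' \<in> X" "F z = F z'" shows "z = z'"
proof (cases "z \<in> X.Per"; cases "z' \<in> X.Per")
  assume zz: "z \<in> X.Per" "z' \<in> X.Per"
  then show ?thesis using assms(3) \<phi>_eq[OF zz] by (simp add: F_def)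
next
  assume zz: "z \<in> X.Per" "z' \<notin> X.Per"
  then have "F z \<in> Y.Per" by (simp add: F_def \<phi>_Per)
  then show ?thesis using F_nonper(3)[OF assms(2) zz(2)] assms(3) by simp
next
  assume zz: "z \<notin> X.Per" "z' \<in> X.Per"
  then have "F z' \<in> Y.Per" by (simp add: F_def \<phi>_Per)
  then show ?thesis using F_nonper(3)[OF assms(1) zz(1)] assms(3) by simp
next
  assume zz: "z \<notin> X.Per" "z' \<notin> X.Per"
  note z = assms(1) zz(1) and z' = assms(2) zz(2)
  let ?p = "X.rep_ends z" and ?p' = "X.rep_ends z'"
  note P = X.rep_ends(1)[OF z] and P' = X.rep_ends(1)[OF z']
  \<comment> \<open>The common image determines its ends, hence the class of ends of both points;
    within the class, injectivity of the matching gives the orbit; within the orbit, aperiodicity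
    gives the offset.\<close>
  have "shift_ends (X.offset z) (\<phi>2 ?p) = shift_ends (X.offset z') (\<phi>2 ?p')"
    using F_nonper(1)[OF z] F_nonper(1)[OF z'] assms(3)
    by (intro Y.conn_unique[of "F z"] Y.shift_ends_Per \<phi>2_Per P P') simp_all
  then have "shift_ends (X.offset z) ?p = shift_ends (X.offset z') ?p'"
    using \<phi>2_eq[OF X.shift_ends_Per[OF P] X.shift_ends_Per[OF P']] by (simp add: \<phi>2_shift P P')
  then have "ends_rep ?p = ends_rep ?p'" by (metis ends_rep_shift)
  moreover have "ends_rep ?p = ?p" "ends_rep ?p' = ?p'"
    using ends_rep_ex[of "X.ends_of z"] ends_rep_ex[of "X.ends_of z'"]
    by (metis X.rep_ends_def ends_rep_shift)+
  ultimately have p: "?p = ?p'" by simp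
  have F: "F z = shift_by (X.offset z) (target z)" "F z' = shift_by (X.offset z') (target z')"
    using zz by (simp_all add: F_def)
  have "shift_orbit (target z) = shift_orbit (target z')"
    using arg_cong[OF assms(3), of shift_orbit] unfolding F by simp
  then have "\<beta> ?p (shift_orbit z) = \<beta> ?p (shift_orbit z')"
    using target(2)[OF z] target(2)[OF z'] p by simp
  then have o: "shift_orbit z = shift_orbit z'"
    using bij_betw_imp_inj_on[OF \<beta>[OF P]] X.rep_ends(2)[OF z] X.rep_ends(2)[OF z'] p
    by (simp add: inj_on_eq_iff)
  have t: "target z = target z'" and b: "X.base_of z = X.base_of z'"
    by (simp_all only: target_def X.base_of_def p o)
  have "target z \<in> Y" "target z \<notin> Y.Per" using Y.conn_X[OF target(1)[OF z]] by simp_all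
  moreover have "shift_by (X.offset z) (target z) = shift_by (X.offset z') (target z)"
    using assms(3) unfolding F t .
  ultimately have "X.offset z = X.offset z'" by (rule Y.nonper_shift_inj)
  then show ?thesis using X.base_of(2)[OF z] X.base_of(2)[OF z'] b by simp
qed

lemma F_surj: assumes "y \<in> Y" shows "\<exists>z\<in>X. F z = y"
proof (cases "y \<in> Y.Per")
  case True
  then have "y \<in> \<phi> ` X.Per" using bij by (simp add: bij_betw_def)
  then obtain x where "x \<in> X.Per" "y = \<phi> x" by blast
  then have "x \<in> X" "F x = y" by (simp_all add: F_def)
  then show ?thesis by blast
next
  case False
  note y = assms False
  obtain a b where ab: "Y.ends_of y = (a, b)" by fastforce
  then have "a \<in> \<phi> ` X.Per" "b \<in> \<phi> ` X.Per"
    using Y.ends_of(1)[OF y] bij by (simp_all add: bij_betw_def)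
  then obtain u v where uv: "u \<in> X.Per" "v \<in> X.Per" "a = \<phi> u" "b = \<phi> v" by blast
  have q: "(u, v) \<in> X.Per \<times> X.Per" "Y.ends_of y = \<phi>2 (u, v)" using uv ab by (simp_all add: \<phi>2_def)
  \<comment> \<open>Orbits are matched for representative pairs of ends, so \<open>y\<close> is
    first shifted until its ends form such a pair.\<close>
  obtain n where n: "ends_rep (u, v) = shift_ends n (u, v)" using ends_rep_ex by blast
  let ?p = "ends_rep (u, v)"
  have P: "?p \<in> X.Per \<times> X.Per" by (rule X.ends_rep_Per[OF q(1)])
  have "shift_by n y \<in> Y.conn (\<phi>2 ?p)"
    unfolding n \<phi>2_shift[OF q(1)] q(2)[symmetric] by (rule Y.conn_shift[OF Y.ends_of(2)[OF y]])
  then have "shift_orbit (shift_by n y) \<in> Y.orbs (\<phi>2 ?p)" unfolding Y.orbs_def by (rule imageI)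
  then have "shift_orbit y \<in> \<beta> ?p ` X.orbs ?p"
    using \<beta>[OF P] by (simp add: bij_betw_def)
  then obtain c where c: "c \<in> X.orbs ?p" "shift_orbit y = \<beta> ?p c" by blast
  let ?s = "X.base ?p c"
  note s = X.base[OF c(1)]
  have sX: "?s \<in> X" "?s \<notin> X.Per" using X.conn_X[OF s(1)] by simp_all
  have "X.rep_ends ?s = ends_rep (u, v)"
    by (rule X.rep_ends_conn[of _ n]) (use s(1) q(1) in \<open>simp_all only: n\<close>)
  then have t: "shift_orbit (target ?s) = shift_orbit y"
    using target(2)[OF sX] s(2) c(2) by simp
  then have "shift_orbit (F ?s) = shift_orbit y" using sX by (simp add: F_def)
  then obtain m where "y = shift_by m (F ?s)" using shift_orbit_eqD[OF sym] by metis
  then have "F (shift_by m ?s) = y" using F_shift[OF sX(1)] by simp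
  then show ?thesis using sX(1) by (intro bexI[of _ "shift_by m ?s"]) simp_all
qed

section \<open>Continuity of the matching map\<close>

definition bases :: "((int \<Rightarrow> 'a) \<times> (int \<Rightarrow> 'b) \<times> 'a ends) set" where
  "bases = (\<lambda>(p, c). (X.base p c, Y.base (\<phi>2 p) (\<beta> p c), p)) ` (SIGMA p:X.Per \<times> X.Per. X.orbs p)"

lemma finite_bases: "finite bases"
  unfolding bases_def
  by (rule finite_imageI, rule finite_SigmaI[OF finite_cartesian_product[OF X.finite_Per X.finite_Per] X.finite_orbs])

lemma in_bases: "z \<in> X \<Longrightarrow> z \<notin> X.Per \<Longrightarrow> (X.base_of z, target z, X.rep_ends z) \<in> bases"
proof -
  assume z: "z \<in> X" "z \<notin> X.Per"
  have "(X.rep_ends z, shift_orbit z) \<in> (SIGMA p:X.Per \<times> X.Per. X.orbs p)"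
    by (rule SigmaI, rule X.rep_ends(1)[OF z], rule X.rep_ends(2)[OF z])
  then have "(\<lambda>(p, c). (X.base p c, Y.base (\<phi>2 p) (\<beta> p c), p)) (X.rep_ends z, shift_orbit z) \<in> bases"
    unfolding bases_def by (rule imageI)
  then show ?thesis unfolding X.base_of_def target_def prod.case .
qed

lemma bases_conn:
  assumes "(s, w, p) \<in> bases"
  shows "p \<in> X.Per \<times> X.Per" "s \<in> X.conn p" "w \<in> Y.conn (\<phi>2 p)"
proof -
  obtain q where q: "q \<in> (SIGMA p:X.Per \<times> X.Per. X.orbs p)"
    "(s, w, p) = (\<lambda>(p, c). (X.base p c, Y.base (\<phi>2 p) (\<beta> p c), p)) q"
    using assms unfolding bases_def by (rule imageE)
  obtain p' c where p': "q = (p', c)" by (cases q)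
  have pp: "p' = p" using q(2) unfolding p' by simp
  have c: "p \<in> X.Per \<times> X.Per" "c \<in> X.orbs p" "s = X.base p c" "w = Y.base (\<phi>2 p) (\<beta> p c)"
    using q unfolding p' pp by simp_all
  show "p \<in> X.Per \<times> X.Per" by fact
  show "s \<in> X.conn p" unfolding c(3) by (rule X.base(1)[OF c(2)])
  show "w \<in> Y.conn (\<phi>2 p)" unfolding c(4) by (rule Y.base(1)[OF bij_betw_apply[OF \<beta>[OF c(1)] c(2)]])
qed

text \<open>Near a periodic point \<open>x\<close>, compare with a transition point \<open>z\<close>
  of offset \<open>?k\<close>. If \<open>?k\<close> is bounded by \<open>M\<close>, then
  \<open>z\<close> is one of finitely many points different from \<open>x\<close>, and a large
  window excludes it. Otherwise the origin lies beyond the transition of \<open>z\<close>, so half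
  of the window shows an end of \<open>z\<close>; by \<open>Per_window\<close> that end is
  \<open>x\<close> up to the shift by \<open>?k\<close>, and at the origin the image of
  \<open>z\<close> shows the image of this end.\<close>

lemma F_local: assumes x: "x \<in> X" shows "\<exists>m. \<forall>n\<ge>m. \<forall>y\<in>X. agree n x y \<longrightarrow> F x 0 = F y 0"
proof (cases "x \<in> X.Per")
  case False
  obtain m where m: "\<forall>y\<in>X. agree m x y \<longrightarrow> y = x" using X.isolated[OF x False] by (rule exE)
  show ?thesis
  proof (intro exI[of _ m] allI ballI impI)
    fix n y assume n: "m \<le> n" and y: "y \<in> X" and ag: "agree n x y"
    have yx: "y = x" by (rule m[rule_format, OF y agree_mono[OF ag n]])
    show "F x 0 = F y 0" unfolding yx by (rule refl)
  qed
next
  case True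
  \<comment> \<open>\<open>M\<close> is chosen such that beyond it all base points and their images
    have settled on their ends, on both sides.\<close>
  let ?T = "\<lambda>b M. \<forall>i. (i \<le> - int M \<longrightarrow> fst b i = fst (snd (snd b)) i \<and> fst (snd b) i = \<phi> (fst (snd (snd b))) i) \<and>
      (i \<ge> int M \<longrightarrow> fst b i = snd (snd (snd b)) i \<and> fst (snd b) i = \<phi> (snd (snd (snd b))) i)"
  have "\<exists>M. \<forall>b\<in>bases. \<forall>n\<ge>M. ?T b n"
  proof (rule uniform_bound[OF finite_bases])
    fix b assume "b \<in> bases"
    moreover obtain s w p where "b = (s, w, p)" by (cases b)
    ultimately have b: "b = (s, w, p)" "(s, w, p) \<in> bases" by simp_all
    obtain k :: nat where k: "\<forall>i\<le>- int k. s i = fst p i" "\<forall>i\<ge>int k. s i = snd p i"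
      using bases_conn(2)[OF b(2)] unfolding X.conn_def connecting_points_def by blast
    obtain l :: nat where l: "\<forall>i\<le>- int l. w i = \<phi> (fst p) i" "\<forall>i\<ge>int l. w i = \<phi> (snd p) i"
      using bases_conn(3)[OF b(2)] unfolding Y.conn_def connecting_points_def \<phi>2_def fst_conv snd_conv by blast
    have "?T b n" if "n \<ge> k + l" for n
    proof (intro allI conjI impI)
      fix i assume "i \<le> - int n"
      then have "i \<le> - int k" "i \<le> - int l" using that by linarith+
      then show "fst b i = fst (snd (snd b)) i" "fst (snd b) i = \<phi> (fst (snd (snd b))) i"
        using k(1) l(1) by (simp_all add: b(1))
    next
      fix i assume "i \<ge> int n"
      then have "i \<ge> int k" "i \<ge> int l" using that by linarith+
      then show "fst b i = snd (snd (snd b)) i" "fst (snd b) i = \<phi> (snd (snd (snd b))) i"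
        using k(2) l(2) by (simp_all add: b(1))
    qed
    then show "\<exists>M. \<forall>n\<ge>M. ?T b n" by blast
  qed
  then obtain M where M: "\<forall>b\<in>bases. \<forall>n\<ge>M. ?T b n" ..
  have T: "?T (s, w, p) M" if "(s, w, p) \<in> bases" for s w p using M that by blast
  obtain n0 where n0: "\<forall>m\<ge>n0. \<forall>x\<in>X.Per. \<forall>y\<in>X.Per.
    (\<forall>i. 0 \<le> i \<and> i \<le> int m \<longrightarrow> x i = y i) \<or> (\<forall>i. - int m \<le> i \<and> i \<le> 0 \<longrightarrow> x i = y i) \<longrightarrow> x = y"
    using X.Per_window by blast
  have "\<exists>m. \<forall>b\<in>bases \<times> {- int M..int M}. \<forall>n\<ge>m. \<not> agree n x (shift_by (snd b) (fst (fst b)))"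
  proof (rule uniform_bound)
    fix b assume b: "b \<in> bases \<times> {- int M..int M}"
    obtain s w p where sw1: "fst b = (s, w, p)" by (cases "fst b")
    have sw2: "(s, w, p) \<in> bases" unfolding sw1[symmetric] using b by (simp only: mem_Times_iff)
    note sw = sw1 sw2
    have "shift_by (snd b) s \<notin> X.Per" using X.conn_X[OF bases_conn(2)[OF sw(2)]] by simp
    then have "x \<noteq> shift_by (snd b) (fst (fst b))"
      unfolding sw1 fst_conv by (rule contrapos_nn) (use True in simp)
    then show "\<exists>m. \<forall>n\<ge>m. \<not> agree n x (shift_by (snd b) (fst (fst b)))" by (rule not_agree)
  qed (use finite_bases in simp)
  then obtain n1 where n1: "\<forall>b\<in>bases \<times> {- int M..int M}. \<forall>n\<ge>n1. \<not> agree n x (shift_by (snd b) (fst (fst b)))" ..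
  have "F x 0 = F z 0" if n: "n \<ge> max n0 n1" and z: "z \<in> X" and ag: "agree n x z" for n z
  proof (cases "z \<in> X.Per")
    assume zP: "z \<in> X.Per"
    have "\<forall>i. 0 \<le> i \<and> i \<le> int n \<longrightarrow> x i = z i" using ag by (simp add: agree_def)
    then have "x = z" using n0[rule_format, of n x z] n True zP by simp
    then show ?thesis by simp
  next
    assume zN: "z \<notin> X.Per"
    let ?s = "X.base_of z" and ?w = "target z" and ?p = "X.rep_ends z" and ?k = "X.offset z"
    have B: "(?s, ?w, ?p) \<in> bases" by (rule in_bases[OF z zN])
    have zs: "z i = ?s (i + ?k)" for i
      using fun_cong[OF X.base_of(2)[OF z zN], of i] by (simp only: shift_by_apply)
    have Fz: "F z 0 = ?w ?k" using zN by (simp add: F_def shift_by_apply)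
    have Fx: "F x 0 = \<phi> x 0" using True by (simp add: F_def)
    have P: "fst ?p \<in> X.Per" "snd ?p \<in> X.Per" using bases_conn(1)[OF B] by auto
    have "?k \<notin> {- int M..int M}"
    proof
      assume "?k \<in> {- int M..int M}"
      then have "((?s, ?w, ?p), ?k) \<in> bases \<times> {- int M..int M}" using B by blast
      from n1[rule_format, OF this, of n] n have "\<not> agree n x (shift_by ?k ?s)" by simp
      then show False using ag X.base_of(2)[OF z zN] by simp
    qed
    then consider "?k > int M" | "?k < - int M" by force
    then show ?thesis
    proof cases
      case 1
      have "x i = shift_by ?k (snd ?p) i" if "0 \<le> i" "i \<le> int n" for i
      proof -
        have "x i = z i" using ag that by (simp add: agree_def)
        also have "\<dots> = snd ?p (i + ?k)" using T[OF B] zs[of i] 1 that by simp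
        finally show ?thesis by (simp add: shift_by_apply)
      qed
      then have "x = shift_by ?k (snd ?p)"
        using n0[rule_format, of n x "shift_by ?k (snd ?p)"] n True P(2) by simp
      then have "\<phi> x = shift_by ?k (\<phi> (snd ?p))" using \<phi>_shift[OF P(2)] by simp
      then have "\<phi> x 0 = \<phi> (snd ?p) ?k" by (simp add: shift_by_apply)
      moreover have "?w ?k = \<phi> (snd ?p) ?k" using T[OF B] 1 by simp
      ultimately show ?thesis using Fx Fz by simp
    next
      case 2
      have "x i = shift_by ?k (fst ?p) i" if "- int n \<le> i" "i \<le> 0" for i
      proof -
        have "x i = z i" using ag that by (simp add: agree_def)
        also have "\<dots> = fst ?p (i + ?k)" using T[OF B] zs[of i] 2 that by simp
        finally show ?thesis by (simp add: shift_by_apply)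
      qed
      then have "x = shift_by ?k (fst ?p)"
        using n0[rule_format, of n x "shift_by ?k (fst ?p)"] n True P(1) by simp
      then have "\<phi> x = shift_by ?k (\<phi> (fst ?p))" using \<phi>_shift[OF P(1)] by simp
      then have "\<phi> x 0 = \<phi> (fst ?p) ?k" by (simp add: shift_by_apply)
      moreover have "?w ?k = \<phi> (fst ?p) ?k" using T[OF B] 2 by simp
      ultimately show ?thesis using Fx Fz by simp
    qed
  qed
  then show ?thesis by blast
qed

lemma conjugate: "conjugate A X B Y"
proof -
  have "block_map A X B Y F"
    by (rule block_mapI[OF X.shift_in X.X_range Y.X_range F_in F_shift F_local])
  moreover have "bij_betw F X Y"
    unfolding bij_betw_def
  proof
    show "inj_on F X" by (rule inj_onI) (rule F_inj)
    show "F ` X = Y"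
    proof (intro equalityI subsetI)
      fix y assume "y \<in> Y"
      from F_surj[OF this] show "y \<in> F ` X" by blast
    qed (use F_in in blast)
  qed
  ultimately show ?thesis unfolding conjugate_def by blast
qed

end

theorem conjugate_iff_iso:
  assumes "rank2 A X" "rank2 B Y"
  shows "conjugate A X B Y \<longleftrightarrow> (\<exists>\<phi>. digraph_iso_map \<phi> (structure_graph X) (structure_graph Y))"
proof
  assume "\<exists>\<phi>. digraph_iso_map \<phi> (structure_graph X) (structure_graph Y)"
  then obtain \<phi> where "digraph_iso_map \<phi> (structure_graph X) (structure_graph Y)" ..
  then interpret rank2_iso A X B Y \<phi>
    using assms by (simp add: rank2_iso_def rank2_pair_def rank2_iso_axioms_def)
  show "conjugate A X B Y" by (rule conjugate)
qed (rule conjugate_imp_iso[OF assms])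

section \<open>Structure graphs of countable shifts of rank at most two\<close>

text \<open>The rotation edges form a total injective function, transition labels are positive and
  unique for each pair, every vertex carries a transition loop, and rotating both ends of a
  transition preserves it. All quantifiers range over nodes and edges, so that the condition can be
  evaluated on lists.\<close>

definition structural :: "'v labeled_digraph \<Rightarrow> bool" where
  "structural G \<longleftrightarrow>
     (\<forall>u\<in>nodes G. \<exists>e\<in>edges G. fst e = u \<and> fst (snd e) = Rotation) \<and>
     (\<forall>e\<in>edges G. \<forall>e'\<in>edges G. fst (snd e) = Rotation \<and> fst (snd e') = Rotation \<longrightarrow>
        (fst e = fst e') = (snd (snd e) = snd (snd e'))) \<and>
     (\<forall>e\<in>edges G. fst (snd e) \<noteq> Transition 0) \<and>
     (\<forall>e\<in>edges G. \<forall>e'\<in>edges G. fst (snd e) \<noteq> Rotation \<and> fst (snd e') \<noteq> Rotation \<and>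
        fst e = fst e' \<and> snd (snd e) = snd (snd e') \<longrightarrow> fst (snd e) = fst (snd e')) \<and>
     (\<forall>u\<in>nodes G. \<exists>e\<in>edges G. fst e = u \<and> fst (snd e) \<noteq> Rotation \<and> snd (snd e) = u) \<and>
     (\<forall>e\<in>edges G. \<forall>r\<in>edges G. \<forall>r'\<in>edges G.
        fst (snd e) \<noteq> Rotation \<and> fst (snd r) = Rotation \<and> fst (snd r') = Rotation \<and>
        fst r = fst e \<and> fst r' = snd (snd e) \<longrightarrow> (snd (snd r), fst (snd e), snd (snd r')) \<in> edges G)"

text \<open>A loop with label 1 counts only the orbit of the periodic point itself. Any other
  transition edge of a structure graph witnesses an aperiodic connecting point.\<close>

definition nontrivial :: "'v \<times> edge_label \<times> 'v \<Rightarrow> bool" where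
  "nontrivial e \<longleftrightarrow> fst (snd e) \<noteq> Rotation \<and> (fst e \<noteq> snd (snd e) \<or> fst (snd e) \<noteq> Transition 1)"

definition one_step :: "'v labeled_digraph \<Rightarrow> bool" where
  "one_step G \<longleftrightarrow> (\<forall>e\<in>edges G. \<forall>e'\<in>edges G. nontrivial e \<and> nontrivial e' \<longrightarrow> snd (snd e) \<noteq> fst e')"

text \<open>The number \<open>c u v\<close> counts the orbits of non-periodic points, hence the correction for loops.\<close>

definition graph_data :: "'v labeled_digraph \<Rightarrow> ('v \<Rightarrow> 'v) \<Rightarrow> ('v \<Rightarrow> 'v \<Rightarrow> nat) \<Rightarrow> bool" where
  "graph_data G \<rho> c \<longleftrightarrow> bij_betw \<rho> (nodes G) (nodes G) \<and>
     (\<forall>u\<in>nodes G. \<forall>v\<in>nodes G. c (\<rho> u) (\<rho> v) = c u v \<and>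
        ((u, Rotation, v) \<in> edges G \<longleftrightarrow> v = \<rho> u) \<and>
        (\<forall>n. (u, Transition n, v) \<in> edges G \<longleftrightarrow> 0 < n \<and> n = c u v + of_bool (u = v)))"

lemma graph_dataD:
  assumes "graph_data G \<rho> c"
  shows "bij_betw \<rho> (nodes G) (nodes G)"
    and "u \<in> nodes G \<Longrightarrow> v \<in> nodes G \<Longrightarrow> c (\<rho> u) (\<rho> v) = c u v"
    and "u \<in> nodes G \<Longrightarrow> v \<in> nodes G \<Longrightarrow> (u, Rotation, v) \<in> edges G \<longleftrightarrow> v = \<rho> u"
    and "u \<in> nodes G \<Longrightarrow> v \<in> nodes G \<Longrightarrow>
      (u, Transition n, v) \<in> edges G \<longleftrightarrow> 0 < n \<and> n = c u v + of_bool (u = v)"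
  using assms unfolding graph_data_def by blast+

lemma wf_digraphD: "wf_digraph G \<Longrightarrow> e \<in> edges G \<Longrightarrow> fst e \<in> nodes G \<and> snd (snd e) \<in> nodes G"
  unfolding wf_digraph_def by auto

lemma not_Rotation: "l \<noteq> Rotation \<Longrightarrow> \<exists>n. l = Transition n"
  by (cases l) simp_all

lemma structural_if_data:
  assumes d: "graph_data G \<rho> c" and wf: "wf_digraph G"
  shows "structural G"
proof -
  note bij = graph_dataD(1)[OF d] and inv = graph_dataD(2)[OF d] and rot = graph_dataD(3)[OF d]
    and tra = graph_dataD(4)[OF d]
  have \<rho>V: "\<rho> u \<in> nodes G" if "u \<in> nodes G" for u by (rule bij_betw_apply[OF bij that])
  have \<rho>_eq: "\<rho> u = \<rho> v \<longleftrightarrow> u = v" if "u \<in> nodes G" "v \<in> nodes G" for u v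
    by (rule inj_on_eq_iff[OF bij_betw_imp_inj_on[OF bij] that])
  have R: "fst e \<in> nodes G \<and> snd (snd e) = \<rho> (fst e)" if "e \<in> edges G" "fst (snd e) = Rotation" for e
    using that rot[of "fst e" "snd (snd e)"] wf_digraphD[OF wf that(1)] by (cases e) simp
  have T: "\<exists>n. fst (snd e) = Transition n \<and> 0 < n \<and> n = c (fst e) (snd (snd e)) + of_bool (fst e = snd (snd e))"
    if e: "e \<in> edges G" "fst (snd e) \<noteq> Rotation" for e
  proof -
    obtain n where n: "fst (snd e) = Transition n" using not_Rotation[OF e(2)] by blast
    then have "(fst e, Transition n, snd (snd e)) \<in> edges G" using e(1) by (cases e) simp
    then show ?thesis using tra wf_digraphD[OF wf e(1)] n by blast
  qed
  show ?thesis
    unfolding structural_def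
  proof (intro conjI ballI impI; (elim conjE)?)
    fix u assume "u \<in> nodes G"
    then have "(u, Rotation, \<rho> u) \<in> edges G" using rot \<rho>V by blast
    then show "\<exists>e\<in>edges G. fst e = u \<and> fst (snd e) = Rotation" by (rule bexI[rotated]) simp
  next
    fix e e' assume e: "e \<in> edges G" "e' \<in> edges G" "fst (snd e) = Rotation" "fst (snd e') = Rotation"
    then show "(fst e = fst e') = (snd (snd e) = snd (snd e'))"
      using R[OF e(1,3)] R[OF e(2,4)] \<rho>_eq by simp
  next
    fix e assume e: "e \<in> edges G"
    show "fst (snd e) \<noteq> Transition 0" using T[OF e] by fastforce
  next
    fix e e' assume "e \<in> edges G" "e' \<in> edges G" "fst (snd e) \<noteq> Rotation" "fst (snd e') \<noteq> Rotation"
      "fst e = fst e'" "snd (snd e) = snd (snd e')"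
    then show "fst (snd e) = fst (snd e')" using T[of e] T[of e'] by auto
  next
    fix u assume u: "u \<in> nodes G"
    have "(u, Transition (c u u + 1), u) \<in> edges G" using tra[OF u u] by simp
    then show "\<exists>e\<in>edges G. fst e = u \<and> fst (snd e) \<noteq> Rotation \<and> snd (snd e) = u"
      by (rule bexI[rotated]) simp
  next
    fix e r r' assume e: "e \<in> edges G" "fst (snd e) \<noteq> Rotation" and r: "r \<in> edges G" "fst (snd r) = Rotation"
      and r': "r' \<in> edges G" "fst (snd r') = Rotation" and eq: "fst r = fst e" "fst r' = snd (snd e)"
    have V: "fst e \<in> nodes G" "snd (snd e) \<in> nodes G" using wf_digraphD[OF wf e(1)] by auto
    have "snd (snd r) = \<rho> (fst e)" "snd (snd r') = \<rho> (snd (snd e))" using R[OF r] R[OF r'] eq by auto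
    then show "(snd (snd r), fst (snd e), snd (snd r')) \<in> edges G"
      using T[OF e] tra[OF \<rho>V[OF V(1)] \<rho>V[OF V(2)]] inv[OF V] \<rho>_eq[OF V] by auto
  qed
qed

text \<open>The local conditions speak of rotation edges going forwards only. Finiteness makes the
  rotation a bijection on vertices and turns preservation of transitions into an
  equivalence.\<close>

lemma data_if_structural:
  assumes st: "structural G" and wf: "wf_digraph G" and fin: "finite (nodes G)"
  shows "\<exists>\<rho> c. graph_data G \<rho> c"
proof -
  let ?V = "nodes G" and ?E = "edges G"
  note s1 = st[unfolded structural_def]
  note s2 = conjunct2[OF s1] note s3 = conjunct2[OF s2] note s4 = conjunct2[OF s3]
  note s5 = conjunct2[OF s4] note s6 = conjunct2[OF s5]
  have R1: "\<exists>v. (u, Rotation, v) \<in> ?E" if u: "u \<in> ?V" for u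
  proof -
    obtain e where "e \<in> ?E" "fst e = u" "fst (snd e) = Rotation" using bspec[OF conjunct1[OF s1] u] by blast
    then have "(u, Rotation, snd (snd e)) \<in> ?E" by (cases e) simp
    then show ?thesis ..
  qed
  have R2: "u = u' \<longleftrightarrow> v = v'" if "(u, Rotation, v) \<in> ?E" "(u', Rotation, v') \<in> ?E" for u v u' v'
    using bspec[OF bspec[OF conjunct1[OF s2] that(1)] that(2)] by simp
  have T1: "n > 0" if "(u, Transition n, v) \<in> ?E" for u n v
    using bspec[OF conjunct1[OF s3] that] by simp
  have T2: "m = n" if "(u, Transition m, v) \<in> ?E" "(u, Transition n, v) \<in> ?E" for u m n v
    using bspec[OF bspec[OF conjunct1[OF s4] that(1)] that(2)] by simp
  have T3: "\<exists>n. (u, Transition n, u) \<in> ?E" if u: "u \<in> ?V" for u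
  proof -
    obtain e where e: "e \<in> ?E" "fst e = u" "fst (snd e) \<noteq> Rotation" "snd (snd e) = u"
      using bspec[OF conjunct1[OF s5] u] by blast
    obtain n where "fst (snd e) = Transition n" using not_Rotation[OF e(3)] by blast
    then have "(u, Transition n, u) \<in> ?E" using e(1,2,4) by (cases e) simp
    then show ?thesis ..
  qed
  have T4: "(u', Transition n, v') \<in> ?E"
    if "(u, Transition n, v) \<in> ?E" "(u, Rotation, u') \<in> ?E" "(v, Rotation, v') \<in> ?E" for u n v u' v'
    using bspec[OF bspec[OF bspec[OF s6 that(1)] that(2)] that(3)] by simp
  have E_V: "u \<in> ?V \<and> v \<in> ?V" if "(u, l, v) \<in> ?E" for u l v
    using wf_digraphD[OF wf that] by simp
  define \<rho> where "\<rho> u = (SOME v. (u, Rotation, v) \<in> ?E)" for u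
  have \<rho>E: "(u, Rotation, \<rho> u) \<in> ?E" if "u \<in> ?V" for u
    unfolding \<rho>_def by (rule someI_ex[OF R1[OF that]])
  have rot: "(u, Rotation, v) \<in> ?E \<longleftrightarrow> v = \<rho> u" if u: "u \<in> ?V" for u v
    using \<rho>E[OF u] R2[OF _ \<rho>E[OF u], of u v] by blast
  have \<rho>V: "\<rho> u \<in> ?V" if "u \<in> ?V" for u using E_V[OF \<rho>E[OF that]] by simp
  have \<rho>_eq: "\<rho> u = \<rho> v \<longleftrightarrow> u = v" if "u \<in> ?V" "v \<in> ?V" for u v
    using R2[OF \<rho>E[OF that(1)] \<rho>E[OF that(2)]] by simp
  have inj: "inj_on \<rho> ?V" by (rule inj_onI) (simp only: \<rho>_eq)
  have bij: "bij_betw \<rho> ?V ?V"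
    unfolding bij_betw_def using inj endo_inj_surj[OF fin image_subsetI[OF \<rho>V] inj] by simp
  have shift: "(\<rho> u, Transition n, \<rho> v) \<in> ?E \<longleftrightarrow> (u, Transition n, v) \<in> ?E" if uv: "u \<in> ?V" "v \<in> ?V" for u n v
  proof
    assume "(u, Transition n, v) \<in> ?E"
    then show "(\<rho> u, Transition n, \<rho> v) \<in> ?E" by (rule T4[OF _ \<rho>E[OF uv(1)] \<rho>E[OF uv(2)]])
  next
    assume e: "(\<rho> u, Transition n, \<rho> v) \<in> ?E"
    \<comment> \<open>The rotation maps the finite set of pairs joined with label \<open>n\<close>
      injectively into itself, hence onto itself; so a transition can also be rotated back.\<close>
    let ?D = "{p \<in> ?V \<times> ?V. (fst p, Transition n, snd p) \<in> ?E}" and ?f = "\<lambda>p. (\<rho> (fst p), \<rho> (snd p))"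
    have "finite ?D" using fin by simp
    moreover have "?f ` ?D \<subseteq> ?D"
    proof (rule image_subsetI)
      fix p assume p: "p \<in> ?D"
      then have V: "fst p \<in> ?V" "snd p \<in> ?V" by auto
      have "(fst p, Transition n, snd p) \<in> ?E" using p by simp
      then have "(\<rho> (fst p), Transition n, \<rho> (snd p)) \<in> ?E" by (rule T4[OF _ \<rho>E[OF V(1)] \<rho>E[OF V(2)]])
      then show "?f p \<in> ?D" using \<rho>V V by simp
    qed
    moreover have "inj_on ?f ?D"
    proof (rule inj_onI)
      fix p q assume "p \<in> ?D" "q \<in> ?D" "?f p = ?f q"
      then have V: "fst p \<in> ?V" "snd p \<in> ?V" "fst q \<in> ?V" "snd q \<in> ?V" "\<rho> (fst p) = \<rho> (fst q)" "\<rho> (snd p) = \<rho> (snd q)"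
        by auto
      have "fst p = fst q" using V(5) \<rho>_eq[OF V(1,3)] by simp
      moreover have "snd p = snd q" using V(6) \<rho>_eq[OF V(2,4)] by simp
      ultimately show "p = q" by (rule prod_eqI)
    qed
    ultimately have "?f ` ?D = ?D" by (rule endo_inj_surj)
    moreover have "(\<rho> u, \<rho> v) \<in> ?D" using e \<rho>V uv by simp
    ultimately obtain p where p: "p \<in> ?D" "(\<rho> u, \<rho> v) = ?f p" by blast
    then have V: "fst p \<in> ?V" "snd p \<in> ?V" by auto
    have "u = fst p" "v = snd p" using p(2) \<rho>_eq[OF uv(1) V(1)] \<rho>_eq[OF uv(2) V(2)] by simp_all
    then show "(u, Transition n, v) \<in> ?E" using p(1) by simp
  qed
  define lab where "lab u v = (if \<exists>n. (u, Transition n, v) \<in> ?E then SOME n. (u, Transition n, v) \<in> ?E else 0)" for u v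
  have lab: "(u, Transition n, v) \<in> ?E \<longleftrightarrow> 0 < n \<and> n = lab u v" for u n v
  proof
    assume e: "(u, Transition n, v) \<in> ?E"
    then have "(u, Transition (SOME n. (u, Transition n, v) \<in> ?E), v) \<in> ?E" by (rule someI)
    moreover have "lab u v = (SOME n. (u, Transition n, v) \<in> ?E)" unfolding lab_def using e by auto
    ultimately have "(u, Transition (lab u v), v) \<in> ?E" by simp
    from T2[OF e this] T1[OF e] show "0 < n \<and> n = lab u v" by simp
  next
    assume n: "0 < n \<and> n = lab u v"
    then have ex: "\<exists>n. (u, Transition n, v) \<in> ?E" unfolding lab_def by presburger
    then have "(u, Transition (SOME n. (u, Transition n, v) \<in> ?E), v) \<in> ?E" by (rule someI_ex)
    then show "(u, Transition n, v) \<in> ?E" using ex n by (simp add: lab_def)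
  qed
  have lab_shift: "lab (\<rho> u) (\<rho> v) = lab u v" if uv: "u \<in> ?V" "v \<in> ?V" for u v
  proof -
    have "0 < n \<and> n = lab (\<rho> u) (\<rho> v) \<longleftrightarrow> 0 < n \<and> n = lab u v" for n
      using shift[OF uv, of n] unfolding lab .
    from this[of "lab u v"] this[of "lab (\<rho> u) (\<rho> v)"] show ?thesis by linarith
  qed
  have lab_loop: "0 < lab u u" if "u \<in> ?V" for u using T3[OF that] unfolding lab by auto
  \<comment> \<open>The truncated subtraction is exact, because labels of loops are positive by
    \<open>lab_loop\<close>.\<close>
  have "graph_data G \<rho> (\<lambda>u v. lab u v - of_bool (u = v))"
    unfolding graph_data_def
  proof (intro conjI ballI allI)
    fix u v assume uv: "u \<in> ?V" "v \<in> ?V"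
    show "lab (\<rho> u) (\<rho> v) - of_bool (\<rho> u = \<rho> v) = lab u v - of_bool (u = v)"
      using lab_shift[OF uv] \<rho>_eq[OF uv] by simp
    show "(u, Rotation, v) \<in> ?E \<longleftrightarrow> v = \<rho> u" by (rule rot[OF uv(1)])
    show "(u, Transition n, v) \<in> ?E \<longleftrightarrow> 0 < n \<and> n = lab u v - of_bool (u = v) + of_bool (u = v)" for n
      unfolding lab using lab_loop[OF uv(1)] by (cases "u = v") simp_all
  qed (rule bij)
  then show ?thesis by blast
qed

lemma graph_data_iso:
  assumes iso: "digraph_iso_map \<phi> G H" and d: "graph_data H \<rho> c"
  shows "graph_data G (\<lambda>u. inv_into (nodes G) \<phi> (\<rho> (\<phi> u))) (\<lambda>u v. c (\<phi> u) (\<phi> v))"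
proof -
  let ?\<psi> = "inv_into (nodes G) \<phi>"
  have bij: "bij_betw \<phi> (nodes G) (nodes H)" using iso by (simp add: digraph_iso_map_def)
  have e: "(u, l, v) \<in> edges G \<longleftrightarrow> (\<phi> u, l, \<phi> v) \<in> edges H" if "u \<in> nodes G" "v \<in> nodes G" for u l v
    using iso that unfolding digraph_iso_map_def by blast
  have \<phi>V: "\<phi> u \<in> nodes H" if "u \<in> nodes G" for u by (rule bij_betw_apply[OF bij that])
  have \<phi>\<psi>: "\<phi> (?\<psi> w) = w" if "w \<in> nodes H" for w by (rule bij_betw_inv_into_right[OF bij that])
  have \<phi>_eq: "\<phi> u = \<phi> v \<longleftrightarrow> u = v" if "u \<in> nodes G" "v \<in> nodes G" for u v
    by (rule inj_on_eq_iff[OF bij_betw_imp_inj_on[OF bij] that])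
  have \<rho>V: "\<rho> w \<in> nodes H" if "w \<in> nodes H" for w by (rule bij_betw_apply[OF graph_dataD(1)[OF d] that])
  have "bij_betw (?\<psi> \<circ> (\<rho> \<circ> \<phi>)) (nodes G) (nodes G)"
    by (rule bij_betw_trans[OF bij_betw_trans[OF bij graph_dataD(1)[OF d]] bij_betw_inv_into[OF bij]])
  then have b: "bij_betw (\<lambda>u. ?\<psi> (\<rho> (\<phi> u))) (nodes G) (nodes G)" by (simp add: comp_def)
  show ?thesis
    unfolding graph_data_def
  proof (intro conjI ballI allI)
    fix u v assume uv: "u \<in> nodes G" "v \<in> nodes G"
    note uv' = \<phi>V[OF uv(1)] \<phi>V[OF uv(2)]
    show "c (\<phi> (?\<psi> (\<rho> (\<phi> u)))) (\<phi> (?\<psi> (\<rho> (\<phi> v)))) = c (\<phi> u) (\<phi> v)"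
      unfolding \<phi>\<psi>[OF \<rho>V[OF uv'(1)]] \<phi>\<psi>[OF \<rho>V[OF uv'(2)]] by (rule graph_dataD(2)[OF d uv'])
    have "v = ?\<psi> (\<rho> (\<phi> u)) \<longleftrightarrow> \<phi> v = \<rho> (\<phi> u)"
      using \<phi>_eq[OF uv(2) bij_betw_apply[OF b uv(1)]] \<phi>\<psi>[OF \<rho>V[OF uv'(1)]] by simp
    then show "(u, Rotation, v) \<in> edges G \<longleftrightarrow> v = ?\<psi> (\<rho> (\<phi> u))"
      unfolding e[OF uv] graph_dataD(3)[OF d uv'] by simp
    show "(u, Transition n, v) \<in> edges G \<longleftrightarrow> 0 < n \<and> n = c (\<phi> u) (\<phi> v) + of_bool (u = v)" for n
      unfolding e[OF uv] graph_dataD(4)[OF d uv'] \<phi>_eq[OF uv] by (rule refl)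
  qed (rule b)
qed

text \<open>Nontrivial edges are exactly the edges between pairs with a positive count of aperiodic
  orbits: for a loop the label exceeds this count by one, and it is different from 1 exactly if the
  count is positive.\<close>

lemma one_step_iff:
  assumes d: "graph_data G \<rho> c" and wf: "wf_digraph G"
  shows "one_step G \<longleftrightarrow> (\<forall>u\<in>nodes G. \<forall>v\<in>nodes G. \<forall>w\<in>nodes G. \<not> (0 < c u v \<and> 0 < c v w))"
proof -
  note tra = graph_dataD(4)[OF d]
  have pos: "0 < c (fst e) (snd (snd e))" if e: "e \<in> edges G" "nontrivial e" for e
  proof -
    obtain n where n: "fst (snd e) = Transition n" using not_Rotation e(2) unfolding nontrivial_def by blast
    then have "(fst e, Transition n, snd (snd e)) \<in> edges G" using e(1) by (cases e) simp
    then have "0 < n \<and> n = c (fst e) (snd (snd e)) + of_bool (fst e = snd (snd e))"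
      using tra wf_digraphD[OF wf e(1)] by blast
    then show ?thesis using e(2) n by (cases "fst e = snd (snd e)") (simp_all add: nontrivial_def)
  qed
  have ex: "(u, Transition (c u v + of_bool (u = v)), v) \<in> edges G \<and>
      nontrivial (u, Transition (c u v + of_bool (u = v)), v)"
    if "u \<in> nodes G" "v \<in> nodes G" "0 < c u v" for u v
    using tra[OF that(1,2)] that(3) by (cases "u = v") (simp_all add: nontrivial_def)
  show ?thesis
  proof
    assume o: "one_step G"
    show "\<forall>u\<in>nodes G. \<forall>v\<in>nodes G. \<forall>w\<in>nodes G. \<not> (0 < c u v \<and> 0 < c v w)"
    proof (intro ballI notI)
      fix u v w assume V: "u \<in> nodes G" "v \<in> nodes G" "w \<in> nodes G" and c: "0 < c u v \<and> 0 < c v w"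
      note 1 = ex[OF V(1,2) conjunct1[OF c]] and 2 = ex[OF V(2,3) conjunct2[OF c]]
      from bspec[OF bspec[OF o[unfolded one_step_def] conjunct1[OF 1]] conjunct1[OF 2]] 1 2 show False by simp
    qed
  next
    assume c: "\<forall>u\<in>nodes G. \<forall>v\<in>nodes G. \<forall>w\<in>nodes G. \<not> (0 < c u v \<and> 0 < c v w)"
    show "one_step G"
      unfolding one_step_def
    proof (intro ballI impI notI; elim conjE)
      fix e e' assume e: "e \<in> edges G" "e' \<in> edges G" "nontrivial e" "nontrivial e'" "snd (snd e) = fst e'"
      have "0 < c (fst e) (fst e')" using pos[OF e(1,3)] e(5) by simp
      moreover have "0 < c (fst e') (snd (snd e'))" by (rule pos[OF e(2,4)])
      ultimately show False using c wf_digraphD[OF wf e(1)] wf_digraphD[OF wf e(2)] by blast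
    qed
  qed
qed

context rank2 begin

lemma orbs_shift: "orbs (shift_ends n p) = orbs p"
proof -
  have sub: "orbs q \<subseteq> orbs (shift_ends m q)" for m q
  proof
    fix c assume "c \<in> orbs q"
    then obtain z where z: "z \<in> conn q" "c = shift_orbit z" unfolding orbs_iff by blast
    have "c = shift_orbit (shift_by m z)" using z(2) by simp
    then show "c \<in> orbs (shift_ends m q)" unfolding orbs_iff using conn_shift[OF z(1)] by blast
  qed
  have "orbs (shift_ends n p) \<subseteq> orbs (shift_ends (- n) (shift_ends n p))" by (rule sub)
  then show ?thesis using sub[of p n] by simp
qed

lemma graph_data_structure_graph: "graph_data (structure_graph X) shift_map (\<lambda>x y. card (orbs (x, y)))"
  unfolding graph_data_def nodes_structure_graph
proof (intro conjI ballI allI)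
  show "bij_betw shift_map Per Per"
  proof (rule bij_betw_byWitness[where f' = "shift_by (- 1)"])
    show "shift_map ` Per \<subseteq> Per" "shift_by (- 1) ` Per \<subseteq> Per" using Per_shift by blast+
  qed simp_all
  fix x y assume xy: "x \<in> Per" "y \<in> Per"
  show "card (orbs (shift_map x, shift_map y)) = card (orbs (x, y))"
    using orbs_shift[of 1 "(x, y)"] by (simp add: shift_ends_def)
  show "(x, Rotation, y) \<in> edges (structure_graph X) \<longleftrightarrow> y = shift_map x"
    using xy by (simp add: rotation_edge)
  show "(x, Transition n, y) \<in> edges (structure_graph X) \<longleftrightarrow> 0 < n \<and> n = card (orbs (x, y)) + of_bool (x = y)" for n
    unfolding transition_edge orbit_count_orbs[OF xy] using xy by simp
qed

end

lemma occurs_in_shift: "occurs_in w (shift_by n x) \<longleftrightarrow> occurs_in w x"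
proof
  assume "occurs_in w (shift_by n x)"
  then obtain i where "\<forall>j<length w. x (i + int j + n) = w ! j" unfolding occurs_in_def shift_by_apply by blast
  then show "occurs_in w x" unfolding occurs_in_def by (intro exI[of _ "i + n"]) (simp add: algebra_simps)
next
  assume "occurs_in w x"
  then obtain i where "\<forall>j<length w. x (i + int j) = w ! j" unfolding occurs_in_def by blast
  then show "occurs_in w (shift_by n x)" unfolding occurs_in_def shift_by_apply
    by (intro exI[of _ "i - n"]) (simp add: algebra_simps)
qed

text \<open>If a point \<open>z\<close> leads to \<open>y\<close> and \<open>z'\<close> leads away from \<open>y\<close>, then in a shift of finite type the point
  that first follows \<open>z\<close>, stays close to \<open>y\<close> for a long time and then follows \<open>z'\<close> is a point near \<open>z\<close>.\<close>

lemma (in rank2) sft_one_step: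
  assumes F: "finite F" "X = avoiding A F" and V: "x \<in> Per" "y \<in> Per" "w \<in> Per"
  shows "\<not> (conn (x, y) \<noteq> {} \<and> conn (y, w) \<noteq> {})"
proof
  assume "conn (x, y) \<noteq> {} \<and> conn (y, w) \<noteq> {}"
  then obtain z z' where z: "z \<in> conn (x, y)" and z': "z' \<in> conn (y, w)" by blast
  obtain k :: nat where k: "\<forall>i\<ge>int k. z i = y i"
    using z unfolding conn_def connecting_points_def fst_conv snd_conv by blast
  obtain k' :: nat where k': "\<forall>i\<le>- int k'. z' i = y i"
    using z' unfolding conn_def connecting_points_def fst_conv snd_conv by blast
  have zX: "z \<in> X" "z \<notin> Per" "z' \<in> X" "z' \<notin> Per" using conn_X[OF z] conn_X[OF z'] by simp_all
  obtain n where n: "\<forall>u\<in>X. agree n z u \<longrightarrow> u = z" using isolated[OF zX(1,2)] by (rule exE)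
  obtain p where p: "p > 0" "shift_by p y = y" using PerE[OF V(2)] by blast
  define L where "L = Max (insert 0 (length ` F))"
  have L: "length v \<le> L" if "v \<in> F" for v unfolding L_def by (rule Max_ge) (use F(1) that in simp_all)
  \<comment> \<open>A multiple of the period of \<open>y\<close>, so that \<open>z'\<close> shifted
    by \<open>c\<close> continues the \<open>y\<close>-stretch of \<open>z\<close> in phase. Its
    size leaves room for the tails of both points, for the window that isolates \<open>z\<close> and
    for the longest forbidden word.\<close>
  define c where "c = int (k + k' + n + L + 1) * p"
  have "int (k + k' + n + L + 1) * 1 \<le> c" unfolding c_def by (rule mult_left_mono) (use p(1) in simp_all)
  then have c: "c \<ge> int k + int k' + int n + int L + 1" by simp
  have yc: "shift_by c y = y" unfolding c_def by (rule periodic_shift_int[OF p(2)])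
  have yc': "y (i - c) = y i" for i
    using fun_cong[OF yc, of "i - c"] by (simp add: shift_by_apply)
  define g where "g i = (if i \<le> c - int k' then z i else z' (i - c))" for i
  have g1: "g i = z i" if "i \<le> c - int k'" for i using that by (simp add: g_def)
  \<comment> \<open>Between \<open>k\<close> and \<open>c - k'\<close> both pieces follow
    \<open>y\<close>, so \<open>g\<close> can be read as either of them there.\<close>
  have g2: "g i = z' (i - c)" if i: "i \<ge> int k" for i
  proof (cases "i \<le> c - int k'")
    case True
    then have "z' (i - c) = y (i - c)" using k'[rule_format, of "i - c"] by simp
    also have "\<dots> = y i" by (rule yc')
    also have "\<dots> = z i" by (rule k[rule_format, OF i, symmetric])
    finally show ?thesis using True by (simp add: g_def)
  qed (simp add: g_def)
  have "g \<in> X"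
    unfolding F(2) avoiding_def mem_Collect_eq
  proof (intro conjI ballI notI)
    have "range z \<subseteq> A" "range z' \<subseteq> A" using X_range zX by blast+
    then show "range g \<subseteq> A" unfolding g_def by (simp add: image_subset_iff)
    fix v assume v: "v \<in> F" and "occurs_in v g"
    then obtain i where i: "\<forall>j<length v. g (i + int j) = v ! j" unfolding occurs_in_def by blast
    have no: "\<not> occurs_in v z" "\<not> occurs_in v z'" using zX(1,3) v unfolding F(2) avoiding_def by blast+
    show False
    \<comment> \<open>The overlap of the two pieces is longer than every forbidden word, so an
      occurrence of such a word lies entirely in one of them.\<close>
    proof (cases "i + int L \<le> c - int k'")
      case True
      have "z (i + int j) = v ! j" if j: "j < length v" for j
        using i[rule_format, OF j] g1[of "i + int j"] L[OF v] True j by simp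
      then have "occurs_in v z" unfolding occurs_in_def by blast
      then show False using no(1) by contradiction
    next
      case False
      have "z' (i - c + int j) = v ! j" if j: "j < length v" for j
      proof -
        have "g (i + int j) = z' (i + int j - c)" by (rule g2) (use False c in linarith)
        then show ?thesis using i[rule_format, OF j] by (simp add: algebra_simps)
      qed
      then have "occurs_in v z'" unfolding occurs_in_def by blast
      then show False using no(2) by contradiction
    qed
  qed
  moreover have "agree n z g" unfolding agree_def
  proof (intro allI impI)
    fix i assume "\<bar>i\<bar> \<le> int n"
    then have "i \<le> c - int k'" using c by linarith
    then show "z i = g i" by (rule g1[symmetric])
  qed
  \<comment> \<open>Since \<open>z\<close> is isolated, the glued point is \<open>z\<close> itself.
    Then it still follows \<open>y\<close> where it should show the transition of \<open>z'\<close>,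
    so \<open>z'\<close> is periodic.\<close>
  ultimately have gz: "g = z" using n[rule_format] by simp
  have "z' i = y i" for i
  proof (cases "i \<le> - int k'")
    case False
    then have ge: "i + c \<ge> int k" using c by linarith
    have "z' i = g (i + c)" using g2[OF ge] by simp
    also have "\<dots> = y (i + c)" unfolding gz by (rule k[rule_format, OF ge])
    also have "\<dots> = y i" using yc'[of "i + c"] by simp
    finally show ?thesis .
  qed (rule k'[rule_format])
  then have "z' = y" by (rule ext)
  then show False using zX(4) V(2) by simp
qed

lemma rank2_one_step:
  assumes r: "rank2 A X" and "shift_of_finite_type A X"
  shows "one_step (structure_graph X)"
proof -
  interpret rank2 A X by (rule r)
  obtain F where F: "finite F" "X = avoiding A F" using assms(2) unfolding shift_of_finite_type_def by blast
  have pos: "0 < card (orbs p) \<longleftrightarrow> conn p \<noteq> {}" for p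
    unfolding card_gt_0_iff using finite_orbs[of p] by (simp add: orbs_def)
  show ?thesis
    unfolding one_step_iff[OF graph_data_structure_graph wf_structure_graph] nodes_structure_graph
  proof (intro ballI notI)
    fix x y w assume V: "x \<in> Per" "y \<in> Per" "w \<in> Per"
      and "0 < card (orbs (x, y)) \<and> 0 < card (orbs (y, w))"
    then have "conn (x, y) \<noteq> {} \<and> conn (y, w) \<noteq> {}" by (simp add: pos)
    with sft_one_step[OF F V] show False by contradiction
  qed
qed

section \<open>Realising structure graphs\<close>

lemma avoiding_shift: assumes "x \<in> avoiding A F" shows "shift_by n x \<in> avoiding A F"
proof -
  have "range x \<subseteq> A" "\<forall>w\<in>F. \<not> occurs_in w x" using assms unfolding avoiding_def by blast+
  then show ?thesis unfolding avoiding_def mem_Collect_eq occurs_in_shift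
    by (simp add: shift_by_apply image_subset_iff)
qed

lemma avoiding_shift_space: assumes "finite A" shows "shift_space A (avoiding A F)"
proof -
  let ?S = "avoiding A F"
  have "openin (full_shift A) ({x. range x \<subseteq> A} - ?S)"
    unfolding openin_full_shift
  proof (intro conjI ballI)
    fix x assume x: "x \<in> {x. range x \<subseteq> A} - ?S"
    then obtain w where w: "w \<in> F" "occurs_in w x" unfolding avoiding_def by blast
    obtain i where i: "\<forall>j<length w. x (i + int j) = w ! j" using w(2) unfolding occurs_in_def by blast
    show "\<exists>n. \<forall>y. range y \<subseteq> A \<longrightarrow> agree n x y \<longrightarrow> y \<in> {x. range x \<subseteq> A} - ?S"
    proof (intro exI[of _ "nat \<bar>i\<bar> + length w"] allI impI)
      fix y assume y: "range y \<subseteq> A" and ag: "agree (nat \<bar>i\<bar> + length w) x y"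
      have "y (i + int j) = w ! j" if j: "j < length w" for j
      proof -
        have "\<bar>i + int j\<bar> \<le> int (nat \<bar>i\<bar> + length w)" using j by simp
        then have "x (i + int j) = y (i + int j)" using ag unfolding agree_def by blast
        then show ?thesis using i[rule_format, OF j] by simp
      qed
      then have "occurs_in w y" unfolding occurs_in_def by blast
      then show "y \<in> {x. range x \<subseteq> A} - ?S" using y w(1) unfolding avoiding_def by blast
    qed
  qed blast
  moreover have "?S \<subseteq> topspace (full_shift A)" unfolding topspace_full_shift avoiding_def by blast
  ultimately have "closedin (full_shift A) ?S" unfolding closedin_def topspace_full_shift by simp
  moreover have "shift_map ` ?S = ?S"
  proof (intro equalityI subsetI)
    fix x assume x: "x \<in> ?S"
    have "x = shift_map (shift_by (- 1) x)" by simp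
    then show "x \<in> shift_map ` ?S" using avoiding_shift[OF x] by (rule image_eqI)
  qed (use avoiding_shift in blast)
  ultimately show ?thesis using assms by (simp add: shift_space_def)
qed

lemma cb_derivative_finite:
  assumes "finite S" "S \<subseteq> {x. range x \<subseteq> A}"
  shows "cb_derivative (full_shift A) S = {}"
proof -
  have False if x: "x \<in> S" "x \<in> full_shift A derived_set_of S" for x
  proof -
    have "\<exists>m. \<forall>y\<in>S. \<forall>n\<ge>m. y \<noteq> x \<longrightarrow> \<not> agree n x y"
    proof (rule uniform_bound[OF assms(1)])
      fix y show "\<exists>m. \<forall>n\<ge>m. y \<noteq> x \<longrightarrow> \<not> agree n x y"
        by (cases "y = x") (simp, use not_agree[of x y] in \<open>simp only: not_sym simp_thms\<close>)
    qed
    then show False using x(2) unfolding derived_set_full_shift[OF assms(2)] by blast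
  qed
  then show ?thesis unfolding cb_derivative_def by blast
qed

lemma cb_rank_le_2:
  assumes S: "S \<subseteq> {x. range x \<subseteq> A}" and fin: "finite (cb_derivative (full_shift A) S)"
  shows "cb_rank (full_shift A) S \<le> 2"
proof -
  let ?D = "cb_derivative (full_shift A)"
  have "?D S \<subseteq> S" unfolding cb_derivative_def by blast
  then have 2: "?D (?D S) = {}" using S by (intro cb_derivative_finite fin) blast
  moreover have "?D {} = {}" unfolding cb_derivative_def by blast
  ultimately have "2 \<in> {k. (?D ^^ k) S = (?D ^^ Suc k) S}" by (simp add: numeral_2_eq_2)
  then have "(INF k \<in> {k. (?D ^^ k) S = (?D ^^ Suc k) S}. enat k) \<le> enat 2" by (rule INF_lower)
  then show ?thesis unfolding cb_rank_def by (simp only: numeral_eq_enat)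
qed

text \<open>The states of an automaton may be of any countable type; \<open>to_nat\<close> turns
  them into the natural numbers that \<open>regular_language\<close> asks for.\<close>

lemma regular_languageI:
  fixes s0 :: "'s::countable"
  assumes "finite S" "s0 \<in> S" "\<And>s a. s \<in> S \<Longrightarrow> a \<in> A \<Longrightarrow> \<delta> s a \<in> S"
  shows "regular_language A {w \<in> lists A. P (foldl \<delta> s0 w)}"
proof -
  let ?Q = "to_nat ` S" and ?\<delta> = "\<lambda>q a. to_nat (\<delta> (from_nat q) a)"
  let ?Acc = "to_nat ` {s \<in> S. P s}"
  have run: "foldl ?\<delta> (to_nat s) w = to_nat (foldl \<delta> s w)" for s w
    by (induction w arbitrary: s) simp_all
  have in_S: "foldl \<delta> s w \<in> S" if "w \<in> lists A" "s \<in> S" for s w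
    using that by (induction w arbitrary: s) (simp_all add: assms(3))
  have acc: "to_nat s \<in> ?Acc \<longleftrightarrow> s \<in> S \<and> P s" for s by (auto simp: image_iff)
  have eq: "{w \<in> lists A. P (foldl \<delta> s0 w)} = {w \<in> lists A. foldl ?\<delta> (to_nat s0) w \<in> ?Acc}"
    unfolding run acc using in_S[OF _ assms(2)] by blast
  have step: "?\<delta> q a \<in> ?Q" if "q \<in> ?Q" "a \<in> A" for q a
    using that assms(3) by (elim imageE) simp
  show ?thesis unfolding regular_language_def
    by (rule exI[of _ ?Q], rule exI[of _ "to_nat s0"], rule exI[of _ ?\<delta>], rule exI[of _ ?Acc],
        intro conjI ballI, rule finite_imageI[OF assms(1)], rule imageI[OF assms(2)], rule image_mono, blast,
        erule step, assumption, rule eq)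
qed

text \<open>Alphabets consist of natural numbers. The option separates two kinds of letters: one
  letter for each vertex, which spells the periodic points, and the letters \<open>tsym\<close> that
  mark transitions.\<close>

definition psym :: "nat \<Rightarrow> nat" where
  "psym v = to_nat (None :: (nat \<times> nat \<times> nat) option, v)"

definition tsym :: "nat \<Rightarrow> nat \<Rightarrow> nat \<Rightarrow> nat" where
  "tsym j u v = to_nat (Some (j, u, v), 0 :: nat)"

lemma psym_simps [simp]: "psym u = psym v \<longleftrightarrow> u = v" "psym v \<noteq> tsym j u w" "tsym j u w \<noteq> psym v"
  "tsym j u v = tsym j' u' v' \<longleftrightarrow> j = j' \<and> u = u' \<and> v = v'"
  by (simp_all add: psym_def tsym_def)

text \<open>\<open>rot\<close> is the action of the integers generated by the rotation, so that also
  negative positions can be spelled; \<open>P\<close> is a common period of all vertices.\<close>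

locale realisation =
  fixes V :: "nat set" and rot :: "int \<Rightarrow> nat \<Rightarrow> nat" and c :: "nat \<Rightarrow> nat \<Rightarrow> nat" and P :: int
  assumes fin: "finite V" and rotV: "v \<in> V \<Longrightarrow> rot n v \<in> V" and rot0: "v \<in> V \<Longrightarrow> rot 0 v = v"
    and rot_rot: "v \<in> V \<Longrightarrow> rot m (rot n v) = rot (m + n) v" and P: "P > 0"
    and rotP: "v \<in> V \<Longrightarrow> rot P v = v"
    and c_rot: "u \<in> V \<Longrightarrow> v \<in> V \<Longrightarrow> c (rot n u) (rot n v) = c u v"
begin

definition rep :: "nat \<times> nat \<Rightarrow> nat \<times> nat" where
  "rep p = (SOME q. \<exists>n. q = (rot n (fst p), rot n (snd p)))"

lemma rep_ex: "\<exists>n. rep p = (rot n (fst p), rot n (snd p))"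
  unfolding rep_def by (rule someI_ex) blast

lemma rep_rot: assumes "u \<in> V" "v \<in> V" shows "rep (rot n u, rot n v) = rep (u, v)"
proof -
  have "(\<exists>m. q = (rot m (rot n u), rot m (rot n v))) \<longleftrightarrow> (\<exists>m. q = (rot m u, rot m v))" for q
  proof
    assume "\<exists>m. q = (rot m u, rot m v)"
    then obtain m where "q = (rot m u, rot m v)" ..
    then have "q = (rot (m - n) (rot n u), rot (m - n) (rot n v))" using assms by (simp add: rot_rot)
    then show "\<exists>m. q = (rot m (rot n u), rot m (rot n v))" ..
  qed (use assms in \<open>auto simp: rot_rot\<close>)
  then show ?thesis unfolding rep_def fst_conv snd_conv by (simp only:)
qed

text \<open>Only one pair of each rotation class receives transition letters. A shift of a
  transition point connects the rotated ends, so letters for all pairs of a class would count its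
  orbits several times.\<close>

definition T :: "nat \<Rightarrow> nat \<Rightarrow> nat \<Rightarrow> bool" where
  "T j u v \<longleftrightarrow> u \<in> V \<and> v \<in> V \<and> rep (u, v) = (u, v) \<and> j < c u v"

definition per :: "nat \<Rightarrow> int \<Rightarrow> nat" where "per v i = psym (rot i v)"

definition trans_pt :: "nat \<Rightarrow> nat \<Rightarrow> nat \<Rightarrow> int \<Rightarrow> nat" where
  "trans_pt j u v i = (if i = 0 then tsym j u v else psym (rot i (if i < 0 then u else v)))"

definition Ts :: "nat set" where "Ts = {tsym j u v | j u v. T j u v}"

definition alph :: "nat set" where "alph = psym ` V \<union> Ts"

definition pts :: "(int \<Rightarrow> nat) set" where
  "pts = per ` V \<union> {shift_by n (trans_pt j u v) | n j u v. T j u v}"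

text \<open>These are the words of length two in points of \<open>pts\<close>. A transition letter
  replaces the letter at its position and does not delay the phases, which is why the neighbours are
  obtained from \<open>u\<close> and \<open>v\<close> by rotations by -1 and 1.\<close>

definition E2 :: "nat \<Rightarrow> nat \<Rightarrow> bool" where
  "E2 a b \<longleftrightarrow> (\<exists>v\<in>V. a = psym v \<and> b = psym (rot 1 v)) \<or>
     (\<exists>j u v. T j u v \<and> a = psym (rot (- 1) u) \<and> b = tsym j u v) \<or>
     (\<exists>j u v. T j u v \<and> a = tsym j u v \<and> b = psym (rot 1 v))"

lemma TD: "T j u v \<Longrightarrow> u \<in> V" "T j u v \<Longrightarrow> v \<in> V" "T j u v \<Longrightarrow> j < c u v" "T j u v \<Longrightarrow> rep (u, v) = (u, v)"
  by (simp_all add: T_def)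

lemma Ts_simps [simp]: "tsym j u v \<in> Ts \<longleftrightarrow> T j u v" "psym v \<notin> Ts"
  unfolding Ts_def by auto

lemma TsE: assumes "a \<in> Ts" obtains j u v where "a = tsym j u v" "T j u v"
  using assms unfolding Ts_def by blast

lemma finite_alph: "finite alph"
proof -
  have "Ts \<subseteq> (\<lambda>(p, j). tsym j (fst p) (snd p)) ` (SIGMA p:V \<times> V. {..<c (fst p) (snd p)})"
  proof
    fix a assume "a \<in> Ts"
    then obtain j u v where a: "a = tsym j u v" "T j u v" by (rule TsE)
    show "a \<in> (\<lambda>(p, j). tsym j (fst p) (snd p)) ` (SIGMA p:V \<times> V. {..<c (fst p) (snd p)})"
      by (rule image_eqI[of _ _ "((u, v), j)"]) (use a TD[OF a(2)] in simp_all)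
  qed
  then have "finite Ts" by (rule finite_subset) (use fin in simp)
  then show ?thesis using fin by (simp add: alph_def)
qed

section \<open>Local rules of the realising shift\<close>

lemma E2_sym: assumes "E2 (psym v) b" "b \<notin> Ts" "v \<in> V" shows "b = psym (rot 1 v)"
  using assms(1,2) unfolding E2_def by auto

lemma E2_tsym: assumes "E2 (tsym j u v) b" shows "b = psym (rot 1 v)"
  using assms unfolding E2_def by auto

lemma E2_sym_rev: assumes "E2 a (psym w)" "a \<notin> Ts" "w \<in> V" shows "a = psym (rot (- 1) w)"
proof -
  obtain v where v: "v \<in> V" "a = psym v" "w = rot 1 v" using assms(1,2) unfolding E2_def by auto
  show ?thesis unfolding v(2,3) by (simp add: rot_rot rot0 v(1))
qed

lemma E2_tsym_rev: assumes "E2 a (tsym j u v)" shows "a = psym (rot (- 1) u)"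
  using assms unfolding E2_def by auto

text \<open>The last clause, at most one transition letter, is the only one that is not a condition
  on words of bounded length. It is regular, and \<open>finite_type\<close> derives it from
  \<open>E2\<close> if transitions cannot be composed.\<close>

definition valid :: "(int \<Rightarrow> nat) \<Rightarrow> bool" where
  "valid x \<longleftrightarrow> range x \<subseteq> alph \<and> (\<forall>i. E2 (x i) (x (i + 1))) \<and> (\<forall>i j. x i \<in> Ts \<and> x j \<in> Ts \<longrightarrow> i = j)"

lemma validI:
  assumes "range x \<subseteq> alph" "\<And>i. E2 (x i) (x (i + 1))" "\<And>i j. x i \<in> Ts \<Longrightarrow> x j \<in> Ts \<Longrightarrow> i = j"
  shows "valid x"
  unfolding valid_def by (intro conjI allI impI assms) (elim conjE; assumption)+

lemma validD:
  assumes "valid x"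
  shows "range x \<subseteq> alph" "E2 (x i) (x (i + 1))" "x i \<in> Ts \<Longrightarrow> x j \<in> Ts \<Longrightarrow> i = j"
proof -
  note v = assms[unfolded valid_def]
  show "range x \<subseteq> alph" by (rule conjunct1[OF v])
  show "E2 (x i) (x (i + 1))" by (rule spec[OF conjunct1[OF conjunct2[OF v]]])
  show "x i \<in> Ts \<Longrightarrow> x j \<in> Ts \<Longrightarrow> i = j" by (rule conjunct2[OF conjunct2[OF v], rule_format]) (rule conjI)
qed

lemma forward:
  assumes E: "\<And>i. E2 (x i) (x (i + 1))" and v: "v \<in> V" "x a = psym v" and no: "\<And>i. i > a \<Longrightarrow> x i \<notin> Ts"
  shows "x (a + int k) = psym (rot (int k) v)"
proof (induction k)
  case (Suc k)
  have "E2 (psym (rot (int k) v)) (x (a + int k + 1))" using E[of "a + int k"] unfolding Suc .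
  then have "x (a + int k + 1) = psym (rot 1 (rot (int k) v))"
    by (rule E2_sym) (use no[of "a + int k + 1"] rotV[OF v(1)] in simp_all)
  then show ?case by (simp add: rot_rot v(1) algebra_simps)
qed (simp add: v rot0)

lemma backward:
  assumes E: "\<And>i. E2 (x i) (x (i + 1))" and v: "v \<in> V" "x a = psym v" and no: "\<And>i. i < a \<Longrightarrow> x i \<notin> Ts"
  shows "x (a - int k) = psym (rot (- int k) v)"
proof (induction k)
  case (Suc k)
  have "E2 (x (a - int k - 1)) (psym (rot (- int k) v))" using E[of "a - int k - 1"] unfolding Suc[symmetric] by simp
  then have "x (a - int k - 1) = psym (rot (- 1) (rot (- int k) v))"
    by (rule E2_sym_rev) (use no[of "a - int k - 1"] rotV[OF v(1)] in simp_all)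
  then show ?case by (simp add: rot_rot v(1) algebra_simps)
qed (simp add: v rot0)

lemma trans_pt_Ts: "trans_pt j u v i \<in> Ts \<longleftrightarrow> i = 0 \<and> T j u v"
  by (simp add: trans_pt_def)

lemma trans_pt_eq_tsym: "trans_pt j u v i = tsym j' u' v' \<longleftrightarrow> i = 0 \<and> j = j' \<and> u = u' \<and> v = v'"
  by (simp add: trans_pt_def)

lemma valid_pts: assumes "x \<in> pts" shows "valid x"
  using assms unfolding pts_def
proof (elim UnE)
  assume "x \<in> per ` V"
  then obtain v where v: "x = per v" "v \<in> V" by (rule imageE)
  have "E2 (per v i) (per v (i + 1))" for i
    unfolding E2_def per_def
    by (intro disjI1 bexI[of _ "rot i v"]) (simp_all add: rot_rot rotV v(2) add.commute)
  then show "valid x" unfolding v(1)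
    by (intro validI) (simp_all add: per_def alph_def image_subset_iff rotV v(2))
next
  assume "x \<in> {shift_by n (trans_pt j u v) | n j u v. T j u v}"
  then obtain n j u v where x: "x = shift_by n (trans_pt j u v)" and t: "T j u v" by blast
  have E: "E2 (trans_pt j u v i) (trans_pt j u v (i + 1))" for i
  proof -
    consider "i < - 1" | "i = - 1" | "i = 0" | "i > 0" by linarith
    then show ?thesis
    proof cases
      case 1
      then show ?thesis unfolding E2_def trans_pt_def
        by (intro disjI1 bexI[of _ "rot i u"]) (simp_all add: rot_rot rotV TD[OF t] add.commute)
    next
      case 2
      show ?thesis unfolding E2_def
        by (rule disjI2, rule disjI1, rule exI[of _ j], rule exI[of _ u], rule exI[of _ v]) (simp add: t trans_pt_def 2)
    next
      case 3
      show ?thesis unfolding E2_def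
        by (rule disjI2, rule disjI2, rule exI[of _ j], rule exI[of _ u], rule exI[of _ v]) (simp add: t trans_pt_def 3)
    next
      case 4
      then show ?thesis unfolding E2_def trans_pt_def
        by (intro disjI1 bexI[of _ "rot i v"]) (simp_all add: rot_rot rotV TD[OF t] add.commute)
    qed
  qed
  have "trans_pt j u v i \<in> alph" for i using t TD[OF t] rotV by (simp add: trans_pt_def alph_def)
  moreover have "E2 (trans_pt j u v (i + n)) (trans_pt j u v (i + 1 + n))" for i
    using E[of "i + n"] by (simp add: algebra_simps)
  moreover have "i = i'" if "trans_pt j u v (i + n) \<in> Ts" "trans_pt j u v (i' + n) \<in> Ts" for i i'
    using that unfolding trans_pt_Ts by linarith
  ultimately show "valid x" unfolding x
    by (intro validI) (simp_all only: shift_by_apply image_subset_iff simp_thms ball_simps)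
qed

text \<open>\<open>E2\<close> is deterministic in both directions away from transition letters. So
  the letter at 0, or the only transition letter, determines the whole point.\<close>

lemma pts_valid: assumes "valid x" shows "x \<in> pts"
proof -
  have ran: "x i \<in> alph" for i using validD(1)[OF assms] by blast
  note E = validD(2)[OF assms] and one = validD(3)[OF assms]
  show ?thesis
  proof (cases "\<exists>a. x a \<in> Ts")
    case False
    then have no: "x i \<notin> Ts" for i by blast
    obtain v where v: "v \<in> V" "x 0 = psym v" using ran[of 0] no[of 0] unfolding alph_def by blast
    have "x i = per v i" for i
    proof (cases i rule: int_cases2)
      case (nonneg k)
      then show ?thesis using forward[where x = x and a = 0 and v = v and k = k, OF E v no] by (simp add: per_def)
    next
      case (nonpos k)
      then show ?thesis using backward[where x = x and a = 0 and v = v and k = k, OF E v no] by (simp add: per_def)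
    qed
    then have "x = per v" by (rule ext)
    then show ?thesis using v(1) unfolding pts_def by blast
  next
    case True
    then obtain a where a: "x a \<in> Ts" ..
    then obtain j u v where t: "x a = tsym j u v" "T j u v" by (rule TsE)
    note uv = TD(1,2)[OF t(2)]
    have no: "x i \<notin> Ts" if "i \<noteq> a" for i using one[OF a, of i] that by blast
    have r: "x (a + 1) = psym (rot 1 v)" by (rule E2_tsym) (use E[of a] in \<open>simp only: t(1)\<close>)
    have l: "x (a - 1) = psym (rot (- 1) u)" by (rule E2_tsym_rev) (use E[of "a - 1"] in \<open>simp add: t(1)\<close>)
    have "x i = shift_by (- a) (trans_pt j u v) i" for i
    proof -
      consider "i < a" | "i = a" | "i > a" by linarith
      then show ?thesis
      proof cases
        case 1
        have "x (a - 1 - int (nat (a - 1 - i))) = psym (rot (- int (nat (a - 1 - i))) (rot (- 1) u))"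
          by (rule backward[where x = x and a = "a - 1" and v = "rot (- 1) u"], rule E, rule rotV[OF uv(1)], rule l, rule no, simp)
        then show ?thesis using 1 by (simp add: shift_by_apply trans_pt_def rot_rot uv(1))
      next
        case 2
        then show ?thesis by (simp add: shift_by_apply trans_pt_def t(1))
      next
        case 3
        have "x (a + 1 + int (nat (i - a - 1))) = psym (rot (int (nat (i - a - 1))) (rot 1 v))"
          by (rule forward[where x = x and a = "a + 1" and v = "rot 1 v"], rule E, rule rotV[OF uv(2)], rule r, rule no, simp)
        then show ?thesis using 3 by (simp add: shift_by_apply trans_pt_def rot_rot uv(2))
      qed
    qed
    then have "x = shift_by (- a) (trans_pt j u v)" by (rule ext)
    then show ?thesis using t(2) unfolding pts_def by blast
  qed
qed

definition good :: "nat list \<Rightarrow> bool" where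
  "good w \<longleftrightarrow> successively E2 w \<and> length (filter (\<lambda>a. a \<in> Ts) w) \<le> Suc 0"

lemma good_iff: "good w \<longleftrightarrow> (\<forall>k. Suc k < length w \<longrightarrow> E2 (w ! k) (w ! Suc k)) \<and>
    (\<forall>k<length w. \<forall>l<length w. w ! k \<in> Ts \<and> w ! l \<in> Ts \<longrightarrow> k = l)"
proof -
  let ?S = "{k. k < length w \<and> w ! k \<in> Ts}"
  have fin: "finite ?S" by simp
  have "(\<forall>k\<in>?S. \<forall>l\<in>?S. k = l) \<longleftrightarrow> (\<forall>k<length w. \<forall>l<length w. w ! k \<in> Ts \<and> w ! l \<in> Ts \<longrightarrow> k = l)"
    (is "?L \<longleftrightarrow> ?R")
  proof
    assume L: ?L
    show ?R
    proof (intro allI impI)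
      fix k l assume "k < length w" "l < length w" "w ! k \<in> Ts \<and> w ! l \<in> Ts"
      then show "k = l" using bspec[OF bspec[OF L, of k], of l] by simp
    qed
  next
    assume R: ?R
    show ?L
    proof (intro ballI)
      fix k l assume "k \<in> ?S" "l \<in> ?S"
      then show "k = l" using R[rule_format, of k l] by simp
    qed
  qed
  then show ?thesis
    unfolding good_def successively_conv_nth length_filter_conv_card card_le_Suc0_iff_eq[OF fin] by (rule arg_cong)
qed

text \<open>A repeated transition letter is detected by the word between its two positions. Its
  length is unbounded, so this description uses infinitely many forbidden words in general.\<close>

lemma pts_avoiding: "pts = avoiding alph {w \<in> lists alph. \<not> good w}"
proof (intro equalityI subsetI)
  fix x assume "x \<in> pts"
  then have v: "valid x" by (rule valid_pts)
  have "good w" if h: "occurs_in w x" for w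
  proof -
    obtain i where i: "\<forall>j<length w. x (i + int j) = w ! j" using h unfolding occurs_in_def by blast
    show ?thesis unfolding good_iff
    proof (intro conjI allI impI)
      fix k assume k: "Suc k < length w"
      have "E2 (x (i + int k)) (x (i + int k + 1))" by (rule validD(2)[OF v])
      then show "E2 (w ! k) (w ! Suc k)"
        using i[rule_format, of k] i[rule_format, of "Suc k"] k by (simp add: algebra_simps)
    next
      fix k l assume kl: "k < length w" "l < length w" "w ! k \<in> Ts \<and> w ! l \<in> Ts"
      then have "x (i + int k) \<in> Ts" "x (i + int l) \<in> Ts" using i by simp_all
      then have "i + int k = i + int l" by (rule validD(3)[OF v])
      then show "k = l" by simp
    qed
  qed
  then show "x \<in> avoiding alph {w \<in> lists alph. \<not> good w}"
    using validD(1)[OF v] unfolding avoiding_def by blast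
next
  fix x assume x: "x \<in> avoiding alph {w \<in> lists alph. \<not> good w}"
  then have ran: "range x \<subseteq> alph" unfolding avoiding_def by blast
  have good: "good (map (\<lambda>j. x (i + int j)) [0..<n])" (is "good ?w") for i n
  proof (rule ccontr)
    assume "\<not> good ?w"
    moreover have "?w \<in> lists alph" unfolding in_lists_conv_set using ran by auto
    moreover have "occurs_in ?w x" unfolding occurs_in_def by (rule exI[of _ i]) simp
    ultimately show False using x unfolding avoiding_def by blast
  qed
  have le: "i = j" if "x i \<in> Ts" "x j \<in> Ts" "i \<le> j" for i j
  proof -
    let ?n = "nat (j - i)"
    have "\<forall>k<Suc ?n. \<forall>l<Suc ?n. x (i + int k) \<in> Ts \<and> x (i + int l) \<in> Ts \<longrightarrow> k = l"
      using good[of i "Suc ?n"] unfolding good_iff by (simp del: upt_Suc)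
    from this[rule_format, of 0 ?n] have "0 = ?n" using that by simp
    then show ?thesis using that(3) by simp
  qed
  have "E2 (x i) (x (i + 1))" for i
    using good[of i 2] unfolding good_iff by (simp add: numeral_2_eq_2)
  moreover have "i = j" if h: "x i \<in> Ts" "x j \<in> Ts" for i j
  proof (cases "i \<le> j")
    case False
    then show ?thesis using le[OF h(2,1)] by simp
  qed (rule le[OF h])
  ultimately have "valid x" by (intro validI ran)
  then show "x \<in> pts" by (rule pts_valid)
qed

text \<open>The automaton remembers whether the word read so far is good, its last letter and whether it
  contains a transition symbol.\<close>

definition \<delta> :: "bool \<times> nat option \<times> bool \<Rightarrow> nat \<Rightarrow> bool \<times> nat option \<times> bool" where
  "\<delta> s a = (fst s \<and> (case fst (snd s) of None \<Rightarrow> True | Some b \<Rightarrow> E2 b a) \<and> \<not> (snd (snd s) \<and> a \<in> Ts),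
     Some a, snd (snd s) \<or> a \<in> Ts)"

lemma run_\<delta>: "foldl \<delta> (True, None, False) w = (good w, if w = [] then None else Some (last w), \<exists>a\<in>set w. a \<in> Ts)"
proof (induction w rule: rev_induct)
  case (snoc a w)
  have "length (filter (\<lambda>a. a \<in> Ts) w) = 0 \<longleftrightarrow> \<not> (\<exists>b\<in>set w. b \<in> Ts)"
    unfolding length_0_conv filter_empty_conv by blast
  then have "good (w @ [a]) \<longleftrightarrow> good w \<and> (w = [] \<or> E2 (last w) a) \<and> \<not> ((\<exists>b\<in>set w. b \<in> Ts) \<and> a \<in> Ts)"
    unfolding good_def successively_append_iff by auto
  then show ?case unfolding foldl_append snoc by (simp add: \<delta>_def) blast
qed (simp add: good_def)

lemma sofic: "sofic_shift alph pts"
proof -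
  have "regular_language alph {w \<in> lists alph. \<not> fst (foldl \<delta> (True, None, False) w)}"
  proof (rule regular_languageI[where S = "UNIV \<times> insert None (Some ` alph) \<times> UNIV"])
    show "finite ((UNIV :: bool set) \<times> insert None (Some ` alph) \<times> (UNIV :: bool set))"
      using finite_alph by simp
  qed (simp_all add: \<delta>_def)
  then have "regular_language alph {w \<in> lists alph. \<not> good w}" unfolding run_\<delta> fst_conv .
  moreover have "shift_space alph pts" unfolding pts_avoiding by (rule avoiding_shift_space[OF finite_alph])
  ultimately show ?thesis unfolding sofic_shift_def using pts_avoiding by blast
qed

text \<open>Forbidding the two-letter words outside \<open>E2\<close> suffices here: behind a
  transition letter the phases follow the target \<open>v\<close>, so a second transition letter
  would have a rotation of \<open>v\<close> as its source, and the two transitions could be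
  composed.\<close>

lemma finite_type:
  assumes os: "\<And>u v w. u \<in> V \<Longrightarrow> v \<in> V \<Longrightarrow> w \<in> V \<Longrightarrow> \<not> (0 < c u v \<and> 0 < c v w)"
  shows "shift_of_finite_type alph pts"
proof -
  let ?F = "(\<lambda>p. [fst p, snd p]) ` {p \<in> alph \<times> alph. \<not> E2 (fst p) (snd p)}"
  have right: "x (a + 1 + int k) = psym (rot (1 + int k) v)"
    if E: "\<And>i. E2 (x i) (x (i + 1))" and t: "x a = tsym j u v" "T j u v" for x a j u v k
  proof (induction k)
    case 0
    have "x (a + 1) = psym (rot 1 v)" by (rule E2_tsym) (use E[of a] in \<open>simp only: t(1)\<close>)
    then show ?case by simp
  next
    case (Suc k)
    note uv = TD(1,2)[OF t(2)]
    have e: "E2 (psym (rot (1 + int k) v)) (x (a + 1 + int k + 1))" using E[of "a + 1 + int k"] unfolding Suc .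
    have "x (a + 1 + int k + 1) \<notin> Ts"
    proof
      assume "x (a + 1 + int k + 1) \<in> Ts"
      then obtain j' u' v' where t': "x (a + 1 + int k + 1) = tsym j' u' v'" "T j' u' v'" by (rule TsE)
      have "rot (1 + int k) v = rot (- 1) u'" using E2_tsym_rev[OF e[unfolded t'(1)]] by simp
      then have "rot 1 (rot (1 + int k) v) = rot 1 (rot (- 1) u')" by (rule arg_cong)
      then have u': "u' = rot (2 + int k) v" using uv(2) TD(1)[OF t'(2)] by (simp add: rot_rot rot0)
      \<comment> \<open>Rotated by this amount, the first transition ends at \<open>u'\<close>,
        where the second one begins.\<close>
      have "c (rot (2 + int k) u) u' = c u v" unfolding u' by (rule c_rot[OF uv])
      moreover have "0 < c u v" "0 < c u' v'" using TD(3)[OF t(2)] TD(3)[OF t'(2)] by simp_all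
      ultimately show False using os[OF rotV[OF uv(1)] TD(1,2)[OF t'(2)], of "2 + int k"] by simp
    qed
    from E2_sym[OF e this rotV[OF uv(2)]] show ?case by (simp add: rot_rot uv(2) algebra_simps)
  qed
  have "pts = avoiding alph ?F"
  proof (intro equalityI subsetI)
    fix x assume "x \<in> pts"
    then have v: "valid x" by (rule valid_pts)
    have "\<not> occurs_in w x" if w: "w \<in> ?F" for w
    proof
      assume "occurs_in w x"
      then obtain i where i: "\<forall>j<length w. x (i + int j) = w ! j" unfolding occurs_in_def by blast
      obtain p where p: "w = [fst p, snd p]" "\<not> E2 (fst p) (snd p)" using w by blast
      have "x i = fst p" "x (i + 1) = snd p"
        using i[rule_format, of 0] i[rule_format, of 1] by (simp_all add: p(1))
      moreover have "E2 (x i) (x (i + 1))" by (rule validD(2)[OF v])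
      ultimately show False using p(2) by simp
    qed
    then show "x \<in> avoiding alph ?F" using validD(1)[OF v] unfolding avoiding_def mem_Collect_eq by blast
  next
    fix x assume x: "x \<in> avoiding alph ?F"
    then have ran: "range x \<subseteq> alph" and no: "\<And>w. w \<in> ?F \<Longrightarrow> \<not> occurs_in w x" unfolding avoiding_def by blast+
    have E: "E2 (x i) (x (i + 1))" for i
    proof (rule ccontr)
      assume "\<not> E2 (x i) (x (i + 1))"
      then have F: "[x i, x (i + 1)] \<in> ?F"
        using ran by (intro image_eqI[of _ _ "(x i, x (i + 1))"]) (simp_all add: image_subset_iff)
      have "occurs_in [x i, x (i + 1)] x"
        unfolding occurs_in_def by (rule exI[of _ i]) (simp add: less_Suc_eq numeral_2_eq_2)
      with no[OF F] show False by contradiction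
    qed
    have less: False if h: "x i \<in> Ts" "x i' \<in> Ts" "i < i'" for i i'
    proof -
      obtain j u v where t: "x i = tsym j u v" "T j u v" using h(1) by (rule TsE)
      have "x (i + 1 + int (nat (i' - i - 1))) \<notin> Ts" unfolding right[OF E t] by simp
      then show False using h(2,3) by simp
    qed
    have "i = i'" if h: "x i \<in> Ts" "x i' \<in> Ts" for i i'
    proof (rule ccontr)
      assume "i \<noteq> i'"
      then have "i < i' \<or> i' < i" by linarith
      then show False using less[OF h] less[OF h(2,1)] by blast
    qed
    with ran E have "valid x" by (rule validI)
    then show "x \<in> pts" by (rule pts_valid)
  qed
  note eq = this
  have "shift_space alph pts" unfolding eq by (rule avoiding_shift_space[OF finite_alph])
  moreover have "finite ?F"
    by (rule finite_imageI, rule finite_subset[OF _ finite_cartesian_product[OF finite_alph finite_alph]]) blast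
  moreover have "?F \<subseteq> lists alph" by auto
  ultimately show ?thesis unfolding shift_of_finite_type_def using eq by blast
qed

section \<open>Rank and structure graph of the realisation\<close>

lemma trans_pt_pts: "T j u v \<Longrightarrow> shift_by n (trans_pt j u v) \<in> pts"
  unfolding pts_def by blast

lemma per_pts: "v \<in> V \<Longrightarrow> per v \<in> pts"
  unfolding pts_def by blast

lemma ptsE:
  assumes "x \<in> pts"
  obtains v where "v \<in> V" "x = per v" | n j u v where "T j u v" "x = shift_by n (trans_pt j u v)"
  using assms unfolding pts_def by blast

text \<open>A transition letter together with its position determines the point, so transition
  points are isolated.\<close>

lemma trans_pt_isolated:
  assumes y: "y \<in> pts" and t: "T j u v" and eq: "y (- n) = tsym j u v"
  shows "y = shift_by n (trans_pt j u v)"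
  using y
proof (rule ptsE)
  fix w assume "y = per w"
  then show ?thesis using eq by (simp add: per_def)
next
  fix m j' u' v' assume y': "y = shift_by m (trans_pt j' u' v')"
  have "m - n = 0 \<and> j' = j \<and> u' = u \<and> v' = v"
    using eq unfolding y' shift_by_apply trans_pt_eq_tsym by linarith
  then show ?thesis unfolding y' by simp
qed

text \<open>Transition points are isolated, so the derivative lies in the finite set of periodic
  points, and the second derivative is empty.\<close>

lemma rank2: "rank2 alph pts"
proof
  show ss: "shift_space alph pts" using sofic by (simp add: sofic_shift_def)
  have "pts \<subseteq> per ` V \<union> (\<lambda>(n, j, u, v). shift_by n (trans_pt j u v)) ` UNIV"
  proof
    fix x assume "x \<in> pts"
    then show "x \<in> per ` V \<union> (\<lambda>(n, j, u, v). shift_by n (trans_pt j u v)) ` UNIV"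
    proof (rule ptsE)
      fix n j u v assume "x = shift_by n (trans_pt j u v)"
      then show ?thesis by (intro UnI2 image_eqI[of _ _ "(n, j, u, v)"]) simp_all
    qed blast
  qed
  then show "countable pts" by (rule countable_subset) (use fin in \<open>simp add: countable_finite\<close>)
  have ran: "pts \<subseteq> {x. range x \<subseteq> alph}" using validD(1)[OF valid_pts] by blast
  have "cb_derivative (full_shift alph) pts \<subseteq> per ` V"
  proof
    fix x assume x: "x \<in> cb_derivative (full_shift alph) pts"
    then have "x \<in> pts" "x \<in> full_shift alph derived_set_of pts" unfolding cb_derivative_def by blast+
    note D = this(2)[unfolded derived_set_full_shift[OF ran]]
    from \<open>x \<in> pts\<close> show "x \<in> per ` V"
    proof (rule ptsE)
      fix n j u v assume t: "T j u v" and x': "x = shift_by n (trans_pt j u v)"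
      obtain y where y: "y \<in> pts" "y \<noteq> x" "agree (nat \<bar>n\<bar>) x y" using D by blast
      have "x (- n) = y (- n)" using y(3) unfolding agree_def by simp
      then have "y (- n) = tsym j u v" unfolding x' by (simp add: shift_by_apply trans_pt_def)
      from trans_pt_isolated[OF y(1) t this] have False using y(2) x' by simp
      then show ?thesis ..
    qed blast
  qed
  then have "finite (cb_derivative (full_shift alph) pts)" by (rule finite_subset) (use fin in simp)
  then show "cb_rank (full_shift alph) pts \<le> 2" by (rule cb_rank_le_2[OF ran])
qed

lemma shift_per: "v \<in> V \<Longrightarrow> shift_by n (per v) = per (rot n v)"
  by (simp add: fun_eq_iff shift_by_apply per_def rot_rot)

lemma per_eq: "u \<in> V \<Longrightarrow> v \<in> V \<Longrightarrow> per u = per v \<longleftrightarrow> u = v"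
proof
  assume uv: "u \<in> V" "v \<in> V" "per u = per v"
  from fun_cong[OF uv(3), of 0] show "u = v" by (simp add: per_def rot0 uv(1,2))
qed simp

lemma periodic_pts: "periodic_points pts = per ` V"
proof (intro equalityI subsetI)
  fix x assume "x \<in> periodic_points pts"
  then obtain p where p: "x \<in> pts" "p > 0" "shift_by p x = x" unfolding periodic_points_def by blast
  from p(1) show "x \<in> per ` V"
  proof (rule ptsE)
    fix n j u v assume x: "x = shift_by n (trans_pt j u v)"
    have "x (p - n) = x (- n)" using fun_cong[OF p(3), of "- n"] by (simp add: shift_by_apply algebra_simps)
    then have "trans_pt j u v p = tsym j u v" unfolding x by (simp add: shift_by_apply) (simp add: trans_pt_def)
    then have False unfolding trans_pt_eq_tsym using p(2) by simp
    then show ?thesis ..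
  qed blast
next
  fix x assume "x \<in> per ` V"
  then obtain v where v: "x = per v" "v \<in> V" by (rule imageE)
  have "shift_by P x = x" unfolding v(1) shift_per[OF v(2)] rotP[OF v(2)] ..
  then show "x \<in> periodic_points pts" unfolding periodic_points_def using P per_pts[OF v(2)] v(1) by blast
qed

sublocale R: rank2 alph pts by (rule rank2)

lemma trans_pt_conn: assumes t: "T j u v" shows "shift_by n (trans_pt j u v) \<in> R.conn (per (rot n u), per (rot n v))"
proof -
  note uv = TD(1,2)[OF t]
  have "trans_pt j u v \<in> pts" using trans_pt_pts[OF t, of 0] by simp
  moreover have "trans_pt j u v \<notin> periodic_points pts"
  proof
    assume "trans_pt j u v \<in> periodic_points pts"
    then obtain w where "trans_pt j u v = per w" unfolding periodic_pts by blast
    from fun_cong[OF this, of 0] show False by (simp add: trans_pt_def per_def)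
  qed
  moreover have "(\<forall>i\<le>- int 1. trans_pt j u v i = per u i) \<and> (\<forall>i\<ge>int 1. trans_pt j u v i = per v i)"
    by (simp add: trans_pt_def per_def)
  ultimately have "trans_pt j u v \<in> R.conn (per u, per v)"
    unfolding R.conn_def connecting_points_def fst_conv snd_conv by blast
  from R.conn_shift[OF this, of n] show ?thesis
    by (simp only: shift_ends_def fst_conv snd_conv shift_per[OF uv(1)] shift_per[OF uv(2)])
qed

text \<open>All connecting orbits of a pair are orbits of the transition points whose letters belong
  to the representative of the pair. There are \<open>c u v\<close> such letters, and different
  letters give different orbits because an orbit contains only one of them.\<close>

lemma card_orbs_per: assumes uv: "u \<in> V" "v \<in> V" shows "card (R.orbs (per u, per v)) = c u v"
proof -
  obtain n where n: "rep (u, v) = (rot n u, rot n v)" using rep_ex[of "(u, v)"] by auto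
  let ?u = "rot n u" and ?v = "rot n v"
  have V: "?u \<in> V" "?v \<in> V" by (simp_all add: rotV uv)
  have T_iff: "T j ?u ?v \<longleftrightarrow> j < c u v" for j
    unfolding T_def using V rep_rot[OF uv, of n] n c_rot[OF uv, of n] by simp
  let ?f = "\<lambda>j. shift_orbit (trans_pt j ?u ?v)"
  have "R.orbs (per u, per v) = ?f ` {..<c u v}"
  proof (intro equalityI subsetI)
    fix o' assume "o' \<in> R.orbs (per u, per v)"
    then obtain z where z: "z \<in> R.conn (per u, per v)" "o' = shift_orbit z" unfolding R.orbs_iff by blast
    have zX: "z \<in> pts" "z \<notin> per ` V" using R.conn_X[OF z(1)] unfolding periodic_pts by blast+
    from zX(1) show "o' \<in> ?f ` {..<c u v}"
    proof (rule ptsE)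
      fix w assume "w \<in> V" "z = per w"
      then show ?thesis using zX(2) by blast
    next
      fix m j a b assume t: "T j a b" and z': "z = shift_by m (trans_pt j a b)"
      note ab = TD(1,2)[OF t]
      have P: "(per w, per w') \<in> periodic_points pts \<times> periodic_points pts" if "w \<in> V" "w' \<in> V" for w w'
        unfolding periodic_pts using that by blast
      have "z \<in> R.conn (per (rot m a), per (rot m b))" unfolding z' by (rule trans_pt_conn[OF t])
      from R.conn_unique[OF z(1) this P[OF uv] P[OF rotV[OF ab(1)] rotV[OF ab(2)]]]
      have "u = rot m a" "v = rot m b" using per_eq uv rotV ab by simp_all
      then have "rep (u, v) = (a, b)" using rep_rot[OF ab, of m] TD(4)[OF t] by simp
      then have ab': "a = ?u" "b = ?v" using n by simp_all
      have "j < c u v" using t unfolding ab' T_iff .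
      moreover have "o' = ?f j" unfolding z(2) z' ab' by simp
      ultimately show ?thesis by blast
    qed
  next
    fix o' assume "o' \<in> ?f ` {..<c u v}"
    then obtain j where j: "o' = ?f j" "j < c u v" by blast
    have "shift_by (- n) (trans_pt j ?u ?v) \<in> R.conn (per (rot (- n) ?u), per (rot (- n) ?v))"
      by (rule trans_pt_conn) (simp only: T_iff j(2))
    then have "shift_by (- n) (trans_pt j ?u ?v) \<in> R.conn (per u, per v)" by (simp add: rot_rot rot0 uv)
    then show "o' \<in> R.orbs (per u, per v)" unfolding R.orbs_iff by (rule bexI[rotated]) (simp add: j(1))
  qed
  moreover have "inj_on ?f {..<c u v}"
  proof (rule inj_onI)
    fix j j' assume "?f j = ?f j'"
    then obtain m where "trans_pt j ?u ?v = shift_by m (trans_pt j' ?u ?v)" using shift_orbit_eqD by blast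
    from fun_cong[OF this, of 0] have "trans_pt j' ?u ?v m = tsym j ?u ?v"
      by (simp add: shift_by_apply) (simp add: trans_pt_def)
    then show "j = j'" unfolding trans_pt_eq_tsym by simp
  qed
  ultimately show ?thesis by (simp add: card_image)
qed

lemma iso_per:
  assumes d: "graph_data G \<rho> c" and V: "nodes G = V" and \<rho>: "\<And>v. v \<in> V \<Longrightarrow> rot 1 v = \<rho> v"
  shows "digraph_iso_map per G (structure_graph pts)"
  unfolding digraph_iso_map_def R.nodes_structure_graph V
proof (intro conjI ballI allI)
  show "bij_betw per V (periodic_points pts)" unfolding periodic_pts
    by (rule inj_on_imp_bij_betw) (rule inj_onI, simp only: per_eq)
  fix u v l assume uv: "u \<in> V" "v \<in> V"
  then have uv': "u \<in> nodes G" "v \<in> nodes G" unfolding V .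
  have P: "per u \<in> periodic_points pts" "per v \<in> periodic_points pts" unfolding periodic_pts using uv by blast+
  show "(u, l, v) \<in> edges G \<longleftrightarrow> (per u, l, per v) \<in> edges (structure_graph pts)"
  proof (cases l)
    case Rotation
    have "per v = shift_map (per u) \<longleftrightarrow> v = \<rho> u"
      unfolding shift_per[OF uv(1)] \<rho>[OF uv(1), symmetric] by (rule per_eq[OF uv(2) rotV[OF uv(1)]])
    then show ?thesis unfolding Rotation graph_dataD(3)[OF d uv'] R.rotation_edge using P(1) by simp
  next
    case (Transition n)
    show ?thesis
      unfolding Transition graph_dataD(4)[OF d uv'] R.transition_edge R.orbit_count_orbs[OF P] card_orbs_per[OF uv] per_eq[OF uv]
      using P by simp
  qed
qed

end

text \<open>Finitely many vertices have a common period \<open>M\<close>, the product of their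
  individual periods. Powers with exponent \<open>n mod M\<close> then define the action for
  negative \<open>n\<close> as well, without using an inverse.\<close>

lemma realisation_exists:
  assumes fin: "finite V" and bij: "bij_betw \<rho> V V" and c: "\<And>u v. u \<in> V \<Longrightarrow> v \<in> V \<Longrightarrow> c (\<rho> u) (\<rho> v) = c u v"
  shows "\<exists>rot P. realisation V rot c P \<and> (\<forall>v\<in>V. rot 1 v = \<rho> v)"
proof -
  \<comment> \<open>Extended by the identity outside \<open>V\<close>, the rotation becomes
    injective on the whole type, so that the facts on iterates of injective functions apply.\<close>
  define \<pi> where "\<pi> v = (if v \<in> V then \<rho> v else v)" for v
  have \<pi>V: "\<pi> v \<in> V" if "v \<in> V" for v using bij_betw_apply[OF bij that] that by (simp add: \<pi>_def)
  have "inj \<pi>"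
  proof (rule injI)
    fix u v assume eq: "\<pi> u = \<pi> v"
    have "u \<in> V \<longleftrightarrow> v \<in> V" using \<pi>V[of u] \<pi>V[of v] eq by (auto simp: \<pi>_def split: if_splits)
    then show "u = v" using eq inj_onD[OF bij_betw_imp_inj_on[OF bij], of u v] by (auto simp: \<pi>_def split: if_splits)
  qed
  have powV: "(\<pi> ^^ k) v \<in> V" if "v \<in> V" for k v by (induction k) (simp_all add: that \<pi>V)
  have "\<exists>n>0. (\<pi> ^^ n) v = v" if v: "v \<in> V" for v
  proof -
    have "finite {y. \<exists>n. y = (\<pi> ^^ n) v}" by (rule finite_subset[OF _ fin]) (use powV[OF v] in blast)
    from funpow_inj_finite[OF \<open>inj \<pi>\<close> this] show ?thesis by blast
  qed
  then obtain N where N: "\<And>v. v \<in> V \<Longrightarrow> N v > 0" "\<And>v. v \<in> V \<Longrightarrow> (\<pi> ^^ N v) v = v" by metis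
  define M where "M = prod N V"
  have M: "M > 0" unfolding M_def using N(1) by (intro prod_pos) simp
  have \<pi>M: "(\<pi> ^^ M) v = v" if v: "v \<in> V" for v
  proof -
    have "N v dvd M" unfolding M_def by (rule dvd_prodI[OF fin v])
    then have "M mod N v = 0" by simp
    then show ?thesis using funpow_mod_eq[OF N(2)[OF v], of M] by simp
  qed
  define rot where "rot n v = (\<pi> ^^ nat (n mod int M)) v" for n v
  have "realisation V rot c (int M)"
  proof
    show "rot m (rot n v) = rot (m + n) v" if v: "v \<in> V" for m n v
    proof -
      let ?a = "nat (m mod int M)" and ?b = "nat (n mod int M)"
      have ab: "int ?a = m mod int M" "int ?b = n mod int M" using M by simp_all
      have "int ((?a + ?b) mod M) = (m mod int M + n mod int M) mod int M" unfolding zmod_int of_nat_add ab ..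
      also have "\<dots> = (m + n) mod int M" by (rule mod_add_eq)
      finally have eq: "nat ((m + n) mod int M) = (?a + ?b) mod M" by linarith
      have "rot m (rot n v) = (\<pi> ^^ (?a + ?b)) v" unfolding rot_def funpow_add comp_def ..
      then show ?thesis unfolding rot_def eq funpow_mod_eq[OF \<pi>M[OF v]] by simp
    qed
    have "c ((\<pi> ^^ k) u) ((\<pi> ^^ k) v) = c u v" if "u \<in> V" "v \<in> V" for k u v
    proof (induction k)
      case (Suc k)
      have "\<pi> ((\<pi> ^^ k) u) = \<rho> ((\<pi> ^^ k) u)" "\<pi> ((\<pi> ^^ k) v) = \<rho> ((\<pi> ^^ k) v)"
        unfolding \<pi>_def[of "(\<pi> ^^ k) u"] \<pi>_def[of "(\<pi> ^^ k) v"] using powV[OF that(1), of k] powV[OF that(2), of k] by simp_all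
      then show ?case using c[OF powV[OF that(1), of k] powV[OF that(2), of k]] Suc by simp
    qed simp
    then show "c (rot n u) (rot n v) = c u v" if "u \<in> V" "v \<in> V" for n u v
      unfolding rot_def using that by blast
  qed (use fin M powV in \<open>simp_all add: rot_def\<close>)
  moreover have "rot 1 v = \<rho> v" if v: "v \<in> V" for v
  proof -
    have "int (1 mod M) = 1 mod int M" by (simp only: of_nat_mod of_nat_1)
    then have "nat (1 mod int M) = 1 mod M" by linarith
    then have "rot 1 v = (\<pi> ^^ 1) v" unfolding rot_def using funpow_mod_eq[OF \<pi>M[OF v], of 1] by simp
    then show ?thesis using v by (simp add: \<pi>_def)
  qed
  ultimately show ?thesis by blast
qed

text \<open>One construction serves both classes: the realising shift is always sofic, and it is of
  finite type if \<open>one_step\<close> holds. Conversely, the conditions are invariant under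
  isomorphism and hold for structure graphs.\<close>

lemma structural_iff_sofic:
  fixes G :: "nat labeled_digraph"
  assumes "finite (nodes G)" "wf_digraph G"
  shows "structural G \<longleftrightarrow> (\<exists>A X \<phi>. countable_sofic_rank2 (A :: nat set) X \<and> digraph_iso_map \<phi> G (structure_graph X))"
    and "structural G \<and> one_step G \<longleftrightarrow>
      (\<exists>A X \<phi>. countable_sft_rank2 (A :: nat set) X \<and> digraph_iso_map \<phi> G (structure_graph X))"
proof -
  have real: "\<exists>A X \<phi>. countable_sofic_rank2 (A :: nat set) X \<and> digraph_iso_map \<phi> G (structure_graph X) \<and>
      (one_step G \<longrightarrow> countable_sft_rank2 A X)" if st: "structural G"
  proof -
    obtain \<rho> c where d: "graph_data G \<rho> c" using data_if_structural[OF st assms(2,1)] by blast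
    have "\<exists>rot P. realisation (nodes G) rot c P \<and> (\<forall>v\<in>nodes G. rot 1 v = \<rho> v)"
    proof (rule realisation_exists[OF assms(1) graph_dataD(1)[OF d]])
      fix u v assume uv: "u \<in> nodes G" "v \<in> nodes G"
      show "c (\<rho> u) (\<rho> v) = c u v" by (rule graph_dataD(2)[OF d uv])
    qed
    then obtain rot P where rP: "realisation (nodes G) rot c P \<and> (\<forall>v\<in>nodes G. rot 1 v = \<rho> v)"
      by (elim exE)
    note r = conjunct1[OF rP] and \<rho> = conjunct2[OF rP]
    interpret realisation "nodes G" rot c P by (rule r)
    have "digraph_iso_map per G (structure_graph pts)" by (rule iso_per[OF d refl bspec[OF \<rho>]])
    moreover have "countable_sofic_rank2 alph pts"
      unfolding countable_sofic_rank2_def by (intro conjI sofic R.count R.rank)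
    moreover have "countable_sft_rank2 alph pts" if os: "one_step G"
      unfolding countable_sft_rank2_def
      by (intro conjI finite_type R.count R.rank) (use os[unfolded one_step_iff[OF d assms(2)]] in blast)
    ultimately show ?thesis by (intro exI[of _ alph] exI[of _ pts] exI[of _ per] conjI impI)
  qed
  have conv: "structural G" "shift_of_finite_type A X \<Longrightarrow> one_step G"
    if r: "rank2 A X" and i: "digraph_iso_map \<phi> G (structure_graph X)"
    for A :: "nat set" and X :: "(int \<Rightarrow> nat) set" and \<phi>
  proof -
    interpret rank2 A X by (rule r)
    note d = graph_data_iso[OF i graph_data_structure_graph]
    show "structural G" by (rule structural_if_data[OF d assms(2)])
    assume "shift_of_finite_type A X"
    then have "one_step (structure_graph X)" by (rule rank2_one_step[OF r])
    note os = this[unfolded one_step_iff[OF graph_data_structure_graph wf_structure_graph]]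
    have \<phi>V: "\<phi> u \<in> nodes (structure_graph X)" if "u \<in> nodes G" for u
      by (rule bij_betw_apply[OF conjunct1[OF i[unfolded digraph_iso_map_def]] that])
    show "one_step G"
      unfolding one_step_iff[OF d assms(2)]
    proof (intro ballI)
      fix u v w assume V: "u \<in> nodes G" "v \<in> nodes G" "w \<in> nodes G"
      show "\<not> (0 < card (orbs (\<phi> u, \<phi> v)) \<and> 0 < card (orbs (\<phi> v, \<phi> w)))"
        by (rule bspec[OF bspec[OF bspec[OF os \<phi>V[OF V(1)]] \<phi>V[OF V(2)]] \<phi>V[OF V(3)]])
    qed
  qed
  have sof: "rank2 A X" if "countable_sofic_rank2 A X" for A :: "nat set" and X
    using that by (simp add: countable_sofic_rank2_def sofic_shift_def rank2_def)
  have sft: "rank2 A X" "shift_of_finite_type A X" if "countable_sft_rank2 A X" for A :: "nat set" and X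
    using that by (simp_all add: countable_sft_rank2_def shift_of_finite_type_def rank2_def)
  show "structural G \<longleftrightarrow> (\<exists>A X \<phi>. countable_sofic_rank2 (A :: nat set) X \<and> digraph_iso_map \<phi> G (structure_graph X))"
  proof
    assume "structural G"
    from real[OF this] show "\<exists>A X \<phi>. countable_sofic_rank2 (A :: nat set) X \<and> digraph_iso_map \<phi> G (structure_graph X)"
      by blast
  next
    assume "\<exists>A X \<phi>. countable_sofic_rank2 (A :: nat set) X \<and> digraph_iso_map \<phi> G (structure_graph X)"
    then obtain A X \<phi> where X: "countable_sofic_rank2 (A :: nat set) X" "digraph_iso_map \<phi> G (structure_graph X)"
      by blast
    show "structural G" by (rule conv(1)[OF sof[OF X(1)] X(2)])
  qed
  show "structural G \<and> one_step G \<longleftrightarrow>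
      (\<exists>A X \<phi>. countable_sft_rank2 (A :: nat set) X \<and> digraph_iso_map \<phi> G (structure_graph X))"
  proof
    assume G: "structural G \<and> one_step G"
    from real[OF conjunct1[OF G]]
    show "\<exists>A X \<phi>. countable_sft_rank2 (A :: nat set) X \<and> digraph_iso_map \<phi> G (structure_graph X)"
      using conjunct2[OF G] by blast
  next
    assume "\<exists>A X \<phi>. countable_sft_rank2 (A :: nat set) X \<and> digraph_iso_map \<phi> G (structure_graph X)"
    then obtain A X \<phi> where X: "countable_sft_rank2 (A :: nat set) X" "digraph_iso_map \<phi> G (structure_graph X)"
      by blast
    show "structural G \<and> one_step G"
      using conv[OF sft(1)[OF X(1)] X(2)] sft(2)[OF X(1)] by blast
  qed
qed

section \<open>The decision problems in terms of lists\<close>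

text \<open>A normal form in which instances are codes of valid data and the answer is a predicate
  on the data. Reductions between problems of this form are mere functions on data.\<close>

definition problem_of :: "('a \<Rightarrow> bool list) \<Rightarrow> ('a \<Rightarrow> bool) \<Rightarrow> ('a \<Rightarrow> bool) \<Rightarrow> decision_problem" where
  "problem_of e valid yes = \<lparr>yes_instances = {e x | x. valid x \<and> yes x},
     no_instances = {e x | x. valid x \<and> \<not> yes x}\<rparr>"

lemma parser_inj:
  assumes "parser k e p" "e x = e y"
  shows "x = y"
proof -
  have "p (e z @ []) = (z, [])" for z using assms(1) unfolding parser_def by blast
  from this[of x] this[of y] show ?thesis using assms(2) by simp
qed

text \<open>A code determines its value, so membership of a word can be read off from the value. The
  remaining words are mapped to the empty word, which is no code in the target problem and thus no
  yes-instance.\<close>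

lemma poly_reducible_problem_of:
  fixes e :: "'a::treeable \<Rightarrow> bool list" and d :: "'b::treeable \<Rightarrow> bool list"
  assumes e: "\<exists>k p. parser k e p" "pt e" and d: "\<exists>k p. parser k d p" "pt d" "\<And>y. d y \<noteq> []"
    and "pt valid" "pt f"
    and f: "\<And>x. valid x \<Longrightarrow> valid' (f x) \<and> (yes' (f x) \<longleftrightarrow> yes x)"
  shows "poly_reducible (problem_of e valid yes) (problem_of d valid' yes')"
proof -
  have "pt (\<lambda>x. d (f x))" by (rule pt_compose[OF d(2) \<open>pt f\<close>])
  from polynomial_time_on_codes[OF e this \<open>pt valid\<close>] obtain h where h: "polynomial_time_computable h"
    "\<And>x. h (e x) = (if valid x then d (f x) else [])" "\<And>w. w \<notin> range e \<Longrightarrow> h w = []"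
    by blast
  have d_inj: "d x = d y \<Longrightarrow> x = y" for x y using d(1) parser_inj by blast
  have e_inj: "e x = e y \<Longrightarrow> x = y" for x y using e(1) parser_inj by blast
  have "w \<in> yes_instances (problem_of e valid yes) \<longleftrightarrow> h w \<in> yes_instances (problem_of d valid' yes')"
    and "w \<in> no_instances (problem_of e valid yes) \<Longrightarrow> h w \<in> no_instances (problem_of d valid' yes')" for w
  proof -
    have empty: "[] \<notin> yes_instances (problem_of d valid' yes')"
    proof
      assume "[] \<in> yes_instances (problem_of d valid' yes')"
      then obtain x where "[] = d x" by (auto simp: problem_of_def)
      then show False using d(3)[of x] by simp
    qed
    show "w \<in> yes_instances (problem_of e valid yes) \<longleftrightarrow> h w \<in> yes_instances (problem_of d valid' yes')"
    proof (cases "\<exists>x. w = e x \<and> valid x")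
      case True
      then obtain x where x: "w = e x" "valid x" by blast
      have "w \<in> yes_instances (problem_of e valid yes) \<longleftrightarrow> yes x"
        using x e_inj by (auto simp: problem_of_def)
      moreover have "d (f x) \<in> yes_instances (problem_of d valid' yes') \<longleftrightarrow> yes' (f x)"
        using f[OF x(2)] d_inj by (auto simp: problem_of_def)
      ultimately show ?thesis using f[OF x(2)] x h(2) by simp
    next
      case False
      then have "h w = []" using h(2,3) by (cases "w \<in> range e") auto
      moreover have "w \<notin> yes_instances (problem_of e valid yes)"
        using False by (auto simp: problem_of_def)
      ultimately show ?thesis using empty by simp
    qed
    show "h w \<in> no_instances (problem_of d valid' yes')" if w: "w \<in> no_instances (problem_of e valid yes)"
    proof -
      obtain x where x: "w = e x" "valid x" "\<not> yes x" using w by (auto simp: problem_of_def)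
      then have "h w = d (f x)" using h(2) by simp
      then show ?thesis using f[OF x(2)] x(3) by (auto simp: problem_of_def)
    qed
  qed
  then show ?thesis unfolding poly_reducible_def using h(1) by blast
qed

section \<open>Pairs of graphs as coded data\<close>

type_synonym dlists = "nat list \<times> (nat \<times> edge_label \<times> nat) list"
type_synonym ulists = "nat list \<times> (nat \<times> nat) list"

definition enc_digraphs :: "dlists \<times> dlists \<Rightarrow> bool list" where
  "enc_digraphs p = encode_digraph (fst p) @ encode_digraph (snd p)"

definition enc_ugraphs :: "ulists \<times> ulists \<Rightarrow> bool list" where
  "enc_ugraphs p = encode_ugraph (fst p) @ encode_ugraph (snd p)"

lemma enc_digraphs_parser: "\<exists>k p. parser k enc_digraphs p"
proof -
  have "enc_digraphs = (\<lambda>(D, D'). encode_digraph D @ encode_digraph D')"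
    by (auto simp: enc_digraphs_def fun_eq_iff)
  then show ?thesis using parser_digraphs by simp
qed

lemma enc_ugraphs_parser: "\<exists>k p. parser k enc_ugraphs p"
proof -
  have "enc_ugraphs = (\<lambda>(D, D'). encode_ugraph D @ encode_ugraph D')"
    by (auto simp: enc_ugraphs_def fun_eq_iff)
  then show ?thesis using parser_ugraphs by simp
qed

lemma enc_nonempty: "enc_digraphs p \<noteq> []" "enc_ugraphs q \<noteq> []"
proof -
  have "encode_digraph D \<noteq> []" for D by (cases D) (simp add: encode_list_def)
  then show "enc_digraphs p \<noteq> []" by (simp add: enc_digraphs_def)
  have "encode_ugraph D \<noteq> []" for D by (cases D) (simp add: encode_list_def)
  then show "enc_ugraphs q \<noteq> []" by (simp add: enc_ugraphs_def)
qed

lemma pt_enc_digraphs: "pt enc_digraphs"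
  unfolding enc_digraphs_def by (intro pt_append pt_encode_digraph pt_basic)

lemma pt_enc_ugraphs: "pt enc_ugraphs"
  unfolding enc_ugraphs_def by (intro pt_append pt_encode_ugraph pt_basic)

definition graph_of :: "dlists \<Rightarrow> nat labeled_digraph" where
  "graph_of D = \<lparr>nodes = set (fst D), edges = set (snd D)\<rparr>"

definition digraph_lists_ok :: "dlists \<Rightarrow> bool" where
  "digraph_lists_ok D \<longleftrightarrow> distinct (fst D) \<and> distinct (snd D) \<and>
     (\<forall>e\<in>set (snd D). fst e \<in> set (fst D) \<and> snd (snd e) \<in> set (fst D))"

lemma digraph_presentation_iff: "digraph_presentation D G \<longleftrightarrow> digraph_lists_ok D \<and> G = graph_of D"
  by (cases D) (auto simp: digraph_lists_ok_def graph_of_def)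

lemma wf_graph_of: "digraph_lists_ok D \<Longrightarrow> wf_digraph (graph_of D)"
  by (auto simp: digraph_lists_ok_def graph_of_def wf_digraph_def)

lemma pt_digraph_lists_ok: "pt f \<Longrightarrow> pt (\<lambda>x. digraph_lists_ok (f x))"
proof -
  have "pt digraph_lists_ok"
    unfolding digraph_lists_ok_def by (intro pt_basic pt_lists)
  then show "pt f \<Longrightarrow> pt (\<lambda>x. digraph_lists_ok (f x))" by (rule pt_compose)
qed

text \<open>Equivalent to being a presentation (\<open>ugraph_presentation_iff\<close>), but phrased
  with ordered pairs, since unordered pairs are sets and have no trees: no edge may be listed in
  both orientations.\<close>

definition ugraph_lists_ok :: "ulists \<Rightarrow> bool" where
  "ugraph_lists_ok D \<longleftrightarrow> distinct (fst D) \<and> distinct (snd D) \<and>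
     (\<forall>e\<in>set (snd D). fst e \<in> set (fst D) \<and> snd e \<in> set (fst D) \<and> fst e \<noteq> snd e \<and>
        (snd e, fst e) \<notin> set (snd D))"

definition adjacent :: "('v \<times> 'v) set \<Rightarrow> 'v \<Rightarrow> 'v \<Rightarrow> bool" where
  "adjacent E u v \<longleftrightarrow> (u, v) \<in> E \<or> (v, u) \<in> E"

definition adj_iso_map :: "('v \<Rightarrow> 'w) \<Rightarrow> 'v set \<times> ('v \<times> 'v) set \<Rightarrow> 'w set \<times> ('w \<times> 'w) set \<Rightarrow> bool" where
  "adj_iso_map \<phi> G H \<longleftrightarrow> bij_betw \<phi> (fst G) (fst H) \<and>
     (\<forall>u\<in>fst G. \<forall>v\<in>fst G. adjacent (snd G) u v \<longleftrightarrow> adjacent (snd H) (\<phi> u) (\<phi> v))"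

definition ugraph_of :: "ulists \<Rightarrow> nat set \<times> (nat \<times> nat) set" where
  "ugraph_of D = (set (fst D), set (snd D))"

lemma adj_iso_map_inv:
  assumes "adj_iso_map \<phi> G H"
  shows "adj_iso_map (inv_into (fst G) \<phi>) H G"
proof -
  let ?g = "inv_into (fst G) \<phi>"
  have bij: "bij_betw \<phi> (fst G) (fst H)"
    and adj: "\<And>u v. u \<in> fst G \<Longrightarrow> v \<in> fst G \<Longrightarrow> adjacent (snd G) u v \<longleftrightarrow> adjacent (snd H) (\<phi> u) (\<phi> v)"
    using assms by (simp_all only: adj_iso_map_def)
  have g: "?g u \<in> fst G" "\<phi> (?g u) = u" if "u \<in> fst H" for u
    using bij_betw_apply[OF bij_betw_inv_into[OF bij] that] bij_betw_inv_into_right[OF bij that] .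
  have "adjacent (snd H) u v \<longleftrightarrow> adjacent (snd G) (?g u) (?g v)" if "u \<in> fst H" "v \<in> fst H" for u v
    unfolding adj[OF g(1)[OF that(1)] g(1)[OF that(2)]] g(2)[OF that(1)] g(2)[OF that(2)] ..
  then show ?thesis
    using bij_betw_inv_into[OF bij] by (simp add: adj_iso_map_def)
qed

lemma adj_iso_map_comp:
  assumes "adj_iso_map \<phi> G H" "adj_iso_map \<psi> H K"
  shows "adj_iso_map (\<psi> \<circ> \<phi>) G K"
proof -
  have bij: "bij_betw \<phi> (fst G) (fst H)" "bij_betw \<psi> (fst H) (fst K)"
    using assms by (simp_all only: adj_iso_map_def)
  have "adjacent (snd G) u v \<longleftrightarrow> adjacent (snd K) ((\<psi> \<circ> \<phi>) u) ((\<psi> \<circ> \<phi>) v)"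
    if "u \<in> fst G" "v \<in> fst G" for u v
  proof -
    have "\<phi> u \<in> fst H" "\<phi> v \<in> fst H"
      using bij_betw_apply[OF bij(1) that(1)] bij_betw_apply[OF bij(1) that(2)] .
    then have "adjacent (snd H) (\<phi> u) (\<phi> v) \<longleftrightarrow> adjacent (snd K) (\<psi> (\<phi> u)) (\<psi> (\<phi> v))"
      using assms(2) by (simp add: adj_iso_map_def)
    moreover have "adjacent (snd G) u v \<longleftrightarrow> adjacent (snd H) (\<phi> u) (\<phi> v)"
      using assms(1) that by (simp add: adj_iso_map_def)
    ultimately show ?thesis by simp
  qed
  then show ?thesis
    using bij_betw_trans[OF bij] by (simp add: adj_iso_map_def)
qed

lemma ugraph_presentation_iff:
  "ugraph_presentation D V E \<longleftrightarrow> ugraph_lists_ok D \<and> V = set (fst D) \<and> E = (\<lambda>(u, v). {u, v}) ` set (snd D)"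
proof -
  obtain vs es where D: "D = (vs, es)" by (cases D)
  let ?ok = "\<forall>e\<in>set es. fst e \<in> set vs \<and> snd e \<in> set vs \<and> fst e \<noteq> snd e"
  let ?one = "\<forall>e\<in>set es. (snd e, fst e) \<notin> set es"
  let ?f = "\<lambda>e. {fst e, snd e}"
  have "distinct (map ?f es) \<longleftrightarrow> distinct es \<and> ?one" if ok: ?ok
  proof -
    have "inj_on ?f (set es) \<longleftrightarrow> ?one"
    proof
      assume inj: "inj_on ?f (set es)"
      show ?one
      proof
        fix e assume e: "e \<in> set es"
        show "(snd e, fst e) \<notin> set es"
        proof
          assume se: "(snd e, fst e) \<in> set es"
          have "?f e = ?f (snd e, fst e)" unfolding fst_conv snd_conv by (rule insert_commute)
          from arg_cong[OF inj_onD[OF inj this e se], of fst] have "fst e = snd e"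
            unfolding fst_conv .
          then show False using bspec[OF ok e] by simp
        qed
      qed
    next
      assume one: ?one
      show "inj_on ?f (set es)"
      proof (rule inj_onI)
        fix p q assume pq: "p \<in> set es" "q \<in> set es" "?f p = ?f q"
        then have "fst p = fst q \<and> snd p = snd q \<or> fst p = snd q \<and> snd p = fst q"
          by (simp only: doubleton_eq_iff)
        then show "p = q"
        proof
          assume "fst p = snd q \<and> snd p = fst q"
          then have "(snd p, fst p) = q" by (simp add: prod_eq_iff)
          then show ?thesis using bspec[OF one pq(1)] pq(2) by simp
        qed (simp add: prod_eq_iff)
      qed
    qed
    then show ?thesis by (simp only: distinct_map)
  qed
  then have "?ok \<longrightarrow> (distinct (map ?f es) \<longleftrightarrow> distinct es \<and> ?one)" ..
  moreover have "ugraph_lists_ok D \<longleftrightarrow> distinct vs \<and> distinct es \<and> ?ok \<and> ?one"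
    unfolding D ugraph_lists_ok_def fst_conv snd_conv by (simp only: ball_conj_distrib conj_assoc)
  moreover have "ugraph_presentation D V E \<longleftrightarrow> distinct vs \<and> distinct (map ?f es) \<and> ?ok \<and>
      V = set (fst D) \<and> E = (\<lambda>(u, v). {u, v}) ` set (snd D)"
    unfolding D ugraph_presentation.simps fst_conv snd_conv split_def ..
  ultimately show ?thesis by argo
qed

lemma doubleton_in_image: "{u, v} \<in> (\<lambda>(u, v). {u, v}) ` E \<longleftrightarrow> adjacent E u v"
proof
  assume "{u, v} \<in> (\<lambda>(u, v). {u, v}) ` E"
  then obtain a b where "(a, b) \<in> E" "{u, v} = {a, b}" by auto
  then show "adjacent E u v" unfolding adjacent_def doubleton_eq_iff by blast
next
  assume "adjacent E u v"
  then obtain a b where ab: "(a, b) \<in> E" "a = u \<and> b = v \<or> a = v \<and> b = u" unfolding adjacent_def by blast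
  then have "{u, v} = (\<lambda>(u, v). {u, v}) (a, b)" by auto
  then show "{u, v} \<in> (\<lambda>(u, v). {u, v}) ` E" using ab(1) by (rule image_eqI)
qed

lemma ugraph_iso_iff:
  "ugraph_iso V ((\<lambda>(u, v). {u, v}) ` E) V' ((\<lambda>(u, v). {u, v}) ` E') \<longleftrightarrow>
     (\<exists>\<phi>. adj_iso_map \<phi> (V, E) (V', E'))"
  unfolding ugraph_iso_def adj_iso_map_def doubleton_in_image by simp

definition ugraphs_ok :: "ulists \<times> ulists \<Rightarrow> bool" where
  "ugraphs_ok p \<longleftrightarrow> ugraph_lists_ok (fst p) \<and> ugraph_lists_ok (snd p)"

definition ugraphs_iso :: "ulists \<times> ulists \<Rightarrow> bool" where
  "ugraphs_iso p \<longleftrightarrow> (\<exists>\<phi>. adj_iso_map \<phi> (ugraph_of (fst p)) (ugraph_of (snd p)))"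

lemma graph_isomorphism_eq: "graph_isomorphism = problem_of enc_ugraphs ugraphs_ok ugraphs_iso"
proof -
  \<comment> \<open>The predicate \<open>P\<close> will be the identity and \<open>Not\<close>,
    which treats yes- and no-instances at once.\<close>
  have "{encode_ugraph D @ encode_ugraph D' | D D' V E V' E'. ugraph_presentation D V E \<and>
      ugraph_presentation D' V' E' \<and> P (ugraph_iso V E V' E')}
    = {enc_ugraphs p | p. ugraphs_ok p \<and> P (ugraphs_iso p)}" (is "?L = ?R") for P
  proof (intro equalityI subsetI)
    fix w assume "w \<in> ?L"
    then obtain D D' V E V' E' where w: "w = encode_ugraph D @ encode_ugraph D'"
      "ugraph_presentation D V E" "ugraph_presentation D' V' E'" "P (ugraph_iso V E V' E')" by blast
    have "ugraph_iso V E V' E' = ugraphs_iso (D, D')"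
      using w(2,3) unfolding ugraph_presentation_iff by (simp add: ugraph_iso_iff ugraphs_iso_def ugraph_of_def)
    then have "P (ugraphs_iso (D, D'))" using w(4) by simp
    moreover have "ugraphs_ok (D, D')"
      using w(2,3) unfolding ugraph_presentation_iff by (simp add: ugraphs_ok_def)
    moreover have "w = enc_ugraphs (D, D')" using w(1) by (simp add: enc_ugraphs_def)
    ultimately have "w = enc_ugraphs (D, D') \<and> ugraphs_ok (D, D') \<and> P (ugraphs_iso (D, D'))"
      by (intro conjI)
    then show "w \<in> ?R" unfolding mem_Collect_eq by (rule exI)
  next
    fix w assume "w \<in> ?R"
    then obtain p where p: "w = enc_ugraphs p" "ugraphs_ok p" "P (ugraphs_iso p)" by blast
    let ?E = "\<lambda>D. (\<lambda>(u, v). {u, v}) ` set (snd D)"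
    have "ugraph_presentation (fst p) (set (fst (fst p))) (?E (fst p))"
      "ugraph_presentation (snd p) (set (fst (snd p))) (?E (snd p))"
      using p(2) unfolding ugraph_presentation_iff by (simp_all add: ugraphs_ok_def)
    moreover have "P (ugraph_iso (set (fst (fst p))) (?E (fst p)) (set (fst (snd p))) (?E (snd p)))"
      using p(3) by (simp add: ugraph_iso_iff ugraphs_iso_def ugraph_of_def)
    moreover have "w = encode_ugraph (fst p) @ encode_ugraph (snd p)"
      using p(1) by (simp add: enc_ugraphs_def)
    ultimately have "w = encode_ugraph (fst p) @ encode_ugraph (snd p) \<and>
        ugraph_presentation (fst p) (set (fst (fst p))) (?E (fst p)) \<and>
        ugraph_presentation (snd p) (set (fst (snd p))) (?E (snd p)) \<and>
        P (ugraph_iso (set (fst (fst p))) (?E (fst p)) (set (fst (snd p))) (?E (snd p)))"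
      by (intro conjI)
    then show "w \<in> ?L" unfolding mem_Collect_eq
      by - (rule exI[of _ "fst p"], rule exI[of _ "snd p"], rule exI[of _ "set (fst (fst p))"],
          rule exI[of _ "?E (fst p)"], rule exI[of _ "set (fst (snd p))"],
          rule exI[of _ "?E (snd p)"])
  qed
  note eq = this[of "\<lambda>b. b"] this[of Not]
  show ?thesis unfolding graph_isomorphism_def problem_of_def eq ..
qed

definition digraphs_iso :: "dlists \<times> dlists \<Rightarrow> bool" where
  "digraphs_iso p \<longleftrightarrow> (\<exists>\<phi>. digraph_iso_map \<phi> (graph_of (fst p)) (graph_of (snd p)))"

definition digraphs_ok :: "(nat labeled_digraph \<Rightarrow> bool) \<Rightarrow> dlists \<times> dlists \<Rightarrow> bool" where
  "digraphs_ok ok p \<longleftrightarrow> digraph_lists_ok (fst p) \<and> digraph_lists_ok (snd p) \<and>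
     ok (graph_of (fst p)) \<and> ok (graph_of (snd p))"

text \<open>Shifts disappear from the problem. Conjugacy depends only on the presented graphs up to
  isomorphism (\<open>conj'\<close>), and being a presentation of some shift of the class is a
  property of the lists alone (\<open>okD\<close>).\<close>

lemma conjugacy_problem_eq:
  fixes C :: "nat set \<Rightarrow> (int \<Rightarrow> nat) set \<Rightarrow> bool"
  assumes wf: "\<And>A X. C A X \<Longrightarrow> wf_digraph (structure_graph X)"
    and conj: "\<And>A X B Y. C A X \<Longrightarrow> C B Y \<Longrightarrow>
      conjugate A X B Y \<longleftrightarrow> (\<exists>\<phi>. digraph_iso_map \<phi> (structure_graph X) (structure_graph Y))"
    and ok: "\<And>G :: nat labeled_digraph. finite (nodes G) \<Longrightarrow> wf_digraph G \<Longrightarrow>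
      ok G \<longleftrightarrow> (\<exists>A X \<phi>. C A X \<and> digraph_iso_map \<phi> G (structure_graph X))"
  shows "conjugacy_problem C = problem_of enc_digraphs (digraphs_ok ok) digraphs_iso"
proof -
  have pres: "presents_shift D X \<longleftrightarrow> digraph_lists_ok D \<and> (\<exists>\<phi>. digraph_iso_map \<phi> (graph_of D) (structure_graph X))"
    if "C A X" for D A and X :: "(int \<Rightarrow> nat) set"
    unfolding presents_shift_def digraph_presentation_iff
    using labeled_digraph_iso_iff[OF wf_graph_of[of D] wf[OF that]] by blast
  have conj': "conjugate A X B Y \<longleftrightarrow> digraphs_iso (D, D')"
    if C: "C A X" "C B Y" "presents_shift D X" "presents_shift D' Y" for A X B Y D D'
  proof -
    obtain \<phi> where \<phi>: "digraph_iso_map \<phi> (graph_of D) (structure_graph X)"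
      using pres[OF C(1), of D] C(3) by blast
    obtain \<psi> where \<psi>: "digraph_iso_map \<psi> (graph_of D') (structure_graph Y)"
      using pres[OF C(2), of D'] C(4) by blast
    show ?thesis
      unfolding conj[OF C(1,2)] digraphs_iso_def fst_conv snd_conv
      using digraph_iso_map_comp[OF digraph_iso_map_comp[OF \<phi>] digraph_iso_map_inv[OF \<psi>]]
        digraph_iso_map_comp[OF digraph_iso_map_comp[OF digraph_iso_map_inv[OF \<phi>]] \<psi>] by blast
  qed
  have okD: "digraph_lists_ok D \<and> ok (graph_of D) \<longleftrightarrow> (\<exists>A X. C A X \<and> presents_shift D X)" for D
  proof -
    have fin: "finite (nodes (graph_of D))" by (simp add: graph_of_def)
    have "digraph_lists_ok D \<and> ok (graph_of D) \<longleftrightarrow>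
        digraph_lists_ok D \<and> (\<exists>A X \<phi>. C A X \<and> digraph_iso_map \<phi> (graph_of D) (structure_graph X))"
      using ok[OF fin wf_graph_of[of D]] by blast
    also have "\<dots> \<longleftrightarrow> (\<exists>A X. C A X \<and> presents_shift D X)"
      using pres[of _ _ D] by blast
    finally show ?thesis .
  qed
  have "{encode_digraph D @ encode_digraph D' | D D' A X B Y.
        C A X \<and> C B Y \<and> presents_shift D X \<and> presents_shift D' Y \<and> P (conjugate A X B Y)}
      = {enc_digraphs p | p. digraphs_ok ok p \<and> P (digraphs_iso p)}" (is "?L = ?R") for P
  proof (intro equalityI subsetI)
    fix w assume "w \<in> ?L"
    then obtain D D' A X B Y where w: "w = encode_digraph D @ encode_digraph D'" "C A X" "C B Y"
      "presents_shift D X" "presents_shift D' Y" "P (conjugate A X B Y)" by blast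
    have "P (digraphs_iso (D, D'))" using conj'[OF w(2-5)] w(6) by simp
    moreover have "digraphs_ok ok (D, D')"
    proof -
      have "digraph_lists_ok D \<and> ok (graph_of D)" unfolding okD using w(2,4) by (intro exI conjI)
      moreover have "digraph_lists_ok D' \<and> ok (graph_of D')" unfolding okD using w(3,5) by (intro exI conjI)
      ultimately show ?thesis by (simp add: digraphs_ok_def)
    qed
    moreover have "w = enc_digraphs (D, D')" using w(1) by (simp add: enc_digraphs_def)
    ultimately have "w = enc_digraphs (D, D') \<and> digraphs_ok ok (D, D') \<and> P (digraphs_iso (D, D'))"
      by (intro conjI)
    then show "w \<in> ?R" unfolding mem_Collect_eq by (rule exI)
  next
    fix w assume "w \<in> ?R"
    then obtain p where p: "w = enc_digraphs p" "digraphs_ok ok p" "P (digraphs_iso p)" by blast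
    obtain A X where X: "C A X" "presents_shift (fst p) X"
    proof -
      have "digraph_lists_ok (fst p) \<and> ok (graph_of (fst p))" using p(2) by (simp add: digraphs_ok_def)
      then show ?thesis unfolding okD using that by blast
    qed
    obtain B Y where Y: "C B Y" "presents_shift (snd p) Y"
    proof -
      have "digraph_lists_ok (snd p) \<and> ok (graph_of (snd p))" using p(2) by (simp add: digraphs_ok_def)
      then show ?thesis unfolding okD using that by blast
    qed
    have "P (conjugate A X B Y)" using conj'[OF X(1) Y(1) X(2) Y(2)] p(3) by simp
    moreover have "w = encode_digraph (fst p) @ encode_digraph (snd p)"
      using p(1) by (simp add: enc_digraphs_def)
    ultimately have "w = encode_digraph (fst p) @ encode_digraph (snd p) \<and> C A X \<and> C B Y \<and>
        presents_shift (fst p) X \<and> presents_shift (snd p) Y \<and> P (conjugate A X B Y)"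
      using X Y by (intro conjI)
    then show "w \<in> ?L" unfolding mem_Collect_eq
      by - (rule exI[of _ "fst p"], rule exI[of _ "snd p"], rule exI[of _ A], rule exI[of _ X],
          rule exI[of _ B], rule exI[of _ Y])
  qed
  note eq = this[of "\<lambda>b. b"] this[of Not]
  show ?thesis unfolding conjugacy_problem_def problem_of_def eq ..
qed

section \<open>From labeled digraphs to graphs\<close>

text \<open>A node becomes a vertex, an edge \<open>e\<close> becomes a path from the source of \<open>e\<close> over two vertices to
  the target of \<open>e\<close>. These core vertices are told apart, and the labels are encoded, by the numbers of
  leaves attached to them. All core vertices have at least two leaves.\<close>

type_synonym core = "nat \<times> nat \<times> edge_label \<times> nat"
type_synonym vertex = "core \<times> nat \<times> edge_label"

definition core_id :: "nat \<times> edge_label" where "core_id = (0, Rotation)"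

text \<open>A node has 2 leaves, the first vertex of an edge has 3, and the second one has 4 plus
  the position of its label in \<open>L\<close>. Positions are used because a label is given in
  binary, so that attaching as many leaves as its value would make the graph exponentially
  large.\<close>

definition leaf_ids :: "edge_label list \<Rightarrow> core \<Rightarrow> (nat \<times> edge_label) list" where
  "leaf_ids L c = (if fst c = 0 then [(1, Rotation), (2, Rotation)]
     else if fst c = 1 then [(1, Rotation), (2, Rotation), (3, Rotation)]
     else [(1, Rotation), (2, Rotation), (3, Rotation), (4, Rotation)] @
       map (\<lambda>l. (5, l)) (takeWhile (\<lambda>l. l \<noteq> fst (snd (snd c))) L))"

definition cores :: "dlists \<Rightarrow> core list" where
  "cores D = map (\<lambda>u. (0, u, Rotation, u)) (fst D) @ map (\<lambda>e. (1, e)) (snd D) @ map (\<lambda>e. (2, e)) (snd D)"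

definition core_vertices :: "edge_label list \<Rightarrow> dlists \<Rightarrow> vertex list" where
  "core_vertices L D = concat (map (\<lambda>c. (c, core_id) # map (\<lambda>i. (c, i)) (leaf_ids L c)) (cores D))"

definition core_edges :: "edge_label list \<Rightarrow> dlists \<Rightarrow> (vertex \<times> vertex) list" where
  "core_edges L D =
     concat (map (\<lambda>c. map (\<lambda>i. ((c, core_id), (c, i))) (leaf_ids L c)) (cores D)) @
     map (\<lambda>e. (((0, fst e, Rotation, fst e), core_id), ((1, e), core_id))) (snd D) @
     map (\<lambda>e. (((1, e), core_id), ((2, e), core_id))) (snd D) @
     map (\<lambda>e. (((0, snd (snd e), Rotation, snd (snd e)), core_id), ((2, e), core_id))) (snd D)"

definition to_ugraph :: "edge_label list \<Rightarrow> dlists \<Rightarrow> ulists" where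
  "to_ugraph L D = (dedup (map name (core_vertices L D)),
     dedup (map (\<lambda>p. (name (fst p), name (snd p))) (core_edges L D)))"

text \<open>One list for both digraphs, so that equal labels receive equal numbers of
  leaves.\<close>

definition labels_of :: "dlists \<times> dlists \<Rightarrow> edge_label list" where
  "labels_of p = dedup (map (\<lambda>e. fst (snd e)) (snd (fst p) @ snd (snd p)))"

definition to_ugraphs :: "dlists \<times> dlists \<Rightarrow> ulists \<times> ulists" where
  "to_ugraphs p = (to_ugraph (labels_of p) (fst p), to_ugraph (labels_of p) (snd p))"

lemma pt_to_ugraphs: "pt to_ugraphs"
proof -
  have l: "pt labels_of" unfolding labels_of_def by (intro pt_basic pt_lists)
  have ids: "pt (\<lambda>p :: edge_label list \<times> core. leaf_ids (fst p) (snd p))"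
    unfolding leaf_ids_def by (intro pt_basic pt_lists)
  have ids': "pt (\<lambda>x. leaf_ids (f x) (g x))" if "pt f" "pt g"
    for f :: "'a::treeable \<Rightarrow> edge_label list" and g
    using pt_compose[OF ids pt_pair[OF that]] by simp
  have u: "pt (\<lambda>p. to_ugraph (fst p) (snd p))"
    unfolding to_ugraph_def core_vertices_def core_edges_def cores_def
    by (intro pt_basic pt_lists pt_name ids')
  have u': "pt (\<lambda>x. to_ugraph (f x) (g x))" if "pt f" "pt g"
    for f :: "'a::treeable \<Rightarrow> edge_label list" and g
    using pt_compose[OF u pt_pair[OF that]] by simp
  show ?thesis unfolding to_ugraphs_def by (intro pt_basic u' l pt_compose[OF l])
qed

definition core_graph :: "edge_label list \<Rightarrow> dlists \<Rightarrow> vertex set \<times> (vertex \<times> vertex) set" where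
  "core_graph L D = (set (core_vertices L D), set (core_edges L D))"

lemma to_ugraph_name: "adj_iso_map name (core_graph L D) (ugraph_of (to_ugraph L D))"
proof -
  let ?E = "set (core_edges L D)"
  have "bij_betw name (set (core_vertices L D)) (name ` set (core_vertices L D))"
    by (rule inj_on_imp_bij_betw) (auto simp: inj_on_def inj_name)
  moreover have "(name u, name v) \<in> (\<lambda>p. (name (fst p), name (snd p))) ` ?E \<longleftrightarrow> (u, v) \<in> ?E" for u v
    by (auto simp: image_iff inj_name intro!: bexI[of _ "(u, v)"])
  then have "adjacent ((\<lambda>p. (name (fst p), name (snd p))) ` ?E) (name u) (name v) \<longleftrightarrow> adjacent ?E u v" for u v
    unfolding adjacent_def by simp
  with \<open>bij_betw _ _ _\<close> show ?thesis
    by (simp add: adj_iso_map_def core_graph_def ugraph_of_def to_ugraph_def)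
qed

lemma leaf_ids_pos: "i \<in> set (leaf_ids L c) \<Longrightarrow> i \<noteq> core_id"
  by (auto simp: leaf_ids_def core_id_def split: if_splits)

lemma distinct_leaf_ids: "distinct L \<Longrightarrow> distinct (leaf_ids L c)"
  by (auto simp: leaf_ids_def distinct_map inj_on_def distinct_takeWhile)

lemma core_vertices_iff:
  "(c, i) \<in> set (core_vertices L D) \<longleftrightarrow> c \<in> set (cores D) \<and> (i = core_id \<or> i \<in> set (leaf_ids L c))"
  by (auto simp: core_vertices_def)

lemma cores_iff: "(t, u, l, v) \<in> set (cores D) \<longleftrightarrow>
    t = 0 \<and> u \<in> set (fst D) \<and> l = Rotation \<and> v = u \<or> (t = 1 \<or> t = 2) \<and> (u, l, v) \<in> set (snd D)"
  by (auto simp: cores_def)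

definition core_adj :: "(nat \<times> edge_label \<times> nat) set \<Rightarrow> core \<Rightarrow> core \<Rightarrow> bool" where
  "core_adj E c d \<longleftrightarrow> (\<exists>e\<in>E. (c = (0, fst e, Rotation, fst e) \<and> d = (1, e)) \<or> (c = (1, e) \<and> d = (2, e)) \<or>
     (c = (0, snd (snd e), Rotation, snd (snd e)) \<and> d = (2, e)))"

lemma core_edges_iff: "((c, i), (d, j)) \<in> set (core_edges L D) \<longleftrightarrow>
    (c = d \<and> c \<in> set (cores D) \<and> i = core_id \<and> j \<in> set (leaf_ids L c)) \<or>
    (i = core_id \<and> j = core_id \<and> core_adj (set (snd D)) c d)"
  unfolding core_edges_def core_adj_def by (auto simp: image_iff) 

lemma ugraph_lists_ok_to_ugraph:
  assumes D: "digraph_lists_ok D"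
  shows "ugraph_lists_ok (to_ugraph L D)"
proof -
  have in_V: "(c, i) \<in> set (core_vertices L D) \<and> (d, j) \<in> set (core_vertices L D)"
    if "((c, i), (d, j)) \<in> set (core_edges L D)" for c i d j
    using that D unfolding core_edges_iff core_vertices_iff core_adj_def digraph_lists_ok_def
    by (auto simp: cores_def)
  \<comment> \<open>Every listed edge leads from a smaller to a larger kind of core vertex, or from
    a core vertex to a leaf. So no edge is a loop, and none is listed in both orientations.\<close>
  have rank: "fst (fst a) < fst (fst b) \<or> (fst a = fst b \<and> snd a = core_id \<and> snd b \<noteq> core_id)"
    if "(a, b) \<in> set (core_edges L D)" for a b
  proof -
    obtain c i d j where ab: "a = (c, i)" "b = (d, j)" by (metis prod.exhaust)
    show ?thesis
      using that leaf_ids_pos[of j L c] unfolding ab core_edges_iff core_adj_def by auto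
  qed
  have "fst e \<in> name ` set (core_vertices L D) \<and> snd e \<in> name ` set (core_vertices L D) \<and> fst e \<noteq> snd e \<and>
      (snd e, fst e) \<notin> (\<lambda>p. (name (fst p), name (snd p))) ` set (core_edges L D)"
    if e: "e \<in> (\<lambda>p. (name (fst p), name (snd p))) ` set (core_edges L D)" for e
  proof -
    obtain p where "p \<in> set (core_edges L D)" "e = (name (fst p), name (snd p))" using e by (rule imageE)
    then obtain a b where ab: "(a, b) \<in> set (core_edges L D)" "e = (name a, name b)"
      by (metis prod.collapse)
    have "a \<noteq> b" "(b, a) \<notin> set (core_edges L D)" using rank[OF ab(1)] rank[of b a] by auto
    moreover have "a \<in> set (core_vertices L D)" "b \<in> set (core_vertices L D)"
      using in_V[of "fst a" "snd a" "fst b" "snd b"] ab(1) by auto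
    ultimately show ?thesis using ab(2) by (auto simp: inj_name)
  qed
  then show ?thesis by (simp add: ugraph_lists_ok_def to_ugraph_def)
qed

section \<open>Degrees and numbers of leaves as invariants\<close>

definition nbrs :: "'v set \<times> ('v \<times> 'v) set \<Rightarrow> 'v \<Rightarrow> 'v set" where
  "nbrs G u = {v \<in> fst G. adjacent (snd G) u v}"

definition leaf_count :: "'v set \<times> ('v \<times> 'v) set \<Rightarrow> 'v \<Rightarrow> nat" where
  "leaf_count G u = card {v \<in> nbrs G u. card (nbrs G v) = 1}"

lemma adj_iso_nbrs:
  assumes "adj_iso_map \<phi> G H" "u \<in> fst G"
  shows "nbrs H (\<phi> u) = \<phi> ` nbrs G u" "card (nbrs H (\<phi> u)) = card (nbrs G u)"
proof -
  have bij: "bij_betw \<phi> (fst G) (fst H)" using assms by (simp add: adj_iso_map_def)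
  show im: "nbrs H (\<phi> u) = \<phi> ` nbrs G u"
  proof (intro equalityI subsetI)
    fix w assume w: "w \<in> nbrs H (\<phi> u)"
    then have "w \<in> \<phi> ` fst G" using bij by (simp add: nbrs_def bij_betw_def)
    then obtain v where v: "v \<in> fst G" "w = \<phi> v" by blast
    then have "adjacent (snd G) u v" using w assms by (simp add: nbrs_def adj_iso_map_def)
    then show "w \<in> \<phi> ` nbrs G u" using v by (simp add: nbrs_def)
  next
    fix w assume "w \<in> \<phi> ` nbrs G u"
    then obtain v where v: "v \<in> fst G" "adjacent (snd G) u v" "w = \<phi> v" by (auto simp: nbrs_def)
    then show "w \<in> nbrs H (\<phi> u)"
      using assms bij_betwE[OF bij] by (simp add: nbrs_def adj_iso_map_def)
  qed
  have "inj_on \<phi> (nbrs G u)"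
    using bij by (auto simp: bij_betw_def nbrs_def intro: inj_on_subset)
  then show "card (nbrs H (\<phi> u)) = card (nbrs G u)" unfolding im by (rule card_image)
qed

lemma adj_iso_leaf_count:
  assumes "adj_iso_map \<phi> G H" "u \<in> fst G"
  shows "leaf_count H (\<phi> u) = leaf_count G u"
proof -
  have bij: "bij_betw \<phi> (fst G) (fst H)" using assms by (simp add: adj_iso_map_def)
  have "{v \<in> nbrs H (\<phi> u). card (nbrs H v) = 1} = \<phi> ` {v \<in> nbrs G u. card (nbrs G v) = 1}"
    using adj_iso_nbrs[OF assms(1)] assms(2) by (auto simp: nbrs_def)
  moreover have "inj_on \<phi> {v \<in> nbrs G u. card (nbrs G v) = 1}"
    using bij by (auto simp: bij_betw_def nbrs_def intro: inj_on_subset)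
  ultimately show ?thesis by (simp add: leaf_count_def card_image)
qed

lemma core_adjacent_iff:
  "adjacent (snd (core_graph L D)) (c, i) (d, j) \<longleftrightarrow>
    (c = d \<and> c \<in> set (cores D) \<and>
      (i = core_id \<and> j \<in> set (leaf_ids L c) \<or> j = core_id \<and> i \<in> set (leaf_ids L c))) \<or>
    (i = core_id \<and> j = core_id \<and> (core_adj (set (snd D)) c d \<or> core_adj (set (snd D)) d c))"
  unfolding adjacent_def core_graph_def snd_conv core_edges_iff by blast

lemma nbrs_leaf:
  assumes "c \<in> set (cores D)" "i \<in> set (leaf_ids L c)"
  shows "nbrs (core_graph L D) (c, i) = {(c, core_id)}"
proof (intro equalityI subsetI)
  fix w assume "w \<in> nbrs (core_graph L D) (c, i)"
  then show "w \<in> {(c, core_id)}"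
    using leaf_ids_pos[OF assms(2)] leaf_ids_pos[of core_id L c]
    by (cases w) (auto simp: nbrs_def core_adjacent_iff)
next
  fix w assume "w \<in> {(c, core_id)}"
  then show "w \<in> nbrs (core_graph L D) (c, i)"
    using assms by (simp add: nbrs_def core_adjacent_iff) (simp add: core_graph_def core_vertices_iff)
qed

lemma leaf_ids_two: "{(1, Rotation), (2, Rotation)} \<subseteq> set (leaf_ids L c)"
  by (auto simp: leaf_ids_def)

text \<open>The two leaves that every core vertex has keep its degree away from 1. Together with
  \<open>nbrs_leaf\<close> this makes the vertices of degree 1 exactly the leaves, so isomorphisms
  preserve core vertices.\<close>

lemma nbrs_core_card:
  assumes "c \<in> set (cores D)"
  shows "card (nbrs (core_graph L D) (c, core_id)) \<noteq> 1"
proof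
  assume "card (nbrs (core_graph L D) (c, core_id)) = 1"
  then obtain w where w: "nbrs (core_graph L D) (c, core_id) = {w}" by (auto simp: card_1_singleton_iff)
  have "(c, i) \<in> nbrs (core_graph L D) (c, core_id)" if "i \<in> set (leaf_ids L c)" for i
    using that assms by (simp add: nbrs_def core_adjacent_iff) (simp add: core_graph_def core_vertices_iff)
  then have "(c, 1, Rotation) = w" "(c, 2, Rotation) = w"
    using leaf_ids_two[of L c] w by auto
  then show False by auto
qed

lemma leaf_count_core:
  assumes c: "c \<in> set (cores D)" and L: "distinct L"
  shows "leaf_count (core_graph L D) (c, core_id) = length (leaf_ids L c)"
proof -
  have "{w \<in> nbrs (core_graph L D) (c, core_id). card (nbrs (core_graph L D) w) = 1}
      = (\<lambda>i. (c, i)) ` set (leaf_ids L c)"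
  proof (intro equalityI subsetI)
    fix w assume w: "w \<in> {w \<in> nbrs (core_graph L D) (c, core_id). card (nbrs (core_graph L D) w) = 1}"
    obtain d j where dj: "w = (d, j)" by (cases w)
    have "(d, j) \<in> set (core_vertices L D)" using w dj by (simp add: nbrs_def core_graph_def)
    then have "d \<in> set (cores D)" by (simp add: core_vertices_iff)
    from nbrs_core_card[OF this, of L] have "j \<noteq> core_id" using w dj by auto
    then show "w \<in> (\<lambda>i. (c, i)) ` set (leaf_ids L c)"
      using w dj leaf_ids_pos[of core_id L c] by (auto simp: nbrs_def core_adjacent_iff)
  next
    fix w assume "w \<in> (\<lambda>i. (c, i)) ` set (leaf_ids L c)"
    then obtain i where i: "i \<in> set (leaf_ids L c)" "w = (c, i)" by blast
    then show "w \<in> {w \<in> nbrs (core_graph L D) (c, core_id). card (nbrs (core_graph L D) w) = 1}"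
      using nbrs_leaf[OF c i(1)] c
      by (simp add: nbrs_def[of _ "(c, core_id)"] core_adjacent_iff)
         (simp add: core_graph_def core_vertices_iff)
  qed
  moreover have "card ((\<lambda>i. (c, i)) ` set (leaf_ids L c)) = length (leaf_ids L c)"
    using distinct_card[OF distinct_leaf_ids[OF L]] by (subst card_image) (auto simp: inj_on_def)
  ultimately show ?thesis by (simp add: leaf_count_def)
qed

lemma length_leaf_ids_eq:
  assumes c: "(t, u, l, v) \<in> set (cores D)" and d: "(t', u', l', v') \<in> set (cores D')"
    and eq: "length (leaf_ids L (t, u, l, v)) = length (leaf_ids L (t', u', l', v'))"
    and L: "t = 2 \<Longrightarrow> l \<in> set L" "t' = 2 \<Longrightarrow> l' \<in> set L"
  shows "t = t'" "t = 2 \<Longrightarrow> l = l'"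
proof -
  have t: "t = 0 \<or> t = 1 \<or> t = 2" "t' = 0 \<or> t' = 1 \<or> t' = 2" using c d by (auto simp: cores_iff)
  then show tt: "t = t'" using eq by (auto simp: leaf_ids_def)
  assume "t = 2"
  then have len: "length (takeWhile (\<lambda>x. x \<noteq> l) L) = length (takeWhile (\<lambda>x. x \<noteq> l') L)"
    using eq tt by (simp add: leaf_ids_def)
  \<comment> \<open>The number of entries before the first occurrence of \<open>k\<close> is the
    position of \<open>k\<close>, so equal numbers of leaves give equal labels.\<close>
  have "L ! length (takeWhile (\<lambda>x. x \<noteq> k) L) = k" if "k \<in> set L" for k
  proof -
    have "length (takeWhile (\<lambda>x. x \<noteq> k) L) < length L"
      using that by (induction L) auto
    from nth_length_takeWhile[OF this] show ?thesis by simp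
  qed
  then show "l = l'" using len L \<open>t = 2\<close> tt by metis
qed

definition rename :: "(nat \<Rightarrow> nat) \<Rightarrow> vertex \<Rightarrow> vertex" where
  "rename \<phi> = (\<lambda>((t, u, l, v), i). ((t, \<phi> u, l, \<phi> v), i))"

text \<open>An isomorphism of digraphs simply renames the cores. Conversely, an isomorphism of the
  core graphs preserves degrees and leaf counts, which recovers nodes, directed edges and
  labels.\<close>

lemma to_ugraph_iso:
  assumes ok: "digraph_lists_ok D" "digraph_lists_ok D'" and L: "distinct L"
    "(\<lambda>e. fst (snd e)) ` (set (snd D) \<union> set (snd D')) \<subseteq> set L"
  shows "(\<exists>\<psi>. adj_iso_map \<psi> (core_graph L D) (core_graph L D')) \<longleftrightarrow>
    (\<exists>\<phi>. digraph_iso_map \<phi> (graph_of D) (graph_of D'))"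
proof
  assume "\<exists>\<phi>. digraph_iso_map \<phi> (graph_of D) (graph_of D')"
  then obtain \<phi> where bij: "bij_betw \<phi> (set (fst D)) (set (fst D'))"
    and edge: "\<And>u l v. u \<in> set (fst D) \<Longrightarrow> v \<in> set (fst D) \<Longrightarrow>
      (u, l, v) \<in> set (snd D) \<longleftrightarrow> (\<phi> u, l, \<phi> v) \<in> set (snd D')"
    by (auto simp: digraph_iso_map_def graph_of_def)
  have ends: "u \<in> set (fst D)" "v \<in> set (fst D)" if "(u, l, v) \<in> set (snd D)" for u l v
    using ok(1) that by (auto simp: digraph_lists_ok_def)
  have ends': "u \<in> set (fst D')" "v \<in> set (fst D')" if "(u, l, v) \<in> set (snd D')" for u l v
    using ok(2) that by (auto simp: digraph_lists_ok_def)
  have inj: "\<phi> u = \<phi> v \<longleftrightarrow> u = v" if "u \<in> set (fst D)" "v \<in> set (fst D)" for u v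
    using bij that by (auto simp: bij_betw_def inj_on_eq_iff)
  have surj: "\<exists>u\<in>set (fst D). w = \<phi> u" if "w \<in> set (fst D')" for w
  proof -
    have "w \<in> \<phi> ` set (fst D)" using bij that by (simp add: bij_betw_def)
    then show ?thesis by blast
  qed
  have core: "(t, \<phi> u, l, \<phi> v) \<in> set (cores D') \<longleftrightarrow> (t, u, l, v) \<in> set (cores D)"
    if uv: "u \<in> set (fst D)" "v \<in> set (fst D)" for t u l v
    using uv edge[OF uv] inj[OF uv] inj[OF uv(2,1)] bij_betwE[OF bij] unfolding cores_iff by auto
  have core_ends: "u \<in> set (fst D)" "v \<in> set (fst D)" if "(t, u, l, v) \<in> set (cores D)" for t u l v
    using that ends unfolding cores_iff by auto
  have core_ends': "u \<in> set (fst D')" "v \<in> set (fst D')" if "(t, u, l, v) \<in> set (cores D')" for t u l v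
    using that ends' unfolding cores_iff by auto
  have ids: "leaf_ids L (t, a, l, b) = leaf_ids L (t, u, l, v)" for t a l b u v
    by (simp add: leaf_ids_def)
  have "bij_betw (rename \<phi>) (set (core_vertices L D)) (set (core_vertices L D'))"
    unfolding bij_betw_def
  proof
    show "inj_on (rename \<phi>) (set (core_vertices L D))"
    proof (rule inj_onI)
      fix x y assume xy: "x \<in> set (core_vertices L D)" "y \<in> set (core_vertices L D)" "rename \<phi> x = rename \<phi> y"
      obtain t u l v i where x: "x = ((t, u, l, v), i)" by (metis prod.exhaust)
      obtain t' u' l' v' i' where y: "y = ((t', u', l', v'), i')" by (metis prod.exhaust)
      have c: "(t, u, l, v) \<in> set (cores D)" "(t', u', l', v') \<in> set (cores D)"
        using xy(1,2) by (auto simp: x y core_vertices_iff)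
      show "x = y"
        using xy(3) inj[OF core_ends(1)[OF c(1)] core_ends(1)[OF c(2)]]
          inj[OF core_ends(2)[OF c(1)] core_ends(2)[OF c(2)]]
        by (simp add: x y rename_def)
    qed
    show "rename \<phi> ` set (core_vertices L D) = set (core_vertices L D')"
    proof (intro equalityI subsetI)
      fix y assume "y \<in> rename \<phi> ` set (core_vertices L D)"
      then obtain t u l v i where x: "((t, u, l, v), i) \<in> set (core_vertices L D)"
        "y = ((t, \<phi> u, l, \<phi> v), i)"
        by (auto simp: rename_def)
      then show "y \<in> set (core_vertices L D')"
        using core[OF core_ends, of t u l v] ids[of t "\<phi> u" l "\<phi> v" u v] by (auto simp: core_vertices_iff)
    next
      fix y assume y: "y \<in> set (core_vertices L D')"
      obtain t a l b i where tab: "y = ((t, a, l, b), i)" by (metis prod.exhaust)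
      then have c: "(t, a, l, b) \<in> set (cores D')" using y by (simp add: core_vertices_iff)
      then obtain u v where uv: "u \<in> set (fst D)" "v \<in> set (fst D)" "a = \<phi> u" "b = \<phi> v"
        using surj core_ends' by blast
      then have "((t, u, l, v), i) \<in> set (core_vertices L D)"
        using y tab core[OF uv(1,2)] ids[of t a l b u v] by (simp add: core_vertices_iff)
      then show "y \<in> rename \<phi> ` set (core_vertices L D)"
        using uv tab by (intro image_eqI[of _ _ "((t, u, l, v), i)"]) (simp_all add: rename_def)
    qed
  qed
  moreover have "adjacent (snd (core_graph L D)) x y \<longleftrightarrow> adjacent (snd (core_graph L D')) (rename \<phi> x) (rename \<phi> y)"
    if xy: "x \<in> set (core_vertices L D)" "y \<in> set (core_vertices L D)" for x y
  proof -
    obtain t u l v i where x: "x = ((t, u, l, v), i)" by (metis prod.exhaust)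
    obtain t' u' l' v' i' where y: "y = ((t', u', l', v'), i')" by (metis prod.exhaust)
    have c: "(t, u, l, v) \<in> set (cores D)" "(t', u', l', v') \<in> set (cores D)"
      using xy by (auto simp: x y core_vertices_iff)
    note V = core_ends[OF c(1)] core_ends[OF c(2)]
    have adj: "core_adj (set (snd D')) (t, \<phi> u, l, \<phi> v) (t', \<phi> u', l', \<phi> v') \<longleftrightarrow>
        core_adj (set (snd D)) (t, u, l, v) (t', u', l', v')"
      if V: "u \<in> set (fst D)" "v \<in> set (fst D)" "u' \<in> set (fst D)" "v' \<in> set (fst D)" for t u l v t' u' l' v'
    proof -
      have iff: "core_adj E (t, a, l, b) (t', a', l', b') \<longleftrightarrow>
          (a', l', b') \<in> E \<and> ((t = 0 \<and> l = Rotation \<and> a = b \<and> (t' = 1 \<and> a = a' \<or> t' = 2 \<and> a = b')) \<or>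
            (t = 1 \<and> t' = 2 \<and> a = a' \<and> l = l' \<and> b = b'))" for E and a b a' b' :: nat
        unfolding core_adj_def by force
      show ?thesis unfolding iff using edge[OF V(3,4)] inj V by simp
    qed
    have c': "(t, \<phi> u, l, \<phi> v) \<in> set (cores D')" using core[OF V(1,2)] c(1) by simp
    have eq: "(t, \<phi> u, l, \<phi> v) = (t', \<phi> u', l', \<phi> v') \<longleftrightarrow> (t, u, l, v) = (t', u', l', v')"
      using inj V by simp
    show ?thesis
      unfolding x y rename_def prod.case core_adjacent_iff ids[of t "\<phi> u" l "\<phi> v" u v] eq
        adj[OF V] adj[OF V(3,4,1,2)]
      using c c' by blast
  qed
  ultimately show "\<exists>\<psi>. adj_iso_map \<psi> (core_graph L D) (core_graph L D')"
    unfolding adj_iso_map_def by (intro exI[of _ "rename \<phi>"]) (simp add: core_graph_def)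
next
  assume "\<exists>\<psi>. adj_iso_map \<psi> (core_graph L D) (core_graph L D')"
  then obtain \<psi> where \<psi>: "adj_iso_map \<psi> (core_graph L D) (core_graph L D')" by blast
  \<comment> \<open>Stated for arbitrary \<open>\<psi>\<close>, \<open>D\<close> and
    \<open>D'\<close>, so that it applies to the inverse as well: each direction yields a map on
    nodes that only preserves edges, and the two maps turn out to be inverse to each other.\<close>
  have to_edge: "\<exists>\<phi>. (\<forall>u\<in>set (fst D). \<phi> u \<in> set (fst D') \<and>
        \<psi> ((0, u, Rotation, u), core_id) = ((0, \<phi> u, Rotation, \<phi> u), core_id)) \<and>
      (\<forall>(u, l, v)\<in>set (snd D). (\<phi> u, l, \<phi> v) \<in> set (snd D'))"
    if \<psi>: "adj_iso_map \<psi> (core_graph L D) (core_graph L D')"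
      and ok: "digraph_lists_ok D" "digraph_lists_ok D'"
      and L2: "(\<lambda>e. fst (snd e)) ` (set (snd D) \<union> set (snd D')) \<subseteq> set L" for \<psi> D D'
  proof -
    have lab: "l \<in> set L" if "(2 :: nat, u, l, v) \<in> set (cores D) \<or> (2, u, l, v) \<in> set (cores D')" for u l v
    proof -
      have "(u, l, v) \<in> set (snd D) \<union> set (snd D')" using that by (auto simp: cores_iff)
      then have "fst (snd (u, l, v)) \<in> (\<lambda>e. fst (snd e)) ` (set (snd D) \<union> set (snd D'))" by (rule imageI)
      then show ?thesis using L2 by auto
    qed
    \<comment> \<open>The degree excludes leaves as images of core vertices, and the number of
      leaves then fixes the kind and, for kind 2, the label.\<close>
    have core: "\<exists>u' l' v'. \<psi> ((t, u, l, v), core_id) = ((t, u', l', v'), core_id) \<and>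
        (t, u', l', v') \<in> set (cores D') \<and> (t = 2 \<longrightarrow> l' = l)"
      if c: "(t, u, l, v) \<in> set (cores D)" for t u l v
    proof -
      have x: "((t, u, l, v), core_id) \<in> fst (core_graph L D)"
        using c by (simp add: core_graph_def core_vertices_iff)
      have "bij_betw \<psi> (fst (core_graph L D)) (fst (core_graph L D'))" using \<psi> by (simp add: adj_iso_map_def)
      then have y: "\<psi> ((t, u, l, v), core_id) \<in> fst (core_graph L D')" using x bij_betwE by blast
      obtain t' u' l' v' i where t': "\<psi> ((t, u, l, v), core_id) = ((t', u', l', v'), i)" by (metis prod.exhaust)
      have c': "(t', u', l', v') \<in> set (cores D')" "i = core_id \<or> i \<in> set (leaf_ids L (t', u', l', v'))"
        using y unfolding t' by (auto simp: core_graph_def core_vertices_iff)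
      have "card (nbrs (core_graph L D') (\<psi> ((t, u, l, v), core_id))) \<noteq> 1"
        using adj_iso_nbrs(2)[OF \<psi> x] nbrs_core_card[OF c] by simp
      have i: "i = core_id"
      proof (rule ccontr)
        assume "i \<noteq> core_id"
        then have "i \<in> set (leaf_ids L (t', u', l', v'))" using c'(2) by blast
        from nbrs_leaf[OF c'(1) this] show False
          using \<open>card (nbrs (core_graph L D') (\<psi> ((t, u, l, v), core_id))) \<noteq> 1\<close> unfolding t' by simp
      qed
      have len: "length (leaf_ids L (t, u, l, v)) = length (leaf_ids L (t', u', l', v'))"
        using adj_iso_leaf_count[OF \<psi> x] leaf_count_core[OF c L(1)] leaf_count_core[OF c'(1) L(1)]
        unfolding t' i by simp
      have l: "l \<in> set L" if "t = 2" using lab[of u l v] c that by simp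
      have l': "l' \<in> set L" if "t' = 2" using lab[of u' l' v'] c'(1) that by simp
      note eq = length_leaf_ids_eq[OF c c'(1) len l l']
      have "\<psi> ((t, u, l, v), core_id) = ((t, u', l', v'), core_id)" using t' i eq(1) by simp
      moreover have "(t, u', l', v') \<in> set (cores D')" using c'(1) eq(1) by simp
      moreover have "t = 2 \<longrightarrow> l' = l" using eq(2) by simp
      ultimately show ?thesis by blast
    qed
    have node: "\<exists>u'\<in>set (fst D'). \<psi> ((0, u, Rotation, u), core_id) = ((0, u', Rotation, u'), core_id)"
      if "u \<in> set (fst D)" for u
      using core[of 0 u Rotation u] that by (auto simp: cores_iff)
    define \<phi> where "\<phi> u = (SOME u'. u' \<in> set (fst D') \<and>
        \<psi> ((0, u, Rotation, u), core_id) = ((0, u', Rotation, u'), core_id))" for u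
    have \<phi>: "\<phi> u \<in> set (fst D') \<and> \<psi> ((0, u, Rotation, u), core_id) = ((0, \<phi> u, Rotation, \<phi> u), core_id)"
      if "u \<in> set (fst D)" for u
      unfolding \<phi>_def by (rule someI_ex) (use node[OF that] in blast)
    have "(\<phi> u, l, \<phi> v) \<in> set (snd D')" if e: "(u, l, v) \<in> set (snd D)" for u l v
    proof -
      have uv: "u \<in> set (fst D)" "v \<in> set (fst D)" using e ok(1) by (auto simp: digraph_lists_ok_def)
      have c1: "(1, u, l, v) \<in> set (cores D)" and c2: "(2, u, l, v) \<in> set (cores D)"
        and cu: "(0, u, Rotation, u) \<in> set (cores D)" and cv: "(0, v, Rotation, v) \<in> set (cores D)"
        using e uv by (auto simp: cores_iff)
      obtain a1 l1 b1 where s: "\<psi> ((1, u, l, v), core_id) = ((1, a1, l1, b1), core_id)"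
        using core[OF c1] by blast
      obtain a2 b2 where t: "\<psi> ((2, u, l, v), core_id) = ((2, a2, l, b2), core_id)"
        using core[OF c2] by blast
      have iff: "core_adj E (t, a, l, b) (t', a', l', b') \<longleftrightarrow>
          (a', l', b') \<in> E \<and> ((t = 0 \<and> l = Rotation \<and> a = b \<and> (t' = 1 \<and> a = a' \<or> t' = 2 \<and> a = b')) \<or>
            (t = 1 \<and> t' = 2 \<and> a = a' \<and> l = l' \<and> b = b'))"
        for E and a b a' b' t t' :: nat and l l'
        unfolding core_adj_def by force
      have tr: "adjacent (snd (core_graph L D')) (\<psi> x) (\<psi> y)"
        if "x \<in> fst (core_graph L D)" "y \<in> fst (core_graph L D)" "adjacent (snd (core_graph L D)) x y" for x y
        using \<psi> that unfolding adj_iso_map_def by blast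
      have V: "(c, core_id) \<in> fst (core_graph L D)" if "c \<in> set (cores D)" for c
        using that by (simp add: core_graph_def core_vertices_iff)
      have nid: "core_id \<notin> set (leaf_ids L c)" for c using leaf_ids_pos by blast
      \<comment> \<open>The images of the two inner vertices of an edge path are adjacent, hence
        inner vertices of one edge. The node next to the one of kind 1 is its source, the node next
        to the one of kind 2 is its target.\<close>
      have "adjacent (snd (core_graph L D')) ((1, a1, l1, b1), core_id) ((2, a2, l, b2), core_id)"
        using tr[OF V[OF c1] V[OF c2]] e unfolding s t by (simp add: core_adjacent_iff iff)
      then have 1: "(a2, l, b2) \<in> set (snd D')" "a1 = a2" "l1 = l" "b1 = b2"
        using nid by (auto simp: core_adjacent_iff iff)
      have "adjacent (snd (core_graph L D')) ((0, \<phi> u, Rotation, \<phi> u), core_id) ((1, a1, l1, b1), core_id)"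
        using tr[OF V[OF cu] V[OF c1]] e \<phi>[OF uv(1)] unfolding s by (simp add: core_adjacent_iff iff)
      then have 2: "\<phi> u = a1"
        using nid by (auto simp: core_adjacent_iff iff)
      have "adjacent (snd (core_graph L D')) ((0, \<phi> v, Rotation, \<phi> v), core_id) ((2, a2, l, b2), core_id)"
        using tr[OF V[OF cv] V[OF c2]] e \<phi>[OF uv(2)] unfolding t by (simp add: core_adjacent_iff iff)
      then have 3: "\<phi> v = b2"
        using nid by (auto simp: core_adjacent_iff iff)
      show ?thesis using 1 2 3 by simp
    qed
    then show ?thesis using \<phi> by blast
  qed
  let ?\<chi> = "inv_into (fst (core_graph L D)) \<psi>"
  have bij: "bij_betw \<psi> (fst (core_graph L D)) (fst (core_graph L D'))" using \<psi> by (simp add: adj_iso_map_def)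
  obtain \<phi> where \<phi>: "\<And>u. u \<in> set (fst D) \<Longrightarrow> \<phi> u \<in> set (fst D') \<and>
        \<psi> ((0, u, Rotation, u), core_id) = ((0, \<phi> u, Rotation, \<phi> u), core_id)"
    "\<And>u l v. (u, l, v) \<in> set (snd D) \<Longrightarrow> (\<phi> u, l, \<phi> v) \<in> set (snd D')"
    using to_edge[OF \<psi> ok L(2)] by blast
  have L2: "(\<lambda>e. fst (snd e)) ` (set (snd D') \<union> set (snd D)) \<subseteq> set L" using L(2) by blast
  obtain \<theta> where \<theta>: "\<And>u. u \<in> set (fst D') \<Longrightarrow> \<theta> u \<in> set (fst D) \<and>
        ?\<chi> ((0, u, Rotation, u), core_id) = ((0, \<theta> u, Rotation, \<theta> u), core_id)"
    "\<And>u l v. (u, l, v) \<in> set (snd D') \<Longrightarrow> (\<theta> u, l, \<theta> v) \<in> set (snd D)"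
    using to_edge[OF adj_iso_map_inv[OF \<psi>] ok(2,1) L2] by blast
  have V: "((0, u, Rotation, u), core_id) \<in> fst (core_graph L D)" if "u \<in> set (fst D)" for u
    using that by (simp add: core_graph_def core_vertices_iff cores_iff)
  have V': "((0, u, Rotation, u), core_id) \<in> fst (core_graph L D')" if "u \<in> set (fst D')" for u
    using that by (simp add: core_graph_def core_vertices_iff cores_iff)
  have \<theta>\<phi>: "\<theta> (\<phi> u) = u" if "u \<in> set (fst D)" for u
  proof -
    have "?\<chi> (\<psi> ((0, u, Rotation, u), core_id)) = ((0, u, Rotation, u), core_id)"
      by (rule inv_into_f_f[OF bij_betw_imp_inj_on[OF bij] V[OF that]])
    then show ?thesis using \<phi>(1)[OF that] \<theta>(1)[of "\<phi> u"] by simp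
  qed
  have \<phi>\<theta>: "\<phi> (\<theta> u) = u" if "u \<in> set (fst D')" for u
  proof -
    have "\<psi> (?\<chi> ((0, u, Rotation, u), core_id)) = ((0, u, Rotation, u), core_id)"
      by (rule bij_betw_inv_into_right[OF bij V'[OF that]])
    then show ?thesis using \<theta>(1)[OF that] \<phi>(1)[of "\<theta> u"] by simp
  qed
  have "bij_betw \<phi> (set (fst D)) (set (fst D'))"
    by (rule bij_betwI[where g = \<theta>]) (use \<phi>(1) \<theta>(1) \<theta>\<phi> \<phi>\<theta> in auto)
  moreover have "(u, l, v) \<in> set (snd D) \<longleftrightarrow> (\<phi> u, l, \<phi> v) \<in> set (snd D')"
    if "u \<in> set (fst D)" "v \<in> set (fst D)" for u l v
    using \<phi>(2)[of u l v] \<theta>(2)[of "\<phi> u" l "\<phi> v"] \<theta>\<phi> that by auto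
  ultimately show "\<exists>\<phi>. digraph_iso_map \<phi> (graph_of D) (graph_of D')"
    unfolding digraph_iso_map_def by (intro exI[of _ \<phi>]) (simp add: graph_of_def)
qed

lemma to_ugraphs_correct:
  assumes "digraph_lists_ok (fst p)" "digraph_lists_ok (snd p)"
  shows "ugraphs_ok (to_ugraphs p)" "ugraphs_iso (to_ugraphs p) \<longleftrightarrow> digraphs_iso p"
proof -
  show "ugraphs_ok (to_ugraphs p)"
    using assms ugraph_lists_ok_to_ugraph by (simp add: ugraphs_ok_def to_ugraphs_def)
  have L: "distinct (labels_of p)"
    "(\<lambda>e. fst (snd e)) ` (set (snd (fst p)) \<union> set (snd (snd p))) \<subseteq> set (labels_of p)"
    by (auto simp: labels_of_def)
  have "ugraphs_iso (to_ugraphs p) \<longleftrightarrow>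
      (\<exists>\<psi>. adj_iso_map \<psi> (core_graph (labels_of p) (fst p)) (core_graph (labels_of p) (snd p)))"
  proof
    assume "ugraphs_iso (to_ugraphs p)"
    then obtain \<psi> where "adj_iso_map \<psi> (ugraph_of (to_ugraph (labels_of p) (fst p)))
        (ugraph_of (to_ugraph (labels_of p) (snd p)))"
      by (auto simp: ugraphs_iso_def to_ugraphs_def)
    from adj_iso_map_comp[OF adj_iso_map_comp[OF to_ugraph_name this] adj_iso_map_inv[OF to_ugraph_name]]
    show "\<exists>\<psi>. adj_iso_map \<psi> (core_graph (labels_of p) (fst p)) (core_graph (labels_of p) (snd p))" by blast
  next
    assume "\<exists>\<psi>. adj_iso_map \<psi> (core_graph (labels_of p) (fst p)) (core_graph (labels_of p) (snd p))"
    then obtain \<psi> where "adj_iso_map \<psi> (core_graph (labels_of p) (fst p)) (core_graph (labels_of p) (snd p))" ..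
    from adj_iso_map_comp[OF adj_iso_map_comp[OF adj_iso_map_inv[OF to_ugraph_name] this] to_ugraph_name]
    show "ugraphs_iso (to_ugraphs p)" by (auto simp: ugraphs_iso_def to_ugraphs_def)
  qed
  then show "ugraphs_iso (to_ugraphs p) \<longleftrightarrow> digraphs_iso p"
    using to_ugraph_iso[OF assms L] by (simp add: digraphs_iso_def)
qed

section \<open>Reducing graph isomorphism\<close>

text \<open>Two copies of the vertex set; all transitions lead from the first copy to the second one, so that no
  two of them can be composed. The label \<open>2\<close> marks the two copies of a vertex.\<close>

definition double :: "ulists \<Rightarrow> dlists" where
  "double D =
     (let ks = map (\<lambda>u. name (False, u)) (fst D) @ map (\<lambda>u. name (True, u)) (fst D)
      in (dedup ks,
          dedup (map (\<lambda>k. (k, Rotation, k)) ks @ map (\<lambda>k. (k, Transition 1, k)) ks @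
            map (\<lambda>u. (name (False, u), Transition 2, name (True, u))) (fst D) @
            map (\<lambda>e. (name (False, fst e), Transition 1, name (True, snd e))) (snd D) @
            map (\<lambda>e. (name (False, snd e), Transition 1, name (True, fst e))) (snd D))))"

lemma pt_double: "pt double"
  unfolding double_def by (intro pt_basic pt_lists pt_name)

lemma names_iff:
  fixes S :: "'a::treeable set"
  shows "k \<in> (\<lambda>p. name p) ` ((UNIV :: bool set) \<times> S) \<longleftrightarrow> (\<exists>c. \<exists>u\<in>S. k = name (c :: bool, u))"
proof
  assume "k \<in> (\<lambda>p. name p) ` ((UNIV :: bool set) \<times> S)"
  then obtain p :: "bool \<times> 'a" where p: "k = name p" "p \<in> UNIV \<times> S" by (rule imageE)
  have "k = name (fst p, snd p)" "snd p \<in> S" using p by (simp_all add: mem_Times_iff)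
  then show "\<exists>c. \<exists>u\<in>S. k = name (c :: bool, u)" by blast
qed blast

lemma double_nodes: "set (fst (double D)) = (\<lambda>p. name p) ` ((UNIV :: bool set) \<times> set (fst D))"
proof (intro equalityI subsetI)
  fix k assume "k \<in> (\<lambda>p. name p) ` ((UNIV :: bool set) \<times> set (fst D))"
  then obtain b u where bu: "k = name (b :: bool, u)" "u \<in> set (fst D)" unfolding names_iff by blast
  then show "k \<in> set (fst (double D))" by (cases b) (simp_all add: double_def Let_def)
qed (auto simp: double_def Let_def)

lemma double_edge: "(a, l, b) \<in> set (snd (double D)) \<longleftrightarrow>
    (\<exists>c. \<exists>u\<in>set (fst D). a = name (c :: bool, u) \<and> b = a \<and> (l = Rotation \<or> l = Transition 1)) \<or>
    (\<exists>u\<in>set (fst D). a = name (False, u) \<and> l = Transition 2 \<and> b = name (True, u)) \<or>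
    (\<exists>u v. adjacent (set (snd D)) u v \<and> a = name (False, u) \<and> l = Transition 1 \<and> b = name (True, v))"
  (is "_ \<longleftrightarrow> ?loop \<or> ?mark \<or> ?adj")
proof
  assume "(a, l, b) \<in> set (snd (double D))"
  then consider u c where "u \<in> set (fst D)" "a = name (c :: bool, u)" "b = a" "l = Rotation \<or> l = Transition 1"
    | u where "u \<in> set (fst D)" "a = name (False, u)" "l = Transition 2" "b = name (True, u)"
    | e where "e \<in> set (snd D)" "a = name (False, fst e)" "l = Transition 1" "b = name (True, snd e)"
    | e where "e \<in> set (snd D)" "a = name (False, snd e)" "l = Transition 1" "b = name (True, fst e)"
    unfolding double_def Let_def by auto
  then show "?loop \<or> ?mark \<or> ?adj"
  proof cases
    case 3
    then have "adjacent (set (snd D)) (fst e) (snd e)" by (simp add: adjacent_def)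
    with 3(2-) show ?thesis by blast
  next
    case 4
    then have "adjacent (set (snd D)) (snd e) (fst e)" by (simp add: adjacent_def)
    with 4(2-) show ?thesis by blast
  qed blast+
next
  assume "?loop \<or> ?mark \<or> ?adj"
  then show "(a, l, b) \<in> set (snd (double D))"
  proof (elim disjE)
    assume ?loop
    then obtain c u where "u \<in> set (fst D)" "a = name (c :: bool, u)" "b = a" "l = Rotation \<or> l = Transition 1" by blast
    then show ?thesis by (cases c) (auto simp: double_def Let_def)
  next
    assume ?mark
    then show ?thesis by (auto simp: double_def Let_def)
  next
    assume ?adj
    then obtain u v where uv: "adjacent (set (snd D)) u v" "a = name (False, u)" "l = Transition 1" "b = name (True, v)"
      by blast
    from uv(1) show ?thesis unfolding adjacent_def
    proof
      assume "(u, v) \<in> set (snd D)"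
      then have "(a, l, b) \<in> (\<lambda>e. (name (False, fst e), Transition 1, name (True, snd e))) ` set (snd D)"
        using uv(2-) by (intro image_eqI[of _ _ "(u, v)"]) simp_all
      then show ?thesis by (simp add: double_def Let_def)
    next
      assume "(v, u) \<in> set (snd D)"
      then have "(a, l, b) \<in> (\<lambda>e. (name (False, snd e), Transition 1, name (True, fst e))) ` set (snd D)"
        using uv(2-) by (intro image_eqI[of _ _ "(v, u)"]) simp_all
      then show ?thesis by (simp add: double_def Let_def)
    qed
  qed
qed

lemma adjacent_ok:
  assumes "ugraph_lists_ok D" "adjacent (set (snd D)) u v"
  shows "u \<in> set (fst D)" "v \<in> set (fst D)" "u \<noteq> v"
  using assms unfolding adjacent_def ugraph_lists_ok_def by force+

lemma double_edge_name:
  assumes "ugraph_lists_ok D"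
  shows "(name (c, u), l, name (d, v)) \<in> set (snd (double D)) \<longleftrightarrow>
    (c = d \<and> u = v \<and> u \<in> set (fst D) \<and> (l = Rotation \<or> l = Transition 1)) \<or>
    (\<not> c \<and> d \<and> u = v \<and> u \<in> set (fst D) \<and> l = Transition 2) \<or>
    (\<not> c \<and> d \<and> adjacent (set (snd D)) u v \<and> l = Transition 1)"
  unfolding double_edge inj_name by auto

lemma double_edgeE:
  assumes "ugraph_lists_ok D" "e \<in> set (snd (double D))"
  obtains c u d v where "u \<in> set (fst D)" "v \<in> set (fst D)" "fst e = name (c :: bool, u)" "snd (snd e) = name (d :: bool, v)"
    "(name (c, u), fst (snd e), name (d, v)) \<in> set (snd (double D))"
proof -
  obtain a l b where e: "e = (a, l, b)" by (cases e)
  from assms(2)[unfolded e double_edge]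
  have "\<exists>c u d v. u \<in> set (fst D) \<and> v \<in> set (fst D) \<and> a = name (c :: bool, u) \<and> b = name (d :: bool, v)"
    using adjacent_ok[OF assms(1)] by blast
  then obtain c u d v where "u \<in> set (fst D)" "v \<in> set (fst D)" "a = name (c :: bool, u)" "b = name (d :: bool, v)"
    by blast
  then show thesis using that[of u v c d] assms(2) e by simp
qed

lemma digraph_lists_ok_double:
  assumes "ugraph_lists_ok D"
  shows "digraph_lists_ok (double D)"
proof -
  have "fst e \<in> set (fst (double D)) \<and> snd (snd e) \<in> set (fst (double D))" if "e \<in> set (snd (double D))" for e
    using that
  proof (rule double_edgeE[OF assms])
    fix c u d v assume "u \<in> set (fst D)" "v \<in> set (fst D)" "fst e = name (c :: bool, u)" "snd (snd e) = name (d :: bool, v)"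
    then show ?thesis unfolding double_nodes names_iff by blast
  qed
  then show ?thesis unfolding digraph_lists_ok_def by (simp add: double_def Let_def)
qed

text \<open>An isomorphism of doubles respects the marked edges, so it acts on both copies by one
  and the same vertex map; the edges with label 1 between the copies then say that this map
  preserves adjacency. A vertex is not adjacent to itself, so these edges never compete with the
  marks.\<close>

lemma double_iso:
  assumes ok: "ugraph_lists_ok D" "ugraph_lists_ok D'"
  shows "(\<exists>\<psi>. digraph_iso_map \<psi> (graph_of (double D)) (graph_of (double D'))) \<longleftrightarrow>
    (\<exists>\<phi>. adj_iso_map \<phi> (ugraph_of D) (ugraph_of D'))"
proof
  let ?V = "set (fst D)" and ?V' = "set (fst D')" and ?E = "set (snd (double D))" and ?E' = "set (snd (double D'))"
  let ?N = "(\<lambda>p :: bool \<times> nat. name p) ` (UNIV \<times> ?V)" and ?N' = "(\<lambda>p :: bool \<times> nat. name p) ` (UNIV \<times> ?V')"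
  have nodes: "nodes (graph_of (double D)) = ?N" "nodes (graph_of (double D')) = ?N'"
    by (simp_all add: graph_of_def double_nodes)
  have edges: "edges (graph_of (double D)) = ?E" "edges (graph_of (double D')) = ?E'"
    by (simp_all add: graph_of_def)
  {
    assume "\<exists>\<phi>. adj_iso_map \<phi> (ugraph_of D) (ugraph_of D')"
    then obtain \<phi> where \<phi>: "adj_iso_map \<phi> (ugraph_of D) (ugraph_of D')" ..
    then have bij: "bij_betw \<phi> ?V ?V'" by (simp add: adj_iso_map_def ugraph_of_def)
    have adj: "adjacent (set (snd D)) u v \<longleftrightarrow> adjacent (set (snd D')) (\<phi> u) (\<phi> v)" if "u \<in> ?V" "v \<in> ?V" for u v
      using \<phi> that by (simp add: adj_iso_map_def ugraph_of_def)
    have \<phi>_eq: "\<phi> u = \<phi> v \<longleftrightarrow> u = v" if "u \<in> ?V" "v \<in> ?V" for u v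
      by (rule inj_on_eq_iff[OF bij_betw_imp_inj_on[OF bij] that])
    define \<psi> where "\<psi> k = (case inv (name :: bool \<times> nat \<Rightarrow> nat) k of (c, u) \<Rightarrow> name (c, \<phi> u))" for k
    have "inj (name :: bool \<times> nat \<Rightarrow> nat)" by (rule injI) (simp only: inj_name)
    then have \<psi>: "\<psi> (name (c, u)) = name (c :: bool, \<phi> u)" for c u by (simp add: \<psi>_def inv_f_f)
    have "digraph_iso_map \<psi> (graph_of (double D)) (graph_of (double D'))"
      unfolding digraph_iso_map_def nodes edges
    proof (intro conjI ballI allI)
      show "bij_betw \<psi> ?N ?N'"
        unfolding bij_betw_def
      proof
        show "inj_on \<psi> ?N"
        proof (rule inj_onI)
          fix k k' assume "k \<in> ?N" "k' \<in> ?N" and eq: "\<psi> k = \<psi> k'"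
          then obtain c u c' u' where k: "k = name (c :: bool, u)" "k' = name (c' :: bool, u')"
            and u: "u \<in> ?V" "u' \<in> ?V" unfolding names_iff by blast
          have "c = c' \<and> \<phi> u = \<phi> u'" using eq unfolding k \<psi> inj_name by simp
          then show "k = k'" unfolding k inj_name using \<phi>_eq[OF u] by simp
        qed
        have "\<phi> ` ?V = ?V'" using bij by (simp add: bij_betw_def)
        have "\<psi> ` ?N = (\<lambda>p. \<psi> (name p)) ` ((UNIV :: bool set) \<times> ?V)" by (rule image_image)
        also have "\<dots> = (\<lambda>p. name (map_prod id \<phi> p)) ` ((UNIV :: bool set) \<times> ?V)"
        proof (rule image_cong[OF refl])
          fix p :: "bool \<times> nat"
          show "\<psi> (name p) = name (map_prod id \<phi> p)" by (cases p) (simp add: \<psi>)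
        qed
        also have "\<dots> = (\<lambda>p. name p) ` (map_prod id \<phi> ` ((UNIV :: bool set) \<times> ?V))" by (rule image_image[symmetric])
        also have "map_prod id \<phi> ` ((UNIV :: bool set) \<times> ?V) = UNIV \<times> ?V'"
          by (rule map_prod_surj_on) (simp_all add: \<open>\<phi> ` ?V = ?V'\<close>)
        finally show "\<psi> ` ?N = ?N'" .
      qed
      fix k k' l assume "k \<in> ?N" "k' \<in> ?N"
      then obtain c u c' u' where k: "k = name (c :: bool, u)" "k' = name (c' :: bool, u')"
        and u: "u \<in> ?V" "u' \<in> ?V" unfolding names_iff by blast
      have "\<phi> u \<in> ?V'" by (rule bij_betw_apply[OF bij u(1)])
      then show "(k, l, k') \<in> ?E \<longleftrightarrow> (\<psi> k, l, \<psi> k') \<in> ?E'"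
        unfolding k \<psi> double_edge_name[OF ok(1)] double_edge_name[OF ok(2)] using \<phi>_eq[OF u] adj[OF u] u by argo
    qed
    then show "\<exists>\<psi>. digraph_iso_map \<psi> (graph_of (double D)) (graph_of (double D'))"
      by (rule exI[of "\<lambda>\<psi>. digraph_iso_map \<psi> (graph_of (double D)) (graph_of (double D'))" \<psi>])
  }
  {
    assume "\<exists>\<psi>. digraph_iso_map \<psi> (graph_of (double D)) (graph_of (double D'))"
    then obtain \<psi> where \<psi>: "digraph_iso_map \<psi> (graph_of (double D)) (graph_of (double D'))" ..
    then have bij: "bij_betw \<psi> ?N ?N'" by (simp add: digraph_iso_map_def nodes)
    have N: "name (c, u) \<in> ?N" if "u \<in> ?V" for c :: bool and u using that by (intro imageI) simp
    have e: "(name (c, u), l, name (d, v)) \<in> ?E \<longleftrightarrow> (\<psi> (name (c, u)), l, \<psi> (name (d, v))) \<in> ?E'"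
      if "u \<in> ?V" "v \<in> ?V" for c d :: bool and u v l
      using \<psi> N[OF that(1)] N[OF that(2)] unfolding digraph_iso_map_def nodes edges by blast
    \<comment> \<open>The label 2 occurs only between the two copies of a vertex, in a fixed
      direction; so the copies of \<open>u\<close> are mapped to the copies of a single vertex, in
      the same order.\<close>
    have ex: "\<exists>u'\<in>?V'. \<psi> (name (False, u)) = name (False, u') \<and> \<psi> (name (True, u)) = name (True, u')"
      if u: "u \<in> ?V" for u
    proof -
      have "(name (False, u), Transition 2, name (True, u)) \<in> ?E"
        unfolding double_edge_name[OF ok(1)] using u by simp
      then have "(\<psi> (name (False, u)), Transition 2, \<psi> (name (True, u))) \<in> ?E'" using e[OF u u] by simp
      then show ?thesis unfolding double_edge by auto
    qed
    then obtain \<phi> where \<phi>: "\<And>u. u \<in> ?V \<Longrightarrow> \<phi> u \<in> ?V'"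
      "\<And>u. u \<in> ?V \<Longrightarrow> \<psi> (name (False, u)) = name (False, \<phi> u)"
      "\<And>u. u \<in> ?V \<Longrightarrow> \<psi> (name (True, u)) = name (True, \<phi> u)" by metis
    have "adj_iso_map \<phi> (ugraph_of D) (ugraph_of D')"
      unfolding adj_iso_map_def ugraph_of_def fst_conv snd_conv
    proof (intro conjI ballI)
      show "bij_betw \<phi> ?V ?V'"
        unfolding bij_betw_def
      proof
        show "inj_on \<phi> ?V"
        proof (rule inj_onI)
          fix u v assume uv: "u \<in> ?V" "v \<in> ?V" "\<phi> u = \<phi> v"
          then have "\<psi> (name (False, u)) = \<psi> (name (False, v))" using \<phi>(2) by simp
          from inj_onD[OF bij_betw_imp_inj_on[OF bij] this N[OF uv(1)] N[OF uv(2)]]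
          show "u = v" unfolding inj_name by simp
        qed
        show "\<phi> ` ?V = ?V'"
        proof (intro equalityI subsetI)
          fix u' assume "u' \<in> ?V'"
          then have "name (False, u') \<in> ?N'" by (intro imageI) simp
          then have "name (False, u') \<in> \<psi> ` ?N" using bij by (simp add: bij_betw_def)
          then obtain k where k: "name (False, u') = \<psi> k" "k \<in> ?N" by (rule imageE)
          obtain c u where "u \<in> ?V" "k = name (c :: bool, u)" using k(2) unfolding names_iff by blast
          with k(1) have cu: "u \<in> ?V" "name (False, u') = \<psi> (name (c :: bool, u))" by simp_all
          have "name (False, u') = name (c, \<phi> u)" using cu \<phi> by (cases c) simp_all
          then have "u' = \<phi> u" unfolding inj_name by simp
          then show "u' \<in> \<phi> ` ?V" using cu(1) by (rule image_eqI)
        qed (use \<phi>(1) in blast)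
      qed
      fix u v assume uv: "u \<in> ?V" "v \<in> ?V"
      have "adjacent (set (snd D)) u v \<longleftrightarrow> (name (False, u), Transition 1, name (True, v)) \<in> ?E"
        unfolding double_edge_name[OF ok(1)] by simp
      also have "\<dots> \<longleftrightarrow> (name (False, \<phi> u), Transition 1, name (True, \<phi> v)) \<in> ?E'"
        using e[OF uv] \<phi>(2)[OF uv(1)] \<phi>(3)[OF uv(2)] by simp
      also have "\<dots> \<longleftrightarrow> adjacent (set (snd D')) (\<phi> u) (\<phi> v)"
        unfolding double_edge_name[OF ok(2)] by simp
      finally show "adjacent (set (snd D)) u v \<longleftrightarrow> adjacent (set (snd D')) (\<phi> u) (\<phi> v)" .
    qed
    then show "\<exists>\<phi>. adj_iso_map \<phi> (ugraph_of D) (ugraph_of D')"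
      by (rule exI[of "\<lambda>\<phi>. adj_iso_map \<phi> (ugraph_of D) (ugraph_of D')" \<phi>])
  }
qed

section \<open>Completeness\<close>

lemma pt_structural: "pt (\<lambda>D :: dlists. structural (graph_of D))"
  unfolding structural_def graph_of_def labeled_digraph.select_convs
  by (intro pt_basic pt_lists)

lemma pt_one_step: "pt (\<lambda>D :: dlists. one_step (graph_of D))"
  unfolding one_step_def nontrivial_def graph_of_def labeled_digraph.select_convs
  by (intro pt_basic pt_lists)

lemma pt_digraphs_ok:
  assumes "pt (\<lambda>D :: dlists. ok (graph_of D))"
  shows "pt (digraphs_ok ok)"
proof -
  have "pt (\<lambda>p :: dlists \<times> dlists. ok (graph_of (fst p)))" "pt (\<lambda>p :: dlists \<times> dlists. ok (graph_of (snd p)))"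
    by (rule pt_compose[OF assms pt_fst[OF pt_id]], rule pt_compose[OF assms pt_snd[OF pt_id]])
  then show ?thesis unfolding digraphs_ok_def[abs_def] by (intro pt_basic pt_digraph_lists_ok)
qed

lemma double_structural:
  assumes ok: "ugraph_lists_ok D"
  shows "structural (graph_of (double D))" "one_step (graph_of (double D))"
proof -
  let ?V = "set (fst D)" and ?E = "set (snd (double D))"
  have sel: "nodes (graph_of (double D)) = set (fst (double D))" "edges (graph_of (double D)) = ?E"
    by (simp_all add: graph_of_def)
  have edgeE: "\<exists>c u d v. fst e = name (c :: bool, u :: nat) \<and> snd (snd e) = name (d :: bool, v :: nat) \<and>
    ((c = d \<and> u = v \<and> u \<in> ?V \<and> (fst (snd e) = Rotation \<or> fst (snd e) = Transition 1)) \<or>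
    (\<not> c \<and> d \<and> u = v \<and> u \<in> ?V \<and> fst (snd e) = Transition 2) \<or>
    (\<not> c \<and> d \<and> u \<noteq> v \<and> fst (snd e) = Transition 1))" if e: "e \<in> ?E" for e
    using e
  proof (rule double_edgeE[OF ok])
    fix c d :: bool and u v :: nat
    assume uv: "fst e = name (c, u)" "snd (snd e) = name (d, v)"
      and edge: "(name (c, u), fst (snd e), name (d, v)) \<in> ?E"
    from edge[unfolded double_edge_name[OF ok]] adjacent_ok(3)[OF ok, of u v]
    have cases: "(c = d \<and> u = v \<and> u \<in> ?V \<and> (fst (snd e) = Rotation \<or> fst (snd e) = Transition 1)) \<or>
      (\<not> c \<and> d \<and> u = v \<and> u \<in> ?V \<and> fst (snd e) = Transition 2) \<or>
      (\<not> c \<and> d \<and> u \<noteq> v \<and> fst (snd e) = Transition 1)" by argo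
    show ?thesis
      by (rule exI[of _ c], rule exI[of _ u], rule exI[of _ d], rule exI[of _ v]) (intro conjI uv cases)
  qed
  \<comment> \<open>The rotation is the identity, so invariance of transitions under rotation is
    immediate.\<close>
  have loop: "snd (snd e) = fst e" if e: "e \<in> ?E" "fst (snd e) = Rotation" for e
    using edgeE[OF e(1)] e(2) by auto
  have nodeE: "\<exists>l. (k, Rotation, k) \<in> ?E \<and> (k, Transition 1, k) \<in> ?E" if k: "k \<in> set (fst (double D))" for k
  proof -
    obtain c u where cu: "u \<in> ?V" "k = name (c :: bool, u)" using k unfolding double_nodes names_iff by blast
    show ?thesis unfolding cu(2) double_edge_name[OF ok] using cu(1) by simp
  qed
  show "structural (graph_of (double D))"
    unfolding structural_def sel
  proof (intro conjI ballI impI; (elim conjE)?)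
    fix k assume k: "k \<in> set (fst (double D))"
    show "\<exists>e\<in>?E. fst e = k \<and> fst (snd e) = Rotation"
      using nodeE[OF k] by (intro bexI[of _ "(k, Rotation, k)"]) simp_all
    show "\<exists>e\<in>?E. fst e = k \<and> fst (snd e) \<noteq> Rotation \<and> snd (snd e) = k"
      using nodeE[OF k] by (intro bexI[of _ "(k, Transition 1, k)"]) simp_all
  next
    fix e e' assume e: "e \<in> ?E" "e' \<in> ?E" "fst (snd e) = Rotation" "fst (snd e') = Rotation"
    show "(fst e = fst e') = (snd (snd e) = snd (snd e'))"
      unfolding loop[OF e(1,3)] loop[OF e(2,4)] by (rule refl)
  next
    fix e assume "e \<in> ?E"
    from edgeE[OF this] show "fst (snd e) \<noteq> Transition 0" by auto
  next
    fix e e' assume e: "e \<in> ?E" "e' \<in> ?E" "fst (snd e) \<noteq> Rotation" "fst (snd e') \<noteq> Rotation"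
      "fst e = fst e'" "snd (snd e) = snd (snd e')"
    obtain c u d v where 1: "fst e = name (c :: bool, u :: nat)" "snd (snd e) = name (d :: bool, v :: nat)"
      "(c = d \<and> u = v \<and> u \<in> ?V \<and> (fst (snd e) = Rotation \<or> fst (snd e) = Transition 1)) \<or>
      (\<not> c \<and> d \<and> u = v \<and> u \<in> ?V \<and> fst (snd e) = Transition 2) \<or>
      (\<not> c \<and> d \<and> u \<noteq> v \<and> fst (snd e) = Transition 1)" using edgeE[OF e(1)] by (elim exE conjE)
    obtain c' u' d' v' where 2: "fst e' = name (c' :: bool, u' :: nat)" "snd (snd e') = name (d' :: bool, v' :: nat)"
      "(c' = d' \<and> u' = v' \<and> u' \<in> ?V \<and> (fst (snd e') = Rotation \<or> fst (snd e') = Transition 1)) \<or>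
      (\<not> c' \<and> d' \<and> u' = v' \<and> u' \<in> ?V \<and> fst (snd e') = Transition 2) \<or>
      (\<not> c' \<and> d' \<and> u' \<noteq> v' \<and> fst (snd e') = Transition 1)" using edgeE[OF e(2)] by (elim exE conjE)
    have eq: "c' = c" "u' = u" "d' = d" "v' = v" using e(5,6) unfolding 1(1,2) 2(1,2) inj_name by simp_all
    show "fst (snd e) = fst (snd e')" using 1(3) 2(3)[unfolded eq] e(3,4) by (argo | (elim disjE conjE; simp))
  next
    fix e r r' assume e: "e \<in> ?E" "r \<in> ?E" "r' \<in> ?E" "fst (snd r) = Rotation" "fst (snd r') = Rotation"
      "fst r = fst e" "fst r' = snd (snd e)"
    show "(snd (snd r), fst (snd e), snd (snd r')) \<in> ?E"
      unfolding loop[OF e(2,4)] loop[OF e(3,5)] e(6,7) using e(1) by simp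
  qed
  have nontriv: "\<exists>u v. fst e = name (False, u :: nat) \<and> snd (snd e) = name (True, v :: nat)"
    if e: "e \<in> ?E" "nontrivial e" for e
  proof -
    obtain c u d v where 1: "fst e = name (c :: bool, u :: nat)" "snd (snd e) = name (d :: bool, v :: nat)"
      "(c = d \<and> u = v \<and> u \<in> ?V \<and> (fst (snd e) = Rotation \<or> fst (snd e) = Transition 1)) \<or>
      (\<not> c \<and> d \<and> u = v \<and> u \<in> ?V \<and> fst (snd e) = Transition 2) \<or>
      (\<not> c \<and> d \<and> u \<noteq> v \<and> fst (snd e) = Transition 1)" using edgeE[OF e(1)] by (elim exE conjE)
    have "\<not> (c = d \<and> u = v \<and> (fst (snd e) = Rotation \<or> fst (snd e) = Transition 1))"
      using e(2) unfolding nontrivial_def 1(1,2) inj_name by auto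
    then have "c = False" "d = True" using 1(3) by argo+
    then show ?thesis using 1(1,2) by - (rule exI[of _ u], rule exI[of _ v], simp)
  qed
  show "one_step (graph_of (double D))"
    unfolding one_step_def sel
  proof (intro ballI impI; elim conjE)
    fix e e' assume e: "e \<in> ?E" "e' \<in> ?E" "nontrivial e" "nontrivial e'"
    obtain u v where 1: "snd (snd e) = name (True, v :: nat)" using nontriv[OF e(1,3)] by blast
    obtain u' v' where 2: "fst e' = name (False, u' :: nat)" using nontriv[OF e(2,4)] by blast
    show "snd (snd e) \<noteq> fst e'" unfolding 1 2 inj_name by simp
  qed
qed

text \<open>The two classes of shifts differ only in the test \<open>ok\<close>. Membership in
  \<open>GI\<close> uses that the test is computable in polynomial time, hardness uses that doubles
  of graphs pass it; transitivity extends hardness from graph isomorphism to all of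
  \<open>GI\<close>.\<close>

lemma GI_complete_digraphs:
  assumes "pt (\<lambda>D :: dlists. ok (graph_of D))" "\<And>D. ugraph_lists_ok D \<Longrightarrow> ok (graph_of (double D))"
  shows "GI_complete (problem_of enc_digraphs (digraphs_ok ok) digraphs_iso)"
proof -
  let ?P = "problem_of enc_digraphs (digraphs_ok ok) digraphs_iso"
  have "poly_reducible ?P graph_isomorphism"
    unfolding graph_isomorphism_eq
    by (rule poly_reducible_problem_of[OF enc_digraphs_parser pt_enc_digraphs enc_ugraphs_parser pt_enc_ugraphs
          enc_nonempty(2) pt_digraphs_ok[OF assms(1)] pt_to_ugraphs])
       (use to_ugraphs_correct in \<open>simp add: digraphs_ok_def\<close>)
  moreover have "poly_reducible graph_isomorphism ?P"
    unfolding graph_isomorphism_eq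
  proof (rule poly_reducible_problem_of[OF enc_ugraphs_parser pt_enc_ugraphs enc_digraphs_parser pt_enc_digraphs
        enc_nonempty(1), where f = "\<lambda>p. (double (fst p), double (snd p))"])
    have ok: "pt ugraph_lists_ok" unfolding ugraph_lists_ok_def[abs_def] by (intro pt_basic pt_lists)
    show "pt ugraphs_ok" unfolding ugraphs_ok_def[abs_def] by (intro pt_basic pt_compose[OF ok])
    show "pt (\<lambda>p. (double (fst p), double (snd p)))" by (intro pt_basic pt_compose[OF pt_double])
    fix p assume "ugraphs_ok p"
    then have p: "ugraph_lists_ok (fst p)" "ugraph_lists_ok (snd p)" by (simp_all add: ugraphs_ok_def)
    show "digraphs_ok ok (double (fst p), double (snd p)) \<and>
      digraphs_iso (double (fst p), double (snd p)) = ugraphs_iso p"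
      unfolding digraphs_ok_def digraphs_iso_def ugraphs_iso_def fst_conv snd_conv double_iso[OF p]
      using digraph_lists_ok_double[OF p(1)] digraph_lists_ok_double[OF p(2)] assms(2)[OF p(1)] assms(2)[OF p(2)]
      by simp
  qed
  ultimately show ?thesis unfolding GI_complete_def GI_def using poly_reducible_trans by blast
qed

theorem theorem1:
  shows "GI_complete (conjugacy_problem countable_sofic_rank2) \<and>
    GI_complete (conjugacy_problem countable_sft_rank2)"
proof
  have sofic: "rank2 A X" if "countable_sofic_rank2 A X" for A :: "nat set" and X
    using that by (simp add: countable_sofic_rank2_def sofic_shift_def rank2_def)
  have sft: "rank2 A X" if "countable_sft_rank2 A X" for A :: "nat set" and X
    using that by (simp add: countable_sft_rank2_def shift_of_finite_type_def rank2_def)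
  have "conjugacy_problem countable_sofic_rank2 = problem_of enc_digraphs (digraphs_ok structural) digraphs_iso"
  proof (rule conjugacy_problem_eq)
    fix A B :: "nat set" and X Y assume X: "countable_sofic_rank2 A X" and Y: "countable_sofic_rank2 B Y"
    show "conjugate A X B Y \<longleftrightarrow> (\<exists>\<phi>. digraph_iso_map \<phi> (structure_graph X) (structure_graph Y))"
      by (rule conjugate_iff_iso[OF sofic[OF X] sofic[OF Y]])
  qed (erule rank2.wf_structure_graph[OF sofic], erule (1) structural_iff_sofic(1))
  then show "GI_complete (conjugacy_problem countable_sofic_rank2)"
    using GI_complete_digraphs[OF pt_structural double_structural(1)] by simp
  have "conjugacy_problem countable_sft_rank2 =
      problem_of enc_digraphs (digraphs_ok (\<lambda>G. structural G \<and> one_step G)) digraphs_iso"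
  proof (rule conjugacy_problem_eq)
    fix A B :: "nat set" and X Y assume X: "countable_sft_rank2 A X" and Y: "countable_sft_rank2 B Y"
    show "conjugate A X B Y \<longleftrightarrow> (\<exists>\<phi>. digraph_iso_map \<phi> (structure_graph X) (structure_graph Y))"
      by (rule conjugate_iff_iso[OF sft[OF X] sft[OF Y]])
  qed (erule rank2.wf_structure_graph[OF sft], erule (1) structural_iff_sofic(2))
  moreover have "GI_complete (problem_of enc_digraphs (digraphs_ok (\<lambda>G. structural G \<and> one_step G)) digraphs_iso)"
  proof (rule GI_complete_digraphs)
    show "pt (\<lambda>D :: dlists. structural (graph_of D) \<and> one_step (graph_of D))"
      by (rule pt_conj[OF pt_structural pt_one_step])
    show "structural (graph_of (double D)) \<and> one_step (graph_of (double D))" if "ugraph_lists_ok D" for D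
      by (rule conjI[OF double_structural[OF that]])
  qed
  ultimately show "GI_complete (conjugacy_problem countable_sft_rank2)" by simp
qed

end
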